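(* Let $\mathcal{X}$ be a torsion free Noetherian $\mathbb{F}_1$-scheme with counting function $N(t)$, and let $X_{\mathbb{Z}}$ be the geometric realisation of $\mathcal{X}|_{\mathfrak{CRing}}$. Assume that $X_{\mathbb{Z}}$ is of finite type over $\mathbb{Z}$. Then $N(t)\in\mathbb{Z}[t]$ and $\deg N=\operatorname{reldim}X_{\mathbb{Z}}/\mathbb{Z}$, the relative dimension of $X_{\mathbb{Z}}$ over $\operatorname{Spec}\mathbb{Z}$.
   Context: A monoid is a commutative multiplicative monoid with identity $1$ and an absorbing element $0$; $\mathfrak{M}_0$ is the category of monoids, $\mathfrak{CRing}$ that of commutative rings. For a monoid $M$, $\operatorname{spec}M$ is the set of prime ideals (proper subsets $\mathfrak{p}$ with $\mathfrak{p}M\subset\mathfrak{p}$ and $M\setminus\mathfrak{p}$ multiplicatively closed) with Zariski topology and structure sheaf of localisations; a monoid scheme is a space with a sheaf of monoids locally isomorphic to some $\operatorname{spec}M$. The category $\mathfrak{MR}$ has objects those of $\mathfrak{M}_0$ and $\mathfrak{CRing}$, usual morphisms within each, $\operatorname{Hom}(M,R):=\operatorname{Hom}_{\mathfrak{CRing}}(\mathbb{Z}[M],R)$ and $\operatorname{Hom}(R,M)=\emptyset$. An $\mathbb{F}_1$-scheme is a functor $\mathcal{X}:\mathfrak{MR}\to\mathfrak{Set}$ with $\mathcal{X}|_{\mathfrak{M}_0}\cong\operatorname{Hom}(\operatorname{spec}(\cdot),X_{\mathfrak{M}_0})$ for a monoid scheme $X_{\mathfrak{M}_0}$ and $\mathcal{X}|_{\mathfrak{CRing}}\cong\operatorname{Hom}(\operatorname{Spec}(\cdot),X_{\mathbb{Z}})$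 for a scheme $X_{\mathbb{Z}}$ (geometric realisations), such that for every field $K$ the natural map $\mathcal{X}(K\text{ as monoid})\to\mathcal{X}(K)$ is bijective. It is Noetherian if $\mathcal{X}|_{\mathfrak{M}_0}$ is covered by finitely many open subfunctors $\operatorname{Hom}_{\mathfrak{M}_0}(M_i,\cdot)$ with $M_i$ finitely generated and $X_{\mathbb{Z}}$ is Noetherian; torsion free if all $\mathcal{O}_{X_{\mathfrak{M}_0},x}^\times$ are torsion free. For such $\mathcal{X}$ the counting function is the function $N(t)$ with $\#\mathcal{X}|_{\mathfrak{M}_0}(\mathbb{F}_1[C_n])=N(n+1)$ for $n\in\mathbb{N}$ ($C_n$ cyclic of order $n$, $\mathbb{F}_1[C_n]=C_n\cup\{0\}$) and $\#X_{\mathbb{Z}}(\mathbb{F}_q)=N(q)$ for all prime powers $q$; explicitly $N(t)=\sum_{x\in X_{\mathfrak{M}_0}}(t-1)^{\operatorname{rank}\mathcal{O}_{X_{\mathfrak{M}_0},x}^\times}$. *)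

theory Defs
  imports
    "HOL-Algebra.Ring_Divisibility"
    "HOL-Algebra.Subrings"
    "HOL-Algebra.IntRing"
    "HOL-Algebra.Elementary_Groups"
    "HOL-Analysis.Abstract_Topology"
    "HOL-Library.Extended_Real"
    "HOL-Library.Infinite_Typeclass"
    "HOL-Computational_Algebra.Polynomial"
begin

section \<open>Commutative monoids with an absorbing element\<close>

record 'a pmonoid = "'a monoid" +
  absorb :: 'a

text \<open>The case $0 = 1$ is allowed, just as the zero ring is; it is the value of a sheaf of monoids
  on the empty set.\<close>

locale pmonoid = comm_monoid M for M :: "'a pmonoid" (structure) +
  assumes absorb_closed: "absorb M \<in> carrier M"
    and absorb_mult: "x \<in> carrier M \<Longrightarrow> absorb M \<otimes> x = absorb M"

definition pmonoid_hom :: "'a pmonoid \<Rightarrow> 'b pmonoid \<Rightarrow> ('a \<Rightarrow> 'b) set" where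
  "pmonoid_hom M N = {f \<in> hom M N. f \<one>\<^bsub>M\<^esub> = \<one>\<^bsub>N\<^esub> \<and> f (absorb M) = absorb N}"

definition pmonoid_iso :: "'a pmonoid \<Rightarrow> 'b pmonoid \<Rightarrow> bool" where
  "pmonoid_iso M N \<longleftrightarrow> (\<exists>f \<in> pmonoid_hom M N. bij_betw f (carrier M) (carrier N))"

definition pmonoid_fin_gen :: "'a pmonoid \<Rightarrow> bool" where
  "pmonoid_fin_gen M \<longleftrightarrow>
     (\<exists>G \<subseteq> carrier M. finite G \<and>
        (\<forall>S. submonoid S M \<and> absorb M \<in> S \<and> G \<subseteq> S \<longrightarrow> S = carrier M))"

text \<open>An ideal contains the absorbing element; this only excludes the empty set.\<close>

definition pmonoid_ideal :: "'a set \<Rightarrow> 'a pmonoid \<Rightarrow> bool" where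
  "pmonoid_ideal I M \<longleftrightarrow>
     I \<subseteq> carrier M \<and> absorb M \<in> I \<and> (\<forall>a \<in> I. \<forall>x \<in> carrier M. a \<otimes>\<^bsub>M\<^esub> x \<in> I)"

definition pmonoid_prime :: "'a set \<Rightarrow> 'a pmonoid \<Rightarrow> bool" where
  "pmonoid_prime p M \<longleftrightarrow>
     pmonoid_ideal p M \<and> p \<noteq> carrier M \<and>
     (\<forall>a \<in> carrier M - p. \<forall>b \<in> carrier M - p. a \<otimes>\<^bsub>M\<^esub> b \<notin> p)"

definition group_pmonoid :: "('a, 'm) monoid_scheme \<Rightarrow> 'a option pmonoid" where
  "group_pmonoid H =
     \<lparr>carrier = insert None (Some ` carrier H),
      mult = (\<lambda>x y. case (x, y) of (Some a, Some b) \<Rightarrow> Some (a \<otimes>\<^bsub>H\<^esub> b) | _ \<Rightarrow> None),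
      one = Some \<one>\<^bsub>H\<^esub>,
      absorb = None\<rparr>"

definition ring_pmonoid :: "'a ring \<Rightarrow> 'a pmonoid" where
  "ring_pmonoid R = \<lparr>carrier = carrier R, mult = mult R, one = \<one>\<^bsub>R\<^esub>, absorb = \<zero>\<^bsub>R\<^esub>\<rparr>"

text \<open>In $\mathbb{Z}[M]$ the absorbing element of $M$ becomes the zero of the ring, so a basis is given
  by the remaining elements of $M$.\<close>

definition monoid_ring :: "'a pmonoid \<Rightarrow> ('a \<Rightarrow> int) ring" where
  "monoid_ring M =
     \<lparr>carrier = {f. finite {x. f x \<noteq> 0} \<and> {x. f x \<noteq> 0} \<subseteq> carrier M - {absorb M}},
      mult = (\<lambda>f g z. if z \<in> carrier M - {absorb M}
                then \<Sum>(x, y) \<in> {(x, y). f x \<noteq> 0 \<and> g y \<noteq> 0 \<and> x \<otimes>\<^bsub>M\<^esub> y = z}. f x * g y else 0),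
      one = (\<lambda>z. if z = \<one>\<^bsub>M\<^esub> \<and> z \<noteq> absorb M then 1 else 0),
      zero = (\<lambda>_. 0),
      add = (\<lambda>f g z. f z + g z)\<rparr>"

definition monoid_ring_map ::
  "'a pmonoid \<Rightarrow> 'b pmonoid \<Rightarrow> ('a \<Rightarrow> 'b) \<Rightarrow> ('a \<Rightarrow> int) \<Rightarrow> 'b \<Rightarrow> int" where
  "monoid_ring_map M N \<phi> =
     (\<lambda>f \<in> carrier (monoid_ring M). \<lambda>y.
        if y \<in> carrier N - {absorb N} then \<Sum>x \<in> {x. f x \<noteq> 0 \<and> \<phi> x = y}. f x else 0)"

definition monoid_ring_eval :: "'a ring \<Rightarrow> ('a \<Rightarrow> int) \<Rightarrow> 'a" where
  "monoid_ring_eval R =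
     (\<lambda>f \<in> carrier (monoid_ring (ring_pmonoid R)).
        \<Oplus>\<^bsub>R\<^esub>x \<in> {x. f x \<noteq> 0}. [f x] \<cdot>\<^bsub>R\<^esub> x)"


section \<open>Spaces with a sheaf of algebraic structures\<close>

text \<open>\<open>res X U V\<close> is the restriction of sections from \<open>U\<close> to \<open>V\<close>. The type parameter \<open>'m\<close> is the
  record extension: sheaves of rings and sheaves of monoids are both instances.\<close>

record ('x, 's, 'm) sheafed_space =
  pts :: "'x topology"
  sec :: "'x set \<Rightarrow> ('s, 'm) monoid_scheme"
  res :: "'x set \<Rightarrow> 'x set \<Rightarrow> 's \<Rightarrow> 's"

type_synonym ('x, 's) ringed_space = "('x, 's, ('s, unit) ring_ext) sheafed_space"
type_synonym ('x, 's) monoidal_space = "('x, 's, ('s, unit) pmonoid_ext) sheafed_space"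

definition is_sheaf ::
  "(('s, 'm) monoid_scheme \<Rightarrow> bool) \<Rightarrow>
   (('s, 'm) monoid_scheme \<Rightarrow> ('s, 'm) monoid_scheme \<Rightarrow> ('s \<Rightarrow> 's) set) \<Rightarrow>
   ('x, 's, 'm) sheafed_space \<Rightarrow> bool" where
  "is_sheaf ob hm X \<longleftrightarrow>
     (\<forall>U. openin (pts X) U \<longrightarrow> ob (sec X U)) \<and>
     (\<forall>U V. openin (pts X) U \<and> openin (pts X) V \<and> V \<subseteq> U \<longrightarrow>
        res X U V \<in> hm (sec X U) (sec X V)) \<and>
     (\<forall>U. openin (pts X) U \<longrightarrow> (\<forall>s \<in> carrier (sec X U). res X U U s = s)) \<and>
     (\<forall>U V W. openin (pts X) U \<and> openin (pts X) V \<and> openin (pts X) W \<and> W \<subseteq> V \<and> V \<subseteq> U \<longrightarrow>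
        (\<forall>s \<in> carrier (sec X U). res X V W (res X U V s) = res X U W s)) \<and>
     (\<forall>\<V>. (\<forall>V \<in> \<V>. openin (pts X) V) \<longrightarrow>
        (\<forall>s \<in> carrier (sec X (\<Union>\<V>)). \<forall>t \<in> carrier (sec X (\<Union>\<V>)).
           (\<forall>V \<in> \<V>. res X (\<Union>\<V>) V s = res X (\<Union>\<V>) V t) \<longrightarrow> s = t)) \<and>
     (\<forall>\<V> \<sigma>. (\<forall>V \<in> \<V>. openin (pts X) V \<and> \<sigma> V \<in> carrier (sec X V)) \<and>
        (\<forall>V \<in> \<V>. \<forall>W \<in> \<V>. res X V (V \<inter> W) (\<sigma> V) = res X W (V \<inter> W) (\<sigma> W)) \<longrightarrow>
        (\<exists>s \<in> carrier (sec X (\<Union>\<V>)). \<forall>V \<in> \<V>. res X (\<Union>\<V>) V s = \<sigma> V))"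

definition open_subspace :: "('x, 's, 'm) sheafed_space \<Rightarrow> 'x set \<Rightarrow> ('x, 's, 'm) sheafed_space" where
  "open_subspace X U = \<lparr>pts = subtopology (pts X) U, sec = sec X, res = res X\<rparr>"

definition germ :: "('x, 's, 'm) sheafed_space \<Rightarrow> 'x \<Rightarrow> 'x set \<Rightarrow> 's \<Rightarrow> ('x set \<times> 's) set" where
  "germ X x U s =
     {(V, t). openin (pts X) V \<and> x \<in> V \<and> t \<in> carrier (sec X V) \<and>
        (\<exists>W. openin (pts X) W \<and> x \<in> W \<and> W \<subseteq> U \<inter> V \<and> res X U W s = res X V W t)}"

text \<open>For a sheaf of rings this is the multiplicative monoid of the stalk; only its units are used.\<close>

definition stalk :: "('x, 's, 'm) sheafed_space \<Rightarrow> 'x \<Rightarrow> ('x set \<times> 's) set monoid" where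
  "stalk X x =
     \<lparr>carrier = {germ X x U s | U s. openin (pts X) U \<and> x \<in> U \<and> s \<in> carrier (sec X U)},
      mult = (\<lambda>A B. \<Union>(U, s) \<in> A. \<Union>(V, t) \<in> B.
                germ X x (U \<inter> V) (res X U (U \<inter> V) s \<otimes>\<^bsub>sec X (U \<inter> V)\<^esub> res X V (U \<inter> V) t)),
      one = germ X x (topspace (pts X)) \<one>\<^bsub>sec X (topspace (pts X))\<^esub>\<rparr>"

definition preim ::
  "('x, 's, 'm) sheafed_space \<Rightarrow> ('x \<Rightarrow> 'y) \<Rightarrow> 'y set \<Rightarrow> 'x set" where
  "preim X f V = {x \<in> topspace (pts X). f x \<in> V}"

text \<open>Morphisms of locally ringed (resp. monoidal) spaces: the last clause says that the maps on
  stalks are local. All functions are extensional, so that equality of morphisms is equality.\<close>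

definition sh_hom ::
  "(('t, 'n) monoid_scheme \<Rightarrow> ('s, 'm) monoid_scheme \<Rightarrow> ('t \<Rightarrow> 's) set) \<Rightarrow>
   ('x, 's, 'm) sheafed_space \<Rightarrow> ('y, 't, 'n) sheafed_space \<Rightarrow>
   (('x \<Rightarrow> 'y) \<times> ('y set \<Rightarrow> 't \<Rightarrow> 's)) set" where
  "sh_hom hm X Y =
     {(f, F).
        continuous_map (pts X) (pts Y) f \<and> f \<in> extensional (topspace (pts X)) \<and>
        (\<forall>V. openin (pts Y) V \<longrightarrow>
           F V \<in> hm (sec Y V) (sec X (preim X f V)) \<and> F V \<in> extensional (carrier (sec Y V))) \<and>
        F \<in> extensional {V. openin (pts Y) V} \<and>
        (\<forall>V W. openin (pts Y) V \<and> openin (pts Y) W \<and> W \<subseteq> V \<longrightarrow>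
           (\<forall>s \<in> carrier (sec Y V).
              F W (res Y V W s) = res X (preim X f V) (preim X f W) (F V s))) \<and>
        (\<forall>x \<in> topspace (pts X). \<forall>V. openin (pts Y) V \<and> f x \<in> V \<longrightarrow>
           (\<forall>s \<in> carrier (sec Y V).
              germ X x (preim X f V) (F V s) \<in> Units (stalk X x) \<longrightarrow>
              germ Y (f x) V s \<in> Units (stalk Y (f x))))}"

definition sh_comp ::
  "('x, 's, 'm) sheafed_space \<Rightarrow> ('y, 't, 'n) sheafed_space \<Rightarrow> ('z, 'u, 'k) sheafed_space \<Rightarrow>
   ('y \<Rightarrow> 'z) \<times> ('z set \<Rightarrow> 'u \<Rightarrow> 't) \<Rightarrow> ('x \<Rightarrow> 'y) \<times> ('y set \<Rightarrow> 't \<Rightarrow> 's) \<Rightarrow>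
   ('x \<Rightarrow> 'z) \<times> ('z set \<Rightarrow> 'u \<Rightarrow> 's)" where
  "sh_comp X Y Z g f =
     (compose (topspace (pts X)) (fst g) (fst f),
      \<lambda>W \<in> {W. openin (pts Z) W}. compose (carrier (sec Z W)) (snd f (preim Y (fst g) W)) (snd g W))"

definition sh_isomorphic ::
  "(('t, 'n) monoid_scheme \<Rightarrow> ('s, 'm) monoid_scheme \<Rightarrow> ('t \<Rightarrow> 's) set) \<Rightarrow>
   ('x, 's, 'm) sheafed_space \<Rightarrow> ('y, 't, 'n) sheafed_space \<Rightarrow> bool" where
  "sh_isomorphic hm X Y \<longleftrightarrow>
     (\<exists>(f, F) \<in> sh_hom hm X Y. homeomorphic_map (pts X) (pts Y) f \<and>
        (\<forall>V. openin (pts Y) V \<longrightarrow>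
           bij_betw (F V) (carrier (sec Y V)) (carrier (sec X (preim X f V)))))"


section \<open>Spectra\<close>

text \<open>The fraction \<open>a/s\<close> in the localisation at \<open>S\<close>, as an equivalence class. In a ring the condition
  $u a t = u b s$ is the usual $u (a t - b s) = 0$.\<close>

definition loc_frac :: "('a, 'm) monoid_scheme \<Rightarrow> 'a set \<Rightarrow> 'a \<Rightarrow> 'a \<Rightarrow> ('a \<times> 'a) set" where
  "loc_frac M S a s =
     {(b, t). b \<in> carrier M \<and> t \<in> S \<and> (\<exists>u \<in> S. u \<otimes>\<^bsub>M\<^esub> (a \<otimes>\<^bsub>M\<^esub> t) = u \<otimes>\<^bsub>M\<^esub> (b \<otimes>\<^bsub>M\<^esub> s))}"

definition loc_mult ::
  "('a, 'm) monoid_scheme \<Rightarrow> 'a set \<Rightarrow> ('a \<times> 'a) set \<Rightarrow> ('a \<times> 'a) set \<Rightarrow> ('a \<times> 'a) set" where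
  "loc_mult M S A B =
     (\<Union>(a, s) \<in> A. \<Union>(b, t) \<in> B. loc_frac M S (a \<otimes>\<^bsub>M\<^esub> b) (s \<otimes>\<^bsub>M\<^esub> t))"

definition loc_add ::
  "'a ring \<Rightarrow> 'a set \<Rightarrow> ('a \<times> 'a) set \<Rightarrow> ('a \<times> 'a) set \<Rightarrow> ('a \<times> 'a) set" where
  "loc_add R S A B =
     (\<Union>(a, s) \<in> A. \<Union>(b, t) \<in> B.
        loc_frac R S (a \<otimes>\<^bsub>R\<^esub> t \<oplus>\<^bsub>R\<^esub> b \<otimes>\<^bsub>R\<^esub> s) (s \<otimes>\<^bsub>R\<^esub> t))"

definition zariski :: "'a set set \<Rightarrow> 'a set \<Rightarrow> 'a set topology" where
  "zariski P C = topology (\<lambda>U. \<exists>I \<subseteq> C. U = {p \<in> P. \<not> I \<subseteq> p})"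

text \<open>Sections over \<open>U\<close> are the functions assigning to each prime \<open>p \<in> U\<close> an element of the localisation
  at \<open>p\<close> that are locally given by one fraction.\<close>

definition loc_sections ::
  "('a, 'm) monoid_scheme \<Rightarrow> 'a set topology \<Rightarrow> 'a set set \<Rightarrow> ('a set \<Rightarrow> ('a \<times> 'a) set) set" where
  "loc_sections M T U =
     {\<sigma> \<in> extensional U. \<forall>p \<in> U. \<exists>V a s. openin T V \<and> p \<in> V \<and> V \<subseteq> U \<and>
        a \<in> carrier M \<and> s \<in> carrier M \<and>
        (\<forall>q \<in> V. s \<notin> q \<and> \<sigma> q = loc_frac M (carrier M - q) a s)}"

definition mspec :: "'a pmonoid \<Rightarrow> ('a set, 'a set \<Rightarrow> ('a \<times> 'a) set) monoidal_space" where
  "mspec M =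
     (let T = zariski {p. pmonoid_prime p M} (carrier M); S = (\<lambda>p. carrier M - p) in
      \<lparr>pts = T,
       sec = (\<lambda>U.
         \<lparr>carrier = loc_sections M T U,
          mult = (\<lambda>\<sigma> \<tau>. \<lambda>p \<in> U. loc_mult M (S p) (\<sigma> p) (\<tau> p)),
          one = (\<lambda>p \<in> U. loc_frac M (S p) \<one>\<^bsub>M\<^esub> \<one>\<^bsub>M\<^esub>),
          absorb = (\<lambda>p \<in> U. loc_frac M (S p) (absorb M) \<one>\<^bsub>M\<^esub>)\<rparr>),
       res = (\<lambda>U V \<sigma>. restrict \<sigma> V)\<rparr>)"

definition Spec :: "'a ring \<Rightarrow> ('a set, 'a set \<Rightarrow> ('a \<times> 'a) set) ringed_space" where
  "Spec R =
     (let T = zariski {p. primeideal p R} (carrier R); S = (\<lambda>p. carrier R - p) in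
      \<lparr>pts = T,
       sec = (\<lambda>U.
         \<lparr>carrier = loc_sections R T U,
          mult = (\<lambda>\<sigma> \<tau>. \<lambda>p \<in> U. loc_mult R (S p) (\<sigma> p) (\<tau> p)),
          one = (\<lambda>p \<in> U. loc_frac R (S p) \<one>\<^bsub>R\<^esub> \<one>\<^bsub>R\<^esub>),
          zero = (\<lambda>p \<in> U. loc_frac R (S p) \<zero>\<^bsub>R\<^esub> \<one>\<^bsub>R\<^esub>),
          add = (\<lambda>\<sigma> \<tau>. \<lambda>p \<in> U. loc_add R (S p) (\<sigma> p) (\<tau> p))\<rparr>),
       res = (\<lambda>U V \<sigma>. restrict \<sigma> V)\<rparr>)"

text \<open>The morphism \<open>Y \<rightarrow> X\<close> of spectra induced by \<open>\<phi>: A \<rightarrow> B\<close>, where \<open>X\<close> and \<open>Y\<close> are the spectra of \<open>A\<close>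
  and \<open>B\<close>.\<close>

definition spectral_map ::
  "('a, 'm) monoid_scheme \<Rightarrow> ('b, 'n) monoid_scheme \<Rightarrow>
   ('a set, 'a set \<Rightarrow> ('a \<times> 'a) set, 'k) sheafed_space \<Rightarrow>
   ('b set, 'b set \<Rightarrow> ('b \<times> 'b) set, 'l) sheafed_space \<Rightarrow> ('a \<Rightarrow> 'b) \<Rightarrow>
   ('b set \<Rightarrow> 'a set) \<times> ('a set set \<Rightarrow> ('a set \<Rightarrow> ('a \<times> 'a) set) \<Rightarrow> 'b set \<Rightarrow> ('b \<times> 'b) set)" where
  "spectral_map A B X Y \<phi> =
     (let c = (\<lambda>q \<in> topspace (pts Y). {a \<in> carrier A. \<phi> a \<in> q}) in
      (c, \<lambda>V \<in> {V. openin (pts X) V}. \<lambda>\<sigma> \<in> carrier (sec X V). \<lambda>q \<in> preim Y c V.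
            \<Union>(a, s) \<in> \<sigma> (c q). loc_frac B (carrier B - q) (\<phi> a) (\<phi> s)))"

abbreviation mspec_map where
  "mspec_map M N \<phi> \<equiv> spectral_map M N (mspec M) (mspec N) \<phi>"

abbreviation Spec_map where
  "Spec_map R S \<phi> \<equiv> spectral_map R S (Spec R) (Spec S) \<phi>"

lemma istopology_zariski:
  assumes "\<And>p. p \<in> P \<Longrightarrow> p \<subset> C"
    and "\<And>a b. a \<in> C \<Longrightarrow> b \<in> C \<Longrightarrow> f a b \<in> C"
    and "\<And>p a b. p \<in> P \<Longrightarrow> a \<in> C \<Longrightarrow> b \<in> C \<Longrightarrow> f a b \<in> p \<longleftrightarrow> a \<in> p \<or> b \<in> p"
  shows "istopology (\<lambda>U. \<exists>I \<subseteq> C. U = {p \<in> P. \<not> I \<subseteq> p})"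
proof -
  define D where "D I = {p \<in> P. \<not> I \<subseteq> p}" for I
  have D: "p \<in> D I \<longleftrightarrow> p \<in> P \<and> \<not> I \<subseteq> p" for p I
    by (simp add: D_def)
  have inter: "\<exists>K \<subseteq> C. D I \<inter> D J = D K" if "I \<subseteq> C" "J \<subseteq> C" for I J
  proof -
    define K where "K = {f a b | a b. a \<in> I \<and> b \<in> J}"
    have "K \<subseteq> C"
      unfolding K_def using that assms(2) by blast
    moreover have "\<not> K \<subseteq> p \<longleftrightarrow> \<not> I \<subseteq> p \<and> \<not> J \<subseteq> p" if "p \<in> P" for p
      using assms(3)[OF that] \<open>I \<subseteq> C\<close> \<open>J \<subseteq> C\<close> unfolding K_def by (auto simp: subset_iff) metis+
    then have "D I \<inter> D J = D K"
      by (intro Set.set_eqI) (simp add: D, metis)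
    ultimately show ?thesis by blast
  qed
  have union: "\<exists>K \<subseteq> C. \<Union>\<K> = D K" if "\<forall>U \<in> \<K>. \<exists>I \<subseteq> C. U = D I" for \<K>
  proof -
    define K where "K = \<Union>{I. I \<subseteq> C \<and> D I \<in> \<K>}"
    have "K \<subseteq> C"
      unfolding K_def by blast
    moreover have "\<Union>\<K> = D K"
    proof (intro Set.set_eqI iffI)
      fix p assume "p \<in> \<Union>\<K>"
      then obtain U where U: "U \<in> \<K>" "p \<in> U" by blast
      with that obtain I where I: "I \<subseteq> C" "U = D I" by blast
      then have "I \<subseteq> K"
        unfolding K_def using U by blast
      then show "p \<in> D K"
        using U I by (auto simp: D)
    next
      fix p assume p: "p \<in> D K"
      then obtain a where "a \<in> K" "a \<notin> p" by (auto simp: D)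
      then obtain I where "a \<in> I" "D I \<in> \<K>" unfolding K_def by blast
      moreover have "p \<in> D I"
        using p \<open>a \<in> I\<close> \<open>a \<notin> p\<close> by (auto simp: D)
      ultimately show "p \<in> \<Union>\<K>" by blast
    qed
    ultimately show ?thesis by blast
  qed
  have "istopology (\<lambda>U. \<exists>I \<subseteq> C. U = D I)"
    unfolding istopology_def
  proof (intro conjI allI impI)
    fix S T assume "\<exists>I \<subseteq> C. S = D I" "\<exists>I \<subseteq> C. T = D I"
    then show "\<exists>I \<subseteq> C. S \<inter> T = D I"
      using inter by (elim exE conjE) simp
  next
    fix \<K> assume "\<forall>U \<in> \<K>. \<exists>I \<subseteq> C. U = D I"
    then show "\<exists>I \<subseteq> C. \<Union>\<K> = D I"
      by (rule union)
  qed
  then show ?thesis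
    by (simp only: D_def)
qed

lemma openin_mspec:
  assumes "pmonoid M"
  shows "openin (pts (mspec M)) U \<longleftrightarrow> (\<exists>I \<subseteq> carrier M. U = {p. pmonoid_prime p M \<and> \<not> I \<subseteq> p})"
proof -
  interpret pmonoid M by fact
  have "istopology (\<lambda>U. \<exists>I \<subseteq> carrier M. U = {p \<in> {p. pmonoid_prime p M}. \<not> I \<subseteq> p})"
  proof (rule istopology_zariski[where f = "mult M"])
    fix p a b
    assume "p \<in> {p. pmonoid_prime p M}" and ab: "a \<in> carrier M" "b \<in> carrier M"
    then have p: "pmonoid_prime p M" by simp
    have id: "x \<otimes>\<^bsub>M\<^esub> y \<in> p" if "x \<in> p" "y \<in> carrier M" for x y
      using p that unfolding pmonoid_prime_def pmonoid_ideal_def by blast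
    have "a \<otimes>\<^bsub>M\<^esub> b \<notin> p" if "a \<notin> p" "b \<notin> p"
      using p that ab unfolding pmonoid_prime_def by blast
    then show "a \<otimes>\<^bsub>M\<^esub> b \<in> p \<longleftrightarrow> a \<in> p \<or> b \<in> p"
      using id[of a b] id[of b a] ab m_comm[OF ab] by metis
  qed (auto simp: pmonoid_prime_def pmonoid_ideal_def)
  then show ?thesis
    by (simp add: mspec_def Let_def zariski_def)
qed

lemma openin_Spec:
  assumes "cring R"
  shows "openin (pts (Spec R)) U \<longleftrightarrow> (\<exists>I \<subseteq> carrier R. U = {p. primeideal p R \<and> \<not> I \<subseteq> p})"
proof -
  interpret cring R by fact
  have "istopology (\<lambda>U. \<exists>I \<subseteq> carrier R. U = {p \<in> {p. primeideal p R}. \<not> I \<subseteq> p})"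
  proof (rule istopology_zariski[where f = "mult R"])
    fix p assume "p \<in> {p. primeideal p R}"
    then interpret primeideal p R by simp
    show "p \<subset> carrier R"
      using a_subset I_notcarr by blast
    fix a b assume "a \<in> carrier R" "b \<in> carrier R"
    then show "a \<otimes>\<^bsub>R\<^esub> b \<in> p \<longleftrightarrow> a \<in> p \<or> b \<in> p"
      using I_prime I_l_closed I_r_closed by blast
  qed auto
  then show ?thesis
    by (simp add: Spec_def Let_def zariski_def)
qed


section \<open>Schemes and monoid schemes\<close>

definition affine_open :: "('x, 's) ringed_space \<Rightarrow> 'x set \<Rightarrow> 'a ring \<Rightarrow> bool" where
  "affine_open X U R \<longleftrightarrow>
     openin (pts X) U \<and> cring R \<and> sh_isomorphic ring_hom (open_subspace X U) (Spec R)"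

definition maffine_open :: "('x, 's) monoidal_space \<Rightarrow> 'x set \<Rightarrow> 'a pmonoid \<Rightarrow> bool" where
  "maffine_open X U M \<longleftrightarrow>
     openin (pts X) U \<and> pmonoid M \<and> sh_isomorphic pmonoid_hom (open_subspace X U) (mspec M)"

text \<open>A ring whose spectrum is \<open>U\<close> is isomorphic to the ring of sections over \<open>U\<close>, so it is no
  restriction to look for it in the type \<open>'s\<close>. Likewise for monoids.\<close>

definition scheme :: "('x, 's) ringed_space \<Rightarrow> bool" where
  "scheme X \<longleftrightarrow>
     is_sheaf cring ring_hom X \<and>
     (\<forall>x \<in> topspace (pts X). \<exists>U (R :: 's ring). x \<in> U \<and> affine_open X U R)"

definition monoid_scheme :: "('x, 's) monoidal_space \<Rightarrow> bool" where
  "monoid_scheme X \<longleftrightarrow>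
     is_sheaf pmonoid pmonoid_hom X \<and>
     (\<forall>x \<in> topspace (pts X). \<exists>U (M :: 's pmonoid). x \<in> U \<and> maffine_open X U M)"

definition noetherian_scheme :: "('x, 's) ringed_space \<Rightarrow> bool" where
  "noetherian_scheme X \<longleftrightarrow>
     scheme X \<and>
     (\<exists>\<U>. finite \<U> \<and> \<Union>\<U> = topspace (pts X) \<and>
        (\<forall>U \<in> \<U>. \<exists>R :: 's ring. affine_open X U R \<and> noetherian_ring R))"

definition ring_fin_gen :: "'a ring \<Rightarrow> bool" where
  "ring_fin_gen R \<longleftrightarrow>
     (\<exists>G \<subseteq> carrier R. finite G \<and> (\<forall>S. subring S R \<and> G \<subseteq> S \<longrightarrow> S = carrier R))"

text \<open>Every ring is a \<open>\<int>\<close>-algebra in exactly one way, and finitely generated as such iff it is finitely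
  generated as a ring.\<close>

definition finite_type_over_Z :: "('x, 's) ringed_space \<Rightarrow> bool" where
  "finite_type_over_Z X \<longleftrightarrow>
     scheme X \<and>
     (\<exists>\<U>. finite \<U> \<and> \<Union>\<U> = topspace (pts X) \<and>
        (\<forall>U \<in> \<U>. \<exists>R :: 's ring. affine_open X U R \<and> ring_fin_gen R))"

definition irreducible_closed :: "'x topology \<Rightarrow> 'x set \<Rightarrow> bool" where
  "irreducible_closed T Z \<longleftrightarrow>
     closedin T Z \<and> Z \<noteq> {} \<and>
     (\<forall>A B. closedin T A \<and> closedin T B \<and> Z \<subseteq> A \<union> B \<longrightarrow> Z \<subseteq> A \<or> Z \<subseteq> B)"

text \<open>The empty space has dimension \<open>-\<infinity>\<close>.\<close>

definition krull_dim :: "'x topology \<Rightarrow> ereal" where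
  "krull_dim T =
     Sup {ereal (real n) | n. \<exists>Z. (\<forall>i \<le> n. irreducible_closed T (Z i)) \<and> (\<forall>i < n. Z i \<subset> Z (Suc i))}"

text \<open>The supremum of the dimensions of the fibres of \<open>\<pi>: X \<rightarrow> S\<close>; the space underlying the
  scheme-theoretic fibre over a point is the set-theoretic fibre with the subspace topology.\<close>

definition reldim ::
  "('x, 's) ringed_space \<Rightarrow> ('y, 't) ringed_space \<Rightarrow> ('x \<Rightarrow> 'y) \<times> ('y set \<Rightarrow> 't \<Rightarrow> 's) \<Rightarrow> ereal" where
  "reldim X S \<pi> = (SUP y \<in> topspace (pts S). krull_dim (subtopology (pts X) (preim X (fst \<pi>) {y})))"


section \<open>The category of monoids and rings\<close>

datatype 'u mr_obj = MonObj "'u pmonoid" | RingObj "'u ring"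

datatype 'u mr_mor = MonMor "'u \<Rightarrow> 'u" | RingMor "'u \<Rightarrow> 'u" | MixMor "('u \<Rightarrow> int) \<Rightarrow> 'u"

fun is_mr_obj :: "'u mr_obj \<Rightarrow> bool" where
  "is_mr_obj (MonObj M) = pmonoid M"
| "is_mr_obj (RingObj R) = cring R"

fun mr_hom :: "'u mr_obj \<Rightarrow> 'u mr_obj \<Rightarrow> 'u mr_mor set" where
  "mr_hom (MonObj M) (MonObj N) = MonMor ` (pmonoid_hom M N \<inter> extensional (carrier M))"
| "mr_hom (RingObj R) (RingObj S) = RingMor ` (ring_hom R S \<inter> extensional (carrier R))"
| "mr_hom (MonObj M) (RingObj R) =
     MixMor ` (ring_hom (monoid_ring M) R \<inter> extensional (carrier (monoid_ring M)))"
| "mr_hom (RingObj R) (MonObj M) = {}"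

fun mr_id :: "'u mr_obj \<Rightarrow> 'u mr_mor" where
  "mr_id (MonObj M) = MonMor (\<lambda>x \<in> carrier M. x)"
| "mr_id (RingObj R) = RingMor (\<lambda>x \<in> carrier R. x)"

text \<open>\<open>mr_comp A B g f\<close> is the composite of \<open>f: A \<rightarrow> B\<close> followed by \<open>g\<close>.\<close>

fun mr_comp :: "'u mr_obj \<Rightarrow> 'u mr_obj \<Rightarrow> 'u mr_mor \<Rightarrow> 'u mr_mor \<Rightarrow> 'u mr_mor" where
  "mr_comp (MonObj M) B (MonMor g) (MonMor f) = MonMor (compose (carrier M) g f)"
| "mr_comp (RingObj R) B (RingMor g) (RingMor f) = RingMor (compose (carrier R) g f)"
| "mr_comp (MonObj M) B (RingMor g) (MixMor f) = MixMor (compose (carrier (monoid_ring M)) g f)"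
| "mr_comp (MonObj M) (MonObj N) (MixMor g) (MonMor f) =
     MixMor (compose (carrier (monoid_ring M)) g (monoid_ring_map M N f))"
| "mr_comp _ _ _ _ = undefined"

record ('u, 'v) mr_functor =
  fobj :: "'u mr_obj \<Rightarrow> 'v set"
  fmor :: "'u mr_obj \<Rightarrow> 'u mr_obj \<Rightarrow> 'u mr_mor \<Rightarrow> 'v \<Rightarrow> 'v"

definition is_mr_functor :: "('u, 'v) mr_functor \<Rightarrow> bool" where
  "is_mr_functor X \<longleftrightarrow>
     (\<forall>A B. is_mr_obj A \<and> is_mr_obj B \<longrightarrow>
        (\<forall>f \<in> mr_hom A B. fmor X A B f \<in> fobj X A \<rightarrow> fobj X B)) \<and>
     (\<forall>A. is_mr_obj A \<longrightarrow> (\<forall>x \<in> fobj X A. fmor X A A (mr_id A) x = x)) \<and>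
     (\<forall>A B C. is_mr_obj A \<and> is_mr_obj B \<and> is_mr_obj C \<longrightarrow>
        (\<forall>f \<in> mr_hom A B. \<forall>g \<in> mr_hom B C. \<forall>x \<in> fobj X A.
           fmor X A C (mr_comp A B g f) x = fmor X B C g (fmor X A B f x)))"

abbreviation mon_obj :: "('u, 'v) mr_functor \<Rightarrow> 'u pmonoid \<Rightarrow> 'v set" where
  "mon_obj X M \<equiv> fobj X (MonObj M)"

abbreviation mon_mor ::
  "('u, 'v) mr_functor \<Rightarrow> 'u pmonoid \<Rightarrow> 'u pmonoid \<Rightarrow> ('u \<Rightarrow> 'u) \<Rightarrow> 'v \<Rightarrow> 'v" where
  "mon_mor X M N \<phi> \<equiv> fmor X (MonObj M) (MonObj N) (MonMor \<phi>)"

abbreviation ring_obj :: "('u, 'v) mr_functor \<Rightarrow> 'u ring \<Rightarrow> 'v set" where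
  "ring_obj X R \<equiv> fobj X (RingObj R)"

abbreviation ring_mor ::
  "('u, 'v) mr_functor \<Rightarrow> 'u ring \<Rightarrow> 'u ring \<Rightarrow> ('u \<Rightarrow> 'u) \<Rightarrow> 'v \<Rightarrow> 'v" where
  "ring_mor X R S \<phi> \<equiv> fmor X (RingObj R) (RingObj S) (RingMor \<phi>)"


section \<open>\<open>\<F>\<^sub>1\<close>-schemes\<close>

definition monoid_realisation :: "('u, 'v) mr_functor \<Rightarrow> ('x, 's) monoidal_space \<Rightarrow> bool" where
  "monoid_realisation X XM \<longleftrightarrow>
     monoid_scheme XM \<and>
     (\<exists>\<eta>. (\<forall>M. pmonoid M \<longrightarrow> bij_betw (\<eta> M) (mon_obj X M) (sh_hom pmonoid_hom (mspec M) XM)) \<and>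
        (\<forall>M N. pmonoid M \<and> pmonoid N \<longrightarrow>
           (\<forall>\<phi> \<in> pmonoid_hom M N \<inter> extensional (carrier M). \<forall>x \<in> mon_obj X M.
              \<eta> N (mon_mor X M N \<phi> x) = sh_comp (mspec N) (mspec M) XM (\<eta> M x) (mspec_map M N \<phi>))))"

definition ring_realisation :: "('u, 'v) mr_functor \<Rightarrow> ('y, 't) ringed_space \<Rightarrow> bool" where
  "ring_realisation X XZ \<longleftrightarrow>
     scheme XZ \<and>
     (\<exists>\<eta>. (\<forall>R. cring R \<longrightarrow> bij_betw (\<eta> R) (ring_obj X R) (sh_hom ring_hom (Spec R) XZ)) \<and>
        (\<forall>R S. cring R \<and> cring S \<longrightarrow>
           (\<forall>\<phi> \<in> ring_hom R S \<inter> extensional (carrier R). \<forall>x \<in> ring_obj X R.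
              \<eta> S (ring_mor X R S \<phi> x) = sh_comp (Spec S) (Spec R) XZ (\<eta> R x) (Spec_map R S \<phi>))))"

text \<open>The type \<open>'u\<close> plays the part of the universe in which monoids and rings live. The two
  realisations are arguments because their types cannot be quantified over inside a definition.\<close>

definition F1_scheme ::
  "('u, 'v) mr_functor \<Rightarrow> ('x, 's) monoidal_space \<Rightarrow> ('y, 't) ringed_space \<Rightarrow> bool" where
  "F1_scheme X XM XZ \<longleftrightarrow>
     is_mr_functor X \<and> monoid_realisation X XM \<and> ring_realisation X XZ \<and>
     (\<forall>K. field K \<longrightarrow>
        bij_betw (fmor X (MonObj (ring_pmonoid K)) (RingObj K) (MixMor (monoid_ring_eval K)))
          (mon_obj X (ring_pmonoid K)) (ring_obj X K))"

definition mon_subfunctor :: "('u, 'v) mr_functor \<Rightarrow> ('u pmonoid \<Rightarrow> 'v set) \<Rightarrow> bool" where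
  "mon_subfunctor X Y \<longleftrightarrow>
     (\<forall>M. pmonoid M \<longrightarrow> Y M \<subseteq> mon_obj X M) \<and>
     (\<forall>M N. pmonoid M \<and> pmonoid N \<longrightarrow>
        (\<forall>\<phi> \<in> pmonoid_hom M N \<inter> extensional (carrier M). mon_mor X M N \<phi> \<in> Y M \<rightarrow> Y N))"

text \<open>By the Yoneda lemma \<open>x \<in> X(M)\<close> is a transformation \<open>Hom(M, -) \<rightarrow> X\<close>; openness means that each
  pull-back of \<open>Y\<close> along such a transformation consists of those \<open>\<phi>: M \<rightarrow> N\<close> for which the image of
  some fixed ideal of \<open>M\<close> generates the unit ideal of \<open>N\<close>.\<close>

definition mon_open_subfunctor :: "('u, 'v) mr_functor \<Rightarrow> ('u pmonoid \<Rightarrow> 'v set) \<Rightarrow> bool" where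
  "mon_open_subfunctor X Y \<longleftrightarrow>
     mon_subfunctor X Y \<and>
     (\<forall>M. pmonoid M \<longrightarrow> (\<forall>x \<in> mon_obj X M. \<exists>I. pmonoid_ideal I M \<and>
        (\<forall>N. pmonoid N \<longrightarrow> (\<forall>\<phi> \<in> pmonoid_hom M N \<inter> extensional (carrier M).
           mon_mor X M N \<phi> x \<in> Y N \<longleftrightarrow>
           {\<phi> a \<otimes>\<^bsub>N\<^esub> b | a b. a \<in> I \<and> b \<in> carrier N} = carrier N))))"

definition mon_represented ::
  "('u, 'v) mr_functor \<Rightarrow> ('u pmonoid \<Rightarrow> 'v set) \<Rightarrow> 'u pmonoid \<Rightarrow> bool" where
  "mon_represented X Y M \<longleftrightarrow>
     pmonoid M \<and>
     (\<exists>\<theta>. (\<forall>N. pmonoid N \<longrightarrow> bij_betw (\<theta> N) (Y N) (pmonoid_hom M N \<inter> extensional (carrier M))) \<and>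
        (\<forall>N N'. pmonoid N \<and> pmonoid N' \<longrightarrow>
           (\<forall>\<phi> \<in> pmonoid_hom N N' \<inter> extensional (carrier N). \<forall>y \<in> Y N.
              \<theta> N' (mon_mor X N N' \<phi> y) = compose (carrier M) \<phi> (\<theta> N y))))"

text \<open>Subfunctors cover if they do so on the monoids \<open>\<F>\<^sub>1[H]\<close> with \<open>H\<close> an abelian group, which are the
  analogues of fields.\<close>

definition F1_noetherian :: "('u, 'v) mr_functor \<Rightarrow> ('y, 't) ringed_space \<Rightarrow> bool" where
  "F1_noetherian X XZ \<longleftrightarrow>
     (\<exists>\<Y>. finite \<Y> \<and>
        (\<forall>Y \<in> \<Y>. mon_open_subfunctor X Y \<and> (\<exists>M. pmonoid_fin_gen M \<and> mon_represented X Y M)) \<and>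
        (\<forall>M (H :: 'u monoid). pmonoid M \<and> comm_group H \<and> pmonoid_iso M (group_pmonoid H) \<longrightarrow>
           mon_obj X M = (\<Union>Y \<in> \<Y>. Y M))) \<and>
     noetherian_scheme XZ"

definition stalk_units :: "('x, 's) monoidal_space \<Rightarrow> 'x \<Rightarrow> ('x set \<times> 's) set monoid" where
  "stalk_units XM x = units_of (stalk XM x)"

definition F1_torsion_free :: "('x, 's) monoidal_space \<Rightarrow> bool" where
  "F1_torsion_free XM \<longleftrightarrow>
     (\<forall>x \<in> topspace (pts XM). \<forall>u \<in> carrier (stalk_units XM x). \<forall>n :: nat. n > 0 \<longrightarrow>
        u [^]\<^bsub>stalk_units XM x\<^esub> n = \<one>\<^bsub>stalk_units XM x\<^esub> \<longrightarrow> u = \<one>\<^bsub>stalk_units XM x\<^esub>)"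

text \<open>The largest number of \<open>\<int>\<close>-linearly independent elements; meaningful only if this number is
  finite, as it is for finitely generated groups.\<close>

definition ab_rank :: "'g monoid \<Rightarrow> nat" where
  "ab_rank G =
     Sup {card B | B. B \<subseteq> carrier G \<and> finite B \<and>
       (\<forall>c :: 'g \<Rightarrow> int. (\<Otimes>\<^bsub>G\<^esub>b \<in> B. b [^]\<^bsub>G\<^esub> c b) = \<one>\<^bsub>G\<^esub> \<longrightarrow> (\<forall>b \<in> B. c b = 0))}"

text \<open>The orders of the finite fields \<open>K\<close> are exactly the prime powers.\<close>

definition counting_function ::
  "('u, 'v) mr_functor \<Rightarrow> ('x, 's) monoidal_space \<Rightarrow> ('y, 't) ringed_space \<Rightarrow> (real \<Rightarrow> real) \<Rightarrow> bool" where
  "counting_function X XM XZ N \<longleftrightarrow>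
     (\<forall>n (M :: 'u pmonoid). n \<ge> 1 \<and> pmonoid M \<and>
        pmonoid_iso M (group_pmonoid (integer_mod_group n)) \<longrightarrow>
        real (card (mon_obj X M)) = N (real n + 1)) \<and>
     (\<forall>K :: 'u ring. field K \<and> finite (carrier K) \<longrightarrow>
        real (card (sh_hom ring_hom (Spec K) XZ)) = N (real (card (carrier K)))) \<and>
     (\<forall>t. N t = (\<Sum>x \<in> topspace (pts XM). (t - 1) ^ ab_rank (stalk_units XM x)))"

definition poly_deg :: "int poly \<Rightarrow> ereal" where
  "poly_deg p = (if p = 0 then -\<infinity> else ereal (real (Polynomial.degree p)))"

end

theory Submission
  imports Defs "HOL-Algebra.Generated_Fields" "HOL-Algebra.Weak_Morphisms" "HOL-Analysis.Continuum_Not_Denumerable"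
begin

text \<open>Both sides are compared with the same quantity, the largest rank of the units outside a prime \<open>p\<close> of
 one of the finitely generated monoids \<open>M\<close> that cover \<open>X\<close>. Up to torsion these units are free on a finite
 set \<open>B\<close>, so the number of homomorphisms from \<open>M\<close> to \<open>\<F>\<^sub>1[C\<^sub>m]\<close> grows like the power of \<open>m\<close>
 with exponent the largest \<open>card B\<close>; hence this exponent is the degree of the counting polynomial.

 On the other side, a chain of irreducible closed sets in a fibre over \<open>\<int>\<close> yields, in an affine chart with ring
 \<open>R\<close>, elements algebraically independent modulo a prime \<open>P\<close>, and conversely. The residue field \<open>K\<close> of \<open>P\<close> is
 countable, so a copy of it lives in \<open>'u\<close>, and the bijection \<open>X(K as a monoid) \<cong> X(K)\<close> turns the point \<open>P\<close>
 into a homomorphism \<open>M \<rightarrow> K\<close>. Applying naturality to subfields, the image of \<open>M\<close> and the image of \<open>R\<close> generate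
 the same subfield of \<open>K\<close>, whose transcendence degree is bounded by \<open>card B\<close>. For the converse, \<open>B\<close> is sent
 to algebraically independent elements of a field.\<close>

section \<open>Algebraic independence and chains of primes\<close>

text \<open>Independence is always measured over \<open>zim R\<close>, the image of the integers.
  Modulo a prime this base is Z or a prime field, so characteristics need no separate treatment, and
  keeping the intersection with \<open>zim R\<close> fixed amounts to staying in one fibre. The
  bijection X(K as a monoid) = X(K) is only a bijection of sets: it does not tell how M -> K
  determines R -> K. What can be exploited is its compatibility with inclusions of subfields, which
  is why generated subfields are compared and not the images themselves. Passing from a subfield of
  definition of the point to one of M -> K needs in addition that the subfunctor given by M is open.
  The rings of sections and the rings on which X is defined have different types, and a type cannot
  vary along a tower of extensions. Hence primes, independence and finiteness are phrased for
  subsets of one fixed ring, modulo a prime where necessary, with polynomials as coefficient lists;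
  changes of type are confined to the construction of countable fields over \<open>'u\<close>.
  Torsion never has to be split off: an exponent e clears it, and passing to e-th powers changes
  neither growth rates nor transcendence degrees.\<close>

primrec horner :: "('a, 'm) ring_scheme => 'a list => 'a => 'a" where
 "horner R [] x = \<zero>\<^bsub>R\<^esub>"
| "horner R (c # cs) x = c\<oplus>\<^bsub>R\<^esub> x\<otimes>\<^bsub>R\<^esub> horner R cs x"

definition adjoin :: "('a, 'm) ring_scheme => 'a set => 'a => 'a set" where
 "adjoin R C x = {horner R cs x | cs. set cs<=C}"

text \<open>Transcendence of the image of \<open>x\<close> over the image of \<open>C\<close> in
  R/P, phrased without the quotient: a value in \<open>P\<close> forces the coefficients into
  \<open>P\<close>. For P = {0} it is transcendence in the usual sense.\<close>

definition transc_mod :: "('a, 'm) ring_scheme => 'a set => 'a set => 'a => bool" where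
 "transc_mod R P C x \<longleftrightarrow> (\<forall>cs. set cs<=C --> horner R cs x\<in>P --> set cs<=P)"

text \<open>Algebraic independence tested one element at a time over a growing base; in this form
  chains of primes produce it and are produced from it.\<close>

primrec indep_mod :: "('a, 'm) ring_scheme => 'a set => 'a set => 'a list => bool" where
 "indep_mod R P C [] \<longleftrightarrow> True"
| "indep_mod R P C (x # xs) \<longleftrightarrow> transc_mod R P C x & indep_mod R P (adjoin R C x) xs"

text \<open>Prime ideals of a subring, kept as subsets of the ambient ring so that they can be
  lifted along towers of subrings. For a subring \<open>C\<close>, closure under negation follows
  because -1 lies in \<open>C\<close>.\<close>

definition prime_in :: "('a, 'm) ring_scheme => 'a set => 'a set => bool" where
 "prime_in R C q \<longleftrightarrow>
   q<=C & \<zero>\<^bsub>R\<^esub>\<in>q & (\<forall>a\<in>q. \<forall>b\<in>q. a\<oplus>\<^bsub>R\<^esub> b\<in>q) & (\<forall>a\<in>q. \<forall>c\<in>C. c\<otimes>\<^bsub>R\<^esub> a\<in>q) &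
   \<one>\<^bsub>R\<^esub>\<notin>q & (\<forall>a\<in>C. \<forall>b\<in>C. a\<otimes>\<^bsub>R\<^esub> b\<in>q --> a\<in>q \<or> b\<in>q)"

context cring
begin

lemma horner_closed [simp, intro]:
 "set cs<=carrier R ==> x\<in>carrier R ==> horner R cs x\<in>carrier R"
 by (induction cs) auto

lemma horner_in_subring:
 "subring C R ==> set cs<=C ==> x\<in>C ==> horner R cs x\<in>C"
 by (induction cs) (auto intro: subringE)

lemma horner_append:
 assumes "set cs<=carrier R" "set ds<=carrier R" "x\<in>carrier R"
 shows "horner R (cs @ ds) x = horner R cs x\<oplus>x [^] length cs\<otimes>horner R ds x"
 using assms
proof (induction cs)
 case (Cons c cs)
 hence "horner R ds x\<in>carrier R" "horner R cs x\<in>carrier R" by auto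
 thus ?case
  using Cons by (simp add: r_distr a_ac m_ac nat_pow_Suc del: nat_pow_Suc2)
qed simp

lemma horner_smult:
 assumes "set cs<=carrier R" "a\<in>carrier R" "x\<in>carrier R"
 shows "horner R (map ((\<otimes>) a) cs) x = a\<otimes>horner R cs x"
 using assms
proof (induction cs)
 case (Cons c cs)
 hence "horner R cs x\<in>carrier R" by auto
 thus ?case
  using Cons by (simp add: r_distr m_ac)
qed simp

lemma horner_replicate_zero: "x\<in>carrier R ==> horner R (replicate n \<zero>) x = \<zero>"
 by (induction n) auto

text \<open>The shorter list is padded by zeros. Length and coefficients are recorded because the
  division arguments below count degrees and check that coefficients lie in a given prime.\<close>

lemma horner_add:
 assumes "subring C R" "set cs<=C" "set ds<=C" "x\<in>carrier R"
 shows "\<exists>es. set es<=C & length es = max (length cs) (length ds) &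
      horner R es x = horner R cs x\<oplus>horner R ds x &
      (\<forall>i < length es. es ! i = (if i < length cs then cs ! i else \<zero>)\<oplus>(if i < length ds then ds ! i else \<zero>))"
 using assms(2,3)
proof (induction cs arbitrary: ds)
 case Nil
 have C: "C<=carrier R" using subringE(1)[OF assms(1)] .
 have "ds ! i\<in>carrier R" if "i < length ds" for i using Nil C that nth_mem by blast
 thus ?case using Nil C assms(4) by (intro exI[of _ ds]) auto
next
 case (Cons c cs)
 have C: "C<=carrier R" using subringE(1)[OF assms(1)] .
 show ?case
 proof (cases ds)
  case Nil
  have "(c # cs) ! i\<in>carrier R" if "i < length (c # cs)" for i
   using Cons.prems C that nth_mem by blast
  moreover have "horner R (c # cs) x\<in>carrier R"
   using Cons.prems C assms(4) by (intro horner_closed) auto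
  ultimately show ?thesis using Nil Cons.prems by (intro exI[of _ "c # cs"]) auto
 next
  case ds: (Cons d ds')
  then obtain es where es: "set es<=C" "length es = max (length cs) (length ds')"
    "horner R es x = horner R cs x\<oplus>horner R ds' x"
    "\<forall>i < length es. es ! i = (if i < length cs then cs ! i else \<zero>)\<oplus>(if i < length ds' then ds' ! i else \<zero>)"
   using Cons.IH[of ds'] Cons.prems by (auto simp del: max_def)
  have cl: "c\<in>carrier R" "d\<in>carrier R" "horner R cs x\<in>carrier R" "horner R ds' x\<in>carrier R"
   using Cons.prems ds C assms(4) by auto
  show ?thesis
  proof (intro exI[of _ "(c\<oplus>d) # es"] conjI allI impI)
   show "set ((c\<oplus>d) # es)<=C" using es Cons.prems ds subringE(7)[OF assms(1)] by auto
   show "horner R ((c\<oplus>d) # es) x = horner R (c # cs) x\<oplus>horner R ds x"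
    using cl es(3) ds assms(4) by (simp add: r_distr a_ac)
   show "((c\<oplus>d) # es) ! i = (if i < length (c # cs) then (c # cs) ! i else \<zero>) \<oplus>
     (if i < length ds then ds ! i else \<zero>)" if "i < length ((c\<oplus>d) # es)" for i
    using that es(4) ds by (cases i) auto
  qed (use es ds in auto)
 qed
qed

lemma adjoin_base: "C<=carrier R ==> x\<in>carrier R ==> C<=adjoin R C x"
proof
 fix c assume "C<=carrier R" "x\<in>carrier R" "c\<in>C"
 thus "c\<in>adjoin R C x"
  unfolding adjoin_def by (intro CollectI exI[of _ "[c]"]) auto
qed

lemma adjoin_gen: "subring C R ==> x\<in>carrier R ==> x\<in>adjoin R C x"
 unfolding adjoin_def
 by (intro CollectI exI[of _ "[\<zero>, \<one>]"]) (auto simp: subringE)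

lemma adjoin_closed: "C<=carrier R ==> x\<in>carrier R ==> adjoin R C x<=carrier R"
 unfolding adjoin_def by auto

lemma adjoin_minimal: "subring D R ==> C<=D ==> x\<in>D ==> adjoin R C x<=D"
 unfolding adjoin_def using horner_in_subring by blast

lemma adjoin_add:
 assumes "subring C R" "x\<in>carrier R" "a\<in>adjoin R C x" "b\<in>adjoin R C x"
 shows "a\<oplus>b\<in>adjoin R C x"
proof -
 obtain cs ds where "set cs<=C" "set ds<=C" "a = horner R cs x" "b = horner R ds x"
  using assms(3,4) unfolding adjoin_def by auto
 with horner_add[OF assms(1) this(1,2) assms(2)] show ?thesis
  unfolding adjoin_def by (smt (verit, best) mem_Collect_eq)
qed

lemma adjoin_smult:
 assumes "subring C R" "x\<in>carrier R" "c\<in>C" "a\<in>adjoin R C x"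
 shows "c\<otimes>a\<in>adjoin R C x"
proof -
 obtain cs where cs: "set cs<=C" "a = horner R cs x"
  using assms(4) unfolding adjoin_def by auto
 hence "c\<otimes>a = horner R (map ((\<otimes>) c) cs) x"
  using subringE(1)[OF assms(1)] assms(2,3) by (subst horner_smult) auto
 moreover have "set (map ((\<otimes>) c) cs)<=C"
  using cs assms(3) subringE(6)[OF assms(1)] by auto
 ultimately show ?thesis unfolding adjoin_def by blast
qed

lemma adjoin_mult_gen:
 assumes "subring C R" "x\<in>carrier R" "a\<in>adjoin R C x"
 shows "x\<otimes>a\<in>adjoin R C x"
proof -
 obtain cs where cs: "set cs<=C" "a = horner R cs x"
  using assms(3) unfolding adjoin_def by auto
 hence "horner R cs x\<in>carrier R"
  using assms(2) subringE(1)[OF assms(1)] by auto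
 hence "x\<otimes>a = horner R (\<zero> # cs) x"
  using cs assms(2) by simp
 thus ?thesis
  unfolding adjoin_def using cs subringE(2)[OF assms(1)] by (intro CollectI exI[of _ "\<zero> # cs"]) auto
qed

lemma adjoin_subring:
 assumes "subring C R" "x\<in>carrier R"
 shows "subring (adjoin R C x) R"
proof (rule ring.subringI[OF ring_axioms])
 have C: "C<=carrier R" using subringE(1)[OF assms(1)] .
 show sub: "adjoin R C x<=carrier R" using adjoin_closed[OF C assms(2)] .
 show "\<one>\<in>adjoin R C x" using adjoin_base[OF C assms(2)] subringE(3)[OF assms(1)] by auto
 show "\<ominus> h\<in>adjoin R C x" if "h\<in>adjoin R C x" for h
 proof -
  have "\<ominus> \<one>\<in>C" using subringE(3,5)[OF assms(1)] by auto
  from adjoin_smult[OF assms this that] show ?thesis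
   using that sub by (auto simp: l_minus)
 qed
 show "h1\<otimes>h2\<in>adjoin R C x" if h1': "h1\<in>adjoin R C x" and h2: "h2\<in>adjoin R C x" for h1 h2
 proof -
  obtain cs where "set cs<=C" and h1: "h1 = horner R cs x"
   using h1' unfolding adjoin_def by blast
  hence "horner R cs x\<otimes>h2\<in>adjoin R C x"
  proof (induction cs arbitrary: h1)
   case Nil
   thus ?case using adjoin_smult[OF assms _ h2, of \<zero>] subringE(2)[OF assms(1)] by simp
  next
   case (Cons c cs)
   have "h2\<in>carrier R" "c\<in>carrier R" "horner R cs x\<in>carrier R"
    using Cons.prems C h2 sub assms(2) by auto
   hence "horner R (c # cs) x\<otimes>h2 = c\<otimes>h2\<oplus>x\<otimes>(horner R cs x\<otimes>h2)"
    using assms(2) by (simp add: l_distr m_assoc)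
   also have "...\<in>adjoin R C x"
    using Cons adjoin_add[OF assms] adjoin_smult[OF assms _ h2] adjoin_mult_gen[OF assms] by auto
   finally show ?case .
  qed
  thus ?thesis using h1 by simp
 qed
 show "h1\<oplus>h2\<in>adjoin R C x" if "h1\<in>adjoin R C x" "h2\<in>adjoin R C x" for h1 h2
  using adjoin_add[OF assms that] .
qed

lemma adjoin_mono: "C<=D ==> adjoin R C x<=adjoin R D x"
 unfolding adjoin_def by auto

lemma foldl_adjoin_subring:
 "subring C R ==> set xs<=carrier R ==> subring (foldl (adjoin R) C xs) R"
 by (induction xs arbitrary: C) (auto intro: adjoin_subring)

lemma foldl_adjoin_base:
 assumes "subring C R" "set xs<=carrier R" 
 shows "C<=foldl (adjoin R) C xs"
 using assms
proof (induction xs arbitrary: C)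
 case (Cons x xs)
 hence "adjoin R C x<=foldl (adjoin R) (adjoin R C x) xs"
  by (simp add: adjoin_subring)
 moreover have "C<=adjoin R C x"
  using Cons.prems subringE(1)[of C R] adjoin_base[of C x] by auto
 ultimately show ?case by simp
qed simp

lemma foldl_adjoin_gens:
 assumes "subring C R" "set xs<=carrier R" 
 shows "set xs<=foldl (adjoin R) C xs"
 using assms
proof (induction xs arbitrary: C)
 case (Cons x xs)
 hence "x\<in>foldl (adjoin R) (adjoin R C x) xs"
  using adjoin_gen foldl_adjoin_base adjoin_subring by (metis insert_subset list.set(2) subsetD)
 thus ?case using Cons by (simp add: adjoin_subring)
qed simp

lemma foldl_adjoin_minimal:
 assumes "subring D R" "C<=D" "set xs<=D"
 shows "foldl (adjoin R) C xs<=D"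
 using assms(2,3)
 by (induction xs arbitrary: C) (use adjoin_minimal[OF assms(1)] in auto)

lemma countable_adjoin: "countable C ==> countable (adjoin R C x)"
proof -
 assume "countable C"
 hence "countable (lists C)" by simp
 moreover have "adjoin R C x = (%cs. horner R cs x) ` lists C"
  unfolding adjoin_def by auto
 ultimately show ?thesis by simp
qed

lemma countable_foldl_adjoin: "countable C ==> countable (foldl (adjoin R) C xs)"
 by (induction xs arbitrary: C) (auto intro: countable_adjoin)

lemma prime_inI_primeideal: "primeideal q R ==> prime_in R (carrier R) q"
proof -
 assume "primeideal q R"
 then interpret primeideal q R .
 show ?thesis
  unfolding prime_in_def
  using a_subset I_l_closed I_prime one_imp_carrier I_notcarr
  by (auto simp: additive_subgroup.zero_closed is_additive_subgroup additive_subgroup.a_closed)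
qed

lemma primeideal_iff_prime_in: "primeideal q R \<longleftrightarrow> prime_in R (carrier R) q"
proof
 assume q: "prime_in R (carrier R) q"
 show "primeideal q R"
 proof (rule primeidealI)
  show "ideal q R"
  proof (rule idealI[OF ring_axioms])
   show "subgroup q (add_monoid R)"
   proof (rule subgroup.intro)
    show "inv\<^bsub>add_monoid R\<^esub> x\<in>q" if "x\<in>q" for x
    proof -
     have x: "x\<in>carrier R" using q that unfolding prime_in_def by auto
     have "\<ominus> \<one>\<otimes>x\<in>q"
      using q that unfolding prime_in_def by auto
     thus ?thesis using x by (simp add: l_minus flip: a_inv_def)
    qed
   qed (use q in \<open>auto simp: prime_in_def\<close>)
  qed (use q m_comm in \<open>auto simp: prime_in_def subset_iff\<close>)
 qed (use q in \<open>auto simp: prime_in_def is_cring\<close>)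
qed (rule prime_inI_primeideal)

lemma prime_in_minus:
 assumes "prime_in R C q" "subring C R" "a\<in>q"
 shows "\<ominus> a\<in>q"
proof -
 have "a\<in>carrier R" "\<ominus> \<one>\<in>C"
  using assms subringE(1,3,5)[OF assms(2)] unfolding prime_in_def by auto
 moreover hence "\<ominus> \<one>\<otimes>a\<in>q"
  using assms unfolding prime_in_def by auto
 ultimately show ?thesis by (simp add: l_minus)
qed

lemma prime_in_add_cancel:
 assumes "prime_in R C q" "subring C R" "a\<in>q" "b\<in>carrier R" "a\<oplus>b\<in>q"
 shows "b\<in>q"
proof -
 have "a\<in>carrier R" using assms subringE(1)[OF assms(2)] unfolding prime_in_def by auto
 hence "b = \<ominus> a\<oplus>(a\<oplus>b)" using assms(4) by (simp add: r_neg1)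
 thus ?thesis
  using prime_in_minus[OF assms(1-3)] assms(1,5) unfolding prime_in_def by metis
qed

lemma prime_in_horner:
 assumes "prime_in R C q" "subring C R" "set cs<=q" "x\<in>C"
 shows "horner R cs x\<in>q"
 using assms(3) by (induction cs) (use assms in \<open>auto simp: prime_in_def\<close>)

text \<open>Krull's argument: an ideal maximal among those that contain \<open>I\<close> and miss
  the multiplicative set \<open>S\<close> is prime. If a and b were outside it, the two larger
  ideals would meet \<open>S\<close>, and so would their product.\<close>

lemma prime_in_exists:
 assumes C: "subring C R" and I: "I<=C" "\<zero>\<in>I" "!!a b. a\<in>I ==> b\<in>I ==> a\<oplus>b\<in>I"
  "!!a c. a\<in>I ==> c\<in>C ==> c\<otimes>a\<in>I"
  and S: "S<=C" "\<one>\<in>S" "!!a b. a\<in>S ==> b\<in>S ==> a\<otimes>b\<in>S"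
  and disj: "I\<inter>S = {}"
 shows "\<exists>q. prime_in R C q & I<=q & q\<inter>S = {}"
proof -
 define idl where "idl J \<longleftrightarrow> J<=C & I<=J & J\<inter>S = {} &
  (\<forall>a\<in>J. \<forall>b\<in>J. a\<oplus>b\<in>J) & (\<forall>a\<in>J. \<forall>c\<in>C. c\<otimes>a\<in>J)" for J
 have CR: "C<=carrier R" using subringE(1)[OF C] .
 have "\<exists>M\<in>Collect idl. \<forall>X\<in>Collect idl. M<=X --> X = M"
 proof (rule subset_Zorn_nonempty)
  show "Collect idl ~= {}" using I disj unfolding idl_def by blast
  fix \<C> assume ne: "\<C> ~= {}" and ch: "subset.chain (Collect idl) \<C>"
  hence mem: "!!J. J\<in>\<C> ==> idl J" unfolding subset.chain_def by auto
  have "\<exists>J\<in>\<C>. a\<in>J & b\<in>J" if "a\<in>\<Union>\<C>" "b\<in>\<Union>\<C>" for a b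
   using that ch unfolding subset_chain_def by blast
  hence add: "a\<oplus>b\<in>\<Union>\<C>" if "a\<in>\<Union>\<C>" "b\<in>\<Union>\<C>" for a b
   using that mem unfolding idl_def by (metis UnionI)
  have "\<Union>\<C><=C" "\<Union>\<C>\<inter>S = {}" "\<forall>a\<in>\<Union>\<C>. \<forall>c\<in>C. c\<otimes>a\<in>\<Union>\<C>"
   using mem unfolding idl_def by blast+
  moreover have "I<=\<Union>\<C>" using ne mem unfolding idl_def by blast
  ultimately show "\<Union>\<C>\<in>Collect idl"
   using add unfolding idl_def by auto
 qed
 then obtain q where q: "idl q" and max: "!!J. idl J ==> q<=J ==> J = q" by blast
 \<comment> \<open>By maximality the ideal q + C a, called \<open>J\<close> below, must meet
   \<open>S\<close>.\<close>
 have big: "\<exists>r\<in>q. \<exists>c\<in>C. r\<oplus>c\<otimes>a\<in>S" if a: "a\<in>C" "a\<notin>q" for a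
 proof (rule ccontr)
  assume no: "\<not> ?thesis"
  define J where "J = {r\<oplus>c\<otimes>a | r c. r\<in>q & c\<in>C}"
  have qC: "q<=C" and q0: "\<zero>\<in>q" using q I(2) unfolding idl_def by auto
  have aR: "a\<in>carrier R" using a CR by auto
  have "q<=J"
  proof
   fix r assume "r\<in>q"
   moreover hence "r = r\<oplus>\<zero>\<otimes>a" using qC CR aR by auto
   ultimately show "r\<in>J" unfolding J_def using subringE(2)[OF C] by blast
  qed
  moreover have "idl J"
   unfolding idl_def
  proof (intro conjI ballI)
   show "J<=C" unfolding J_def using qC a subringE(6,7)[OF C] by auto
   show "I<=J" using q \<open>q<=J\<close> unfolding idl_def by auto
   show "J\<inter>S = {}" using no unfolding J_def by auto
  next
   fix x y assume "x\<in>J" "y\<in>J"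
   then obtain r c r' c' where *: "r\<in>q" "c\<in>C" "r'\<in>q" "c'\<in>C" "x = r\<oplus>c\<otimes>a" "y = r'\<oplus>c'\<otimes>a"
    unfolding J_def by blast
   hence "r\<in>carrier R" "c\<in>carrier R" "r'\<in>carrier R" "c'\<in>carrier R" using qC CR by auto
   hence "x\<oplus>y = (r\<oplus>r')\<oplus>(c\<oplus>c')\<otimes>a" using * aR by (simp add: l_distr a_ac)
   moreover have "r\<oplus>r'\<in>q" "c\<oplus>c'\<in>C" using * q subringE(7)[OF C] unfolding idl_def by auto
   ultimately show "x\<oplus>y\<in>J" unfolding J_def by blast
  next
   fix x d assume "x\<in>J" "d\<in>C"
   then obtain r c where *: "r\<in>q" "c\<in>C" "x = r\<oplus>c\<otimes>a" unfolding J_def by blast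
   hence "r\<in>carrier R" "c\<in>carrier R" "d\<in>carrier R" using qC CR \<open>d\<in>C\<close> by auto
   hence "d\<otimes>x = d\<otimes>r\<oplus>(d\<otimes>c)\<otimes>a" using * aR by (simp add: r_distr m_ac)
   moreover have "d\<otimes>r\<in>q" "d\<otimes>c\<in>C"
    using * q subringE(6)[OF C] \<open>d\<in>C\<close> unfolding idl_def by auto
   ultimately show "d\<otimes>x\<in>J" unfolding J_def by blast
  qed
  ultimately have "J = q" using max by blast
  moreover have "a = \<zero>\<oplus>\<one>\<otimes>a" using aR by simp
  hence "a\<in>J" unfolding J_def using q0 subringE(3)[OF C] by blast
  ultimately show False using a by simp
 qed
 have "a\<in>q \<or> b\<in>q" if ab: "a\<in>C" "b\<in>C" "a\<otimes>b\<in>q" for a b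
 proof (rule ccontr)
  assume "\<not> ?thesis"
  then obtain r c r' c' where *: "r\<in>q" "c\<in>C" "r\<oplus>c\<otimes>a\<in>S" "r'\<in>q" "c'\<in>C" "r'\<oplus>c'\<otimes>b\<in>S"
   using big ab by metis
  have cl: "r\<in>C" "r'\<in>C" using * q unfolding idl_def by auto
  have inR: "x\<in>carrier R" if "x\<in>C" for x using that CR by auto
  have "(r\<oplus>c\<otimes>a)\<otimes>(r'\<oplus>c'\<otimes>b) = (r'\<oplus>c'\<otimes>b)\<otimes>r\<oplus>((c\<otimes>a)\<otimes>r'\<oplus>(c\<otimes>c')\<otimes>(a\<otimes>b))"
   using * cl ab inR by (simp add: l_distr r_distr a_ac m_ac)
  moreover have "(r'\<oplus>c'\<otimes>b)\<otimes>r\<oplus>((c\<otimes>a)\<otimes>r'\<oplus>(c\<otimes>c')\<otimes>(a\<otimes>b))\<in>q"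
   using * cl ab q subringE(6,7)[OF C] unfolding idl_def by auto
  ultimately have "(r\<oplus>c\<otimes>a)\<otimes>(r'\<oplus>c'\<otimes>b)\<in>q\<inter>S" using *(3,6) S(3) by (metis IntI)
  thus False using q unfolding idl_def by blast
 qed
 moreover have "\<one>\<notin>q" using q S(2) unfolding idl_def by blast
 ultimately have "prime_in R C q" using q I(2) unfolding prime_in_def idl_def by auto
 thus ?thesis using q unfolding idl_def by blast
qed

end

section \<open>From descending chains of primes to independent elements\<close>

context cring
begin

lemma transc_mod_mono: "D<=C ==> transc_mod R P C x ==> transc_mod R P D x"
 unfolding transc_mod_def by (meson subset_trans)

lemma indep_mod_append:
 "indep_mod R P C (xs @ ys) \<longleftrightarrow> indep_mod R P C xs & indep_mod R P (foldl (adjoin R) C xs) ys"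
 by (induction xs arbitrary: C) auto

lemma prime_inD:
 assumes "prime_in R C q"
 shows "q<=C" "\<zero>\<in>q" "a\<in>q ==> b\<in>q ==> a\<oplus>b\<in>q" "a\<in>q ==> c\<in>C ==> c\<otimes>a\<in>q"
  "\<one>\<notin>q" "a\<in>C ==> b\<in>C ==> a\<otimes>b\<in>q ==> a\<in>q \<or> b\<in>q"
 using assms unfolding prime_in_def by auto

lemma carrier_subring: "subring (carrier R) R"
 by (rule ring.subringI[OF ring_axioms]) auto

text \<open>A polynomial value in the larger prime \<open>Q\<close> has, by transcendence, all
  coefficients in \<open>Q\<close>; these lie in \<open>C\<close>, where \<open>P\<close> and
  \<open>Q\<close> agree, so the value lies in \<open>P\<close> as well.\<close>

lemma prime_adjoin_agree:
 assumes P: "prime_in R (carrier R) P" and Q: "prime_in R (carrier R) Q" "P<=Q"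
  and C: "subring C R" and eq: "P\<inter>C = Q\<inter>C" and x: "x\<in>carrier R" "transc_mod R Q C x"
 shows "transc_mod R P C x" "P\<inter>adjoin R C x = Q\<inter>adjoin R C x"
proof -
 have *: "set cs<=P" if "set cs<=C" "horner R cs x\<in>Q" for cs
  using x(2) that eq unfolding transc_mod_def by blast
 thus "transc_mod R P C x"
  unfolding transc_mod_def using Q(2) by blast
 have "horner R cs x\<in>P" if "set cs<=C" "horner R cs x\<in>Q" for cs
  using prime_in_horner[OF P carrier_subring *[OF that] x(1)] .
 thus "P\<inter>adjoin R C x = Q\<inter>adjoin R C x"
  unfolding adjoin_def using Q(2) by blast
qed

lemma prime_foldl_adjoin_agree:
 assumes P: "prime_in R (carrier R) P" and Q: "prime_in R (carrier R) Q" "P<=Q"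
  and "subring C R" and "P\<inter>C = Q\<inter>C" and "set xs<=carrier R" "indep_mod R Q C xs"
 shows "indep_mod R P C xs & P\<inter>foldl (adjoin R) C xs = Q\<inter>foldl (adjoin R) C xs"
 using assms(4-)
proof (induction xs arbitrary: C)
 case (Cons x xs)
 thus ?case
  using prime_adjoin_agree[OF P Q Cons.prems(1,2), of x] adjoin_subring by auto
qed simp

text \<open>A relation for \<open>b\<in>Q - P\<close> modulo \<open>P\<close> can be divided by \<open>b\<close> until its constant term is not in \<open>P\<close>;
 reading it modulo \<open>Q\<close> gives a contradiction.\<close>

lemma transc_mod_prime_diff:
 assumes P: "prime_in R (carrier R) P" and Q: "prime_in R (carrier R) Q" "P<=Q"
  and C: "subring C R" and eq: "P\<inter>C = Q\<inter>C" and b: "b\<in>Q" "b\<notin>P"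
 shows "transc_mod R P C b"
 unfolding transc_mod_def
proof (intro allI impI)
 fix cs assume "set cs<=C" "horner R cs b\<in>P"
 thus "set cs<=P"
 proof (induction cs)
  case (Cons c cs)
  have bR: "b\<in>carrier R" using prime_inD(1)[OF Q(1)] b by auto
  have CR: "C<=carrier R" using subringE(1)[OF C] .
  have hR: "horner R cs b\<in>carrier R" "c\<in>carrier R"
   using Cons.prems CR bR by auto
  have "b\<otimes>horner R cs b\<in>Q"
   using prime_inD(4)[OF Q(1) b(1) hR(1)] m_comm[OF bR hR(1)] by simp
  moreover have "b\<otimes>horner R cs b\<oplus>c\<in>Q"
   using Cons.prems(2) Q(2) hR bR by (auto simp: a_comm)
  ultimately have "c\<in>Q"
   using prime_in_add_cancel[OF Q(1) carrier_subring _ hR(2)] by blast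
  hence "c\<in>P" using eq Cons.prems by auto
  hence "b\<otimes>horner R cs b\<in>P"
   using prime_in_add_cancel[OF P carrier_subring, of c "b\<otimes>horner R cs b"] Cons.prems(2) hR bR
   by simp
  hence "horner R cs b\<in>P" using prime_inD(6)[OF P] b hR bR by blast
  thus ?case using Cons \<open>c\<in>P\<close> by auto
 qed simp
qed

text \<open>The chain is indexed downwards, with \<open>Z 0\<close> the largest prime. Each strict
  step gives an element of \<open>Z n\<close> outside \<open>Z (Suc n)\<close>. The elements found
  so far stay independent modulo the smaller prime, and both primes agree on the subring they
  generate, so the new element can be appended.\<close>

lemma prime_chain_indep:
 fixes n :: nat
 assumes "!!i. i \<le> n ==> prime_in R (carrier R) (Z i)" "!!i. i < n ==> Z (Suc i) \<subset> Z i"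
  and C: "subring C R" and "!!i. i \<le> n ==> Z i\<inter>C = Z 0\<inter>C"
 shows "\<exists>xs. length xs = n & set xs<=carrier R & indep_mod R (Z n) C xs"
 using assms(1,2,4)
proof (induction n)
 case 0
 thus ?case by (intro exI[of _ "[]"]) auto
next
 case (Suc n)
 have "\<exists>xs. length xs = n & set xs<=carrier R & indep_mod R (Z n) C xs"
 proof (rule Suc.IH)
  show "prime_in R (carrier R) (Z i)" if "i \<le> n" for i using Suc.prems(1)[of i] that by simp
  show "Z (Suc i) \<subset> Z i" if "i < n" for i using Suc.prems(2)[of i] that by simp
  show "Z i\<inter>C = Z 0\<inter>C" if "i \<le> n" for i using Suc.prems(3)[of i] that by simp
 qed
 then obtain xs where xs: "length xs = n" "set xs<=carrier R" "indep_mod R (Z n) C xs"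
  by blast
 have P: "prime_in R (carrier R) (Z (Suc n))" "prime_in R (carrier R) (Z n)" "Z (Suc n)<=Z n"
  and eq: "Z (Suc n)\<inter>C = Z n\<inter>C"
  using Suc.prems(1)[of n] Suc.prems(1)[of "Suc n"] Suc.prems(2)[of n]
   Suc.prems(3)[of n] Suc.prems(3)[of "Suc n"] by (simp_all add: psubset_eq)
 obtain b where b: "b\<in>Z n" "b\<notin>Z (Suc n)" using Suc.prems(2)[of n] by auto
 note * = prime_foldl_adjoin_agree[OF P C eq xs(2,3)]
 hence "transc_mod R (Z (Suc n)) (foldl (adjoin R) C xs) b"
  using transc_mod_prime_diff[OF P foldl_adjoin_subring[OF C xs(2)] _ b] by auto
 hence "indep_mod R (Z (Suc n)) C (xs @ [b])"
  using * by (simp add: indep_mod_append)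
 thus ?case
  using xs prime_inD(1)[OF P(2)] b by (intro exI[of _ "xs @ [b]"]) auto
qed

text \<open>A double sum over powers of \<open>t\<close> and \<open>g\<close> read by columns
  instead of rows. Rows of different length are padded, which is why the coefficient sets are only
  compared after inserting zero.\<close>

lemma horner_transpose:
 assumes "t\<in>carrier R" "g\<in>carrier R" "\<Union>(set ` set dss)<=carrier R"
 shows "\<exists>ess. horner R (map (%ds. horner R ds g) dss) t = horner R (map (%es. horner R es t) ess) g &
      insert \<zero> (\<Union>(set ` set ess)) = insert \<zero> (\<Union>(set ` set dss))"
 using assms(3)
proof (induction dss)
 case Nil
 thus ?case by (intro exI[of _ "[]"]) auto
next
 case (Cons d dss)
 then obtain ess where ess: "horner R (map (%ds. horner R ds g) dss) t = horner R (map (%es. horner R es t) ess) g"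
  "insert \<zero> (\<Union>(set ` set ess)) = insert \<zero> (\<Union>(set ` set dss))" by auto
 have "\<Union>(set ` set ess)<=insert \<zero> (\<Union>(set ` set dss))" using ess(2) by blast
 hence "\<Union>(set ` set ess)<=carrier R" using Cons.prems by auto
 moreover have "set d<=carrier R" using Cons.prems by auto
 \<comment> \<open>The new row \<open>d\<close> is distributed over the columns: its i-th
   coefficient becomes the head of the i-th column, and columns beyond its end receive a
   zero.\<close>
 ultimately have "\<exists>ess'. horner R d g\<oplus>t\<otimes>horner R (map (%es. horner R es t) ess) g =
   horner R (map (%es. horner R es t) ess') g &
   insert \<zero> (\<Union>(set ` set ess')) = insert \<zero> (set d\<union>\<Union>(set ` set ess))"
 proof (induction d arbitrary: ess)
  case Nil
  have cl: "horner R es t\<in>carrier R" if "es\<in>set ess" for es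
   using Nil assms(1) that by (intro horner_closed) auto
  have "horner R (map (%es. horner R es t) (map ((#) \<zero>) ess)) g
    = horner R (map ((\<otimes>) t) (map (%es. horner R es t) ess)) g"
   using cl assms(1) unfolding map_map
   by (intro arg_cong[where f = "%l. horner R l g"] map_cong) auto
  also have "... = t\<otimes>horner R (map (%es. horner R es t) ess) g"
   using cl assms(1,2) by (intro horner_smult) auto
  also have "t\<otimes>horner R (map (%es. horner R es t) ess) g = horner R [] g\<oplus>t\<otimes>horner R (map (%es. horner R es t) ess) g"
  proof -
   have "set (map (%es. horner R es t) ess)<=carrier R" using cl by auto
   hence "t\<otimes>horner R (map (%es. horner R es t) ess) g\<in>carrier R"
    using assms(1,2) horner_closed m_closed by blast
   thus ?thesis
    by simp
  qed
  finally have "horner R [] g\<oplus>t\<otimes>horner R (map (%es. horner R es t) ess) g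
    = horner R (map (%es. horner R es t) (map ((#) \<zero>) ess)) g" by (rule sym)
  moreover have "insert \<zero> (\<Union>(set ` set (map ((#) \<zero>) ess))) = insert \<zero> (set []\<union>\<Union>(set ` set ess))"
   by auto
  ultimately show ?case by blast
 next
  case (Cons c d)
  show ?case
  proof (cases ess)
   case Nil
   obtain ess' where *: "horner R d g\<oplus>t\<otimes>horner R (map (%es. horner R es t) []) g =
     horner R (map (%es. horner R es t) ess') g"
     "insert \<zero> (\<Union>(set ` set ess')) = insert \<zero> (set d\<union>\<Union>(set ` set []))"
    using Cons.IH[of "[]"] Cons.prems by auto
   have "horner R d g\<in>carrier R" using Cons.prems assms by auto
   hence "horner R (map (%es. horner R es t) ([c] # ess')) g =
     horner R (c # d) g\<oplus>t\<otimes>horner R (map (%es. horner R es t) ess) g"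
    using * Nil Cons.prems assms(1,2) by simp
   moreover have "insert \<zero> (\<Union>(set ` set ([c] # ess'))) = insert \<zero> (set (c # d)\<union>\<Union>(set ` set ess))"
    using *(2) Nil by auto
   ultimately show ?thesis by metis
  next
   case (Cons e ess0)
   obtain ess' where *: "horner R d g\<oplus>t\<otimes>horner R (map (%es. horner R es t) ess0) g =
     horner R (map (%es. horner R es t) ess') g"
     "insert \<zero> (\<Union>(set ` set ess')) = insert \<zero> (set d\<union>\<Union>(set ` set ess0))"
    using Cons.IH[of ess0] Cons.prems Cons by auto
   have cl: "horner R d g\<in>carrier R" "horner R e t\<in>carrier R" "c\<in>carrier R"
    "horner R (map (%es. horner R es t) ess0) g\<in>carrier R"
   proof -
    have "set (map (%es. horner R es t) ess0)<=carrier R"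
     using Cons.prems Cons assms by (auto intro!: horner_closed)
    moreover have "set d<=carrier R" "set e<=carrier R" "c\<in>carrier R" using Cons.prems Cons by auto
    ultimately show "horner R d g\<in>carrier R" "horner R e t\<in>carrier R" "c\<in>carrier R"
    "horner R (map (%es. horner R es t) ess0) g\<in>carrier R" using assms(1,2) by blast+
   qed
   have "horner R (map (%es. horner R es t) ((c # e) # ess')) g
     = c\<oplus>t\<otimes>horner R e t\<oplus>g\<otimes>(horner R d g\<oplus>t\<otimes>horner R (map (%es. horner R es t) ess0) g)"
    using * by simp
   also have "... = (c\<oplus>g\<otimes>horner R d g)\<oplus>t\<otimes>(horner R e t\<oplus>g\<otimes>horner R (map (%es. horner R es t) ess0) g)"
    using cl assms by (simp add: r_distr a_ac m_ac)
   also have "... = horner R (c # d) g\<oplus>t\<otimes>horner R (map (%es. horner R es t) ess) g"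
    using Cons by simp
   finally have 1: "horner R (map (%es. horner R es t) ((c # e) # ess')) g = ..." .
   have "insert \<zero> (\<Union>(set ` set ((c # e) # ess'))) = insert c (set e\<union>insert \<zero> (\<Union>(set ` set ess')))"
    by auto
   also have "... = insert \<zero> (set (c # d)\<union>\<Union>(set ` set ess))"
    unfolding *(2) Cons by auto
   finally show ?thesis using 1 by metis
  qed
 qed
 then obtain ess' where e1: "horner R d g\<oplus>t\<otimes>horner R (map (%es. horner R es t) ess) g =
   horner R (map (%es. horner R es t) ess') g"
   and e2: "insert \<zero> (\<Union>(set ` set ess')) = insert \<zero> (set d\<union>\<Union>(set ` set ess))" by blast
 show ?case
 proof (intro exI[of _ ess'] conjI)
  show "horner R (map (%ds. horner R ds g) (d # dss)) t = horner R (map (%es. horner R es t) ess') g"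
   using e1 ess(1) by simp
  have "insert \<zero> (\<Union>(set ` set ess')) = set d\<union>insert \<zero> (\<Union>(set ` set ess))" using e2 by auto
  thus "insert \<zero> (\<Union>(set ` set ess')) = insert \<zero> (\<Union>(set ` set (d # dss)))"
   using ess(2) by auto
 qed
qed

text \<open>The exchange property. A relation of \<open>t\<close> over C[g] becomes, after
  transposition, a relation of \<open>g\<close> over C[t]. If the latter were trivial modulo
  \<open>P\<close>, transcendence of \<open>t\<close> over \<open>C\<close> would make all double
  coefficients, and hence the original relation, trivial.\<close>

lemma transc_mod_exchange:
 assumes P: "prime_in R (carrier R) P" and C: "subring C R" and x: "t\<in>carrier R" "g\<in>carrier R"
  and t: "transc_mod R P C t" "\<not> transc_mod R P (adjoin R C g) t"
 shows "\<not> transc_mod R P (adjoin R C t) g"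
proof
 assume g: "transc_mod R P (adjoin R C t) g"
 obtain cs where cs: "set cs<=adjoin R C g" "horner R cs t\<in>P" "\<not> set cs<=P"
  using t(2) unfolding transc_mod_def by blast
 have "\<forall>c\<in>set cs. \<exists>ds. set ds<=C & c = horner R ds g"
  using cs(1) unfolding adjoin_def by blast
 then obtain D where D: "!!c. c\<in>set cs ==> set (D c)<=C & c = horner R (D c) g" by metis
 define dss where "dss = map D cs"
 have cs_eq: "cs = map (%ds. horner R ds g) dss"
  unfolding dss_def using D by (simp add: map_idI)
 have dssC: "\<Union>(set ` set dss)<=C" unfolding dss_def using D by auto
 then obtain ess where ess: "horner R cs t = horner R (map (%es. horner R es t) ess) g"
   "insert \<zero> (\<Union>(set ` set ess)) = insert \<zero> (\<Union>(set ` set dss))"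
  using horner_transpose[OF x, of dss] subringE(1)[OF C] cs_eq by auto
 have "\<Union>(set ` set ess)<=insert \<zero> (\<Union>(set ` set dss))" using ess(2) by blast
 hence essC: "\<Union>(set ` set ess)<=C" using dssC subringE(2)[OF C] by auto
 hence "set (map (%es. horner R es t) ess)<=adjoin R C t" unfolding adjoin_def by auto
 hence "set (map (%es. horner R es t) ess)<=P"
  using g cs(2) ess(1) unfolding transc_mod_def by metis
 hence "\<Union>(set ` set ess)<=P"
  using t(1) essC unfolding transc_mod_def by (auto simp: subset_iff)
 moreover have "\<Union>(set ` set dss)<=insert \<zero> (\<Union>(set ` set ess))" using ess(2) by blast
 ultimately have "\<Union>(set ` set dss)<=P" using prime_inD(2)[OF P] by blast
 hence "horner R ds g\<in>P" if "ds\<in>set dss" for ds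
  using prime_in_horner[OF P carrier_subring _ x(2), of ds] that by blast
 hence "set cs<=P" unfolding cs_eq by auto
 thus False using cs(3) by simp
qed

text \<open>Trailing coefficients in \<open>P\<close> are dropped, which changes the value only by
  an element of \<open>P\<close>. Afterwards the last entry is a genuine leading coefficient modulo
  \<open>P\<close>.\<close>

lemma horner_trim:
 assumes P: "prime_in R (carrier R) P" and C: "C<=carrier R" and "x\<in>carrier R"
  and "set cs<=C" "\<not> set cs<=P"
 shows "\<exists>ds d. set ds<=C & d\<in>C - P & horner R cs x \<ominus> horner R (ds @ [d]) x\<in>P"
 using assms(4,5)
proof (induction cs rule: rev_induct)
 case (snoc c cs)
 have cl: "horner R cs x\<in>carrier R" "c\<in>carrier R" using snoc.prems C assms(3) by auto
 show ?case
 proof (cases "c\<in>P")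
  case True
  then obtain ds d where d: "set ds<=C" "d\<in>C - P" "horner R cs x \<ominus> horner R (ds @ [d]) x\<in>P"
   using snoc by auto
  have dR: "horner R (ds @ [d]) x\<in>carrier R" using d C assms(3) by (intro horner_closed) auto
  have e: "horner R (cs @ [c]) x = horner R cs x\<oplus>x [^] length cs\<otimes>c"
   using horner_append[of cs "[c]" x] snoc.prems C assms(3) by (simp add: subset_iff)
  have "x [^] length cs\<otimes>c\<in>P" using prime_inD(4)[OF P True] assms(3) by auto
  from prime_inD(3)[OF P d(3) this] have "horner R (cs @ [c]) x \<ominus> horner R (ds @ [d]) x\<in>P"
   unfolding e using cl dR assms(3) by (simp add: a_minus_def a_ac)
  thus ?thesis using d by blast
 next
  case False
  moreover have "horner R (cs @ [c]) x \<ominus> horner R (cs @ [c]) x\<in>P"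
  proof -
   have "set (cs @ [c])<=carrier R" using snoc.prems C by blast
   hence "horner R (cs @ [c]) x\<in>carrier R" using assms(3) by (rule horner_closed)
   thus ?thesis using prime_inD(2)[OF P] by (simp add: a_minus_def r_neg)
  qed
  ultimately show ?thesis using snoc.prems by auto
 qed
qed simp

lemma not_transc_modE:
 assumes P: "prime_in R (carrier R) P" and C: "C<=carrier R" and x: "x\<in>carrier R"
  and "\<not> transc_mod R P C x"
 obtains ds d where "set ds<=C" "d\<in>C - P" "horner R (ds @ [d]) x\<in>P"
proof -
 obtain cs where cs: "set cs<=C" "horner R cs x\<in>P" "\<not> set cs<=P"
  using assms(4) unfolding transc_mod_def by blast
 then obtain ds d where d: "set ds<=C" "d\<in>C - P" "horner R cs x \<ominus> horner R (ds @ [d]) x\<in>P"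
  using horner_trim[OF P C x] by blast
 have "set cs<=carrier R" "set (ds @ [d])<=carrier R" using cs d C by auto
 hence "horner R cs x\<in>carrier R" "horner R (ds @ [d]) x\<in>carrier R"
  using x by (blast intro: horner_closed)+
 hence "horner R (ds @ [d]) x\<in>P"
  using prime_in_add_cancel[OF P carrier_subring cs(2), of "\<ominus> horner R (ds @ [d]) x"] d(3)
   prime_in_minus[OF P carrier_subring, of "\<ominus> horner R (ds @ [d]) x"]
  by (simp add: a_minus_def)
 thus ?thesis using that d by blast
qed

text \<open>Only degree and leading coefficient of the product are kept; they suffice to see that a
  product with a factor of positive degree is not a constant.\<close>

lemma horner_mult_lead:
 assumes C: "subring C R" and x: "x\<in>carrier R" and "set cs<=C" "set ds<=C" "c\<in>C" "d\<in>C"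
 shows "\<exists>es. set es<=C & length es = length cs + length ds &
      horner R (es @ [c\<otimes>d]) x = horner R (cs @ [c]) x\<otimes>horner R (ds @ [d]) x"
 using assms(3)
proof (induction cs)
 case Nil
 have CR: "C<=carrier R" using subringE(1)[OF C] .
 have "set (ds @ [d])<=carrier R" "c\<in>carrier R" using assms CR by auto
 hence "horner R (map ((\<otimes>) c) ds @ [c\<otimes>d]) x = horner R ([] @ [c]) x\<otimes>horner R (ds @ [d]) x"
  using horner_smult[of "ds @ [d]" c x] x by auto
 moreover have "set (map ((\<otimes>) c) ds)<=C" using assms subringE(6)[OF C] by auto
 ultimately show ?case by (intro exI[of _ "map ((\<otimes>) c) ds"]) auto
next
 case (Cons a cs)
 have CR: "C<=carrier R" using subringE(1)[OF C] .
 obtain es where es: "set es<=C" "length es = length cs + length ds"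
   "horner R (es @ [c\<otimes>d]) x = horner R (cs @ [c]) x\<otimes>horner R (ds @ [d]) x"
  using Cons by auto
 have a: "a\<in>C" "set cs<=C" using Cons.prems by auto
 have 1: "set (map ((\<otimes>) a) (ds @ [d]))<=C" "set (\<zero> # es)<=C"
  using assms a es subringE(2,6)[OF C] by auto
 obtain fs where fs: "set fs<=C" "length fs = max (length (map ((\<otimes>) a) (ds @ [d]))) (length (\<zero> # es))"
  "horner R fs x = horner R (map ((\<otimes>) a) (ds @ [d])) x\<oplus>horner R (\<zero> # es) x"
  using horner_add[OF C 1 x] by blast
 have len: "length fs = Suc (length es)" using fs(2) es(2) by simp
 have cl: "horner R (cs @ [c]) x\<in>carrier R" "horner R (ds @ [d]) x\<in>carrier R" "a\<in>carrier R"
  "horner R (es @ [c\<otimes>d]) x\<in>carrier R" "horner R es x\<in>carrier R" "c\<otimes>d\<in>carrier R"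
 proof -
  have "set (cs @ [c])<=carrier R" "set (ds @ [d])<=carrier R" "set (es @ [c\<otimes>d])<=carrier R" "set es<=carrier R"
   using a es assms CR by auto
  thus "horner R (cs @ [c]) x\<in>carrier R" "horner R (ds @ [d]) x\<in>carrier R" "a\<in>carrier R"
   "horner R (es @ [c\<otimes>d]) x\<in>carrier R" "horner R es x\<in>carrier R" "c\<otimes>d\<in>carrier R"
   using a CR x horner_closed by (blast, blast, blast, blast, blast, auto)
 qed
 have app: "horner R (es @ [c\<otimes>d]) x = horner R es x\<oplus>x [^] length es\<otimes>(c\<otimes>d)"
  using horner_append[of es "[c\<otimes>d]" x] es(1) CR x cl(6) by auto
 have "horner R (fs @ [c\<otimes>d]) x = horner R fs x\<oplus>x [^] length fs\<otimes>(c\<otimes>d)"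
  using horner_append[of fs "[c\<otimes>d]" x] fs(1) CR x cl(6) by auto
 also have "... = a\<otimes>horner R (ds @ [d]) x\<oplus>x\<otimes>(horner R es x\<oplus>x [^] length es\<otimes>(c\<otimes>d))"
  unfolding fs(3) len using horner_smult[of "ds @ [d]" a x] assms CR x cl
  by (simp add: subset_iff r_distr a_ac m_ac nat_pow_Suc)
 also have "... = horner R ((a # cs) @ [c]) x\<otimes>horner R (ds @ [d]) x"
  unfolding app[symmetric] es(3) using cl x by (simp add: l_distr m_assoc)
 finally show ?case using fs len es(2) by (intro exI[of _ fs]) auto
qed

end

section \<open>Lifting primes through algebraic extensions\<close>

context cring
begin

text \<open>Sorting by \<open>a_ac\<close> can separate a term from its negative; these variants
  cancel such a pair across one intermediate summand.\<close>

lemma add_lneg_cancel: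
 assumes "x\<in>carrier R" "y\<in>carrier R" "z\<in>carrier R"
 shows "x\<oplus>(y\<oplus>(\<ominus> x\<oplus>z)) = y\<oplus>z"
proof -
 have "x\<oplus>(y\<oplus>(\<ominus> x\<oplus>z)) = y\<oplus>(x\<oplus>(\<ominus> x\<oplus>z))" using assms by (simp add: a_lcomm)
 also have "x\<oplus>(\<ominus> x\<oplus>z) = z" using assms by (simp add: r_neg2)
 finally show ?thesis .
qed

lemma add_lneg_cancel2:
 assumes "x\<in>carrier R" "y\<in>carrier R" "z\<in>carrier R"
 shows "x\<oplus>(y\<oplus>(z\<oplus>\<ominus> x)) = y\<oplus>z"
 using add_lneg_cancel[OF assms] assms by (simp add: a_comm)

lemma add_lneg_cancel3:
 assumes "x\<in>carrier R" "y\<in>carrier R"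
 shows "x\<oplus>(y\<oplus>\<ominus> x) = y"
 using add_lneg_cancel2[OF assms zero_closed] assms by simp

text \<open>The heart of the lying-over argument: \<open>v + g f(g)\<close> with \<open>f\<close> having coefficients in \<open>q\<close> and
 \<open>v\<notin>q\<close> would make \<open>q\<close> generate the unit ideal of \<open>C[g]\<close>. Such a relation and one whose leading
 coefficient is outside \<open>q\<close> shorten each other by polynomial division, at the top end or the bottom end.\<close>

lemma no_unit_relation:
 assumes P: "prime_in R (carrier R) P" and C: "subring C R" and q: "prime_in R C q" "P\<inter>C<=q"
  and g: "g\<in>carrier R"
  and "v\<in>C - q" "set fs<=q" "horner R (v # fs) g\<in>P"
  and "set ms<=C" "c\<in>C - q" "horner R (ms @ [c]) g\<in>P"
 shows False
 using assms(6-)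
proof (induction "length fs + length ms" arbitrary: v fs ms c rule: less_induct)
 case less
 have CR: "C<=carrier R" using subringE(1)[OF C] .
 have qC: "q<=C" using prime_inD(1)[OF q(1)] .
 have vR: "v\<in>carrier R" "c\<in>carrier R" using less.prems CR by auto
 have fR: "set fs<=carrier R" "set ms<=carrier R" using less.prems CR qC by auto
 have hR: "horner R fs g\<in>carrier R" using fR g by auto
 have qm: "a\<otimes>b\<in>q" if "a\<in>q" "b\<in>C" for a b
  using prime_inD(4)[OF q(1) that] m_comm that qC CR by (metis subsetD)
 show False
 proof (cases "g\<in>P")
  \<comment> \<open>With \<open>g\<close> in \<open>P\<close> the relation reduces to its constant
    term, so \<open>v\<close> lies in the intersection of \<open>P\<close> with \<open>C\<close> and
    hence in \<open>q\<close>.\<close>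
  case True
  hence "horner R fs g\<otimes>g\<in>P" using prime_inD(4)[OF P] hR by auto
  hence "v\<in>P"
   using prime_in_add_cancel[OF P carrier_subring, of "g\<otimes>horner R fs g" v] less.prems(3) hR g vR
   by (simp add: a_comm m_comm)
  thus False using less.prems(1) q(2) by auto
 next
  case gP: False
  show False
  proof (cases "length ms \<le> length fs")
   case True
   show False
   proof (cases fs rule: rev_cases)
    case Nil
    hence "v\<in>P" using less.prems vR g by simp
    thus False using less.prems(1) q(2) by auto
   next
    case (snoc fs' l)
    \<comment> \<open>The leading coefficient \<open>l\<close> of the first relation is cancelled by
      taking \<open>c\<close> times the first minus l g^j times the second; the shift
      \<open>j\<close> aligns the degrees. As \<open>l\<close> is in \<open>q\<close>, the new
      coefficients are \<open>c\<close> times the old ones modulo \<open>q\<close>, so only the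
      constant term stays outside \<open>q\<close>.\<close>
    define j where "j = Suc (length fs') - length ms"
    have jk: "j + length ms = Suc (length fs')" using True snoc unfolding j_def by simp
    have l: "l\<in>q" "set fs'<=q" using snoc less.prems by auto
    have lR: "l\<in>carrier R" using l qC CR by auto
    have ml: "\<ominus> l\<in>q" using prime_in_minus[OF q(1) C l(1)] .
    have 1: "set (map ((\<otimes>) c) (v # fs'))<=C" 
     using less.prems l subringE(6)[OF C] qC by auto
    have 2: "set (map ((\<otimes>) (\<ominus> l)) (replicate j \<zero> @ ms))<=q"
     using less.prems qm[OF ml] subringE(2)[OF C] by auto
    obtain es where es: "set es<=C" "length es = max (length (map ((\<otimes>) c) (v # fs')))
       (length (map ((\<otimes>) (\<ominus> l)) (replicate j \<zero> @ ms)))"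
     "horner R es g = horner R (map ((\<otimes>) c) (v # fs')) g\<oplus>horner R (map ((\<otimes>) (\<ominus> l)) (replicate j \<zero> @ ms)) g"
     "\<forall>i < length es. es ! i = (if i < length (map ((\<otimes>) c) (v # fs')) then map ((\<otimes>) c) (v # fs') ! i else \<zero>) \<oplus>
       (if i < length (map ((\<otimes>) (\<ominus> l)) (replicate j \<zero> @ ms)) then map ((\<otimes>) (\<ominus> l)) (replicate j \<zero> @ ms) ! i else \<zero>)"
     using horner_add[OF C 1 subset_trans[OF 2 qC] g] by blast
    have len: "length es = Suc (length fs')" using es(2) jk by simp
    have nth: "\<exists>y\<in>q. es ! i = c\<otimes>(v # fs') ! i\<oplus>y" if "i < Suc (length fs')" for i
    proof -
     have i: "i < length es" "i < length (replicate j \<zero> @ ms)" "i < length (v # fs')"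
      using that len jk by auto
     have "map ((\<otimes>) (\<ominus> l)) (replicate j \<zero> @ ms) ! i\<in>q"
      using nth_mem[of i "map ((\<otimes>) (\<ominus> l)) (replicate j \<zero> @ ms)"] 2 i(2) by (metis length_map subsetD)
     moreover have "es ! i = c\<otimes>(v # fs') ! i\<oplus>map ((\<otimes>) (\<ominus> l)) (replicate j \<zero> @ ms) ! i"
      using es(4)[rule_format, OF i(1)] i by (simp only: length_map nth_map if_True)
     ultimately show ?thesis by blast
    qed
    obtain v' fs'' where v': "es = v' # fs''" using len by (cases es) auto
    obtain y where y: "y\<in>q" "v' = c\<otimes>v\<oplus>y" using nth[of 0] v' by auto
    have "v'\<in>C" using es(1) v' by auto
    moreover have "v'\<notin>q"
    proof
     assume "v'\<in>q"
     hence "c\<otimes>v\<in>q"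
      using prime_in_add_cancel[OF q(1) C y(1), of "c\<otimes>v"] y vR qC CR by (simp add: a_comm subset_iff)
     thus False using prime_inD(6)[OF q(1)] less.prems by auto
    qed
    moreover have "set fs''<=q"
    proof
     fix a assume "a\<in>set fs''"
     then obtain i where i: "i < length fs''" "a = fs'' ! i" by (auto simp: in_set_conv_nth)
     then obtain y where y: "y\<in>q" "a = c\<otimes>fs' ! i\<oplus>y" using nth[of "Suc i"] v' len by auto
     have "fs' ! i\<in>q" using l(2) i v' len by (auto simp: subset_iff)
     thus "a\<in>q" using y prime_inD(3,4)[OF q(1)] less.prems by auto
    qed
    moreover have "horner R (v' # fs'') g\<in>P"
    proof -
     have R1: "set (v # fs')<=carrier R" "set (replicate j \<zero> @ ms)<=carrier R" "set (ms @ [c])<=carrier R"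
      using vR l(2) qC CR fR by auto
     have cl: "horner R (v # fs') g\<in>carrier R" "horner R ms g\<in>carrier R"
      using R1 fR g by (auto simp del: horner.simps intro!: horner_closed)
     have 3: "horner R (v # fs) g = horner R (v # fs') g\<oplus>g [^] Suc (length fs')\<otimes>l"
      using horner_append[of "v # fs'" "[l]" g] R1 lR g snoc by simp
     have 4: "horner R (ms @ [c]) g = horner R ms g\<oplus>g [^] length ms\<otimes>c"
      using horner_append[of ms "[c]" g] fR vR g by simp
     have 5: "horner R (replicate j \<zero> @ ms) g = g [^] j\<otimes>horner R ms g"
     proof -
      have "set (replicate j \<zero>)<=carrier R" by auto
      thus ?thesis
       using horner_append[of "replicate j \<zero>" ms g] fR(2) g cl(2) by (simp add: horner_replicate_zero)
     qed
     have pw: "g [^] Suc (length fs') = g [^] j\<otimes>g [^] length ms"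
      using g by (simp add: nat_pow_mult jk del: nat_pow_Suc)
     have pc: "g [^] j\<in>carrier R" "g [^] length ms\<in>carrier R" using g by auto
     have "horner R (v' # fs'') g = c\<otimes>horner R (v # fs') g\<oplus>(\<ominus> l)\<otimes>(g [^] j\<otimes>horner R ms g)"
      unfolding v'[symmetric] es(3) using R1 vR lR g
      by (simp only: horner_smult a_inv_closed 5)
     also have "... = c\<otimes>horner R (v # fs) g\<oplus>(\<ominus> (l\<otimes>g [^] j))\<otimes>horner R (ms @ [c]) g"
      unfolding 3 4 pw using cl vR lR pc
      by (simp add: r_distr l_distr l_minus r_minus a_ac m_ac minus_add r_neg r_neg1 r_neg2 del: horner.simps)
     also have "...\<in>P"
      using prime_inD(3,4)[OF P] less.prems(3,6) vR lR pc by (simp del: horner.simps)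
     finally show ?thesis .
    qed
    ultimately show False
     using less.hyps[of fs'' ms v' c] less.prems(4-6) v' len snoc by auto
   qed
  next
   case False
   \<comment> \<open>The constant term \<open>m0\<close> of the second relation is cancelled:
     \<open>v\<close> times the second minus \<open>m0\<close> times the first is \<open>g\<close>
     times a shorter relation with leading coefficient v c. Since \<open>g\<close> is not in
     \<open>P\<close>, it can be divided out.\<close>
   then obtain m0 ms' where ms: "ms = m0 # ms'" by (cases ms) auto
   have m0: "m0\<in>C" "set ms'<=C" using less.prems ms by auto
   have m0R: "m0\<in>carrier R" "set ms'<=carrier R" "\<ominus> m0\<in>C"
    using m0 CR subringE(5)[OF C] by auto
   have 1: "set (map ((\<otimes>) v) ms')<=C" "set (map ((\<otimes>) (\<ominus> m0)) fs)<=C"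
    using less.prems m0 m0R(3) subringE(6)[OF C] qC by auto
   obtain es where es: "set es<=C" "length es = max (length (map ((\<otimes>) v) ms')) (length (map ((\<otimes>) (\<ominus> m0)) fs))"
    "horner R es g = horner R (map ((\<otimes>) v) ms') g\<oplus>horner R (map ((\<otimes>) (\<ominus> m0)) fs) g"
    using horner_add[OF C 1 g] by blast
   have len: "length es = length ms'" using es(2) False ms by simp
   have esR: "set es<=carrier R" using es(1) CR by auto
   have cl: "horner R ms' g\<in>carrier R" using m0R g by auto
   define pc where "pc = g [^] length ms'"
   have pcR: "pc\<in>carrier R" using g by (simp add: pc_def)
   have a1: "horner R (es @ [v\<otimes>c]) g = horner R es g\<oplus>pc\<otimes>(v\<otimes>c)"
    using horner_append[of es "[v\<otimes>c]" g] esR vR g len by (simp add: pc_def)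
   have a2: "horner R (ms @ [c]) g = m0\<oplus>g\<otimes>(horner R ms' g\<oplus>pc\<otimes>c)"
    using horner_append[of ms' "[c]" g] m0R vR g ms by (simp add: pc_def)
   have "g\<otimes>horner R (es @ [v\<otimes>c]) g
     = g\<otimes>(v\<otimes>horner R ms' g\<oplus>(\<ominus> m0)\<otimes>horner R fs g\<oplus>pc\<otimes>(v\<otimes>c))"
    unfolding a1 es(3) using m0R vR fR g by (simp add: horner_smult)
   also have "... = v\<otimes>horner R (ms @ [c]) g\<oplus>(\<ominus> m0)\<otimes>horner R (v # fs) g"
    unfolding a2 using cl hR vR m0R g pcR
    by (simp add: r_distr l_distr l_minus r_minus a_ac m_ac minus_add r_neg r_neg1 r_neg2)
   also have "...\<in>P"
    using prime_inD(3,4)[OF P] less.prems(3,6) vR m0R by (simp del: horner.simps)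
   finally have "horner R (es @ [v\<otimes>c]) g\<in>P"
    using prime_inD(6)[OF P g, of "horner R (es @ [v\<otimes>c]) g"] gP esR vR g by (auto intro!: horner_closed)
   moreover have "v\<otimes>c\<in>C - q"
    using less.prems(1,5) subringE(6)[OF C, of v c] prime_inD(6)[OF q(1), of v c] by auto
   ultimately show False
    using less.hyps[of fs es v "v\<otimes>c"] less.prems(1-3) es(1) len ms by auto
  qed
 qed
qed

text \<open>Modulo \<open>P\<close> the element \<open>g\<close> becomes integral once
  \<open>c\<close> is inverted, and \<open>c\<close> is outside \<open>q\<close>, so lying over is
  to be expected. The ideal of C[g] generated by \<open>q\<close> and the part of \<open>P\<close>
  in C[g] has to miss C - q, which is the content of \<open>no_unit_relation\<close>; a prime over
  it that still misses C - q contracts to \<open>q\<close>.\<close>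

lemma prime_in_lift_adjoin:
 assumes P: "prime_in R (carrier R) P" and C: "subring C R" and q: "prime_in R C q" "P\<inter>C<=q"
  and g: "g\<in>carrier R" and m: "set ms<=C" "c\<in>C - q" "horner R (ms @ [c]) g\<in>P"
 shows "\<exists>q'. prime_in R (adjoin R C g) q' & P\<inter>adjoin R C g<=q' & q'\<inter>C = q"
proof -
 define D where "D = adjoin R C g"
 have CR: "C<=carrier R" using subringE(1)[OF C] .
 have qC: "q<=C" using prime_inD(1)[OF q(1)] .
 have D: "subring D R" unfolding D_def using adjoin_subring[OF C g] .
 have CD: "C<=D" unfolding D_def using adjoin_base[OF CR g] .
 have gD: "g\<in>D" unfolding D_def using adjoin_gen[OF C g] .
 have DR: "D<=carrier R" using subringE(1)[OF D] .
 have inR: "x\<in>carrier R" if "x\<in>q" for x using that qC CR by auto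
 \<comment> \<open>The extension of \<open>q\<close> to C[g], described by polynomials with
   coefficients in \<open>q\<close>.\<close>
 define J where "J = {horner R fs g | fs. set fs<=q}"
 have JD: "J<=D" unfolding J_def D_def adjoin_def using qC by auto
 have Jadd: "a\<oplus>b\<in>J" if ab: "a\<in>J" "b\<in>J" for a b
 proof -
  obtain fs hs where fs: "set fs<=q" "set hs<=q" "a = horner R fs g" "b = horner R hs g"
   using ab unfolding J_def by auto
  have "set fs<=C" "set hs<=C" using fs qC by auto
  from horner_add[OF C this g] obtain es where es: "horner R es g = a\<oplus>b"
   "\<forall>i < length es. es ! i = (if i < length fs then fs ! i else \<zero>)\<oplus>(if i < length hs then hs ! i else \<zero>)"
   using fs by blast
  have "set es<=q"
  proof
   fix x assume "x\<in>set es"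
   then obtain i where i: "i < length es" "x = es ! i" by (auto simp: in_set_conv_nth)
   have "(if i < length fs then fs ! i else \<zero>)\<in>q" "(if i < length hs then hs ! i else \<zero>)\<in>q"
    using fs prime_inD(2)[OF q(1)] by (auto simp: subset_iff)
   thus "x\<in>q" using es(2) i prime_inD(3)[OF q(1)] by simp
  qed
  thus ?thesis using es(1)[symmetric] unfolding J_def by blast
 qed
 have Jsm: "c\<otimes>a\<in>J" if ca: "c\<in>C" "a\<in>J" for c a
 proof -
  obtain fs where fs: "set fs<=q" "a = horner R fs g" using ca unfolding J_def by auto
  have "c\<otimes>a = horner R (map ((\<otimes>) c) fs) g"
   using fs ca CR g inR by (subst horner_smult) auto
  moreover have "set (map ((\<otimes>) c) fs)<=q" using fs ca prime_inD(4)[OF q(1)] by auto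
  ultimately show ?thesis unfolding J_def by blast
 qed
 have Jg: "g\<otimes>a\<in>J" if a: "a\<in>J" for a
 proof -
  obtain fs where fs: "set fs<=q" "a = horner R fs g" using a unfolding J_def by auto
  have "set fs<=carrier R" using fs inR by blast
  hence "g\<otimes>a = horner R (\<zero> # fs) g" using g fs horner_closed[of fs g] by simp
  moreover have "set (\<zero> # fs)<=q" using fs prime_inD(2)[OF q(1)] by auto
  ultimately show ?thesis unfolding J_def by blast
 qed
 have J0: "\<zero>\<in>J" unfolding J_def by (intro CollectI exI[of _ "[]"]) auto
 have Jmul: "d\<otimes>a\<in>J" if d: "d\<in>D" and a: "a\<in>J" for d a
 proof -
  obtain cs where "set cs<=C" and e: "d = horner R cs g" using d unfolding D_def adjoin_def by blast
  hence "horner R cs g\<otimes>a\<in>J"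
  proof (induction cs arbitrary: d)
   case Nil
   thus ?case using J0 a JD DR by auto
  next
   case (Cons c cs)
   have "c\<in>carrier R" "horner R cs g\<in>carrier R" "a\<in>carrier R"
    using Cons.prems CR g a JD DR by auto
   hence "horner R (c # cs) g\<otimes>a = c\<otimes>a\<oplus>g\<otimes>(horner R cs g\<otimes>a)"
    using g by (simp add: l_distr m_assoc)
   thus ?case using Cons Jadd Jg Jsm a by auto
  qed
  thus ?thesis using e by simp
 qed
 define I where "I = {\<pi>\<oplus>a | \<pi> a. \<pi>\<in>P\<inter>D & a\<in>J}"
 have PR: "P<=carrier R" using prime_inD(1)[OF P] .
 have PD0: "\<zero>\<in>P\<inter>D" using prime_inD(2)[OF P] subringE(2)[OF D] by auto
 have qJ: "q<=J"
 proof
  fix x assume "x\<in>q"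
  thus "x\<in>J" unfolding J_def using inR g by (intro CollectI exI[of _ "[x]"]) auto
 qed
 have "\<exists>q'. prime_in R D q' & I<=q' & q'\<inter>(C - q) = {}"
 proof (rule prime_in_exists[OF D])
  show "I<=D" unfolding I_def using JD subringE(7)[OF D] by auto
  have "\<zero> = \<zero>\<oplus>\<zero>" by simp
  thus "\<zero>\<in>I" unfolding I_def using PD0 J0 by blast
  show "C - q<=D" using CD by auto
  show "\<one>\<in>C - q" using subringE(3)[OF C] prime_inD(5)[OF q(1)] by auto
  show "a\<otimes>b\<in>C - q" if "a\<in>C - q" "b\<in>C - q" for a b
   using that subringE(6)[OF C] prime_inD(6)[OF q(1)] by auto
  show "a\<oplus>b\<in>I" if ab: "a\<in>I" "b\<in>I" for a b
  proof -
   obtain \<pi> x \<rho> y where *: "\<pi>\<in>P\<inter>D" "\<rho>\<in>P\<inter>D" "x\<in>J" "y\<in>J" "a = \<pi>\<oplus>x" "b = \<rho>\<oplus>y"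
    using ab unfolding I_def by blast
   hence "\<pi>\<in>carrier R" "\<rho>\<in>carrier R" "x\<in>carrier R" "y\<in>carrier R" using DR JD by auto
   hence "a\<oplus>b = (\<pi>\<oplus>\<rho>)\<oplus>(x\<oplus>y)" using * by (simp add: a_ac)
   moreover have "\<pi>\<oplus>\<rho>\<in>P\<inter>D" using * prime_inD(3)[OF P] subringE(7)[OF D] by auto
   ultimately show ?thesis unfolding I_def using Jadd * by blast
  qed
  show "c\<otimes>a\<in>I" if ab: "a\<in>I" "c\<in>D" for a c
  proof -
   obtain \<pi> x where *: "\<pi>\<in>P\<inter>D" "x\<in>J" "a = \<pi>\<oplus>x" using ab unfolding I_def by blast
   hence "\<pi>\<in>carrier R" "x\<in>carrier R" "c\<in>carrier R" using DR JD ab by auto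
   hence "c\<otimes>a = c\<otimes>\<pi>\<oplus>c\<otimes>x" "c\<otimes>\<pi>\<in>P\<inter>D"
    using * prime_inD(4)[OF P] subringE(6)[OF D] ab by (auto simp: r_distr)
   thus ?thesis unfolding I_def using Jmul * ab by blast
  qed
  show "I\<inter>(C - q) = {}"
  proof (rule ccontr)
   assume "I\<inter>(C - q) ~= {}"
   then obtain \<pi> fs where s: "\<pi>\<in>P\<inter>D" "set fs<=q" "\<pi>\<oplus>horner R fs g\<in>C - q"
    unfolding I_def J_def by blast
   define s where "s = \<pi>\<oplus>horner R fs g"
   have \<pi>R: "\<pi>\<in>carrier R" using s DR by auto
   have fsR: "set fs<=carrier R" using s inR by auto
   have sR: "s\<in>carrier R" using s CR s_def by auto
   have mpi: "\<ominus> \<pi>\<in>P" using prime_in_minus[OF P carrier_subring] s by auto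
   \<comment> \<open>A common element \<open>s\<close> of the ideal and of C - q is moved to the
     other side: -s + f(g) lies in \<open>P\<close>, and its constant coefficient is outside
     \<open>q\<close> while the remaining ones are inside.\<close>
   have eq: "\<ominus> s\<oplus>horner R fs g = \<ominus> \<pi>"
    unfolding s_def using \<pi>R horner_closed[OF fsR g] by (simp add: minus_add a_ac r_neg r_neg1 r_neg2)
   have ms: "\<ominus> s\<in>C - q"
    using s subringE(5)[OF C, of s] prime_in_minus[OF q(1) C, of "\<ominus> s"] sR by (auto simp: s_def)
   show False
   proof (cases fs)
    case Nil
    hence "\<ominus> s\<in>P" using eq mpi sR by simp
    thus False using ms q(2) by auto
   next
    case (Cons f0 fs')
    have f0: "f0\<in>q" "f0\<in>C" "set fs'<=q" using Cons s qC by auto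
    have "\<ominus> s\<oplus>f0\<in>C - q"
     using ms f0 subringE(7)[OF C, of "\<ominus> s" f0] prime_in_add_cancel[OF q(1) C f0(1), of "\<ominus> s"] sR inR[OF f0(1)]
     by (auto simp: a_comm)
    moreover have "horner R ((\<ominus> s\<oplus>f0) # fs') g\<in>P"
     using mpi eq Cons sR fsR g horner_closed[of fs' g] by (simp add: a_assoc)
    ultimately show False using no_unit_relation[OF P C q g _ f0(3) _ m] by blast
   qed
  qed
 qed
 then obtain q' where q': "prime_in R D q'" "I<=q'" "q'\<inter>(C - q) = {}" by blast
 have "J<=I"
 proof
  fix x assume "x\<in>J"
  moreover hence "x = \<zero>\<oplus>x" using JD DR by auto
  ultimately show "x\<in>I" unfolding I_def using PD0 by blast
 qed
 moreover have "P\<inter>D<=I"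
 proof
  fix x assume "x\<in>P\<inter>D"
  moreover hence "x = x\<oplus>\<zero>" using DR by auto
  ultimately show "x\<in>I" unfolding I_def using J0 by blast
 qed
 ultimately show ?thesis
  using q' qJ qC unfolding D_def by blast
qed

text \<open>The relations have coefficients in a fixed \<open>C0\<close>. A lift of \<open>q\<close>
  meets \<open>C0\<close> in the same elements as \<open>q\<close> does, so the leading coefficients
  stay outside and the one-step lift can be repeated.\<close>

lemma prime_in_lift_foldl:
 assumes P: "prime_in R (carrier R) P" and "subring C R" "C0<=C" and "prime_in R C q" "P\<inter>C<=q"
  and "set gs<=carrier R"
  and "!!g. g\<in>set gs ==> \<exists>ms c. set ms<=C0 & c\<in>C0 - q & horner R (ms @ [c]) g\<in>P"
 shows "\<exists>q'. prime_in R (foldl (adjoin R) C gs) q' & P\<inter>foldl (adjoin R) C gs<=q' & q'\<inter>C = q"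
 using assms(2-)
proof (induction gs arbitrary: C q)
 case (Cons g gs)
 have g: "g\<in>carrier R" using Cons.prems by auto
 obtain ms c where m: "set ms<=C" "c\<in>C - q" "horner R (ms @ [c]) g\<in>P"
  using Cons.prems(6)[of g] Cons.prems(2) by auto
 obtain q1 where q1: "prime_in R (adjoin R C g) q1" "P\<inter>adjoin R C g<=q1" "q1\<inter>C = q"
  using prime_in_lift_adjoin[OF P Cons.prems(1,3,4) g m] by blast
 have CD: "C<=adjoin R C g" using adjoin_base g subringE(1)[OF Cons.prems(1)] by auto
 have "\<exists>q'. prime_in R (foldl (adjoin R) (adjoin R C g) gs) q' &
   P\<inter>foldl (adjoin R) (adjoin R C g) gs<=q' & q'\<inter>adjoin R C g = q1"
 proof (rule Cons.IH)
  show "\<exists>ms c. set ms<=C0 & c\<in>C0 - q1 & horner R (ms @ [c]) g'\<in>P" if "g'\<in>set gs" for g'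
   using Cons.prems(2) Cons.prems(6)[of g'] that q1(3) by (metis DiffD1 DiffD2 DiffI IntI list.set_intros(2) subsetD)
 qed (use Cons.prems q1 CD adjoin_subring g in auto)
 thus ?case using CD q1(3) by auto
qed (auto simp: prime_in_def)

text \<open>With \<open>t\<close> transcendental over \<open>B'\<close>, everything algebraic over \<open>B'[t]\<close> and \<open>h\<close> a common leading
 coefficient, \<open>u = 1 + t h\<close> is a non-unit of \<open>B'[t]\<close> coprime to \<open>h\<close>, so a prime over \<open>u\<close> lifts.\<close>

lemma prime_specialisation_exists:
 assumes P: "prime_in R (carrier R) P" and B: "subring B R" and gs: "foldl (adjoin R) B gs = carrier R"
  "set gs<=carrier R" and t: "t\<in>carrier R" "transc_mod R P B t"
 shows "\<exists>Q. prime_in R (carrier R) Q & P \<subset> Q & Q\<inter>B = P\<inter>B"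
proof -
 \<comment> \<open>A generator is adjoined to \<open>B\<close> as long as \<open>t\<close> remains
   transcendental. When it would not, the exchange property makes that generator algebraic over the
   adjunction of \<open>t\<close>, and it is left out.\<close>
 have "\<exists>B'. subring B' R & B<=B' & transc_mod R P B' t & (\<forall>g\<in>set gs. \<not> transc_mod R P (adjoin R B' t) g)"
  using B t(2) gs(2)
 proof (induction gs arbitrary: B)
  case (Cons g gs)
  have g: "g\<in>carrier R" using Cons.prems by auto
  show ?case
  proof (cases "transc_mod R P (adjoin R B g) t")
   case True
   then obtain B' where B': "subring B' R" "adjoin R B g<=B'" "transc_mod R P B' t"
    "\<forall>g\<in>set gs. \<not> transc_mod R P (adjoin R B' t) g"
    using Cons.IH[of "adjoin R B g"] Cons.prems adjoin_subring by auto
   have "g\<in>adjoin R B' t"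
    using B' adjoin_gen[OF Cons.prems(1) g] adjoin_base[OF subringE(1)[OF B'(1)] t(1)] by auto
   moreover have sub: "subring (adjoin R B' t) R" using adjoin_subring[OF B'(1) t(1)] .
   \<comment> \<open>An adjoined generator is algebraic over B'[t] because of the polynomial T -
     g.\<close>
   ultimately have "set [\<ominus> g, \<one>]<=adjoin R B' t" "horner R [\<ominus> g, \<one>] g = \<zero>"
    using subringE(3,5)[OF sub] g by (auto simp: l_neg)
   hence "\<not> transc_mod R P (adjoin R B' t) g"
    unfolding transc_mod_def using prime_inD(2,5)[OF P]
    by (metis insert_subset list.set_intros(1) list.set_intros(2) list.simps(15) subsetD)
   thus ?thesis
    using B' adjoin_base[OF subringE(1)[OF Cons.prems(1)] g] by (intro exI[of _ B']) auto
  next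
   case False
   hence no: "\<not> transc_mod R P (adjoin R B t) g"
    using transc_mod_exchange[OF P Cons.prems(1) t(1) g Cons.prems(2)] by blast
   obtain B' where B': "subring B' R" "B<=B'" "transc_mod R P B' t"
    "\<forall>g\<in>set gs. \<not> transc_mod R P (adjoin R B' t) g"
    using Cons.IH[of B] Cons.prems by auto
   hence "\<not> transc_mod R P (adjoin R B' t) g"
    using no transc_mod_mono[OF adjoin_mono] by blast
   thus ?thesis using B' by (intro exI[of _ B']) auto
  qed
 qed auto
 then obtain B' where B': "subring B' R" "B<=B'" "transc_mod R P B' t"
  and alg: "!!g. g\<in>set gs ==> \<not> transc_mod R P (adjoin R B' t) g" by blast
 define C where "C = adjoin R B' t"
 have B'R: "B'<=carrier R" using subringE(1)[OF B'(1)] .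
 have C: "subring C R" unfolding C_def using adjoin_subring[OF B'(1) t(1)] .
 have CR: "C<=carrier R" using subringE(1)[OF C] .
 have B'C: "B'<=C" unfolding C_def using adjoin_base[OF B'R t(1)] .
 have tC: "t\<in>C" unfolding C_def using adjoin_gen[OF B'(1) t(1)] .
 have PR: "P<=carrier R" using prime_inD(1)[OF P] .
 \<comment> \<open>Here \<open>h\<close> is a product of leading coefficients outside
   \<open>P\<close>, one for each generator: a prime avoiding \<open>h\<close> avoids every one of
   them.\<close>
 have "\<exists>h\<in>C - P. \<forall>g\<in>set gs. \<exists>ms c. set ms<=C & c\<in>C & (\<exists>d\<in>C. h = d\<otimes>c) & horner R (ms @ [c]) g\<in>P"
  using gs(2) alg
 proof (induction gs)
  case Nil
  thus ?case using subringE(3)[OF C] prime_inD(5)[OF P] by auto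
 next
  case (Cons g gs)
  then obtain h where h: "h\<in>C - P" "\<forall>g\<in>set gs. \<exists>ms c. set ms<=C & c\<in>C & (\<exists>d\<in>C. h = d\<otimes>c) & horner R (ms @ [c]) g\<in>P"
   by auto
  obtain ms c where m: "set ms<=C" "c\<in>C - P" "horner R (ms @ [c]) g\<in>P"
   using not_transc_modE[OF P CR, of g] Cons.prems unfolding C_def by auto
  have "h\<in>C" "h\<notin>P" "c\<in>C" "c\<notin>P" using h(1) m(2) by auto
  hence hc: "h\<otimes>c\<in>C" "h\<otimes>c\<notin>P"
   using subringE(6)[OF C, of h c] prime_inD(6)[OF P, of h c] CR by auto
  have each: "\<exists>ms c'. set ms<=C & c'\<in>C & (\<exists>d\<in>C. h\<otimes>c = d\<otimes>c') & horner R (ms @ [c']) g'\<in>P"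
   if "g'\<in>set (g # gs)" for g'
  proof (cases "g' = g")
   case True
   moreover have "\<exists>d\<in>C. h\<otimes>c = d\<otimes>c" using h(1) by (intro bexI[of _ h]) auto
   ultimately show ?thesis using m by (intro exI[of _ ms] exI[of _ c]) simp
  next
   case False
   hence "g'\<in>set gs" using that by simp
   then obtain ms' c' d where m': "set ms'<=C" "c'\<in>C" "d\<in>C" "h = d\<otimes>c'" "horner R (ms' @ [c']) g'\<in>P"
    using h(2) by blast
   have "h\<otimes>c = (c\<otimes>d)\<otimes>c'" using m' m(2) CR by (auto simp: m_ac subset_iff)
   moreover have "c\<otimes>d\<in>C" using m(2) m' subringE(6)[OF C] by auto
   ultimately have "\<exists>d'\<in>C. h\<otimes>c = d'\<otimes>c'" by blast
   thus ?thesis using m' by (intro exI[of _ ms'] exI[of _ c']) simp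
  qed
  show ?case by (intro bexI[of _ "h\<otimes>c"] ballI each DiffI hc)
 qed
 then obtain h where h: "h\<in>C" "h\<notin>P"
  and rel: "!!g. g\<in>set gs ==> \<exists>ms c. set ms<=C & c\<in>C & (\<exists>d\<in>C. h = d\<otimes>c) & horner R (ms @ [c]) g\<in>P"
  by blast
 have hR: "h\<in>carrier R" using h CR by auto
 define u where "u = \<one>\<oplus>t\<otimes>h"
 have uC: "u\<in>C" unfolding u_def using subringE(3,6,7)[OF C] tC h by auto
 have uR: "u\<in>carrier R" using uC CR by auto
 have lead: "\<exists>ds d. set ds<=B' & d\<in>B' - P & w \<ominus> horner R (ds @ [d]) t\<in>P" if w: "w\<in>C" "w\<notin>P" for w
 proof -
  obtain cs where cs: "set cs<=B'" "w = horner R cs t" using w unfolding C_def adjoin_def by blast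
  hence "\<not> set cs<=P" using w prime_in_horner[OF P carrier_subring _ t(1)] by blast
  thus ?thesis using horner_trim[OF P B'R t(1) cs(1)] cs(2) by auto
 qed
 have Padd: "a\<oplus>b\<in>P" if "a\<in>P" "b\<in>P" for a b using prime_inD(3)[OF P that] .
 have Pmul: "c\<otimes>a\<in>P" if "a\<in>P" "c\<in>carrier R" for a c using prime_inD(4)[OF P that] .
 obtain hs a where hs: "set hs<=B'" "a\<in>B' - P" "h \<ominus> horner R (hs @ [a]) t\<in>P" using lead[OF h] by blast
 have HR: "horner R (hs @ [a]) t\<in>carrier R" using hs B'R t by (intro horner_closed) auto
 have u_eq: "u \<ominus> horner R ((\<one> # hs) @ [a]) t\<in>P"
 proof -
  have "u \<ominus> horner R ((\<one> # hs) @ [a]) t = t\<otimes>(h \<ominus> horner R (hs @ [a]) t)"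
   unfolding u_def using HR t hR by (simp add: a_minus_def r_distr minus_add r_minus a_ac add_lneg_cancel)
  thus ?thesis using Pmul[OF hs(3) t(1)] by simp
 qed
 \<comment> \<open>Compare degrees in \<open>t\<close> modulo \<open>P\<close>. The summand t h
   gives \<open>u\<close> positive degree, and the leading coefficients of \<open>u\<close> and
   \<open>w\<close> are outside the prime \<open>P\<close>, so u w cannot be congruent to the
   constant \<open>s\<close>.\<close>
 have no_s: False if s: "s\<in>B'" "s\<notin>P" and w: "w\<in>C" and e: "s \<ominus> u\<otimes>w\<in>P" for s w
 proof -
  have sR: "s\<in>carrier R" and wR: "w\<in>carrier R" using s w B'R CR by auto
  have "w\<notin>P"
  proof
   assume "w\<in>P"
   hence "u\<otimes>w\<in>P" using Pmul uR by blast
   hence "(s \<ominus> u\<otimes>w)\<oplus>u\<otimes>w\<in>P" using Padd e by blast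
   thus False using s sR uR wR by (simp add: a_minus_def a_assoc l_neg)
  qed
  then obtain ws b where ws: "set ws<=B'" "b\<in>B' - P" "w \<ominus> horner R (ws @ [b]) t\<in>P"
   using lead[OF w] by blast
  define H where "H = horner R ((\<one> # hs) @ [a]) t"
  define W where "W = horner R (ws @ [b]) t"
  have HW: "H\<in>carrier R" "W\<in>carrier R"
  proof -
   have "set ((\<one> # hs) @ [a])<=carrier R" "set (ws @ [b])<=carrier R" using hs ws B'R by auto
   thus "H\<in>carrier R" "W\<in>carrier R" unfolding H_def W_def using t(1) by (blast intro: horner_closed)+
  qed
  have "set (\<one> # hs)<=B'" "a\<in>B'" "b\<in>B'" using hs ws subringE(3)[OF B'(1)] by auto
  from horner_mult_lead[OF B'(1) t(1) this(1) ws(1) this(2,3)]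
  obtain es where es: "set es<=B'" "length es = length (\<one> # hs) + length ws"
   "horner R (es @ [a\<otimes>b]) t = H\<otimes>W" unfolding H_def W_def by blast
  obtain e0 es' where e0: "es = e0 # es'" using es(2) by (cases es) auto
  have abB: "a\<otimes>b\<in>B'" using hs ws subringE(6)[OF B'(1)] by auto
  have es'R: "horner R (es' @ [a\<otimes>b]) t\<in>carrier R" "e0\<in>carrier R"
  proof -
   have "set (es' @ [a\<otimes>b])<=carrier R" "e0\<in>carrier R" using es(1) e0 B'R abB by auto
   thus "horner R (es' @ [a\<otimes>b]) t\<in>carrier R" "e0\<in>carrier R" using t(1) by (blast intro: horner_closed)+
  qed
  have "(s \<ominus> u\<otimes>w)\<oplus>(w\<otimes>(u \<ominus> H)\<oplus>H\<otimes>(w \<ominus> W))\<in>P"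
   using e u_eq ws(3) Padd Pmul wR HW unfolding H_def[symmetric] W_def[symmetric] by auto
  also have "(s \<ominus> u\<otimes>w)\<oplus>(w\<otimes>(u \<ominus> H)\<oplus>H\<otimes>(w \<ominus> W)) = s \<ominus> H\<otimes>W"
  proof -
   have "w\<otimes>(u \<ominus> H)\<oplus>H\<otimes>(w \<ominus> W) = u\<otimes>w\<oplus>\<ominus> (H\<otimes>W)"
    using uR wR HW by (simp add: a_minus_def r_distr r_minus a_ac m_ac add_lneg_cancel add_lneg_cancel2)
   thus ?thesis
    using sR uR wR HW by (simp add: a_minus_def a_assoc r_neg1)
  qed
  finally have "\<ominus> (s \<ominus> H\<otimes>W)\<in>P" using prime_in_minus[OF P carrier_subring] by blast
  also have "\<ominus> (s \<ominus> H\<otimes>W) = horner R ((e0 \<ominus> s) # (es' @ [a\<otimes>b])) t"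
   unfolding es(3)[symmetric] e0 using sR es'R t by (simp add: a_minus_def minus_add a_ac)
  finally have "horner R ((e0 \<ominus> s) # (es' @ [a\<otimes>b])) t\<in>P" .
  moreover have "set ((e0 \<ominus> s) # (es' @ [a\<otimes>b]))<=B'"
   using es(1) e0 abB s(1) subringE(5,7)[OF B'(1)] unfolding a_minus_def by auto
  ultimately have "set ((e0 \<ominus> s) # (es' @ [a\<otimes>b]))<=P"
   using B'(3) unfolding transc_mod_def by blast
  hence "a\<otimes>b\<in>P" by auto
  thus False using hs(2) ws(2) prime_inD(6)[OF P] B'R by blast
 qed
 \<comment> \<open>A prime containing this ideal contains \<open>u\<close> and the part of
   \<open>P\<close> in \<open>C\<close>. By \<open>no_s\<close> the ideal misses B' - P, so the
   prime can be chosen with the same trace on B' as \<open>P\<close>.\<close>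
 define I where "I = {\<pi>\<oplus>u\<otimes>w | \<pi> w. \<pi>\<in>P\<inter>C & w\<in>C}"
 have PC0: "\<zero>\<in>P\<inter>C" using prime_inD(2)[OF P] subringE(2)[OF C] by auto
 have "\<exists>q. prime_in R C q & I<=q & q\<inter>(B' - P) = {}"
 proof (rule prime_in_exists[OF C])
  show "I<=C" unfolding I_def using uC subringE(6,7)[OF C] by auto
  have "\<zero> = \<zero>\<oplus>u\<otimes>\<zero>" using uR by simp
  thus "\<zero>\<in>I" unfolding I_def using PC0 by blast
  show "B' - P<=C" using B'C by auto
  show "\<one>\<in>B' - P" using subringE(3)[OF B'(1)] prime_inD(5)[OF P] by auto
  show "a\<otimes>b\<in>B' - P" if "a\<in>B' - P" "b\<in>B' - P" for a b
   using that subringE(6)[OF B'(1), of a b] prime_inD(6)[OF P, of a b] B'R by blast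
  show "a\<oplus>b\<in>I" if ab: "a\<in>I" "b\<in>I" for a b
  proof -
   obtain \<pi> x \<rho> y where *: "\<pi>\<in>P\<inter>C" "\<rho>\<in>P\<inter>C" "x\<in>C" "y\<in>C" "a = \<pi>\<oplus>u\<otimes>x" "b = \<rho>\<oplus>u\<otimes>y"
    using ab unfolding I_def by blast
   hence "\<pi>\<in>carrier R" "\<rho>\<in>carrier R" "x\<in>carrier R" "y\<in>carrier R" using CR by auto
   hence "a\<oplus>b = (\<pi>\<oplus>\<rho>)\<oplus>u\<otimes>(x\<oplus>y)" using * uR by (simp add: a_ac r_distr)
   moreover have "\<pi>\<oplus>\<rho>\<in>P\<inter>C" "x\<oplus>y\<in>C" using * Padd subringE(7)[OF C] by auto
   ultimately show ?thesis unfolding I_def by blast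
  qed
  show "c\<otimes>a\<in>I" if ab: "a\<in>I" "c\<in>C" for a c
  proof -
   obtain \<pi> x where *: "\<pi>\<in>P\<inter>C" "x\<in>C" "a = \<pi>\<oplus>u\<otimes>x" using ab unfolding I_def by blast
   hence "\<pi>\<in>carrier R" "x\<in>carrier R" "c\<in>carrier R" using CR ab by auto
   hence "c\<otimes>a = c\<otimes>\<pi>\<oplus>u\<otimes>(c\<otimes>x)" and "c\<otimes>\<pi>\<in>P"
    using * Pmul[of \<pi> c] uR by (auto simp: r_distr m_lcomm)
   moreover have "c\<otimes>\<pi>\<in>C" "c\<otimes>x\<in>C" using * subringE(6)[OF C] ab by auto
   ultimately show ?thesis unfolding I_def by blast
  qed
  show "I\<inter>(B' - P) = {}"
  proof (rule ccontr)
   assume "I\<inter>(B' - P) ~= {}"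
   then obtain \<pi> w where *: "\<pi>\<in>P\<inter>C" "w\<in>C" "\<pi>\<oplus>u\<otimes>w\<in>B' - P" unfolding I_def by blast
   hence "\<pi>\<in>carrier R" "w\<in>carrier R" using CR by auto
   hence "(\<pi>\<oplus>u\<otimes>w) \<ominus> u\<otimes>w = \<pi>" using uR by (simp add: a_minus_def a_assoc r_neg)
   thus False using no_s[of "\<pi>\<oplus>u\<otimes>w" w] * by auto
  qed
 qed
 then obtain q where q: "prime_in R C q" "I<=q" "q\<inter>(B' - P) = {}" by blast
 have uq: "u\<in>q"
 proof -
  have "u = \<zero>\<oplus>u\<otimes>\<one>" using uR by simp
  hence "u\<in>I" unfolding I_def using PC0 subringE(3)[OF C] by blast
  thus ?thesis using q by blast
 qed
 have PCq: "P\<inter>C<=q"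
 proof
  fix x assume x: "x\<in>P\<inter>C"
  hence "x = x\<oplus>u\<otimes>\<zero>" using uR CR by auto
  hence "x\<in>I" unfolding I_def using x subringE(2)[OF C] by blast
  thus "x\<in>q" using q by blast
 qed
 have hq: "h\<notin>q"
 proof
  assume "h\<in>q"
  hence "\<ominus> t\<otimes>h\<in>q" using prime_inD(4)[OF q(1)] tC subringE(5)[OF C] by auto
  hence "u\<oplus>\<ominus> t\<otimes>h\<in>q" using prime_inD(3)[OF q(1) uq] by auto
  thus False using prime_inD(5)[OF q(1)] t hR unfolding u_def by (simp add: l_minus a_assoc r_neg)
 qed
 have "\<exists>Q. prime_in R (foldl (adjoin R) C gs) Q & P\<inter>foldl (adjoin R) C gs<=Q & Q\<inter>C = q"
 proof (rule prime_in_lift_foldl[OF P C subset_refl q(1) PCq gs(2)])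
  fix g assume "g\<in>set gs"
  then obtain ms c d where m: "set ms<=C" "c\<in>C" "d\<in>C" "h = d\<otimes>c" "horner R (ms @ [c]) g\<in>P"
   using rel by blast
  moreover have "c\<notin>q" using m hq prime_inD(4)[OF q(1)] by auto
  ultimately show "\<exists>ms c. set ms<=C & c\<in>C - q & horner R (ms @ [c]) g\<in>P" by blast
 qed
 moreover have "foldl (adjoin R) C gs = carrier R"
 proof
  show "foldl (adjoin R) C gs<=carrier R"
   using foldl_adjoin_subring[OF C gs(2)] subringE(1) by blast
  have "foldl (adjoin R) B gs<=foldl (adjoin R) C gs"
   using foldl_adjoin_minimal[OF foldl_adjoin_subring[OF C gs(2)]] foldl_adjoin_base[OF C gs(2)]
    foldl_adjoin_gens[OF C gs(2)] B'(2) B'C by blast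
  thus "carrier R<=foldl (adjoin R) C gs" using gs(1) by simp
 qed
 ultimately obtain Q where Q: "prime_in R (carrier R) Q" "P\<inter>carrier R<=Q" "Q\<inter>C = q" by auto
 \<comment> \<open>As a polynomial in \<open>t\<close> over B', the element \<open>u\<close> has
   constant coefficient 1, so by transcendence it is not in \<open>P\<close>. This makes the
   inclusion of \<open>P\<close> in \<open>Q\<close> strict.\<close>
 have "u\<notin>P"
 proof
  assume "u\<in>P"
  moreover obtain cs where cs: "set cs<=B'" "h = horner R cs t" using h(1) unfolding C_def adjoin_def by blast
  ultimately have "horner R (\<one> # cs) t\<in>P" unfolding u_def by simp
  hence "\<one>\<in>P" using B'(3) cs subringE(3)[OF B'(1)] unfolding transc_mod_def
   by (metis insert_subset list.simps(15))
  thus False using prime_inD(5)[OF P] by blast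
 qed
 moreover have "Q\<inter>B' = P\<inter>B'"
  using Q q(3) B'C PR by blast
 ultimately show ?thesis using Q uq PR B'(2) by blast
qed

text \<open>The last element of the list is specialised first: it is transcendental over the ring
  \<open>D\<close> generated by the others, so there is a strictly larger prime with the same trace
  on \<open>D\<close>. The others remain independent modulo that prime, and the chain continues
  upwards from it.\<close>

lemma prime_chain_exists:
 assumes "prime_in R (carrier R) P" and "subring B R" and "foldl (adjoin R) B gs = carrier R"
  "set gs<=carrier R" and "set xs<=carrier R" "indep_mod R P B xs"
 shows "\<exists>Z. Z 0 = P & (\<forall>i \<le> length xs. prime_in R (carrier R) (Z i) & Z i\<inter>B = P\<inter>B) &
       (\<forall>i < length xs. Z i \<subset> Z (Suc i))"
 using assms(1,5,6)
proof (induction xs arbitrary: P rule: rev_induct)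
 case Nil
 thus ?case by (intro exI[of _ "%_. P"]) auto
next
 case (snoc x xs)
 define D where "D = foldl (adjoin R) B xs"
 have D: "subring D R" "B<=D" unfolding D_def
  using foldl_adjoin_subring foldl_adjoin_base assms(2) snoc.prems by auto
 have x: "x\<in>carrier R" "transc_mod R P D x" "indep_mod R P B xs"
  using snoc.prems unfolding D_def by (auto simp: indep_mod_append)
 have "foldl (adjoin R) D gs = carrier R"
 proof
  show "foldl (adjoin R) D gs<=carrier R"
   using foldl_adjoin_subring[OF D(1) assms(4)] subringE(1) by blast
  have "foldl (adjoin R) B gs<=foldl (adjoin R) D gs"
   using foldl_adjoin_minimal[OF foldl_adjoin_subring[OF D(1) assms(4)]] foldl_adjoin_base[OF D(1) assms(4)]
    foldl_adjoin_gens[OF D(1) assms(4)] D(2) by blast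
  thus "carrier R<=foldl (adjoin R) D gs" using assms(3) by simp
 qed
 from prime_specialisation_exists[OF snoc.prems(1) D(1) this assms(4) x(1,2)]
 obtain Q where Q: "prime_in R (carrier R) Q" "P \<subset> Q" "Q\<inter>D = P\<inter>D" by blast
 \<comment> \<open>All coefficients and values in the tests for these elements lie in
   \<open>D\<close>, where \<open>P\<close> and \<open>Q\<close> agree.\<close>
 have ind: "indep_mod R Q C ys" if "indep_mod R P C ys" "subring C R" "set ys<=carrier R" "foldl (adjoin R) C ys<=D" for ys C
  using that
 proof (induction ys arbitrary: C)
  case (Cons y ys)
  have sub: "subring (adjoin R C y) R" using adjoin_subring Cons.prems by auto
  have "adjoin R C y<=D" using foldl_adjoin_base[OF sub, of ys] Cons.prems by auto
  moreover have "transc_mod R P C y" using Cons.prems by simp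
  ultimately have "transc_mod R Q C y"
   using Q(2,3) unfolding transc_mod_def adjoin_def by blast
  thus ?case using Cons sub by auto
 qed simp
 have "indep_mod R Q B xs" using ind[OF x(3) assms(2)] snoc.prems unfolding D_def by auto
 then obtain Z where Z: "Z 0 = Q" "\<forall>i \<le> length xs. prime_in R (carrier R) (Z i) & Z i\<inter>B = Q\<inter>B"
   "\<forall>i < length xs. Z i \<subset> Z (Suc i)"
  using snoc.IH[OF Q(1)] snoc.prems by auto
 have QB: "Q\<inter>B = P\<inter>B" using Q(3) D(2) by blast
 show ?case
 proof (intro exI[of _ "case_nat P Z"] conjI allI impI)
  fix i
  show "prime_in R (carrier R) (case_nat P Z i)" if "i \<le> length (xs @ [x])"
   using that Z(2) snoc.prems(1) by (cases i) auto
  show "case_nat P Z i\<inter>B = P\<inter>B" if "i \<le> length (xs @ [x])"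
   using that Z(2) QB by (cases i) auto
  show "case_nat P Z i \<subset> case_nat P Z (Suc i)" if "i < length (xs @ [x])"
   using that Z(1,3) Q(2) by (cases i) auto
 qed simp
qed

end

section \<open>Algebraic elements, finite rank and the Steinitz bound\<close>

primrec lspan :: "('a, 'm) ring_scheme => 'a set => 'a list => 'a set" where
 "lspan R C [] = {\<zero>\<^bsub>R\<^esub>}"
| "lspan R C (w # ws) = {a\<otimes>\<^bsub>R\<^esub> w\<oplus>\<^bsub>R\<^esub> s | a s. a\<in>C & s\<in>lspan R C ws}"

fun lcomb :: "('a, 'm) ring_scheme => 'a list => 'a list => 'a" where
 "lcomb R (c # cs) (v # vs) = c\<otimes>\<^bsub>R\<^esub> v\<oplus>\<^bsub>R\<^esub> lcomb R cs vs"
| "lcomb R _ _ = \<zero>\<^bsub>R\<^esub>"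

context cring
begin

lemma lcomb_closed [simp, intro]:
 "set cs<=carrier R ==> set vs<=carrier R ==> lcomb R cs vs\<in>carrier R"
 by (induction cs vs rule: list_induct2') auto

lemma lcomb_in_subring:
 "subring C R ==> set cs<=C ==> set vs<=C ==> lcomb R cs vs\<in>C"
 by (induction cs vs rule: list_induct2') (auto simp: subringE)

lemma lcomb_append:
 assumes "length cs = length vs" "set (cs @ cs')<=carrier R" "set (vs @ vs')<=carrier R"
 shows "lcomb R (cs @ cs') (vs @ vs') = lcomb R cs vs\<oplus>lcomb R cs' vs'"
 using assms
proof (induction cs vs rule: list_induct2)
 case Nil
 thus ?case by simp
next
 case (Cons c cs v vs)
 hence "lcomb R cs vs\<in>carrier R" "lcomb R cs' vs'\<in>carrier R" by auto
 thus ?case using Cons by (simp add: a_assoc)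
qed

lemma lcomb_smult:
 assumes "a\<in>carrier R" "set cs<=carrier R" "set vs<=carrier R"
 shows "lcomb R (map ((\<otimes>) a) cs) vs = a\<otimes>lcomb R cs vs"
 using assms(2,3)
proof (induction cs vs rule: list_induct2')
 case (4 c cs v vs)
 hence "lcomb R cs vs\<in>carrier R" by auto
 thus ?case using 4 assms(1) by (simp add: r_distr m_assoc)
qed (use assms(1) in auto)

lemma lspan_closed: "C<=carrier R ==> set ws<=carrier R ==> lspan R C ws<=carrier R"
 by (induction ws) auto

lemma lspan_add:
 assumes C: "subring C R" and "set ws<=carrier R" "x\<in>lspan R C ws" "y\<in>lspan R C ws"
 shows "x\<oplus>y\<in>lspan R C ws"
 using assms(2-)
proof (induction ws arbitrary: x y)
 case (Cons w ws)
 obtain a s b t where *: "a\<in>C" "s\<in>lspan R C ws" "b\<in>C" "t\<in>lspan R C ws" "x = a\<otimes>w\<oplus>s" "y = b\<otimes>w\<oplus>t"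
  using Cons.prems by auto
 have "a\<in>carrier R" "b\<in>carrier R" "s\<in>carrier R" "t\<in>carrier R" "w\<in>carrier R"
  using * Cons.prems subringE(1)[OF C] lspan_closed[OF subringE(1)[OF C], of ws] by auto
 hence "x\<oplus>y = (a\<oplus>b)\<otimes>w\<oplus>(s\<oplus>t)" using * by (simp add: l_distr a_ac)
 moreover have "a\<oplus>b\<in>C" "s\<oplus>t\<in>lspan R C ws" using * Cons subringE(7)[OF C] by auto
 ultimately show ?case by auto
qed simp

lemma lspan_smult:
 assumes C: "subring C R" and "set ws<=carrier R" "x\<in>lspan R C ws" "c\<in>C"
 shows "c\<otimes>x\<in>lspan R C ws"
 using assms(2,3)
proof (induction ws arbitrary: x)
 case Nil
 thus ?case using assms(4) subringE(1)[OF C] by auto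
next
 case (Cons w ws)
 obtain a s where *: "a\<in>C" "s\<in>lspan R C ws" "x = a\<otimes>w\<oplus>s"
  using Cons.prems by auto
 have "a\<in>carrier R" "c\<in>carrier R" "s\<in>carrier R" "w\<in>carrier R"
  using * Cons.prems subringE(1)[OF C] lspan_closed[OF subringE(1)[OF C], of ws] assms(4) by auto
 hence "c\<otimes>x = (c\<otimes>a)\<otimes>w\<oplus>c\<otimes>s" using * by (simp add: r_distr m_assoc)
 moreover have "c\<otimes>a\<in>C" "c\<otimes>s\<in>lspan R C ws" using * Cons subringE(6)[OF C] assms(4) by auto
 ultimately show ?case by auto
qed

lemma lspan_zero: "subring C R ==> set ws<=carrier R ==> \<zero>\<in>lspan R C ws"
proof (induction ws)
 case (Cons w ws)
 hence "\<zero> = \<zero>\<otimes>w\<oplus>\<zero>" by simp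
 thus ?case using Cons subringE(2)[of C R] by (simp; blast)
qed simp

lemma lspan_append1:
 assumes "subring C R" "set ws<=carrier R" "set us<=carrier R" "x\<in>lspan R C ws"
 shows "x\<in>lspan R C (ws @ us)"
 using assms(2,4)
proof (induction ws arbitrary: x)
 case Nil
 thus ?case using lspan_zero[OF assms(1,3)] by simp
next
 case (Cons w ws)
 thus ?case by fastforce
qed

lemma lspan_append2:
 assumes "subring C R" "set ws<=carrier R" "set us<=carrier R" "x\<in>lspan R C us"
 shows "x\<in>lspan R C (ws @ us)"
 using assms(2)
proof (induction ws)
 case Nil
 thus ?case using assms(4) by simp
next
 case (Cons w ws)
 have "x\<in>carrier R" using assms lspan_closed[OF subringE(1)] by blast
 hence "x = \<zero>\<otimes>w\<oplus>x" using Cons.prems by simp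
 thus ?case using Cons subringE(2)[OF assms(1)] by (simp; blast)
qed

lemma lspan_map_mult:
 assumes C: "subring C R" and "y\<in>carrier R" "set ws<=carrier R" "x\<in>lspan R C ws"
 shows "y\<otimes>x\<in>lspan R C (map ((\<otimes>) y) ws)"
 using assms(3,4)
proof (induction ws arbitrary: x)
 case Nil
 thus ?case using assms(2) by simp
next
 case (Cons w ws)
 obtain a s where *: "a\<in>C" "s\<in>lspan R C ws" "x = a\<otimes>w\<oplus>s"
  using Cons.prems by auto
 have "a\<in>carrier R" "s\<in>carrier R" "w\<in>carrier R"
  using * Cons.prems subringE(1)[OF C] lspan_closed[OF subringE(1)[OF C], of ws] by auto
 hence "y\<otimes>x = a\<otimes>(y\<otimes>w)\<oplus>y\<otimes>s" using * assms(2) by (simp add: r_distr m_ac)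
 moreover have "y\<otimes>s\<in>lspan R C (map ((\<otimes>) y) ws)" using * Cons by auto
 ultimately show ?case using * by auto
qed

end

context domain
begin

text \<open>Fraction-free Gaussian elimination.\<close>

lemma lspan_dependent:
 assumes C: "subring C R" and "set ws<=carrier R" "set vs<=lspan R C ws" "length ws < length vs"
 shows "\<exists>cs. length cs = length vs & set cs<=C & \<not> set cs<={\<zero>} & lcomb R cs vs = \<zero>"
 using assms(2-)
proof (induction ws arbitrary: vs)
 case Nil
 have "lcomb R (replicate (length vs) \<one>) vs = \<zero>" using Nil(2) by (induction vs) auto
 thus ?case using Nil subringE(3)[OF C] by (intro exI[of _ "replicate (length vs) \<one>"]) auto
next
 case (Cons w ws)
 have CR: "C<=carrier R" using subringE(1)[OF C] .
 have wR: "w\<in>carrier R" "set ws<=carrier R" using Cons.prems by auto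
 have spR: "lspan R C ws<=carrier R" using lspan_closed[OF CR wR(2)] .
 show ?case
 proof (cases "set vs<=lspan R C ws")
  case True
  thus ?thesis using Cons by auto
 next
  case False
  \<comment> \<open>The pivot: outside the span of \<open>ws\<close>, the vector \<open>v\<close>
    has a nonzero coefficient \<open>a\<close> at \<open>w\<close>. Replacing u by a u - \<alpha>(u)
    v removes \<open>w\<close> without any division.\<close>
  then obtain v where v: "v\<in>set vs" "v\<notin>lspan R C ws" by auto
  have "\<forall>u\<in>set vs. \<exists>a s. a\<in>C & s\<in>lspan R C ws & u = a\<otimes>w\<oplus>s" using Cons.prems(2) by auto
  then obtain \<alpha> \<sigma> where \<alpha>: "!!u. u\<in>set vs ==> \<alpha> u\<in>C & \<sigma> u\<in>lspan R C ws & u = \<alpha> u\<otimes>w\<oplus>\<sigma> u" by metis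
  have vsR: "u\<in>carrier R" if "u\<in>set vs" for u
   using \<alpha>[OF that] CR spR wR by (metis a_closed m_closed subsetD)
  define a where "a = \<alpha> v"
  have aC: "a\<in>C" and aR: "a\<in>carrier R" using \<alpha>[OF v(1)] CR unfolding a_def by auto
  have a0: "a ~= \<zero>"
  proof
   assume "a = \<zero>"
   hence "v = \<sigma> v" using \<alpha>[OF v(1)] spR wR unfolding a_def by auto
   thus False using v \<alpha>[OF v(1)] by auto
  qed
  obtain A B where AB: "vs = A @ v # B" using v(1) by (meson split_list)
  define f where "f u = a\<otimes>u\<oplus>\<ominus> (\<alpha> u)\<otimes>v" for u
  have f: "f u\<in>lspan R C ws" if u: "u\<in>set vs" for u
  proof -
   have cl: "\<alpha> u\<in>carrier R" "\<sigma> u\<in>carrier R" "\<sigma> v\<in>carrier R" "\<ominus> (\<alpha> u)\<in>C"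
    using \<alpha>[OF u] \<alpha>[OF v(1)] CR spR subringE(5)[OF C] by auto
   have "f u = a\<otimes>(\<alpha> u\<otimes>w\<oplus>\<sigma> u)\<oplus>\<ominus> (\<alpha> u)\<otimes>(a\<otimes>w\<oplus>\<sigma> v)"
    unfolding f_def using \<alpha>[OF u] \<alpha>[OF v(1)] unfolding a_def by metis
   also have "... = a\<otimes>\<sigma> u\<oplus>\<ominus> (\<alpha> u)\<otimes>\<sigma> v"
    using cl aR wR by (simp add: r_distr l_minus r_minus a_ac m_ac r_neg2 add_lneg_cancel add_lneg_cancel2 add_lneg_cancel3)
   also have "...\<in>lspan R C ws"
    using lspan_add[OF C wR(2)] lspan_smult[OF C wR(2)] \<alpha>[OF u] \<alpha>[OF v(1)] aC cl(4) by auto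
   finally show ?thesis .
  qed
  have "set (map f (A @ B))<=lspan R C ws" using f AB by auto
  moreover have "length ws < length (map f (A @ B))" using Cons.prems AB by simp
  ultimately obtain ds where ds: "length ds = length (A @ B)" "set ds<=C" "\<not> set ds<={\<zero>}"
   "lcomb R ds (map f (A @ B)) = \<zero>" using Cons.IH[OF wR(2), of "map f (A @ B)"] by auto
  define dA dB where "dA = take (length A) ds" and "dB = drop (length A) ds"
  have dAB: "ds = dA @ dB" "length dA = length A" "length dB = length B" unfolding dA_def dB_def using ds(1) by auto
  have dC: "set dA<=C" "set dB<=C" using ds(2) dAB by auto
  define \<gamma> where "\<gamma> = lcomb R ds (map \<alpha> (A @ B))"
  have \<alpha>C: "set (map \<alpha> (A @ B))<=C" using \<alpha> AB by auto
  have \<gamma>C: "\<gamma>\<in>C" unfolding \<gamma>_def using lcomb_in_subring[OF C ds(2) \<alpha>C] .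
  have ABR: "set (A @ B)<=carrier R" using vsR AB by auto
  have vR: "v\<in>carrier R" using vsR v by auto
  have "lcomb R es (map f us) = a\<otimes>lcomb R es us\<oplus>\<ominus> lcomb R es (map \<alpha> us)\<otimes>v"
   if "length es = length us" "set es<=carrier R" "set us<=carrier R" "set (map \<alpha> us)<=carrier R" for es us
   using that
  proof (induction es us rule: list_induct2)
   case Nil
   thus ?case using aR vR by simp
  next
   case (Cons e es u us)
   have cl: "lcomb R es us\<in>carrier R" "lcomb R es (map \<alpha> us)\<in>carrier R" "e\<in>carrier R" "u\<in>carrier R" "\<alpha> u\<in>carrier R"
    using Cons.prems by auto
   have "lcomb R (e # es) (map f (u # us)) = e\<otimes>f u\<oplus>(a\<otimes>lcomb R es us\<oplus>\<ominus> lcomb R es (map \<alpha> us)\<otimes>v)"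
    using Cons by simp
   also have "... = a\<otimes>lcomb R (e # es) (u # us)\<oplus>\<ominus> lcomb R (e # es) (map \<alpha> (u # us))\<otimes>v"
    unfolding f_def using cl aR vR by (simp add: r_distr l_distr l_minus r_minus minus_add a_ac m_ac)
   finally show ?case .
  qed
  from this[OF ds(1) subset_trans[OF ds(2) CR] ABR subset_trans[OF \<alpha>C CR]]
  have "a\<otimes>lcomb R ds (A @ B)\<oplus>\<ominus> \<gamma>\<otimes>v = \<zero>"
   using ds(4) unfolding \<gamma>_def by simp
  moreover have "lcomb R ds (A @ B) = lcomb R dA A\<oplus>lcomb R dB B"
   unfolding dAB(1) using dAB dC CR ABR by (intro lcomb_append) auto
  ultimately have rel: "a\<otimes>(lcomb R dA A\<oplus>lcomb R dB B)\<oplus>\<ominus> \<gamma>\<otimes>v = \<zero>" by simp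
  \<comment> \<open>The relation between the reduced vectors is read as one between the original
    vectors; the pivot collects the coefficient -\<gamma>. It is nontrivial because multiplication
    by \<open>a\<close> is injective.\<close>
  define cs where "cs = map ((\<otimes>) a) dA @ \<ominus> \<gamma> # map ((\<otimes>) a) dB"
  have csC: "set cs<=C" unfolding cs_def using dC aC \<gamma>C subringE(5,6)[OF C] by auto
  have cl: "lcomb R dA A\<in>carrier R" "lcomb R dB B\<in>carrier R" "\<gamma>\<in>carrier R"
   using dC CR ABR \<gamma>C by auto
  have "lcomb R cs vs = lcomb R (map ((\<otimes>) a) dA) A\<oplus>lcomb R (\<ominus> \<gamma> # map ((\<otimes>) a) dB) (v # B)"
   unfolding cs_def AB using csC CR ABR vR dAB(2) unfolding cs_def by (intro lcomb_append) auto
  also have "... = a\<otimes>lcomb R dA A\<oplus>(\<ominus> \<gamma>\<otimes>v\<oplus>a\<otimes>lcomb R dB B)"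
   using dC CR ABR aR by (simp add: lcomb_smult subset_iff)
  also have "... = a\<otimes>(lcomb R dA A\<oplus>lcomb R dB B)\<oplus>\<ominus> \<gamma>\<otimes>v"
   using cl aR vR by (simp add: r_distr a_ac)
  finally have "lcomb R cs vs = \<zero>" using rel by simp
  moreover have "\<not> set cs<={\<zero>}"
  proof -
   obtain d where d: "d\<in>set ds" "d ~= \<zero>" using ds(3) by auto
   hence "d\<in>carrier R" using ds(2) CR by auto
   hence "a\<otimes>d ~= \<zero>" using a0 d integral aR by blast
   moreover have "a\<otimes>d\<in>set cs" using d dAB(1) unfolding cs_def by auto
   ultimately show ?thesis by auto
  qed
  moreover have "length cs = length vs" unfolding cs_def AB using dAB by simp
  ultimately show ?thesis using csC by blast
 qed
qed

abbreviation alg_over :: "'a set => 'a => bool" where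
 "alg_over C x \<equiv> \<not> transc_mod R {\<zero>} C x"

text \<open>\<open>E\<close> has finite rank over \<open>C\<close>, after passing to fractions.\<close>

definition fin_over :: "'a set => 'a set => bool" where
 "fin_over C E \<longleftrightarrow> subring E R & C<=E &
   (\<exists>ws. set ws<=carrier R & (\<forall>y\<in>E. \<exists>c\<in>C - {\<zero>}. c\<otimes>y\<in>lspan R C ws))"

lemma prime_zero: "prime_in R (carrier R) {\<zero>}"
 unfolding prime_in_def using integral by auto

lemma fin_over_refl: "subring C R ==> fin_over C C"
proof -
 assume C: "subring C R"
 have "\<one>\<otimes>y\<in>lspan R C [\<one>]" if "y\<in>C" for y
  using that subringE(1)[OF C] by (auto intro!: exI[of _ y])
 thus ?thesis
  unfolding fin_over_def using C subringE(3)[OF C] one_not_zero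
  by (intro conjI exI[of _ "[\<one>]"] ballI bexI[of _ \<one>]) auto
qed

lemma lcomb_powers:
 assumes "x\<in>carrier R" "!!i. d i\<in>carrier R" "set cs<=carrier R"
 shows "lcomb R cs (map (%i. d i\<otimes>x [^] i) [j..<j + length cs])
  = x [^] j\<otimes>horner R (map2 (\<otimes>) cs (map d [j..<j + length cs])) x"
 using assms(3)
proof (induction cs arbitrary: j)
 case (Cons c cs)
 have up: "[j..<j + length (c # cs)] = j # [Suc j..<Suc j + length cs]"
  by (simp add: upt_conv_Cons del: upt_Suc)
 define h where "h = horner R (map2 (\<otimes>) cs (map d [Suc j..<Suc j + length cs])) x"
 have "set (map2 (\<otimes>) cs (map d [Suc j..<Suc j + length cs]))<=carrier R"
 proof
  fix y assume "y\<in>set (map2 (\<otimes>) cs (map d [Suc j..<Suc j + length cs]))"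
  then obtain a b where ab: "(a, b)\<in>set (zip cs (map d [Suc j..<Suc j + length cs]))" "y = a\<otimes>b"
   by (auto simp del: upt_Suc)
  have "a\<in>carrier R" using set_zip_leftD[OF ab(1)] Cons.prems by auto
  moreover have "b\<in>carrier R" using set_zip_rightD[OF ab(1)] assms(2) by (auto simp del: upt_Suc)
  ultimately show "y\<in>carrier R" using ab by simp
 qed
 hence hR: "h\<in>carrier R" unfolding h_def using assms(1) by blast
 have "lcomb R (c # cs) (map (%i. d i\<otimes>x [^] i) [j..<j + length (c # cs)]) = c\<otimes>(d j\<otimes>x [^] j)\<oplus>x [^] Suc j\<otimes>h"
  unfolding up h_def using Cons.IH[of "Suc j"] Cons.prems by (simp del: upt_Suc)
 also have "... = x [^] j\<otimes>(c\<otimes>d j\<oplus>x\<otimes>h)"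
  using hR Cons.prems assms by (simp add: r_distr m_ac)
 finally show ?case unfolding up h_def by (simp del: upt_Suc)
qed (use assms in simp)

text \<open>Enough powers of \<open>x\<close>, each scaled into the span of \<open>ws\<close> by a
  nonzero element of \<open>C\<close>, are linearly dependent over \<open>C\<close>, and a
  dependence between powers is an algebraic equation for \<open>x\<close>.\<close>

lemma fin_over_alg:
 assumes C: "subring C R" and E: "fin_over C E" and x: "x\<in>E"
 shows "alg_over C x"
proof -
 obtain ws where ws: "set ws<=carrier R" "!!y. y\<in>E ==> \<exists>c\<in>C - {\<zero>}. c\<otimes>y\<in>lspan R C ws"
  and Esub: "subring E R" "C<=E" using E unfolding fin_over_def by blast
 have CR: "C<=carrier R" using subringE(1)[OF C] .
 have xR: "x\<in>carrier R" using x subringE(1)[OF Esub(1)] by auto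
 have "x [^] i\<in>E" for i :: nat
  using subringE(3,6)[OF Esub(1)] x by (induction i) auto
 hence "\<forall>i::nat. \<exists>d. d\<in>C - {\<zero>} & d\<otimes>x [^] i\<in>lspan R C ws"
  using ws(2) by blast
 then obtain d where d: "!!i::nat. d i\<in>C - {\<zero>} & d i\<otimes>x [^] i\<in>lspan R C ws"
  by metis
 \<comment> \<open>One power more than there are spanning elements; the exponents run from 0 to
   \<open>length ws\<close>.\<close>
 define n where "n = Suc (length ws)"
 define vs where "vs = map (%i. d i\<otimes>x [^] i) [0..<n]"
 have "set vs<=lspan R C ws" "length ws < length vs" unfolding vs_def n_def using d by auto
 then obtain cs where cs: "length cs = length vs" "set cs<=C" "\<not> set cs<={\<zero>}" "lcomb R cs vs = \<zero>"
  using lspan_dependent[OF C ws(1)] by blast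
 have len: "length cs = n" using cs(1) vs_def by simp
 define es where "es = map2 (\<otimes>) cs (map d [0..<n])"
 have esC: "set es<=C"
 proof
  fix y assume "y\<in>set es"
  then obtain a b where ab: "(a, b)\<in>set (zip cs (map d [0..<n]))" "y = a\<otimes>b"
   unfolding es_def by auto
  have "a\<in>C" using set_zip_leftD[OF ab(1)] cs(2) by auto
  moreover have "b\<in>C" using set_zip_rightD[OF ab(1)] d by auto
  ultimately show "y\<in>C" using ab subringE(6)[OF C] by simp
 qed
 have "lcomb R cs vs = x [^] (0::nat)\<otimes>horner R es x"
  using lcomb_powers[of x d cs 0] xR d CR cs(2) len unfolding vs_def es_def by auto
 moreover have "horner R es x\<in>carrier R" using esC CR xR by auto
 ultimately have "horner R es x = \<zero>" using cs(4) by simp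
 moreover have "\<not> set es<={\<zero>}"
 proof -
  obtain e where "e\<in>set cs" "e ~= \<zero>" using cs(3) by auto
  then obtain i where i: "i < n" "cs ! i ~= \<zero>" using len by (auto simp: in_set_conv_nth)
  hence "es ! i = cs ! i\<otimes>d i" "i < length es" unfolding es_def using len by auto
  moreover have "cs ! i\<otimes>d i ~= \<zero>"
   using i d[of i] integral cs(2) len CR by (metis DiffD1 DiffD2 insertI1 nth_mem subsetD)
  ultimately show ?thesis using nth_mem by (metis singletonD subsetD)
 qed
 ultimately show ?thesis using esC unfolding transc_mod_def by blast
qed

text \<open>An algebraic equation of \<open>d\<close> can be divided by \<open>d\<close> until its
  constant term is nonzero. That constant is then a multiple of \<open>d\<close>, which replaces a
  norm.\<close>

lemma alg_over_cofactor:
 assumes C: "subring C R" and E: "subring E R" "C<=E" and d: "d\<in>E" "d ~= \<zero>" "alg_over C d"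
 shows "\<exists>d'\<in>E. d'\<otimes>d\<in>C - {\<zero>}"
proof -
 have CR: "C<=carrier R" using subringE(1)[OF C] .
 have dR: "d\<in>carrier R" using d subringE(1)[OF E(1)] by auto
 obtain cs where "set cs<=C" "horner R cs d = \<zero>" "\<not> set cs<={\<zero>}"
  using d(3) unfolding transc_mod_def by blast
 thus ?thesis
 proof (induction cs)
  case (Cons c cs)
  have hE: "horner R cs d\<in>E" using horner_in_subring[OF E(1) _ d(1), of cs] Cons.prems E(2) by auto
  hence hR: "horner R cs d\<in>carrier R" using subringE(1)[OF E(1)] by auto
  have cR: "c\<in>carrier R" using Cons.prems CR by auto
  show ?case
  proof (cases "c = \<zero>")
   case True
   hence "horner R cs d = \<zero>" using Cons.prems(2) dR hR d(2) integral by auto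
   thus ?thesis using Cons True by auto
  next
   case False
   have "c = \<ominus> (d\<otimes>horner R cs d)"
    using Cons.prems(2) cR dR hR by (simp add: add.inv_equality minus_equality)
   hence "\<ominus> horner R cs d\<otimes>d = c" using dR hR by (simp add: l_minus r_minus m_comm)
   thus ?thesis using False Cons.prems(1) subringE(5)[OF E(1) hE] by auto
  qed
 qed simp
qed

text \<open>Multiplying the equation of \<open>x\<close> over \<open>E\<close> by a cofactor gives
  it a leading coefficient \<open>c\<close> in \<open>C\<close>. Up to powers of \<open>c\<close>,
  every element of E[x] then has degree below \<open>n\<close> in \<open>x\<close>, and finally its
  coefficients in \<open>E\<close> are brought into the span of \<open>ws\<close> one after the
  other.\<close>

lemma fin_over_adjoin:
 assumes C: "subring C R" and E: "fin_over C E" and x: "x\<in>carrier R" "alg_over E x"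
 shows "fin_over C (adjoin R E x)"
proof -
 obtain ws where ws: "set ws<=carrier R" "!!y. y\<in>E ==> \<exists>c\<in>C - {\<zero>}. c\<otimes>y\<in>lspan R C ws"
  and Es: "subring E R" "C<=E" using E unfolding fin_over_def by blast
 have CR: "C<=carrier R" using subringE(1)[OF C] .
 have ER: "E<=carrier R" using subringE(1)[OF Es(1)] .
 obtain ds d where d: "set ds<=E" "d\<in>E - {\<zero>}" "horner R (ds @ [d]) x\<in>{\<zero>}"
  using not_transc_modE[OF prime_zero ER x] by blast
 obtain d' where d': "d'\<in>E" "d'\<otimes>d\<in>C - {\<zero>}"
  using alg_over_cofactor[OF C Es, of d] d(2) fin_over_alg[OF C E] by auto
 define c where "c = d'\<otimes>d"
 define n where "n = length ds"
 have cC: "c\<in>C" "c ~= \<zero>" "c\<in>E" "c\<in>carrier R" using d' Es(2) CR unfolding c_def by auto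
 \<comment> \<open>The polynomial values of degree below \<open>n\<close>, written with exactly
   \<open>n\<close> coefficients so that sums need no degree bookkeeping.\<close>
 define W where "W = {horner R es x | es. set es<=E & length es = n}"
 have WR: "W<=carrier R" unfolding W_def using ER x by auto
 have Wadd: "a\<oplus>b\<in>W" if ab: "a\<in>W" "b\<in>W" for a b
 proof -
  obtain es fs where *: "set es<=E" "length es = n" "a = horner R es x" "set fs<=E" "length fs = n" "b = horner R fs x"
   using ab unfolding W_def by blast
  from horner_add[OF Es(1) *(1,4) x(1)] obtain gs where
   "set gs<=E" "length gs = max (length es) (length fs)" "horner R gs x = a\<oplus>b" using * by metis
  thus ?thesis unfolding W_def using * by (intro CollectI exI[of _ gs]) auto
 qed
 have Wsm: "e\<otimes>a\<in>W" if ea: "e\<in>E" "a\<in>W" for e a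
 proof -
  obtain es where *: "set es<=E" "length es = n" "a = horner R es x" using ea unfolding W_def by blast
  have "e\<otimes>a = horner R (map ((\<otimes>) e) es) x"
   using * ea ER x(1) by (subst horner_smult) auto
  moreover have "set (map ((\<otimes>) e) es)<=E" using * ea subringE(6)[OF Es(1)] by auto
  ultimately show ?thesis unfolding W_def using * by (intro CollectI exI[of _ "map ((\<otimes>) e) es"]) auto
 qed
 have xn: "c\<otimes>x [^] n\<in>W"
 proof -
  have dR: "d\<in>carrier R" "d'\<in>carrier R" "set ds<=carrier R" using d d' ER by auto
  have hR: "horner R ds x\<in>carrier R" using dR x by auto
  have "horner R ds x\<oplus>x [^] n\<otimes>d = \<zero>"
   using d(3) horner_append[of ds "[d]" x] dR x unfolding n_def by simp
  hence "x [^] n\<otimes>d = \<ominus> horner R ds x"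
   using hR dR x by (metis a_comm m_closed minus_equality nat_pow_closed)
  hence "c\<otimes>x [^] n = \<ominus> d'\<otimes>horner R ds x"
   unfolding c_def using dR x hR by (simp add: m_ac l_minus r_minus)
  moreover have "horner R ds x\<in>W" unfolding W_def n_def using d by blast
  ultimately show ?thesis using Wsm subringE(5)[OF Es(1) d'(1)] by simp
 qed
 have Wx: "c\<otimes>(x\<otimes>a)\<in>W" if a: "a\<in>W" and n: "n > 0" for a
 proof -
  obtain es where *: "set es<=E" "length es = n" "a = horner R es x" using a unfolding W_def by blast
  then obtain es' e where e: "es = es' @ [e]" using n by (cases es rule: rev_cases) auto
  have eE: "set (\<zero> # es')<=E" "e\<in>E" "length (\<zero> # es') = n"
   using * e subringE(2)[OF Es(1)] by auto
  hence w: "horner R (\<zero> # es') x\<in>W" unfolding W_def by blast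
  have cl: "horner R es' x\<in>carrier R" "e\<in>carrier R" using eE ER x by auto
  have len: "n = Suc (length es')" using * e by simp
  have "set es'<=carrier R" using eE ER by auto
  hence "a = horner R es' x\<oplus>x [^] length es'\<otimes>e"
   using *(3) e horner_append[of es' "[e]" x] cl x by simp
  hence "c\<otimes>(x\<otimes>a) = c\<otimes>horner R (\<zero> # es') x\<oplus>e\<otimes>(c\<otimes>x [^] n)"
   unfolding len using cl x cC by (simp add: r_distr m_ac)
  thus ?thesis using Wadd Wsm w xn cC eE(2) by auto
 qed
 have n0: "n > 0"
 proof (rule ccontr)
  assume "\<not> n > 0"
  thus False using d ER x unfolding n_def by auto
 qed
 \<comment> \<open>Each multiplication by \<open>x\<close> costs one factor \<open>c\<close> when
   the result is reduced below degree \<open>n\<close> again.\<close>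
 have toW: "\<exists>N::nat. c [^] N\<otimes>horner R es x\<in>W" if "set es<=E" for es
  using that
 proof (induction es)
  case Nil
  have "\<zero>\<in>W"
   unfolding W_def using subringE(2)[OF Es(1)] horner_replicate_zero[OF x(1)]
   by (intro CollectI exI[of _ "replicate n \<zero>"]) auto
  thus ?case using cC by auto
 next
  case (Cons e es)
  then obtain N :: nat where N: "c [^] N\<otimes>horner R es x\<in>W" by auto
  have cl: "horner R es x\<in>carrier R" "e\<in>carrier R" "e\<in>E" using Cons.prems ER x by auto
  have cN: "c [^] i\<in>E" for i :: nat using cC(3) subringE(3,6)[OF Es(1)] by (induction i) auto
  have pcl: "c [^] N\<in>carrier R" using cC by auto
  have "c [^] Suc N\<otimes>horner R (e # es) x = (c [^] Suc N\<otimes>e)\<otimes>\<one>\<oplus>c\<otimes>(x\<otimes>(c [^] N\<otimes>horner R es x))"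
   using cl cC x pcl by (simp add: r_distr m_ac)
  moreover have "\<one>\<in>W"
  proof -
   have "horner R (\<one> # replicate (n - 1) \<zero>) x = \<one>" using x by (simp add: horner_replicate_zero)
   thus ?thesis unfolding W_def using n0 subringE(2,3)[OF Es(1)]
    by (intro CollectI exI[of _ "\<one> # replicate (n - 1) \<zero>"]) auto
  qed
  moreover have "c [^] Suc N\<otimes>e\<in>E" using cN subringE(6)[OF Es(1)] cl by blast
  ultimately have "c [^] Suc N\<otimes>horner R (e # es) x\<in>W" using Wadd Wsm Wx[OF N n0] by metis
  thus ?case by blast
 qed
 \<comment> \<open>\<open>WS m\<close> lists the products x^i w with i < m and w in
   \<open>ws\<close>.\<close>
 define WS where "WS = rec_nat [] (%_ us. ws @ map ((\<otimes>) x) us)"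
 have WS: "WS 0 = []" "!!m. WS (Suc m) = ws @ map ((\<otimes>) x) (WS m)" unfolding WS_def by auto
 have WSR: "set (WS m)<=carrier R" for m using ws(1) x(1) by (induction m) (auto simp: WS)
 have fromW: "\<exists>b\<in>C - {\<zero>}. b\<otimes>horner R es x\<in>lspan R C (WS (length es))" if "set es<=E" for es
  using that
 proof (induction es)
  case Nil
  thus ?case using subringE(3)[OF C] one_not_zero by (intro bexI[of _ \<one>]) (auto simp: WS)
 next
  case (Cons e es)
  then obtain b where b: "b\<in>C - {\<zero>}" "b\<otimes>horner R es x\<in>lspan R C (WS (length es))" by auto
  obtain b' where b': "b'\<in>C - {\<zero>}" "b'\<otimes>e\<in>lspan R C ws" using ws(2)[of e] Cons.prems by auto
  have cl: "horner R es x\<in>carrier R" "e\<in>carrier R" "b\<in>carrier R" "b'\<in>carrier R"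
   using Cons.prems ER x b b' CR by auto
  have m: "set (map ((\<otimes>) x) (WS (length es)))<=carrier R" using WSR x(1) by auto
  have "x\<otimes>(b\<otimes>horner R es x)\<in>lspan R C (map ((\<otimes>) x) (WS (length es)))"
   using lspan_map_mult[OF C x(1) WSR b(2)] .
  hence 1: "x\<otimes>(b\<otimes>horner R es x)\<in>lspan R C (WS (length (e # es)))"
   using lspan_append2[OF C ws(1) m] WS by simp
  have 2: "b'\<otimes>e\<in>lspan R C (WS (length (e # es)))"
   using lspan_append1[OF C ws(1) m b'(2)] WS by simp
  have "(b\<otimes>b')\<otimes>horner R (e # es) x = b\<otimes>(b'\<otimes>e)\<oplus>b'\<otimes>(x\<otimes>(b\<otimes>horner R es x))"
   using cl x by (simp add: r_distr m_ac)
  also have "...\<in>lspan R C (WS (length (e # es)))"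
   using lspan_add[OF C WSR] lspan_smult[OF C WSR 1] lspan_smult[OF C WSR 2] b b' by blast
  finally have "(b\<otimes>b')\<otimes>horner R (e # es) x\<in>lspan R C (WS (length (e # es)))" .
  moreover have "b\<otimes>b'\<in>C - {\<zero>}" using b b' subringE(6)[OF C] integral cl by auto
  ultimately show ?case by blast
 qed
 have "\<exists>b\<in>C - {\<zero>}. b\<otimes>y\<in>lspan R C (WS n)" if y: "y\<in>adjoin R E x" for y
 proof -
  obtain es where es: "set es<=E" "y = horner R es x" using y unfolding adjoin_def by blast
  then obtain N :: nat where N: "c [^] N\<otimes>y\<in>W" using toW by blast
  then obtain fs where fs: "set fs<=E" "length fs = n" "c [^] N\<otimes>y = horner R fs x" unfolding W_def by blast
  then obtain b where b: "b\<in>C - {\<zero>}" "b\<otimes>(c [^] N\<otimes>y)\<in>lspan R C (WS n)" using fromW by force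
  have yR: "y\<in>carrier R" using es ER x by auto
  have cN: "c [^] i\<in>C - {\<zero>}" for i :: nat
  proof (induction i)
   case 0
   thus ?case using subringE(3)[OF C] one_not_zero by simp
  next
   case (Suc i)
   hence "c [^] i\<in>C" "c [^] i\<in>carrier R" "c [^] i ~= \<zero>" using CR by auto
   thus ?case using cC subringE(6)[OF C] integral[of "c [^] i" c] by auto
  qed
  have "b\<otimes>c [^] N\<in>C - {\<zero>}"
   using b cN[of N] subringE(6)[OF C, of b "c [^] N"] integral[of b "c [^] N"] CR by auto
  moreover have "b\<otimes>(c [^] N\<otimes>y) = (b\<otimes>c [^] N)\<otimes>y"
   using b cC yR CR by (auto simp: m_assoc)
  ultimately show ?thesis using b by metis
 qed
 thus ?thesis
  unfolding fin_over_def using adjoin_subring[OF Es(1) x(1)] adjoin_base[OF ER x(1)] Es(2) WSR[of n] by blast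
qed

lemma alg_over_mono: "C<=D ==> alg_over C x ==> alg_over D x"
 using transc_mod_mono by blast

lemma fin_over_foldl:
 assumes C: "subring C R" and "fin_over C E" "set xs<=carrier R" "!!x. x\<in>set xs ==> alg_over C x"
 shows "fin_over C (foldl (adjoin R) E xs)"
 using assms(2-)
proof (induction xs arbitrary: E)
 case (Cons x xs)
 have "C<=E" using Cons.prems unfolding fin_over_def by simp
 hence "alg_over E x" using Cons.prems alg_over_mono by auto
 hence "fin_over C (adjoin R E x)" using fin_over_adjoin[OF C] Cons.prems by auto
 thus ?case using Cons by auto
qed simp

lemma alg_over_foldl:
 assumes C: "subring C R" and "set xs<=carrier R" "!!x. x\<in>set xs ==> alg_over C x"
  and "y\<in>foldl (adjoin R) C xs"
 shows "alg_over C y"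
 using fin_over_alg[OF C fin_over_foldl[OF C fin_over_refl[OF C] assms(2,3)] assms(4)] by blast

text \<open>Only the finitely many coefficients of one equation over \<open>D\<close> matter.
  Adjoining them and then \<open>x\<close> to \<open>C\<close> keeps the rank finite, and elements
  of a ring of finite rank are algebraic.\<close>

lemma alg_over_trans:
 assumes C: "subring C R" and D: "D<=carrier R" "!!d. d\<in>D ==> alg_over C d"
  and x: "x\<in>carrier R" "alg_over D x"
 shows "alg_over C x"
proof -
 obtain cs where cs: "set cs<=D" "horner R cs x\<in>{\<zero>}" "\<not> set cs<={\<zero>}"
  using x(2) unfolding transc_mod_def by blast
 define E where "E = foldl (adjoin R) C cs"
 have csR: "set cs<=carrier R" using cs D by auto
 have fin: "fin_over C E" unfolding E_def
  using fin_over_foldl[OF C fin_over_refl[OF C] csR] D cs by blast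
 have "set cs<=E" unfolding E_def using foldl_adjoin_gens[OF C csR] .
 hence "alg_over E x" using cs unfolding transc_mod_def by blast
 moreover have "subring E R" using fin unfolding fin_over_def by blast
 ultimately show ?thesis
  using fin_over_alg[OF C fin_over_adjoin[OF C fin x(1)] adjoin_gen[OF _ x(1)]] by blast
qed

lemma alg_over_self: "subring C R ==> x\<in>C ==> alg_over C x"
 using fin_over_alg[OF _ fin_over_refl] by blast

text \<open>Induction on the number of \<open>bs\<close>: the first element of \<open>xs\<close> is
  exchanged for a suitable \<open>b\<close>, and the rest is treated over C[x] with one element
  fewer.\<close>

lemma steinitz:
 assumes "subring C R" "set bs<=carrier R" "set xs<=carrier R" "indep_mod R {\<zero>} C xs"
  and "!!x. x\<in>set xs ==> alg_over (foldl (adjoin R) C bs) x"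
 shows "length xs \<le> length bs"
 using assms
proof (induction "length bs" arbitrary: C bs xs)
 case 0
 thus ?case by (cases xs) auto
next
 case (Suc n)
 show ?case
 proof (cases xs)
  case (Cons x xs')
  have C: "subring C R" by fact
  have x: "x\<in>carrier R" "transc_mod R {\<zero>} C x" "alg_over (foldl (adjoin R) C bs) x"
   using Suc.prems Cons by auto
  \<comment> \<open>Along the growing prefixes of \<open>bs\<close>, \<open>x\<close> turns from
    transcendental to algebraic at some entry \<open>b\<close>; this is the one that can be
    exchanged.\<close>
  have "\<exists>b1 b b2. bs = b1 @ b # b2 & transc_mod R {\<zero>} (foldl (adjoin R) C b1) x &
    alg_over (foldl (adjoin R) C (b1 @ [b])) x"
   using x(2,3)
  proof (induction bs rule: rev_induct)
   case (snoc b bs)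
   thus ?case
   proof (cases "alg_over (foldl (adjoin R) C bs) x")
    case True
    then obtain b1 b' b2 where "bs = b1 @ b' # b2" "transc_mod R {\<zero>} (foldl (adjoin R) C b1) x"
      "alg_over (foldl (adjoin R) C (b1 @ [b'])) x" using snoc by blast
    thus ?thesis by (intro exI[of _ b1] exI[of _ b'] exI[of _ "b2 @ [b]"]) auto
   next
    case False
    thus ?thesis using snoc by (intro exI[of _ bs] exI[of _ b] exI[of _ "[]"]) auto
   qed
  qed auto
  then obtain b1 b b2 where b: "bs = b1 @ b # b2" "transc_mod R {\<zero>} (foldl (adjoin R) C b1) x"
    "alg_over (adjoin R (foldl (adjoin R) C b1) b) x" by auto
  have bR: "set b1<=carrier R" "b\<in>carrier R" "set b2<=carrier R" using Suc.prems b by auto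
  have s1: "subring (foldl (adjoin R) C b1) R" using foldl_adjoin_subring[OF C bR(1)] .
  have Cx: "subring (adjoin R C x) R" using adjoin_subring[OF C x(1)] .
  have bs'R: "set (b1 @ b2)<=carrier R" using bR by auto
  define D where "D = foldl (adjoin R) (adjoin R C x) (b1 @ b2)"
  have D: "subring D R" unfolding D_def using foldl_adjoin_subring[OF Cx bs'R] .
  have DR: "D<=carrier R" using subringE(1)[OF D] .
  have gD: "set (b1 @ b2)<=D" "adjoin R C x<=D"
   unfolding D_def using foldl_adjoin_gens[OF Cx bs'R] foldl_adjoin_base[OF Cx bs'R] by auto
  have CD: "C<=D" using gD(2) adjoin_base[OF subringE(1)[OF C] x(1)] by auto
  have xD: "x\<in>D" using gD(2) adjoin_gen[OF C x(1)] by auto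
  have "alg_over (adjoin R (foldl (adjoin R) C b1) x) b"
   using transc_mod_exchange[OF prime_zero s1 x(1) bR(2) b(2,3)] .
  moreover have "adjoin R (foldl (adjoin R) C b1) x<=D"
   using adjoin_minimal[OF D] foldl_adjoin_minimal[OF D CD, of b1] gD xD by auto
  ultimately have bD: "alg_over D b" using alg_over_mono by blast
  have sub: "foldl (adjoin R) C bs<=adjoin R D b"
  proof (rule foldl_adjoin_minimal[OF adjoin_subring[OF D bR(2)]])
   show "C<=adjoin R D b" using CD adjoin_base[OF DR bR(2)] by auto
   show "set bs<=adjoin R D b"
    using b gD adjoin_base[OF DR bR(2)] adjoin_gen[OF D bR(2)] by auto
  qed
  have Db: "alg_over D y" if "y\<in>adjoin R D b" for y
   using alg_over_foldl[OF D, of "[b]" y] bR bD that by auto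
  have "length xs' \<le> length (b1 @ b2)"
  proof (rule Suc.hyps(1)[OF _ Cx bs'R])
   show "n = length (b1 @ b2)" using Suc.hyps(2) b by simp
   show "alg_over (foldl (adjoin R) (adjoin R C x) (b1 @ b2)) y" if "y\<in>set xs'" for y
   proof -
    have "alg_over (adjoin R D b) y" using alg_over_mono[OF sub] Suc.prems(5)[of y] that Cons by auto
    thus ?thesis
     using alg_over_trans[OF D adjoin_closed[OF DR bR(2)] Db, of y] Suc.prems(3) that Cons unfolding D_def by auto
   qed
  qed (use Suc.prems Cons in auto)
  thus ?thesis using Cons b by simp
 qed simp
qed

end

text \<open>Reversing the coefficients gives an equation for the inverse. The list of length n
  stands for degree n - 1, which accounts for the additional factor \<open>x\<close> in the
  identity.\<close>

lemma (in field) alg_over_inv: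
 assumes C: "subring C R" and x: "x\<in>carrier R" "x ~= \<zero>" "alg_over C x"
 shows "alg_over C (inv x)"
proof -
 have xU: "x\<in>Units R" using x field_Units by auto
 have iR: "inv x\<in>carrier R" using xU by auto
 have *: "x [^] length cs\<otimes>horner R (rev cs) (inv x) = x\<otimes>horner R cs x" if "set cs<=carrier R" for cs
  using that
 proof (induction cs)
  case (Cons c cs)
  have cl: "horner R (rev cs) (inv x)\<in>carrier R" "horner R cs x\<in>carrier R" "c\<in>carrier R"
   using Cons.prems iR x by auto
  have pw: "x [^] n\<otimes>inv x [^] n = \<one>" for n :: nat
   using xU iR x by (simp add: nat_pow_distrib[symmetric])
  have pc: "x [^] length cs\<in>carrier R" "inv x [^] length cs\<in>carrier R" using x iR by auto
  have "horner R (rev (c # cs)) (inv x) = horner R (rev cs) (inv x)\<oplus>inv x [^] length cs\<otimes>c"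
   using horner_append[of "rev cs" "[c]" "inv x"] Cons.prems iR by simp
  hence "x [^] length (c # cs)\<otimes>horner R (rev (c # cs)) (inv x)
    = x\<otimes>(x [^] length cs\<otimes>horner R (rev cs) (inv x))\<oplus>x\<otimes>((x [^] length cs\<otimes>inv x [^] length cs)\<otimes>c)"
   using cl x pc by (simp add: r_distr m_ac)
  also have "... = x\<otimes>horner R (c # cs) x"
   unfolding pw using Cons cl x by (simp add: r_distr a_ac)
  finally show ?case .
 qed (use x in simp)
 obtain cs where cs: "set cs<=C" "horner R cs x = \<zero>" "\<not> set cs<={\<zero>}"
  using x(3) unfolding transc_mod_def by blast
 have csR: "set cs<=carrier R" using cs subringE(1)[OF C] by auto
 have "x [^] length cs\<otimes>horner R (rev cs) (inv x) = \<zero>" using *[OF csR] cs x by simp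
 moreover have "x [^] n ~= \<zero>" for n :: nat using x integral by (induction n) auto
 moreover have "horner R (rev cs) (inv x)\<in>carrier R" using csR iR by auto
 ultimately have "horner R (rev cs) (inv x) = \<zero>" using integral[of "x [^] length cs"] x(1) by auto
 thus ?thesis using cs unfolding transc_mod_def by (intro notI) (metis set_rev singletonI)
qed

text \<open>Sums, products and negatives of algebraic elements a, b lie in C[a, b], which has finite
  rank over \<open>C\<close>; inverses are covered by the reversed equation.\<close>

lemma (in field) alg_over_generate_field:
 assumes C: "subring C R" and S: "S<=carrier R" "!!s. s\<in>S ==> alg_over C s"
  and y: "y\<in>generate_field R S"
 shows "alg_over C y"
proof -
 have clos: "alg_over C (a\<oplus>b)" "alg_over C (a\<otimes>b)" "alg_over C (\<ominus> a)"
  if ab: "a\<in>carrier R" "b\<in>carrier R" "alg_over C a" "alg_over C b" for a b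
 proof -
  define E where "E = foldl (adjoin R) C [a, b]"
  have s: "set [a, b]<=carrier R" using ab by auto
  have E: "subring E R" "a\<in>E" "b\<in>E"
   using foldl_adjoin_subring[OF C s] foldl_adjoin_gens[OF C s] unfolding E_def by auto
  have al: "alg_over C y" if "y\<in>E" for y
   using alg_over_foldl[OF C s, of y] that ab unfolding E_def by auto
  show "alg_over C (a\<oplus>b)" "alg_over C (a\<otimes>b)" "alg_over C (\<ominus> a)"
   using al E subringE(5-7)[OF E(1)] by auto
 qed
 from y have "y\<in>carrier R & alg_over C y"
 proof (induction rule: generate_field.induct)
  case one
  thus ?case using alg_over_self[OF C] subringE(3)[OF C] by auto
 next
  case (m_inv h)
  thus ?case using alg_over_inv[OF C] field_Units by auto
 qed (use S clos in auto)
 thus ?thesis by blast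
qed

section \<open>Homomorphisms from finitely generated monoids\<close>

text \<open>A subgroup of Z^G, with vectors as functions on the whole type that vanish outside
  \<open>G\<close>.\<close>

definition coeff_lattice :: "'g set => ('g => int) set => bool" where
 "coeff_lattice G L \<longleftrightarrow>
   (%_. 0)\<in>L & (\<forall>x\<in>L. \<forall>y\<in>L. (%g. x g + y g)\<in>L) & (\<forall>x\<in>L. (%g. - x g)\<in>L) &
   (\<forall>x\<in>L. \<forall>g. g\<notin>G --> x g = 0)"

lemma coeff_lattice_add:
 "coeff_lattice G L ==> x\<in>L ==> y\<in>L ==> (%g. x g + y g)\<in>L"
 by (simp add: coeff_lattice_def)

lemma coeff_lattice_minus: "coeff_lattice G L ==> x\<in>L ==> (%g. - x g)\<in>L"
 by (simp add: coeff_lattice_def)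

lemma coeff_lattice_smult:
 assumes "coeff_lattice G L" "x\<in>L"
 shows "(%g. k * x g)\<in>L"
proof -
 have nat: "(%g. int n * x g)\<in>L" for n
 proof (induction n)
  case (Suc n)
  have "(%g. int n * x g + x g)\<in>L" using coeff_lattice_add[OF assms(1) Suc assms(2)] .
  thus ?case by (simp add: algebra_simps)
 qed (use assms in \<open>simp add: coeff_lattice_def\<close>)
 show ?thesis
 proof (cases "k \<ge> 0")
  case True
  thus ?thesis using nat[of "nat k"] by simp
 next
  case False
  have "(%g. - (int (nat (- k)) * x g))\<in>L" using coeff_lattice_minus[OF assms(1) nat] .
  thus ?thesis using False by simp
 qed
qed

lemma coeff_lattice_sum:
 assumes "coeff_lattice G L" "finite I" "!!i. i\<in>I ==> x i\<in>L"
 shows "(%g. \<Sum>i\<in>I. x i g)\<in>L"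
 using assms(2,3)
proof (induction I rule: finite_induct)
 case (insert i I)
 hence "(%g. x i g + (\<Sum>i\<in>I. x i g))\<in>L" by (intro coeff_lattice_add[OF assms(1)]) auto
 thus ?case using insert by simp
qed (use assms(1) in \<open>simp add: coeff_lattice_def\<close>)

text \<open>Up to torsion the quotient by the lattice is free on a subset \<open>B\<close> of the coordinates, maximal with
 the property that no non-zero element of the lattice is supported in \<open>B\<close>.\<close>

lemma coeff_lattice_basis:
 assumes fin: "finite G" and L: "coeff_lattice G L"
 obtains B c and e :: nat where "B<=G" "e > 0"
  "!!b b'. b\<in>B ==> b'\<in>B ==> c b b' = (if b = b' then int e else 0)"
  "!!g. g\<in>G ==> (%x. (if x = g then int e else 0) - (if x\<in>B then c x g else 0))\<in>L"
  "!!x b. x\<in>L ==> b\<in>B ==> (\<Sum>g\<in>G. x g * c b g) = 0"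
proof -
 define ok where "ok B \<longleftrightarrow> B<=G & (\<forall>x\<in>L. (\<forall>g. g\<notin>B --> x g = 0) --> (\<forall>g. x g = 0))" for B
 have "ok {}" unfolding ok_def by simp
 moreover have "\<forall>B. ok B --> card B \<le> card G" unfolding ok_def using fin card_mono by blast
 ultimately obtain B where B: "ok B" and max: "!!B'. ok B' ==> card B' \<le> card B"
  using ex_has_greatest_nat[of ok "{}" card "Suc (card G)"] by (metis le_imp_less_Suc)
 have BG: "B<=G" using B unfolding ok_def by simp
 have finB: "finite B" using BG fin finite_subset by blast
 have L0: "(%_. 0)\<in>L" and Lneg: "!!x. x\<in>L ==> (%g. - x g)\<in>L" and Lsup: "!!x g. x\<in>L ==> g\<notin>G ==> x g = 0"
  and Ladd: "!!x y. x\<in>L ==> y\<in>L ==> (%g. x g + y g)\<in>L"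
  using L unfolding coeff_lattice_def by auto
 \<comment> \<open>Adding \<open>j\<close> to the maximal set \<open>B\<close> admits a nonzero
   lattice vector supported on the enlarged set. By the choice of \<open>B\<close> it involves
   \<open>j\<close>, and its sign is free.\<close>
 have "\<exists>x. x\<in>L & x j > 0 & (\<forall>g. g\<notin>insert j B --> x g = 0)" if j: "j\<in>G - B" for j
 proof -
  have "\<not> ok (insert j B)"
  proof
   assume "ok (insert j B)"
   from max[OF this] show False using j finB by simp
  qed
  then obtain x g where x: "x\<in>L" "\<forall>g. g\<notin>insert j B --> x g = 0" "x g ~= 0"
   using j BG unfolding ok_def by auto
  have "x j ~= 0"
  proof
   assume "x j = 0"
   hence "\<forall>g. g\<notin>B --> x g = 0" using x(2) by (metis insertE)
   thus False using B x(1,3) unfolding ok_def by blast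
  qed
  then consider "x j > 0" | "- x j > 0" by linarith
  thus ?thesis
  proof cases
   case 1
   thus ?thesis using x by blast
  next
   case 2
   thus ?thesis using x Lneg[OF x(1)] by (intro exI[of _ "%g. - x g"]) auto
  qed
 qed
 then obtain y where y: "!!j. j\<in>G - B ==> y j\<in>L & y j j > 0 & (\<forall>g. g\<notin>insert j B --> y j g = 0)"
  by metis
 \<comment> \<open>A common denominator for solving all the vectors \<open>y j\<close> for their
   coordinate \<open>j\<close>; it is the empty product 1 if B = G.\<close>
 define e where "e = nat (\<Prod>j\<in>G - B. y j j)"
 have epos: "(\<Prod>j\<in>G - B. y j j) > 0" using y by (intro prod_pos) auto
 hence e: "e > 0" "int e = (\<Prod>j\<in>G - B. y j j)" unfolding e_def by auto
 \<comment> \<open>Column \<open>g\<close> contains \<open>e\<close> times the rational coordinates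
   of \<open>g\<close> with respect to \<open>B\<close> modulo the lattice. Outside \<open>B\<close>
   these come from \<open>y g\<close>, multiplied by the pivots of the other columns.\<close>
 define c where "c b g = (if g\<in>B then (if b = g then int e else 0) else - ((\<Prod>j\<in>G - B - {g}. y j j) * y g b))" for b g
 have c1: "(%x. (if x = g then int e else 0) - (if x\<in>B then c x g else 0))\<in>L" if g: "g\<in>G" for g
 proof (cases "g\<in>B")
  case True
  hence "(%x. (if x = g then int e else 0) - (if x\<in>B then c x g else 0)) = (%_. 0)"
   unfolding c_def by auto
  thus ?thesis using L0 by simp
 next
  case False
  hence gB: "g\<in>G - B" using g by auto
  define k where "k = (\<Prod>j\<in>G - B - {g}. y j j)"
  have ke: "int e = k * y g g"
   unfolding e(2) k_def using prod.remove[OF _ gB, of "%j. y j j"] fin by (simp add: mult.commute)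
  have "(%x. (if x = g then int e else 0) - (if x\<in>B then c x g else 0)) = (%x. k * y g x)"
  proof
   fix x
   show "(if x = g then int e else 0) - (if x\<in>B then c x g else 0) = k * y g x"
    using y[OF gB] False ke unfolding c_def k_def[symmetric] by auto
  qed
  thus ?thesis using coeff_lattice_smult[OF L, of "y g" k] y[OF gB] by simp
 qed
 \<comment> \<open>Subtracting from e x the vectors of \<open>c1\<close> with weights
   \<open>x g\<close> leaves a lattice vector \<open>w\<close> supported in \<open>B\<close>. It
   vanishes by the choice of \<open>B\<close>, and its entry at \<open>b\<close> is the required
   sum.\<close>
 have c2: "(\<Sum>g\<in>G. x g * c b g) = 0" if x: "x\<in>L" and b: "b\<in>B" for x b
 proof -
  define r where "r g z = (if z = g then int e else 0) - (if z\<in>B then c z g else 0)" for g z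
  define w where "w z = int e * x z + (\<Sum>g\<in>G. - x g * r g z)" for z
  have "(%z. \<Sum>g\<in>G. - x g * r g z)\<in>L"
  proof (rule coeff_lattice_sum[OF L fin])
   fix g assume "g\<in>G"
   thus "(%z. - x g * r g z)\<in>L" using coeff_lattice_smult[OF L c1] unfolding r_def by blast
  qed
  hence wL: "w\<in>L" unfolding w_def using coeff_lattice_smult[OF L x] by (intro Ladd) auto
  have weq: "w z = (if z\<in>B then \<Sum>g\<in>G. x g * c z g else 0)" for z
  proof -
   have "(\<Sum>g\<in>G. - x g * r g z) = (\<Sum>g\<in>G. (if z = g then - (x g * int e) else 0) + (if z\<in>B then x g * c z g else 0))"
    unfolding r_def by (intro sum.cong) (auto simp: algebra_simps)
   also have "... = (\<Sum>g\<in>G. (if z = g then - (x g * int e) else 0)) + (if z\<in>B then \<Sum>g\<in>G. x g * c z g else 0)"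
    by (simp add: sum.distrib)
   also have "(\<Sum>g\<in>G. (if z = g then - (x g * int e) else 0)) = - (x z * int e)"
    using fin Lsup[OF x] by (simp add: sum.delta)
   finally show ?thesis unfolding w_def by simp
  qed
  have "\<forall>z. z\<notin>B --> w z = 0" using weq by simp
  hence "w b = 0" using B wL unfolding ok_def by blast
  thus ?thesis using weq b by simp
 qed
 show ?thesis
  by (rule that[of B e c]) (use BG e c1 c2 in \<open>auto simp: c_def\<close>)
qed

definition words :: "'a pmonoid => 'a set => ('a => nat) => 'a" where
 "words M H u = (\<Otimes>\<^bsub>M\<^esub>g\<in>H. g [^]\<^bsub>M\<^esub> u g)"

text \<open>The kernel of the map from Z^H to the group completion of the submonoid generated by
  \<open>H\<close>. Differences build cancellation in: an equality of words that holds only after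
  multiplication by a further word gives the same vector.\<close>

definition rel_lattice :: "'a pmonoid => 'a set => ('a => int) set" where
 "rel_lattice M H =
   {%g. if g\<in>H then int (u g) - int (v g) else 0 | u v. words M H u = words M H v}"

context pmonoid
begin

lemma words_closed: "H<=carrier M ==> words M H u\<in>carrier M"
 unfolding words_def by (intro finprod_closed) auto

lemma words_mult:
 assumes "H<=carrier M"
 shows "words M H (%g. u g + v g) = words M H u\<otimes>words M H v"
proof -
 have "words M H (%g. u g + v g) = (\<Otimes>g\<in>H. g [^] u g\<otimes>g [^] v g)"
  unfolding words_def using assms by (intro finprod_cong') (auto simp: nat_pow_mult)
 thus ?thesis unfolding words_def using assms by (subst (asm) finprod_multf) auto
qed

lemma words_zero: "H<=carrier M ==> words M H (%_. 0) = \<one>"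
 unfolding words_def by (simp add: finprod_one_eqI)

lemma words_single:
 assumes "H<=carrier M" "finite H" "h\<in>H"
 shows "words M H (%g. if g = h then 1 else 0) = h"
proof -
 have "words M H (%g. if g = h then 1 else 0) = (\<Otimes>g\<in>H. if h = g then g else \<one>)"
  unfolding words_def using assms by (intro finprod_cong') auto
 also have "... = h" using finprod_singleton[OF assms(3,2), of "%g. g"] assms(1) by auto
 finally show ?thesis .
qed

lemma coeff_lattice_rel:
 assumes "H<=carrier M"
 shows "coeff_lattice H (rel_lattice M H)"
 unfolding coeff_lattice_def
proof (intro conjI ballI)
 show "(%_. 0)\<in>rel_lattice M H"
  unfolding rel_lattice_def by (intro CollectI exI[of _ "%_. 0"]) auto
 fix x assume "x\<in>rel_lattice M H"
 then obtain u v where x: "x = (%g. if g\<in>H then int (u g) - int (v g) else 0)" "words M H u = words M H v"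
  unfolding rel_lattice_def by blast
 show "(%g. - x g)\<in>rel_lattice M H"
  unfolding rel_lattice_def x(1) using x(2) by (intro CollectI exI[of _ v] exI[of _ u]) auto
 show "\<forall>g. g\<notin>H --> x g = 0" using x by simp
 fix y assume "y\<in>rel_lattice M H"
 then obtain u' v' where y: "y = (%g. if g\<in>H then int (u' g) - int (v' g) else 0)" "words M H u' = words M H v'"
  unfolding rel_lattice_def by blast
 have "words M H (%g. u g + u' g) = words M H (%g. v g + v' g)"
  using x(2) y(2) words_mult[OF assms] by simp
 thus "(%g. x g + y g)\<in>rel_lattice M H"
  unfolding rel_lattice_def x(1) y(1)
  by (intro CollectI exI[of _ "%g. u g + u' g"] exI[of _ "%g. v g + v' g"]) auto
qed

lemma units_of_comm_group: "comm_group (units_of M)"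
 by (rule units_comm_group)

end

text \<open>The group of units of the localisation at \<open>p\<close> is generated by the generators \<open>H\<close> outside \<open>p\<close>; up to
 torsion it is free on \<open>B\<close>, and \<open>c b g / e\<close> is the coordinate of \<open>g\<close> at \<open>b\<close>.\<close>

locale prime_basis = pmonoid M for M :: "'a pmonoid" (structure) +
 fixes G p B :: "'a set" and e :: nat and c :: "'a => 'a => int"
 assumes G: "finite G" "G<=carrier M" "!!S. submonoid S M ==> absorb M\<in>S ==> G<=S ==> S = carrier M"
  and p: "pmonoid_prime p M"
  and B: "B<=G - p" and e: "e > 0"
  and c_basis: "!!b b'. b\<in>B ==> b'\<in>B ==> c b b' = (if b = b' then int e else 0)"
  and c_rel: "!!g. g\<in>G - p ==>
   (%x. (if x = g then int e else 0) - (if x\<in>B then c x g else 0))\<in>rel_lattice M (G - p)"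
  and c_kill: "!!x b. x\<in>rel_lattice M (G - p) ==> b\<in>B ==> (\<Sum>g\<in>G - p. x g * c b g) = 0"
begin

lemma HM: "G - p<=carrier M" "finite (G - p)" using G by auto

lemma p_facts:
 "p<=carrier M" "absorb M\<in>p" "a\<in>p ==> x\<in>carrier M ==> a\<otimes>x\<in>p" "a\<in>p ==> x\<in>carrier M ==> x\<otimes>a\<in>p"
 "a\<in>carrier M ==> b\<in>carrier M ==> a\<notin>p ==> b\<notin>p ==> a\<otimes>b\<notin>p" "\<one>\<notin>p"
proof -
 show sub: "p<=carrier M" "absorb M\<in>p" using p unfolding pmonoid_prime_def pmonoid_ideal_def by auto
 show r: "a\<otimes>x\<in>p" if "a\<in>p" "x\<in>carrier M" for a x
  using p that unfolding pmonoid_prime_def pmonoid_ideal_def by auto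
 show "x\<otimes>a\<in>p" if "a\<in>p" "x\<in>carrier M" for a x
  using r[OF that] m_comm[of a x] that sub by auto
 show "a\<otimes>b\<notin>p" if "a\<in>carrier M" "b\<in>carrier M" "a\<notin>p" "b\<notin>p" for a b
  using p that unfolding pmonoid_prime_def by auto
 show "\<one>\<notin>p"
 proof
  assume one: "\<one>\<in>p"
  have "carrier M<=p"
  proof
   fix x assume "x\<in>carrier M"
   thus "x\<in>p" using r[OF one, of x] by simp
  qed
  thus False using p sub unfolding pmonoid_prime_def by auto
 qed
qed

text \<open>The prime \<open>p\<close> together with all words in the generators outside it is a
  submonoid containing \<open>G\<close>, hence all of \<open>M\<close>.\<close>

lemma outside_is_word:
 assumes "x\<in>carrier M" "x\<notin>p"
 shows "\<exists>u. x = words M (G - p) u"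
proof -
 define S where "S = p\<union>range (words M (G - p))"
 have "submonoid S M"
 proof (rule submonoid.intro)
  show "S<=carrier M" unfolding S_def using p_facts words_closed[OF HM(1)] by auto
  show "\<one>\<in>S" unfolding S_def using words_zero[OF HM(1)] by (metis UnI2 rangeI)
  fix x y assume xy: "x\<in>S" "y\<in>S"
  hence cl: "x\<in>carrier M" "y\<in>carrier M" using \<open>S<=carrier M\<close> by auto
  show "x\<otimes>y\<in>S"
  proof (cases "x\<in>p \<or> y\<in>p")
   case True
   thus ?thesis unfolding S_def using p_facts(3,4) cl by blast
  next
   case False
   then obtain u v where "x = words M (G - p) u" "y = words M (G - p) v" using xy unfolding S_def by auto
   thus ?thesis unfolding S_def using words_mult[OF HM(1), of u v, symmetric] by auto
  qed
 qed
 moreover have "G<=S"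
 proof
  fix g assume "g\<in>G"
  thus "g\<in>S" unfolding S_def using words_single[OF HM, of g] by (metis DiffI UnI1 UnI2 rangeI)
 qed
 ultimately have "S = carrier M" using G(3) p_facts(2) unfolding S_def by auto
 thus ?thesis using assms unfolding S_def by auto
qed

text \<open>Passing to \<open>units_of N\<close>, which is a group, prepares for the negative
  exponents of lattice vectors.\<close>

lemma unit_word:
 assumes N: "pmonoid N" and \<chi>: "\<chi>\<in>pmonoid_hom M N" and un: "!!g. g\<in>F ==> \<chi> g\<in>Units N"
  and F: "finite F" "F<=carrier M"
 shows "\<chi> (words M F u) = (\<Otimes>\<^bsub>units_of N\<^esub>g\<in>F. \<chi> g [^]\<^bsub>units_of N\<^esub> u g)"
proof -
 interpret N: pmonoid N by fact
 interpret U: comm_group "units_of N" by (rule N.units_of_comm_group)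
 have hom: "\<chi> (a\<otimes>b) = \<chi> a\<otimes>\<^bsub>N\<^esub> \<chi> b" if "a\<in>carrier M" "b\<in>carrier M" for a b
  using \<chi> that unfolding pmonoid_hom_def hom_def by auto
 have one: "\<chi> \<one> = \<one>\<^bsub>N\<^esub>" using \<chi> unfolding pmonoid_hom_def by auto
 have pow: "\<chi> (g [^] n) = \<chi> g [^]\<^bsub>units_of N\<^esub> n" if "g\<in>carrier M" for g and n :: nat
  by (induction n) (use that one hom in \<open>auto simp: units_of_one units_of_mult\<close>)
 show ?thesis
  using F un unfolding words_def
 proof (induction F rule: finite_induct)
  case empty
  thus ?case using one by (simp add: units_of_one)
 next
  case (insert g F)
  have cl: "(\<Otimes>g\<in>F. g [^] u g)\<in>carrier M" "g\<in>carrier M"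
   using insert.prems by (auto intro!: finprod_closed)
  have "(\<Otimes>g\<in>insert g F. g [^] u g) = g [^] u g\<otimes>(\<Otimes>g\<in>F. g [^] u g)"
   using insert by (intro finprod_insert) auto
  moreover have "(\<Otimes>\<^bsub>units_of N\<^esub>h\<in>insert g F. \<chi> h [^]\<^bsub>units_of N\<^esub> u h)
    = \<chi> g [^]\<^bsub>units_of N\<^esub> u g\<otimes>\<^bsub>units_of N\<^esub> (\<Otimes>\<^bsub>units_of N\<^esub>h\<in>F. \<chi> h [^]\<^bsub>units_of N\<^esub> u h)"
   using insert by (intro U.finprod_insert) (auto simp: units_of_carrier intro!: U.nat_pow_closed[unfolded units_of_carrier])
  ultimately show ?case
   using insert hom[of "g [^] u g"] cl pow[OF cl(2)] by (simp add: units_of_mult)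
 qed
qed

end

lemma (in comm_group) finprod_int_pow_add:
 assumes "finite F" "a ` F<=carrier G"
 shows "(\<Otimes>g\<in>F. a g [^] (x g + y g :: int)) = (\<Otimes>g\<in>F. a g [^] x g)\<otimes>(\<Otimes>g\<in>F. a g [^] y g)"
proof -
 have cl: "a g\<in>carrier G" if "g\<in>F" for g using assms that by auto
 have "(\<Otimes>g\<in>F. a g [^] (x g + y g)) = (\<Otimes>g\<in>F. a g [^] x g\<otimes>a g [^] y g)"
  using cl by (intro finprod_cong') (auto simp: int_pow_mult)
 also have "... = (\<Otimes>g\<in>F. a g [^] x g)\<otimes>(\<Otimes>g\<in>F. a g [^] y g)"
  using cl by (intro finprod_multf) auto
 finally show ?thesis .
qed

context prime_basis
begin

text \<open>For a relation u - v, the values at \<open>u\<close> and at \<open>v\<close> agree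
  because the words do, and in the group of units the common value cancels.\<close>

lemma hom_rel:
 assumes N: "pmonoid N" and \<chi>: "\<chi>\<in>pmonoid_hom M N" "!!g. g\<in>G - p ==> \<chi> g\<in>Units N"
  and x: "x\<in>rel_lattice M (G - p)"
 shows "(\<Otimes>\<^bsub>units_of N\<^esub>g\<in>G - p. \<chi> g [^]\<^bsub>units_of N\<^esub> x g) = \<one>\<^bsub>units_of N\<^esub>"
proof -
 interpret N: pmonoid N by fact
 interpret U: comm_group "units_of N" by (rule N.units_of_comm_group)
 have cl: "\<chi> g\<in>carrier (units_of N)" if "g\<in>G - p" for g using \<chi>(2)[OF that] by (simp add: units_of_carrier)
 obtain u v where x: "x = (%g. if g\<in>G - p then int (u g) - int (v g) else 0)" "words M (G - p) u = words M (G - p) v"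
  using x unfolding rel_lattice_def by blast
 define E where "E y = (\<Otimes>\<^bsub>units_of N\<^esub>g\<in>G - p. \<chi> g [^]\<^bsub>units_of N\<^esub> (y g :: int))" for y
 have EE: "E (%g. y g + z g) = E y\<otimes>\<^bsub>units_of N\<^esub> E z" for y z
  unfolding E_def using cl HM(2) by (intro U.finprod_int_pow_add) auto
 have Ecl: "E y\<in>carrier (units_of N)" for y
  unfolding E_def using cl by (intro U.finprod_closed) auto
 have E_eq: "E y = E z" if "!!g. g\<in>G - p ==> y g = z g" for y z
  unfolding E_def using cl that by (intro U.finprod_cong') auto
 have nat: "E (%g. int (w g)) = \<chi> (words M (G - p) w)" for w
  unfolding E_def using unit_word[OF N \<chi> HM(2,1), of w] by (simp add: int_pow_int)
 have "E x\<otimes>\<^bsub>units_of N\<^esub> E (%g. int (v g)) = E (%g. int (u g))"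
  unfolding EE[symmetric] by (rule E_eq) (simp add: x(1))
 also have "... = E (%g. int (v g))" using nat x(2) by simp
 finally have "E x = \<one>\<^bsub>units_of N\<^esub>"
  using Ecl U.r_cancel_one by blast
 thus ?thesis unfolding E_def .
qed

text \<open>By \<open>c_rel\<close>, \<open>e\<close> times \<open>g\<close> minus its coordinates
  is a relation and is therefore sent to 1. Hence values on \<open>B\<close> determine the values
  outside \<open>p\<close> up to e-th roots of unity.\<close>

lemma hom_torsion_basis:
 assumes N: "pmonoid N" and \<chi>: "\<chi>\<in>pmonoid_hom M N" "!!g. g\<in>G - p ==> \<chi> g\<in>Units N"
  and g: "g\<in>G - p"
 shows "\<chi> g [^]\<^bsub>units_of N\<^esub> e = (\<Otimes>\<^bsub>units_of N\<^esub>b\<in>B. \<chi> b [^]\<^bsub>units_of N\<^esub> c b g)"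
proof -
 interpret N: pmonoid N by fact
 interpret U: comm_group "units_of N" by (rule N.units_of_comm_group)
 have cl: "\<chi> h\<in>carrier (units_of N)" if "h\<in>G - p" for h using \<chi>(2)[OF that] by (simp add: units_of_carrier)
 define E where "E y = (\<Otimes>\<^bsub>units_of N\<^esub>h\<in>G - p. \<chi> h [^]\<^bsub>units_of N\<^esub> (y h :: int))" for y
 have EE: "E (%h. y h + z h) = E y\<otimes>\<^bsub>units_of N\<^esub> E z" for y z
  unfolding E_def using cl HM(2) by (intro U.finprod_int_pow_add) auto
 define r where "r x = (if x = g then int e else 0) - (if x\<in>B then c x g else 0)" for x
 define y where "y x = (if x\<in>B then c x g else 0)" for x
 have Er: "E r = \<one>\<^bsub>units_of N\<^esub>" unfolding E_def r_def using hom_rel[OF N \<chi> c_rel[OF g]] by simp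
 have Ecl: "E z\<in>carrier (units_of N)" for z
  unfolding E_def using cl by (intro U.finprod_closed) auto
 have "E (%x. r x + y x) = E y" using EE Er Ecl by simp
 moreover have "E (%x. r x + y x) = \<chi> g [^]\<^bsub>units_of N\<^esub> e"
 proof -
  have "E (%x. r x + y x) = (\<Otimes>\<^bsub>units_of N\<^esub>h\<in>G - p. if g = h then \<chi> h [^]\<^bsub>units_of N\<^esub> e else \<one>\<^bsub>units_of N\<^esub>)"
   unfolding E_def r_def y_def using cl by (intro U.finprod_cong') (auto simp: int_pow_int)
  also have "... = \<chi> g [^]\<^bsub>units_of N\<^esub> e"
   using U.finprod_singleton[OF g HM(2), of "%h. \<chi> h [^]\<^bsub>units_of N\<^esub> e"] cl by auto
  finally show ?thesis .
 qed
 moreover have "E y = (\<Otimes>\<^bsub>units_of N\<^esub>b\<in>B. \<chi> b [^]\<^bsub>units_of N\<^esub> c b g)"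
 proof -
  have "E y = (\<Otimes>\<^bsub>units_of N\<^esub>h\<in>G - p. if h\<in>B then \<chi> h [^]\<^bsub>units_of N\<^esub> c h g else \<one>\<^bsub>units_of N\<^esub>)"
   unfolding E_def y_def using cl by (intro U.finprod_cong') auto
  also have "... = (\<Otimes>\<^bsub>units_of N\<^esub>h\<in>B. if h\<in>B then \<chi> h [^]\<^bsub>units_of N\<^esub> c h g else \<one>\<^bsub>units_of N\<^esub>)"
   using cl B HM(2) by (intro U.finprod_mono_neutral_cong_right) auto
  also have "... = (\<Otimes>\<^bsub>units_of N\<^esub>b\<in>B. \<chi> b [^]\<^bsub>units_of N\<^esub> c b g)"
   using cl B by (intro U.finprod_cong') auto
  finally show ?thesis .
 qed
 ultimately show ?thesis by simp
qed

text \<open>The exponents \<open>c b g\<close> are integral only after multiplication by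
  \<open>e\<close>, so on \<open>B\<close> the extension takes the e-th powers of the prescribed
  values. The prime \<open>p\<close> goes to the absorbing element.\<close>

lemma hom_extend_basis:
 assumes N: "pmonoid N" and v: "!!b. b\<in>B ==> v b\<in>Units N"
 shows "\<exists>\<chi>\<in>pmonoid_hom M N\<inter>extensional (carrier M).
  (\<forall>x\<in>p. \<chi> x = absorb N) & (\<forall>b\<in>B. \<chi> b = v b [^]\<^bsub>units_of N\<^esub> e) & (\<forall>x\<in>carrier M - p. \<chi> x\<in>Units N)"
proof -
 interpret N: pmonoid N by fact
 interpret U: comm_group "units_of N" by (rule N.units_of_comm_group)
 have cl: "v b\<in>carrier (units_of N)" if "b\<in>B" for b using v[OF that] by (simp add: units_of_carrier)
 have finB: "finite B" using B HM(2) finite_subset by blast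
 define s where "s u b = (\<Sum>g\<in>G - p. int (u g) * c b g)" for u b
 define E where "E u = (\<Otimes>\<^bsub>units_of N\<^esub>b\<in>B. v b [^]\<^bsub>units_of N\<^esub> s u b)" for u
 have Ecl: "E u\<in>Units N" for u
  unfolding E_def units_of_carrier[symmetric] using cl by (intro U.finprod_closed) auto
 have Eadd: "E (%g. u g + w g) = E u\<otimes>\<^bsub>N\<^esub> E w" for u w
 proof -
  have "s (%g. u g + w g) b = s u b + s w b" for b unfolding s_def by (simp add: algebra_simps sum.distrib)
  hence "E (%g. u g + w g) = (\<Otimes>\<^bsub>units_of N\<^esub>b\<in>B. v b [^]\<^bsub>units_of N\<^esub> (s u b + s w b))"
   unfolding E_def by simp
  also have "... = E u\<otimes>\<^bsub>units_of N\<^esub> E w" unfolding E_def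
   using cl finB by (intro U.finprod_int_pow_add) auto
  finally show ?thesis by (simp add: units_of_mult)
 qed
 \<comment> \<open>Two words for the same element differ by a lattice vector, whose exponent sums
   vanish by \<open>c_kill\<close>.\<close>
 have Ewd: "E u = E w" if "words M (G - p) u = words M (G - p) w" for u w
 proof -
  have "(%g. if g\<in>G - p then int (u g) - int (w g) else 0)\<in>rel_lattice M (G - p)"
   unfolding rel_lattice_def using that by blast
  from c_kill[OF this]
  have "(\<Sum>g\<in>G - p. (if g\<in>G - p then int (u g) - int (w g) else 0) * c b g) = 0" if "b\<in>B" for b
   using that .
  moreover have "(\<Sum>g\<in>G - p. (if g\<in>G - p then int (u g) - int (w g) else 0) * c b g)
    = (\<Sum>g\<in>G - p. (int (u g) - int (w g)) * c b g)" for b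
   by (intro sum.cong) auto
  ultimately have "(\<Sum>g\<in>G - p. (int (u g) - int (w g)) * c b g) = 0" if "b\<in>B" for b
   using that by simp
  hence "s u b = s w b" if "b\<in>B" for b
   using that unfolding s_def by (simp add: left_diff_distrib sum_subtractf)
  thus ?thesis unfolding E_def using cl by (intro U.finprod_cong') auto
 qed
 define rep where "rep x = (SOME u. x = words M (G - p) u)" for x
 have rep: "x = words M (G - p) (rep x)" if "x\<in>carrier M" "x\<notin>p" for x
  unfolding rep_def using someI_ex[OF outside_is_word[OF that]] .
 have word: "words M (G - p) u\<in>carrier M" for u using words_closed[OF HM(1)] .
 define \<chi> where "\<chi> = (\<lambda>x\<in>carrier M. if x\<in>p then absorb N else E (rep x))"
 have \<chi>p: "\<chi> x = absorb N" if "x\<in>p" for x unfolding \<chi>_def using that p_facts(1) by auto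
 have \<chi>E: "\<chi> (words M (G - p) u) = E u" if "words M (G - p) u\<notin>p" for u
  using Ewd[of "rep (words M (G - p) u)" u] rep[OF word that] word that unfolding \<chi>_def by simp
 have \<chi>U: "\<chi> x\<in>Units N" if "x\<in>carrier M - p" for x unfolding \<chi>_def using that Ecl by auto
 have Nab: "absorb N\<otimes>\<^bsub>N\<^esub> y = absorb N" "y\<otimes>\<^bsub>N\<^esub> absorb N = absorb N" if "y\<in>carrier N" for y
  using N.absorb_mult[OF that] N.m_comm[OF that N.absorb_closed] by auto
 have \<chi>cl: "\<chi> x\<in>carrier N" if "x\<in>carrier M" for x
  using \<chi>U[of x] \<chi>p[of x] that N.absorb_closed by (cases "x\<in>p") auto
 have "\<chi>\<in>hom M N"
 proof (rule homI)
  fix x y assume xy: "x\<in>carrier M" "y\<in>carrier M"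
  show "\<chi> (x\<otimes>y) = \<chi> x\<otimes>\<^bsub>N\<^esub> \<chi> y"
  proof (cases "x\<in>p \<or> y\<in>p")
   case True
   hence "x\<otimes>y\<in>p" using p_facts(3,4) xy by blast
   thus ?thesis using True \<chi>p Nab \<chi>cl xy by auto
  next
   case False
   hence np: "x\<otimes>y\<notin>p" using p_facts(5) xy by blast
   obtain u w where uw: "x = words M (G - p) u" "y = words M (G - p) w"
    using rep xy False by blast
   have "x\<otimes>y = words M (G - p) (%g. u g + w g)" using uw words_mult[OF HM(1)] by simp
   thus ?thesis using \<chi>E[of "%g. u g + w g"] \<chi>E[of u] \<chi>E[of w] uw False np Eadd by simp
  qed
 qed (use \<chi>cl in auto)
 moreover have "\<chi> \<one> = \<one>\<^bsub>N\<^esub>"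
 proof -
  have "\<chi> \<one> = E (%_. 0)" using \<chi>E[of "%_. 0"] words_zero[OF HM(1)] p_facts(6) by simp
  also have "... = \<one>\<^bsub>N\<^esub>" unfolding E_def s_def by (simp add: U.finprod_one_eqI units_of_one)
  finally show ?thesis .
 qed
 moreover have "\<chi> (absorb M) = absorb N" using \<chi>p p_facts(2) by blast
 moreover have "\<chi> b = v b [^]\<^bsub>units_of N\<^esub> e" if b: "b\<in>B" for b
 proof -
  have bG: "b\<in>G - p" using b B by auto
  have "\<chi> b = E (%g. if g = b then 1 else 0)"
   using \<chi>E[of "%g. if g = b then 1 else 0"] words_single[OF HM bG] bG by simp
  also have "... = (\<Otimes>\<^bsub>units_of N\<^esub>b'\<in>B. if b = b' then v b' [^]\<^bsub>units_of N\<^esub> e else \<one>\<^bsub>units_of N\<^esub>)"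
  proof -
   have "s (%g. if g = b then 1 else 0) b' = (if b = b' then int e else 0)" if "b'\<in>B" for b'
   proof -
    have "s (%g. if g = b then 1 else 0) b' = (\<Sum>g\<in>G - p. if g = b then c b' g else 0)"
     unfolding s_def by (intro sum.cong) auto
    also have "... = c b' b" using bG HM(2) by (simp add: sum.delta)
    finally show ?thesis using c_basis[OF that b] by auto
   qed
   thus ?thesis unfolding E_def using cl by (intro U.finprod_cong') (auto simp: int_pow_int)
  qed
  also have "... = v b [^]\<^bsub>units_of N\<^esub> e"
   using U.finprod_singleton[OF b finB, of "%h. v h [^]\<^bsub>units_of N\<^esub> e"] cl by auto
  finally show ?thesis .
 qed
 moreover have "\<chi>\<in>extensional (carrier M)" unfolding \<chi>_def by auto
 ultimately show ?thesis using \<chi>p \<chi>U unfolding pmonoid_hom_def by (intro bexI[of _ \<chi>]) auto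
qed

end

lemma prime_basis_exists:
 assumes M: "pmonoid M" and G: "finite G" "G<=carrier M" "\<forall>S. submonoid S M & absorb M\<in>S & G<=S --> S = carrier M"
  and p: "pmonoid_prime p M"
 shows "\<exists>B e c. prime_basis M G p B e c"
proof -
 interpret pmonoid M by fact
 have H: "finite (G - p)" "G - p<=carrier M" using G by auto
 show ?thesis
 proof (rule coeff_lattice_basis[OF H(1) coeff_lattice_rel[OF H(2)]])
  fix B c and e :: nat
  assume "B<=G - p" "e > 0"
   "!!b b'. b\<in>B ==> b'\<in>B ==> c b b' = (if b = b' then int e else 0)"
   "!!g. g\<in>G - p ==> (%x. (if x = g then int e else 0) - (if x\<in>B then c x g else 0))\<in>rel_lattice M (G - p)"
   "!!x b. x\<in>rel_lattice M (G - p) ==> b\<in>B ==> (\<Sum>g\<in>G - p. x g * c b g) = 0"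
  hence "prime_basis M G p B e c"
   unfolding prime_basis_def prime_basis_axioms_def using G p pmonoid_axioms by blast
  thus "\<exists>B e c. prime_basis M G p B e c" by blast
 qed
qed

section \<open>Monoids consisting of zero and units, and the homomorphisms into them\<close>

abbreviation pm_homs :: "'a pmonoid => 'b pmonoid => ('a => 'b) set" where
 "pm_homs M N \<equiv> pmonoid_hom M N\<inter>extensional (carrier M)"

definition pm_ker :: "'a pmonoid => 'b pmonoid => ('a => 'b) => 'a set" where
 "pm_ker M N \<chi> = {x\<in>carrier M. \<chi> x = absorb N}"

text \<open>An intrinsic description of the monoids F_1[H], with H the group of units. It covers
  both the cyclic monoids to be counted and the multiplicative monoids of fields.\<close>

definition pm_field :: "'a pmonoid => bool" where
 "pm_field N \<longleftrightarrow> pmonoid N & carrier N = insert (absorb N) (Units N) & absorb N\<notin>Units N"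

lemma pm_field_iso_units:
 assumes "pm_field N"
 shows "comm_group (units_of N)" "pmonoid_iso N (group_pmonoid (units_of N))"
proof -
 interpret pmonoid N using assms unfolding pm_field_def by blast
 show "comm_group (units_of N)" by (rule units_of_comm_group)
 define f where "f x = (if x = absorb N then None else Some x)" for x
 have car: "carrier N = insert (absorb N) (Units N)" and na: "absorb N\<notin>Units N"
  using assms unfolding pm_field_def by auto
 have un: "x\<in>Units N" if "x\<in>carrier N" "x ~= absorb N" for x using that car by auto
 have "f\<in>hom N (group_pmonoid (units_of N))"
 proof (rule homI)
  show "f x\<in>carrier (group_pmonoid (units_of N))" if "x\<in>carrier N" for x
   using un[OF that] unfolding f_def group_pmonoid_def by (auto simp: units_of_carrier)
  fix x y assume xy: "x\<in>carrier N" "y\<in>carrier N"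
  show "f (x\<otimes>\<^bsub>N\<^esub> y) = f x\<otimes>\<^bsub>group_pmonoid (units_of N)\<^esub> f y"
  proof (cases "x = absorb N \<or> y = absorb N")
   case True
   hence "x\<otimes>\<^bsub>N\<^esub> y = absorb N" using absorb_mult xy m_comm absorb_closed by metis
   thus ?thesis using True unfolding f_def group_pmonoid_def by (auto split: option.split)
  next
   case False
   hence "x\<otimes>\<^bsub>N\<^esub> y\<in>Units N" using un xy by auto
   hence "x\<otimes>\<^bsub>N\<^esub> y ~= absorb N" using na by auto
   thus ?thesis using False unfolding f_def group_pmonoid_def by (simp add: units_of_mult)
  qed
 qed
 moreover have "f \<one>\<^bsub>N\<^esub> = \<one>\<^bsub>group_pmonoid (units_of N)\<^esub>"
 proof -
  have "\<one>\<^bsub>N\<^esub> ~= absorb N" using na Units_one_closed by metis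
  thus ?thesis unfolding f_def group_pmonoid_def by (simp add: units_of_one)
 qed
 moreover have "f (absorb N) = absorb (group_pmonoid (units_of N))" unfolding f_def group_pmonoid_def by simp
 moreover have "bij_betw f (carrier N) (carrier (group_pmonoid (units_of N)))"
 proof (rule bij_betw_imageI)
  show "inj_on f (carrier N)" unfolding inj_on_def f_def by auto
  show "f ` carrier N = carrier (group_pmonoid (units_of N))"
   unfolding group_pmonoid_def using car na by (auto simp: f_def units_of_carrier image_iff)
 qed
 ultimately show "pmonoid_iso N (group_pmonoid (units_of N))"
  unfolding pmonoid_iso_def pmonoid_hom_def by blast
qed

lemma pm_ker_prime:
 assumes M: "pmonoid M" and N: "pm_field N" and \<chi>: "\<chi>\<in>pmonoid_hom M N"
 shows "pmonoid_prime (pm_ker M N \<chi>) M" "!!x. x\<in>carrier M - pm_ker M N \<chi> ==> \<chi> x\<in>Units N"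
proof -
 interpret M: pmonoid M by fact
 interpret N: pmonoid N using N unfolding pm_field_def by blast
 have car: "carrier N = insert (absorb N) (Units N)" and na: "absorb N\<notin>Units N"
  using N unfolding pm_field_def by auto
 have hom: "\<chi> (a\<otimes>\<^bsub>M\<^esub> b) = \<chi> a\<otimes>\<^bsub>N\<^esub> \<chi> b" if "a\<in>carrier M" "b\<in>carrier M" for a b
  using \<chi> that unfolding pmonoid_hom_def hom_def by auto
 have cl: "\<chi> a\<in>carrier N" if "a\<in>carrier M" for a
  using \<chi> that unfolding pmonoid_hom_def hom_def by auto
 have one: "\<chi> \<one>\<^bsub>M\<^esub> = \<one>\<^bsub>N\<^esub>" "\<chi> (absorb M) = absorb N" using \<chi> unfolding pmonoid_hom_def by auto
 show un: "\<chi> x\<in>Units N" if "x\<in>carrier M - pm_ker M N \<chi>" for x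
  using cl[of x] that car unfolding pm_ker_def by auto
 show "pmonoid_prime (pm_ker M N \<chi>) M"
  unfolding pmonoid_prime_def pmonoid_ideal_def
 proof (intro conjI ballI)
  show "pm_ker M N \<chi><=carrier M" "absorb M\<in>pm_ker M N \<chi>"
   unfolding pm_ker_def using one M.absorb_closed by auto
  show "a\<otimes>\<^bsub>M\<^esub> x\<in>pm_ker M N \<chi>" if "a\<in>pm_ker M N \<chi>" "x\<in>carrier M" for a x
   using that hom[of a x] N.absorb_mult[OF cl, of x] unfolding pm_ker_def by auto
  have "\<one>\<^bsub>N\<^esub> ~= absorb N" using na N.Units_one_closed by metis
  hence "\<one>\<^bsub>M\<^esub>\<notin>pm_ker M N \<chi>" unfolding pm_ker_def using one by simp
  thus "pm_ker M N \<chi> ~= carrier M" using M.one_closed by auto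
  show "a\<otimes>\<^bsub>M\<^esub> b\<notin>pm_ker M N \<chi>" if "a\<in>carrier M - pm_ker M N \<chi>" "b\<in>carrier M - pm_ker M N \<chi>" for a b
  proof -
   have "\<chi> (a\<otimes>\<^bsub>M\<^esub> b)\<in>Units N"
    using un[OF that(1)] un[OF that(2)] hom[of a b] that N.Units_m_closed by simp
   thus ?thesis using na unfolding pm_ker_def by auto
  qed
 qed
qed

lemma pm_hom_eqI:
 assumes M: "pmonoid M" and N: "pmonoid N" and G: "G<=carrier M" "\<forall>S. submonoid S M & absorb M\<in>S & G<=S --> S = carrier M"
  and \<chi>: "\<chi>\<in>pm_homs M N" "\<chi>'\<in>pm_homs M N" and eq: "!!g. g\<in>G ==> \<chi> g = \<chi>' g"
 shows "\<chi> = \<chi>'"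
proof -
 interpret M: pmonoid M by fact
 define S where "S = {x\<in>carrier M. \<chi> x = \<chi>' x}"
 have "submonoid S M"
  unfolding S_def using \<chi> by (intro submonoid.intro) (auto simp: pmonoid_hom_def hom_def)
 moreover have "absorb M\<in>S" "G<=S"
  unfolding S_def using \<chi> eq G M.absorb_closed by (auto simp: pmonoid_hom_def)
 ultimately have "S = carrier M" using G by blast
 hence "\<chi> x = \<chi>' x" if "x\<in>carrier M" for x using that unfolding S_def by blast
 thus ?thesis using \<chi> by (intro extensionalityI[of _ "carrier M"]) auto
qed

lemma finite_pm_homs:
 assumes M: "pmonoid M" "pmonoid_fin_gen M" and N: "pmonoid N" "finite (carrier N)"
 shows "finite (pm_homs M N)"
proof -
 obtain G where G: "G<=carrier M" "finite G" "\<forall>S. submonoid S M & absorb M\<in>S & G<=S --> S = carrier M"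
  using M(2) unfolding pmonoid_fin_gen_def by blast
 have "inj_on (\<lambda>\<chi>. restrict \<chi> G) (pm_homs M N)"
 proof (rule inj_onI)
  fix \<chi> \<chi>' assume a: "\<chi>\<in>pm_homs M N" "\<chi>'\<in>pm_homs M N" "restrict \<chi> G = restrict \<chi>' G"
  hence "\<chi> g = \<chi>' g" if "g\<in>G" for g using that by (metis restrict_apply')
  thus "\<chi> = \<chi>'" using pm_hom_eqI[OF M(1) N(1) G(1,3) a(1,2)] by blast
 qed
 moreover have "(\<lambda>\<chi>. restrict \<chi> G) ` pm_homs M N<=G \<rightarrow>\<^sub>E carrier N"
  using G(1) by (auto simp: pmonoid_hom_def hom_def)
 moreover have "finite (G \<rightarrow>\<^sub>E carrier N)" using G(2) N(2) by (intro finite_PiE) auto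
 ultimately show ?thesis by (meson finite_imageD finite_subset)
qed

text \<open>A copy of F_1[C_m] inside an arbitrary infinite type, in which \<open>el\<close> injects
  the integers and \<open>z\<close> is the absorbing element: the functor takes values only on
  monoids over its own type.\<close>

definition cyc_pmonoid :: "(int => 'a) => 'a => nat => 'a pmonoid" where
 "cyc_pmonoid el z m =
   \<lparr>carrier = insert z (el ` {0..<int m}),
   mult = (%x y. if x = z \<or> y = z then z else el ((inv_into UNIV el x + inv_into UNIV el y) mod int m)),
   one = el 0, absorb = z\<rparr>"

locale cyc =
 fixes el :: "int => 'a" and z :: 'a and m :: nat
 assumes el: "inj el" "z\<notin>range el" and m: "m \<ge> 1"
begin

abbreviation "N \<equiv> cyc_pmonoid el z m"

lemma ops: "carrier N = insert z (el ` {0..<int m})" "\<one>\<^bsub>N\<^esub> = el 0" "absorb N = z"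
 "el a\<otimes>\<^bsub>N\<^esub> el b = el ((a + b) mod int m)" "z\<otimes>\<^bsub>N\<^esub> x = z" "x\<otimes>\<^bsub>N\<^esub> z = z"
proof -
 have "el a ~= z" for a using el(2) by auto
 thus "el a\<otimes>\<^bsub>N\<^esub> el b = el ((a + b) mod int m)" unfolding cyc_pmonoid_def using el(1) by simp
qed (auto simp: cyc_pmonoid_def)

lemma pm: "pmonoid N"
proof (unfold_locales, goal_cases)
 case (1 x y)
 thus ?case using m by (auto simp: ops)
next
 case (2 x y w)
 thus ?case by (auto simp: ops mod_simps add.assoc)
next
 case 3
 thus ?case using m by (auto simp: ops)
next
 case (4 x)
 thus ?case by (auto simp: ops)
next
 case (5 x)
 thus ?case by (auto simp: ops)
next
 case (6 x y)
 thus ?case by (auto simp: ops add.commute)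
next
 case 7
 thus ?case by (simp add: ops)
next
 case (8 x)
 thus ?case by (simp add: ops)
qed

lemma units: "Units N = el ` {0..<int m}"
proof -
 have "el k\<in>Units N" if k: "k\<in>{0..<int m}" for k
 proof -
  define l where "l = (- k) mod int m"
  have "l\<in>{0..<int m}" unfolding l_def using m by auto
  moreover have "el l\<otimes>\<^bsub>N\<^esub> el k = \<one>\<^bsub>N\<^esub>" "el k\<otimes>\<^bsub>N\<^esub> el l = \<one>\<^bsub>N\<^esub>"
   unfolding l_def ops by (simp_all add: mod_simps)
  ultimately have "\<exists>x\<in>carrier N. x\<otimes>\<^bsub>N\<^esub> el k = \<one>\<^bsub>N\<^esub> & el k\<otimes>\<^bsub>N\<^esub> x = \<one>\<^bsub>N\<^esub>"
   by (intro bexI[of _ "el l"]) (auto simp: ops(1))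
  thus ?thesis unfolding Units_def using k by (simp add: ops(1))
 qed
 moreover have "z\<notin>Units N"
  unfolding Units_def using el(2) by (auto simp: ops)
 moreover have "Units N<=insert z (el ` {0..<int m})" unfolding Units_def ops(1) by blast
 ultimately show ?thesis by blast
qed

lemma field: "pm_field N"
 unfolding pm_field_def units using pm el by (auto simp: ops)

lemma finite_carrier: "finite (carrier N)" by (simp add: ops)

lemma iso: "pmonoid_iso N (group_pmonoid (integer_mod_group m))"
proof -
 define f where "f x = (if x = z then None else Some (inv_into UNIV el x))" for x
 have f: "f z = None" "f (el k) = Some k" for k
  unfolding f_def using el by auto
 have C: "carrier (integer_mod_group m) = {0..<int m}" "a\<otimes>\<^bsub>integer_mod_group m\<^esub> b = (a + b) mod int m"
  "\<one>\<^bsub>integer_mod_group m\<^esub> = 0" for a b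
  using m unfolding integer_mod_group_def by auto
 have "f\<in>hom N (group_pmonoid (integer_mod_group m))"
 proof (rule homI)
  show "f x\<in>carrier (group_pmonoid (integer_mod_group m))" if "x\<in>carrier N" for x
   using that unfolding group_pmonoid_def by (auto simp: ops C f)
  show "f (x\<otimes>\<^bsub>N\<^esub> y) = f x\<otimes>\<^bsub>group_pmonoid (integer_mod_group m)\<^esub> f y"
   if "x\<in>carrier N" "y\<in>carrier N" for x y
   using that unfolding group_pmonoid_def by (auto simp: ops C f)
 qed
 moreover have "bij_betw f (carrier N) (carrier (group_pmonoid (integer_mod_group m)))"
 proof (rule bij_betw_imageI)
  show "inj_on f (carrier N)" unfolding inj_on_def by (auto simp: ops f)
  show "f ` carrier N = carrier (group_pmonoid (integer_mod_group m))"
   unfolding group_pmonoid_def by (auto simp: ops f C image_image)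
 qed
 ultimately show ?thesis
  unfolding pmonoid_iso_def pmonoid_hom_def group_pmonoid_def by (auto simp: ops f C)
qed

lemma el_pow: "k\<in>{0..<int m} ==> el k [^]\<^bsub>units_of N\<^esub> (n::nat) = el ((k * int n) mod int m)"
proof (induction n)
 case 0
 thus ?case by (simp add: units_of_one ops)
next
 case (Suc n)
 thus ?case
  by (simp add: units_of_mult ops mod_simps) (simp add: algebra_simps)
qed

end

locale prime_basis_cyc = prime_basis M G p B e c + cyc el z m
 for M :: "'a pmonoid" (structure) and G p B :: "'a set" and e :: nat and c :: "'a => 'a => int"
  and el :: "int => 'a" and z :: 'a and m :: nat
begin

lemma finB: "finite B" using B HM(2) finite_subset by blast

lemma fin_gen: "pmonoid_fin_gen M"
 unfolding pmonoid_fin_gen_def using G by blast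

text \<open>Exponents below \<open>m div e\<close> remain below \<open>m\<close> after
  multiplication by \<open>e\<close>. So the e-th powers taken by \<open>hom_extend_basis\<close> do
  not wrap around, and different choices on \<open>B\<close> give different homomorphisms.\<close>

lemma count_lower: "(m div e) ^ card B \<le> card (pm_homs M N)"
proof -
 have "\<exists>\<chi>. \<chi>\<in>pm_homs M N & (\<forall>b\<in>B. \<chi> b = el (int (e * k b)))" if k: "k\<in>B \<rightarrow>\<^sub>E {0..<m div e}" for k
 proof -
  have lt: "e * k b < m" if "b\<in>B" for b
  proof -
   have "k b + 1 \<le> m div e" using k that by (auto simp: PiE_iff)
   hence "e * (k b + 1) \<le> e * (m div e)" by (rule mult_le_mono2)
   also have "... \<le> m" by simp
   finally show ?thesis using e by simp
  qed
  have lt': "k b < m" if "b\<in>B" for b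
   using lt[OF that] e by (metis One_nat_def Suc_leI le_less_trans mult_le_mono1 nat_mult_1)
  have "el (int (k b))\<in>Units N" if "b\<in>B" for b unfolding units using lt'[OF that] by auto
  from hom_extend_basis[OF pm, of "%b. el (int (k b))", OF this] obtain \<chi> where \<chi>: "\<chi>\<in>pm_homs M N"
   "!!b. b\<in>B ==> \<chi> b = el (int (k b)) [^]\<^bsub>units_of N\<^esub> e" by blast
  have "\<chi> b = el (int (e * k b))" if "b\<in>B" for b
   using \<chi>(2)[OF that] el_pow[of "int (k b)" e] lt[OF that] lt'[OF that]
   by (simp add: mult.commute flip: of_nat_mult)
  thus ?thesis using \<chi>(1) by blast
 qed
 then obtain F where F: "!!k. k\<in>B \<rightarrow>\<^sub>E {0..<m div e} ==> F k\<in>pm_homs M N & (\<forall>b\<in>B. F k b = el (int (e * k b)))"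
  by metis
 have "inj_on F (B \<rightarrow>\<^sub>E {0..<m div e})"
 proof (rule inj_onI)
  fix k l assume kl: "k\<in>B \<rightarrow>\<^sub>E {0..<m div e}" "l\<in>B \<rightarrow>\<^sub>E {0..<m div e}" "F k = F l"
  have "k b = l b" if "b\<in>B" for b
  proof -
   have "el (int (e * k b)) = el (int (e * l b))" using F[OF kl(1)] F[OF kl(2)] kl(3) that by auto
   thus ?thesis using el(1) e by (simp add: inj_eq)
  qed
  thus "k = l" using kl(1,2) by (intro PiE_ext)
 qed
 moreover have "F ` (B \<rightarrow>\<^sub>E {0..<m div e})<=pm_homs M N" using F by auto
 moreover have "finite (pm_homs M N)" using finite_pm_homs[OF pmonoid_axioms fin_gen pm finite_carrier] .
 ultimately have "card (B \<rightarrow>\<^sub>E {0..<m div e}) \<le> card (pm_homs M N)" by (intro card_inj_on_le)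
 thus ?thesis using finB by (simp add: card_PiE)
qed

text \<open>Write the value at a generator as \<open>el k\<close>. The exponents on \<open>B\<close>
  determine k e modulo \<open>m\<close> for every generator outside \<open>p\<close>; the quotient
  of k e by \<open>m\<close>, which has at most \<open>e\<close> possible values, then determines k.
  Generators in \<open>p\<close> go to zero.\<close>

lemma count_upper: "card {\<chi>\<in>pm_homs M N. pm_ker M N \<chi> = p} \<le> e ^ card (G - p) * m ^ card B"
proof -
 define A where "A = {\<chi>\<in>pm_homs M N. pm_ker M N \<chi> = p}"
 define k where "k \<chi> g = inv_into UNIV el (\<chi> g)" for \<chi> :: "'a => 'a" and g
 have k: "\<chi> g = el (k \<chi> g)" "k \<chi> g\<in>{0..<int m}" if "\<chi>\<in>A" "g\<in>G - p" for \<chi> g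
 proof -
  have "\<chi> g\<in>Units N"
   using that pm_ker_prime(2)[OF pmonoid_axioms field, of \<chi> g] HM(1) unfolding A_def by auto
  thus "\<chi> g = el (k \<chi> g)" "k \<chi> g\<in>{0..<int m}" unfolding units k_def using el(1) by auto
 qed
 define F where "F \<chi> = (\<lambda>b\<in>B. k \<chi> b, \<lambda>g\<in>G - p. (k \<chi> g * int e) div int m)" for \<chi>
 have "inj_on F A"
 proof (rule inj_onI)
  fix \<chi> \<chi>' assume a: "\<chi>\<in>A" "\<chi>'\<in>A" "F \<chi> = F \<chi>'"
  have kb: "k \<chi> b = k \<chi>' b" if "b\<in>B" for b
   using fun_cong[OF arg_cong[OF a(3), of fst], of b] that unfolding F_def by simp
  have kd: "(k \<chi> g * int e) div int m = (k \<chi>' g * int e) div int m" if "g\<in>G - p" for g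
   using fun_cong[OF arg_cong[OF a(3), of snd], of g] that unfolding F_def by auto
  have \<chi>b: "\<chi> b = \<chi>' b" if "b\<in>B" for b using kb[OF that] k(1)[OF a(1)] k(1)[OF a(2)] that B by auto
  have hm: "\<chi>\<in>pmonoid_hom M N" "\<chi>'\<in>pmonoid_hom M N" "\<chi>\<in>pm_homs M N" "\<chi>'\<in>pm_homs M N" using a unfolding A_def by auto
  have un: "\<chi> g\<in>Units N" "\<chi>' g\<in>Units N" if "g\<in>G - p" for g using k[OF a(1) that] k[OF a(2) that] units by auto
  interpret U: comm_group "units_of N" using pmonoid.units_of_comm_group[OF pm] .
  have "\<chi> g = \<chi>' g" if g: "g\<in>G" for g
  proof (cases "g\<in>p")
   case True
   hence "g\<in>pm_ker M N \<chi>" "g\<in>pm_ker M N \<chi>'" using a unfolding A_def by auto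
   thus ?thesis unfolding pm_ker_def by simp
  next
   case False
   hence gp: "g\<in>G - p" using g by auto
   have cl: "\<chi> b\<in>carrier (units_of N)" if "b\<in>B" for b
    using un(1)[of b] that B by (auto simp: units_of_carrier)
   have "\<chi> g [^]\<^bsub>units_of N\<^esub> e = (\<Otimes>\<^bsub>units_of N\<^esub>b\<in>B. \<chi> b [^]\<^bsub>units_of N\<^esub> c b g)"
    using hom_torsion_basis[OF pm hm(1) un(1) gp] .
   also have "... = (\<Otimes>\<^bsub>units_of N\<^esub>b\<in>B. \<chi>' b [^]\<^bsub>units_of N\<^esub> c b g)"
    using \<chi>b cl by (intro U.finprod_cong') auto
   also have "... = \<chi>' g [^]\<^bsub>units_of N\<^esub> e"
    using hom_torsion_basis[OF pm hm(2) un(2) gp] by simp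
   finally have "el ((k \<chi> g * int e) mod int m) = el ((k \<chi>' g * int e) mod int m)"
    using el_pow k[OF a(1) gp] k[OF a(2) gp] by metis
   hence "(k \<chi> g * int e) mod int m = (k \<chi>' g * int e) mod int m" using el(1) by (simp add: inj_eq)
   hence "k \<chi> g * int e = k \<chi>' g * int e" using kd[OF gp] by (metis mult_div_mod_eq)
   thus ?thesis using e k(1)[OF a(1) gp] k(1)[OF a(2) gp] by simp
  qed
  thus "\<chi> = \<chi>'" using pm_hom_eqI[OF pmonoid_axioms pm G(2) _ hm(3,4)] G(3) by blast
 qed
 moreover have "F ` A<=(B \<rightarrow>\<^sub>E {0..<int m}) \<times> (G - p \<rightarrow>\<^sub>E {0..<int e})"
 proof
  fix y assume "y\<in>F ` A"
  then obtain \<chi> where \<chi>: "\<chi>\<in>A" "y = F \<chi>" by auto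
  have "(k \<chi> g * int e) div int m\<in>{0..<int e}" if "g\<in>G - p" for g
  proof -
   have kk: "0 \<le> k \<chi> g" "k \<chi> g < int m" using k(2)[OF \<chi>(1) that] by auto
   hence "k \<chi> g * int e < int e * int m" using e by (simp add: mult.commute)
   moreover have "int m * ((k \<chi> g * int e) div int m) \<le> k \<chi> g * int e"
    using m by (simp add: minus_mod_eq_mult_div[symmetric])
   ultimately have "int m * ((k \<chi> g * int e) div int m) < int m * int e" by (simp add: mult.commute)
   hence "(k \<chi> g * int e) div int m < int e" using m by (simp add: mult_less_cancel_left_pos)
   moreover have "(k \<chi> g * int e) div int m \<ge> 0" using kk m by (simp add: pos_imp_zdiv_nonneg_iff)
   ultimately show ?thesis by simp
  qed
  thus "y\<in>(B \<rightarrow>\<^sub>E {0..<int m}) \<times> (G - p \<rightarrow>\<^sub>E {0..<int e})"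
   unfolding \<chi>(2) F_def using k(2)[OF \<chi>(1)] B by auto
 qed
 moreover have "finite ((B \<rightarrow>\<^sub>E {0..<int m}) \<times> (G - p \<rightarrow>\<^sub>E {0..<int e}))"
  using finB HM(2) by (intro finite_cartesian_product finite_PiE) auto
 ultimately have "card A \<le> card ((B \<rightarrow>\<^sub>E {0..<int m}) \<times> (G - p \<rightarrow>\<^sub>E {0..<int e}))"
  by (rule card_inj_on_le)
 also have "... = e ^ card (G - p) * m ^ card B"
  using finB HM(2) by (simp add: card_cartesian_product card_PiE mult.commute)
 finally show ?thesis unfolding A_def .
qed

end

lemma (in prime_basis) words_notin: "words M (G - p) u\<notin>p"
proof -
 have "(\<Otimes>g\<in>F. g [^] u g)\<in>carrier M & (\<Otimes>g\<in>F. g [^] u g)\<notin>p" if "finite F" "F<=G - p" for F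
  using that
 proof (induction F rule: finite_induct)
  case empty
  thus ?case using p_facts(6) by simp
 next
  case (insert g F)
  have g: "g\<in>carrier M" "g\<notin>p" using insert.prems HM(1) by auto
  have "g [^] n\<notin>p" for n :: nat
   by (induction n) (use g p_facts(5,6) in auto)
  moreover have "(\<Otimes>h\<in>insert g F. h [^] u h) = g [^] u g\<otimes>(\<Otimes>h\<in>F. h [^] u h)"
   using insert HM(1) by (intro finprod_insert) auto
  ultimately show ?case using insert g p_facts(5) by simp
 qed
 thus ?thesis unfolding words_def using HM(2) by blast
qed

text \<open>A prime is determined by the generators it does not contain, since its complement
  consists of the words in these.\<close>

lemma finite_pm_primes:
 assumes M: "pmonoid M" "pmonoid_fin_gen M"
 shows "finite {p. pmonoid_prime p M}"
proof -
 obtain G where G: "G<=carrier M" "finite G" "\<forall>S. submonoid S M & absorb M\<in>S & G<=S --> S = carrier M"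
  using M(2) unfolding pmonoid_fin_gen_def by blast
 have "inj_on (%p. G - p) {p. pmonoid_prime p M}"
 proof (rule inj_onI)
  have sub: "q<=p" if pq: "pmonoid_prime p M" "pmonoid_prime q M" "G - p = G - q" for p q
  proof
   fix x assume x: "x\<in>q"
   obtain B e c where pb: "prime_basis M G p B e c" using prime_basis_exists[OF M(1) G(2,1,3) pq(1)] by blast
   obtain B' e' c' where qb: "prime_basis M G q B' e' c'" using prime_basis_exists[OF M(1) G(2,1,3) pq(2)] by blast
   have xM: "x\<in>carrier M" using x prime_basis.p_facts(1)[OF qb] by auto
   show "x\<in>p"
   proof (rule ccontr)
    assume "x\<notin>p"
    then obtain u where "x = words M (G - p) u" using prime_basis.outside_is_word[OF pb xM] by blast
    hence "x\<notin>q" using prime_basis.words_notin[OF qb, of u] pq(3) by simp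
    thus False using x by simp
   qed
  qed
  fix p q assume "p\<in>{p. pmonoid_prime p M}" "q\<in>{p. pmonoid_prime p M}" "G - p = G - q"
  thus "p = q" using sub[of p q] sub[of q p] by auto
 qed
 moreover have "(%p. G - p) ` {p. pmonoid_prime p M}<=Pow G" by auto
 ultimately show ?thesis using G(2) by (meson finite_Pow_iff finite_imageD finite_subset)
qed

section \<open>Comparison of growth exponents\<close>

lemma exponent_le_of_sum_bound:
 fixes C r :: "'i => nat"
 assumes fin: "finite I" and bound: "!!m::nat. m \<ge> 1 ==> m ^ d \<le> (\<Sum>i\<in>I. C i * m ^ r i)"
 shows "\<exists>i\<in>I. d \<le> r i"
proof (rule ccontr)
 assume "\<not> ?thesis"
 hence lt: "!!i. i\<in>I ==> r i < d" by auto
 \<comment> \<open>Larger than the sum of all constants, so that one additional power of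
   \<open>m\<close> outweighs them.\<close>
 define m where "m = (\<Sum>i\<in>I. C i) + 1"
 show False
 proof (cases d)
  case 0
  hence "I = {}" using lt by auto
  thus False using bound[of 1] by simp
 next
  case (Suc d')
  have "m ^ d \<le> (\<Sum>i\<in>I. C i * m ^ r i)" using bound[of m] unfolding m_def by simp
  also have "... \<le> (\<Sum>i\<in>I. C i * m ^ d')"
  proof (intro sum_mono mult_le_mono2 power_increasing)
   show "r i \<le> d'" if "i\<in>I" for i using lt[OF that] Suc by simp
  qed (simp add: m_def)
  also have "... = (m - 1) * m ^ d'" unfolding m_def by (simp add: sum_distrib_right)
  finally have "m * m ^ d' \<le> (m - 1) * m ^ d'" using Suc by simp
  moreover have "m ^ d' > 0" "m > 0" unfolding m_def by auto
  ultimately show False by (simp add: m_def)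
 qed
qed

lemma exponent_le_of_div_bound:
 fixes K e d r :: nat
 assumes e: "e > 0" and bound: "!!m::nat. m \<ge> 1 ==> (m div e) ^ r \<le> K * m ^ d"
 shows "r \<le> d"
proof (rule ccontr)
 assume "\<not> r \<le> d"
 \<comment> \<open>The bound is applied at \<open>e * k\<close>, where the division by
   \<open>e\<close> is exact; \<open>k\<close> exceeds the constant that this multiple
   produces.\<close>
 define k where "k = K * e ^ d + 1"
 have "k ^ Suc d \<le> k ^ r" using \<open>\<not> r \<le> d\<close> by (intro power_increasing) (auto simp: k_def)
 also have "... \<le> K * (e * k) ^ d" using bound[of "e * k"] e unfolding k_def by simp
 also have "... = (K * e ^ d) * k ^ d" by (simp add: power_mult_distrib)
 also have "... = (k - 1) * k ^ d" unfolding k_def by simp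
 finally have "k * k ^ d \<le> (k - 1) * k ^ d" by simp
 moreover have "k ^ d > 0" "k > 0" unfolding k_def by auto
 ultimately show False by (simp add: k_def)
qed

section \<open>Affine charts and points with values in fields\<close>

locale loc_monoid = comm_monoid M for M :: "('a, 'm) monoid_scheme" (structure) +
 fixes S :: "'a set"
 assumes S: "S<=carrier M" "\<one>\<in>S" "!!a b. a\<in>S ==> b\<in>S ==> a\<otimes>b\<in>S"
begin

lemma SM: "s\<in>S ==> s\<in>carrier M" using S by auto

lemma loc_frac_refl: "a\<in>carrier M ==> s\<in>S ==> (a, s)\<in>loc_frac M S a s"
 unfolding loc_frac_def using S(2) by auto

lemma loc_fracD:
 assumes "(b, t)\<in>loc_frac M S a s"
 shows "b\<in>carrier M" "t\<in>S" "\<exists>u\<in>S. u\<otimes>(a\<otimes>t) = u\<otimes>(b\<otimes>s)"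
 using assms unfolding loc_frac_def by auto

lemma loc_frac_subset:
 assumes "a\<in>carrier M" "s\<in>S" "b\<in>carrier M" "t\<in>S" "u\<in>S" "u\<otimes>(a\<otimes>t) = u\<otimes>(b\<otimes>s)"
 shows "loc_frac M S b t<=loc_frac M S a s"
proof
 fix y assume "y\<in>loc_frac M S b t"
 then obtain d w v where y: "y = (d, w)" "d\<in>carrier M" "w\<in>S" "v\<in>S" "v\<otimes>(b\<otimes>w) = v\<otimes>(d\<otimes>t)"
  unfolding loc_frac_def by auto
 have cl: "s\<in>carrier M" "t\<in>carrier M" "u\<in>carrier M" "v\<in>carrier M" "w\<in>carrier M"
  using assms y SM by auto
 have "(u\<otimes>(v\<otimes>t))\<otimes>(a\<otimes>w) = (v\<otimes>w)\<otimes>(u\<otimes>(a\<otimes>t))" using assms(1) cl by (simp add: m_ac)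
 also have "... = (v\<otimes>(b\<otimes>w))\<otimes>(u\<otimes>s)" unfolding assms(6) using assms(3) cl by (simp add: m_ac)
 also have "... = (u\<otimes>(v\<otimes>t))\<otimes>(d\<otimes>s)" unfolding y(5) using cl y(2) by (simp add: m_ac)
 finally have "\<exists>u\<in>S. u\<otimes>(a\<otimes>w) = u\<otimes>(d\<otimes>s)"
  by (rule bexI[OF _ S(3)[OF assms(5) S(3)[OF y(4) assms(4)]]])
 thus "y\<in>loc_frac M S a s"
  unfolding loc_frac_def y(1) using y(2,3) by simp
qed

lemma loc_frac_eq_iff:
 assumes "a\<in>carrier M" "s\<in>S" "b\<in>carrier M" "t\<in>S"
 shows "loc_frac M S a s = loc_frac M S b t \<longleftrightarrow> (\<exists>u\<in>S. u\<otimes>(a\<otimes>t) = u\<otimes>(b\<otimes>s))"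
proof
 assume "loc_frac M S a s = loc_frac M S b t"
 hence "(b, t)\<in>loc_frac M S a s" using loc_frac_refl[OF assms(3,4)] by simp
 thus "\<exists>u\<in>S. u\<otimes>(a\<otimes>t) = u\<otimes>(b\<otimes>s)" by (rule loc_fracD)
next
 assume "\<exists>u\<in>S. u\<otimes>(a\<otimes>t) = u\<otimes>(b\<otimes>s)"
 then obtain u where u: "u\<in>S" "u\<otimes>(a\<otimes>t) = u\<otimes>(b\<otimes>s)" by blast
 show "loc_frac M S a s = loc_frac M S b t"
  using loc_frac_subset[OF assms u] loc_frac_subset[OF assms(3,4,1,2) u(1) u(2)[symmetric]] by blast
qed

text \<open>The product is defined as a union over all pairs of representatives. Every pair yields
  the same class, and the index sets are nonempty, so the union is that class.\<close>

lemma loc_mult_frac: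
 assumes "a\<in>carrier M" "s\<in>S" "b\<in>carrier M" "t\<in>S"
 shows "loc_mult M S (loc_frac M S a s) (loc_frac M S b t) = loc_frac M S (a\<otimes>b) (s\<otimes>t)"
proof -
 have "loc_frac M S (a'\<otimes>b') (s'\<otimes>t') = loc_frac M S (a\<otimes>b) (s\<otimes>t)"
  if *: "(a', s')\<in>loc_frac M S a s" "(b', t')\<in>loc_frac M S b t" for a' s' b' t'
 proof -
  obtain u v where u: "u\<in>S" "u\<otimes>(a\<otimes>s') = u\<otimes>(a'\<otimes>s)" and v: "v\<in>S" "v\<otimes>(b\<otimes>t') = v\<otimes>(b'\<otimes>t)"
   using loc_fracD(3)[OF *(1)] loc_fracD(3)[OF *(2)] by blast
  have m: "a'\<in>carrier M" "s'\<in>S" "b'\<in>carrier M" "t'\<in>S" using loc_fracD * by blast+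
  hence cl: "s\<in>carrier M" "t\<in>carrier M" "s'\<in>carrier M" "t'\<in>carrier M" "u\<in>carrier M" "v\<in>carrier M"
   using assms u v SM by auto
  have "(u\<otimes>v)\<otimes>((a'\<otimes>b')\<otimes>(s\<otimes>t)) = (u\<otimes>(a'\<otimes>s))\<otimes>(v\<otimes>(b'\<otimes>t))" using cl m by (simp add: m_ac)
  also have "... = (u\<otimes>(a\<otimes>s'))\<otimes>(v\<otimes>(b\<otimes>t'))" using u v by simp
  also have "... = (u\<otimes>v)\<otimes>((a\<otimes>b)\<otimes>(s'\<otimes>t'))" using cl m assms by (simp add: m_ac)
  finally have "\<exists>w\<in>S. w\<otimes>((a'\<otimes>b')\<otimes>(s\<otimes>t)) = w\<otimes>((a\<otimes>b)\<otimes>(s'\<otimes>t'))"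
   using S(3)[OF u(1) v(1)] by (rule bexI)
  thus ?thesis
   using loc_frac_eq_iff[OF m_closed[OF m(1,3)] S(3)[OF m(2,4)] m_closed[OF assms(1,3)] S(3)[OF assms(2,4)]]
   by simp
 qed
 thus ?thesis
  unfolding loc_mult_def
  by (intro UN_constant_eq[OF loc_frac_refl[OF assms(1,2)]] ballI)
   (auto intro!: UN_constant_eq[OF loc_frac_refl[OF assms(3,4)]])
qed

end

locale loc_ring = cring R for R :: "'a ring" (structure) +
 fixes S :: "'a set"
 assumes S: "S<=carrier R" "\<one>\<in>S" "!!a b. a\<in>S ==> b\<in>S ==> a\<otimes>b\<in>S"

sublocale loc_ring \<subseteq> loc_monoid R S
 using S by unfold_locales auto

lemma (in loc_ring) loc_add_frac:
 assumes "a\<in>carrier R" "s\<in>S" "b\<in>carrier R" "t\<in>S"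
 shows "loc_add R S (loc_frac R S a s) (loc_frac R S b t) = loc_frac R S (a\<otimes>t\<oplus>b\<otimes>s) (s\<otimes>t)"
proof -
 have "loc_frac R S (a'\<otimes>t'\<oplus>b'\<otimes>s') (s'\<otimes>t') = loc_frac R S (a\<otimes>t\<oplus>b\<otimes>s) (s\<otimes>t)"
  if *: "(a', s')\<in>loc_frac R S a s" "(b', t')\<in>loc_frac R S b t" for a' s' b' t'
 proof -
  obtain u v where u: "u\<in>S" "u\<otimes>(a\<otimes>s') = u\<otimes>(a'\<otimes>s)" and v: "v\<in>S" "v\<otimes>(b\<otimes>t') = v\<otimes>(b'\<otimes>t)"
   using loc_fracD(3)[OF *(1)] loc_fracD(3)[OF *(2)] by blast
  have m: "a'\<in>carrier R" "s'\<in>S" "b'\<in>carrier R" "t'\<in>S" using loc_fracD * by blast+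
  hence cl: "s\<in>carrier R" "t\<in>carrier R" "s'\<in>carrier R" "t'\<in>carrier R" "u\<in>carrier R" "v\<in>carrier R"
   using assms u v SM by auto
  have "(u\<otimes>v)\<otimes>((a'\<otimes>t'\<oplus>b'\<otimes>s')\<otimes>(s\<otimes>t))
    = (u\<otimes>(a'\<otimes>s))\<otimes>(v\<otimes>(t\<otimes>t'))\<oplus>(v\<otimes>(b'\<otimes>t))\<otimes>(u\<otimes>(s\<otimes>s'))"
   using cl m by (simp add: l_distr r_distr m_ac)
  also have "... = (u\<otimes>(a\<otimes>s'))\<otimes>(v\<otimes>(t\<otimes>t'))\<oplus>(v\<otimes>(b\<otimes>t'))\<otimes>(u\<otimes>(s\<otimes>s'))"
   using u v by simp
  also have "... = (u\<otimes>v)\<otimes>((a\<otimes>t\<oplus>b\<otimes>s)\<otimes>(s'\<otimes>t'))"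
   using cl m assms by (simp add: l_distr r_distr m_ac)
  finally have "\<exists>w\<in>S. w\<otimes>((a'\<otimes>t'\<oplus>b'\<otimes>s')\<otimes>(s\<otimes>t)) = w\<otimes>((a\<otimes>t\<oplus>b\<otimes>s)\<otimes>(s'\<otimes>t'))"
   using S(3)[OF u(1) v(1)] by (rule bexI)
  moreover have "a'\<otimes>t'\<oplus>b'\<otimes>s'\<in>carrier R" "a\<otimes>t\<oplus>b\<otimes>s\<in>carrier R"
   using m assms cl by simp_all
  ultimately show ?thesis
   using loc_frac_eq_iff[OF _ S(3)[OF m(2,4)] _ S(3)[OF assms(2,4)]] by simp
 qed
 thus ?thesis
  unfolding loc_add_def
  by (intro UN_constant_eq[OF loc_frac_refl[OF assms(1,2)]] ballI)
   (auto intro!: UN_constant_eq[OF loc_frac_refl[OF assms(3,4)]])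
qed

lemma loc_ring_prime:
 assumes "cring R" "primeideal p R"
 shows "loc_ring R (carrier R - p)"
proof -
 interpret cring R by fact
 interpret primeideal p R by fact
 show ?thesis
 proof (unfold_locales, goal_cases)
  case 2
  show ?case using one_imp_carrier I_notcarr by auto
 next
  case (3 a b)
  thus ?case using I_prime by auto
 qed auto
qed

section \<open>Sections, germs and affine charts\<close>

lemma Spec_simps:
 "carrier (sec (Spec R) U) = loc_sections R (pts (Spec R)) U"
 "\<sigma>\<otimes>\<^bsub>sec (Spec R) U\<^esub> \<tau> = (\<lambda>p\<in>U. loc_mult R (carrier R - p) (\<sigma> p) (\<tau> p))"
 "\<one>\<^bsub>sec (Spec R) U\<^esub> = (\<lambda>p\<in>U. loc_frac R (carrier R - p) \<one>\<^bsub>R\<^esub> \<one>\<^bsub>R\<^esub>)"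
 "\<zero>\<^bsub>sec (Spec R) U\<^esub> = (\<lambda>p\<in>U. loc_frac R (carrier R - p) \<zero>\<^bsub>R\<^esub> \<one>\<^bsub>R\<^esub>)"
 "\<sigma>\<oplus>\<^bsub>sec (Spec R) U\<^esub> \<tau> = (\<lambda>p\<in>U. loc_add R (carrier R - p) (\<sigma> p) (\<tau> p))"
 "res (Spec R) U V \<sigma> = restrict \<sigma> V"
 unfolding Spec_def Let_def by simp_all

lemma topspace_Spec: "cring R ==> topspace (pts (Spec R)) = {p. primeideal p R}"
proof -
 assume R: "cring R"
 interpret cring R by fact
 have "U<={p. primeideal p R}" if "openin (pts (Spec R)) U" for U
  using that unfolding openin_Spec[OF R] by auto
 moreover have "openin (pts (Spec R)) {p. primeideal p R}"
  unfolding openin_Spec[OF R]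
 proof (intro exI[of _ "carrier R"] conjI)
  have "\<not> carrier R<=p" if "primeideal p R" for p
  proof -
   interpret primeideal p R by fact
   show ?thesis using I_notcarr a_subset by auto
  qed
  thus "{p. primeideal p R} = {p. primeideal p R & \<not> carrier R<=p}" by auto
 qed simp
 ultimately show ?thesis by (simp add: topspace_def) blast
qed

lemma openin_Spec_basic:
 "cring R ==> s\<in>carrier R ==> openin (pts (Spec R)) {p. primeideal p R & s\<notin>p}"
 unfolding openin_Spec by (intro exI[of _ "{s}"]) auto

lemma loc_sections_const:
 assumes "openin T V" "a\<in>carrier R" "s\<in>carrier R" "!!q. q\<in>V ==> s\<notin>q"
 shows "(\<lambda>q\<in>V. loc_frac R (carrier R - q) a s)\<in>loc_sections R T V"
 unfolding loc_sections_def using assms by auto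

lemma loc_sectionsE:
 assumes "\<sigma>\<in>loc_sections R T U" "p\<in>U"
 obtains W a s where "openin T W" "p\<in>W" "W<=U" "a\<in>carrier R" "s\<in>carrier R" "!!q. q\<in>W ==> s\<notin>q"
  "!!q. q\<in>W ==> \<sigma> q = loc_frac R (carrier R - q) a s"
proof -
 have "\<exists>W a s. openin T W & p\<in>W & W<=U & a\<in>carrier R & s\<in>carrier R &
   (\<forall>q\<in>W. s\<notin>q & \<sigma> q = loc_frac R (carrier R - q) a s)"
  using assms unfolding loc_sections_def by simp
 then obtain W a s where "openin T W & p\<in>W & W<=U & a\<in>carrier R & s\<in>carrier R &
   (\<forall>q\<in>W. s\<notin>q & \<sigma> q = loc_frac R (carrier R - q) a s)"
  by (elim exE)
 thus ?thesis using that[of W a s] by simp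
qed

lemma loc_sections_restrict:
 assumes "openin T V" "V<=U" "\<sigma>\<in>loc_sections R T U"
 shows "restrict \<sigma> V\<in>loc_sections R T V"
 unfolding loc_sections_def
proof (intro CollectI conjI ballI)
 fix p assume "p\<in>V"
 hence "p\<in>U" using assms(2) by blast
 then obtain W a s where W: "openin T W" "p\<in>W" "a\<in>carrier R" "s\<in>carrier R" "!!q. q\<in>W ==> s\<notin>q"
  "!!q. q\<in>W ==> \<sigma> q = loc_frac R (carrier R - q) a s"
  using loc_sectionsE[OF assms(3)] by metis
 show "\<exists>W a s. openin T W & p\<in>W & W<=V & a\<in>carrier R & s\<in>carrier R &
   (\<forall>q\<in>W. s\<notin>q & restrict \<sigma> V q = loc_frac R (carrier R - q) a s)"
  using W assms(1) \<open>p\<in>V\<close> by (intro exI[of _ "W\<inter>V"] exI[of _ a] exI[of _ s]) auto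
qed auto

text \<open>Replaces the invertibility of a germ in the stalk by an inverse section on some
  neighbourhood, so that sets of germs occur only in the comparison lemmas below.\<close>

definition unit_near :: "('x, 's, 'm) sheafed_space => 'x => 'x set => 's => bool" where
 "unit_near X x U s \<longleftrightarrow>
   (\<exists>W t. openin (pts X) W & x\<in>W & W<=U & t\<in>carrier (sec X W) &
    res X U W s\<otimes>\<^bsub>sec X W\<^esub> t = \<one>\<^bsub>sec X W\<^esub>)"

text \<open>The multiplicative part of the presheaf axioms. It suffices for comparing unit germs
  with \<open>unit_near\<close>, and for \<open>Spec R\<close> it can be verified without any
  gluing.\<close>

definition presheaf :: "('x, 's, 'm) sheafed_space => bool" where
 "presheaf X \<longleftrightarrow>
   (\<forall>U V. openin (pts X) U & openin (pts X) V & V<=U -->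
    (\<forall>s\<in>carrier (sec X U). res X U V s\<in>carrier (sec X V)) &
    (\<forall>s\<in>carrier (sec X U). \<forall>t\<in>carrier (sec X U).
      res X U V (s\<otimes>\<^bsub>sec X U\<^esub> t) = res X U V s\<otimes>\<^bsub>sec X V\<^esub> res X U V t) &
    res X U V \<one>\<^bsub>sec X U\<^esub> = \<one>\<^bsub>sec X V\<^esub>) &
   (\<forall>U. openin (pts X) U --> comm_monoid (sec X U) & (\<forall>s\<in>carrier (sec X U). res X U U s = s)) &
   (\<forall>U V W. openin (pts X) U & openin (pts X) V & openin (pts X) W & W<=V & V<=U -->
    (\<forall>s\<in>carrier (sec X U). res X V W (res X U V s) = res X U W s))"

context
 fixes X :: "('x, 's, 'm) sheafed_space"
 assumes X: "presheaf X"
begin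

lemma presheaf_closed: "openin (pts X) U ==> openin (pts X) V ==> V<=U ==> s\<in>carrier (sec X U) ==>
  res X U V s\<in>carrier (sec X V)"
 and presheaf_mult: "openin (pts X) U ==> openin (pts X) V ==> V<=U ==> s\<in>carrier (sec X U) ==> t\<in>carrier (sec X U) ==>
  res X U V (s\<otimes>\<^bsub>sec X U\<^esub> t) = res X U V s\<otimes>\<^bsub>sec X V\<^esub> res X U V t"
 and presheaf_one: "openin (pts X) U ==> openin (pts X) V ==> V<=U ==> res X U V \<one>\<^bsub>sec X U\<^esub> = \<one>\<^bsub>sec X V\<^esub>"
 and presheaf_monoid: "openin (pts X) U ==> comm_monoid (sec X U)"
 and presheaf_id: "openin (pts X) U ==> s\<in>carrier (sec X U) ==> res X U U s = s"
 and presheaf_comp: "openin (pts X) U ==> openin (pts X) V ==> openin (pts X) W ==> W<=V ==> V<=U ==>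
  s\<in>carrier (sec X U) ==> res X V W (res X U V s) = res X U W s"
 using X unfolding presheaf_def by auto

lemma germ_self: "openin (pts X) U ==> x\<in>U ==> s\<in>carrier (sec X U) ==> (U, s)\<in>germ X x U s"
 unfolding germ_def by auto

lemma germ_eqI:
 assumes U: "openin (pts X) U" "x\<in>U" "s\<in>carrier (sec X U)" and V: "openin (pts X) V" "x\<in>V" "t\<in>carrier (sec X V)"
  and W: "openin (pts X) W" "x\<in>W" "W<=U\<inter>V" "res X U W s = res X V W t"
 shows "germ X x U s = germ X x V t"
proof -
 have "germ X x U s<=germ X x V t"
  if U: "openin (pts X) U" "x\<in>U" "s\<in>carrier (sec X U)" and V: "openin (pts X) V" "x\<in>V" "t\<in>carrier (sec X V)"
  and W: "openin (pts X) W" "x\<in>W" "W<=U\<inter>V" "res X U W s = res X V W t" for U V s t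
 proof
  fix y assume "y\<in>germ X x U s"
  then obtain V' r W' where y: "y = (V', r)" "openin (pts X) V'" "x\<in>V'" "r\<in>carrier (sec X V')"
   "openin (pts X) W'" "x\<in>W'" "W'<=U\<inter>V'" "res X U W' s = res X V' W' r"
   unfolding germ_def by auto
  have o: "openin (pts X) (W\<inter>W')" using W y by auto
  have "res X V (W\<inter>W') t = res X W (W\<inter>W') (res X V W t)"
   using V W o by (intro presheaf_comp[symmetric]) auto
  also have "... = res X W (W\<inter>W') (res X U W s)" using W by simp
  also have "... = res X U (W\<inter>W') s" using U W o by (intro presheaf_comp) auto
  also have "... = res X W' (W\<inter>W') (res X U W' s)" using U y o by (intro presheaf_comp[symmetric]) auto
  also have "... = res X W' (W\<inter>W') (res X V' W' r)" using y by simp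
  also have "... = res X V' (W\<inter>W') r" using y o by (intro presheaf_comp) auto
  finally show "y\<in>germ X x V t"
   unfolding germ_def using y W o by (auto intro!: exI[of _ "W\<inter>W'"])
 qed
 from this[OF U V W] this[OF V U W(1,2)] W(3,4) show ?thesis by auto
qed

text \<open>The unit of the stalk contains the global section 1. As the product of germs is a union
  over representatives, 1 belongs to the germ of one particular product, and restricting everything
  to a common neighbourhood gives an inverse there.\<close>

lemma Units_stalk_imp_unit_near:
 assumes U: "openin (pts X) U" "x\<in>U" "s\<in>carrier (sec X U)" and unit: "germ X x U s\<in>Units (stalk X x)"
 shows "unit_near X x U s"
proof -
 obtain Bg where Bg: "Bg\<in>carrier (stalk X x)" "germ X x U s\<otimes>\<^bsub>stalk X x\<^esub> Bg = \<one>\<^bsub>stalk X x\<^esub>"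
  using unit unfolding Units_def by blast
 obtain V t where V: "openin (pts X) V" "x\<in>V" "t\<in>carrier (sec X V)" "Bg = germ X x V t"
  using Bg(1) unfolding stalk_def by auto
 define T where "T = topspace (pts X)"
 have T: "openin (pts X) T" "x\<in>T" "\<one>\<^bsub>sec X T\<^esub>\<in>carrier (sec X T)"
  unfolding T_def using U openin_subset comm_monoid.axioms(1)[OF presheaf_monoid[of "topspace (pts X)"]] monoid.one_closed by auto
 have "(T, \<one>\<^bsub>sec X T\<^esub>)\<in>\<one>\<^bsub>stalk X x\<^esub>"
  unfolding stalk_def T_def[symmetric] using germ_self[OF T] by simp
 hence "(T, \<one>\<^bsub>sec X T\<^esub>)\<in>germ X x U s\<otimes>\<^bsub>stalk X x\<^esub> germ X x V t"
  using Bg V by simp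
 then obtain U' s' V' t' where *: "(U', s')\<in>germ X x U s" "(V', t')\<in>germ X x V t"
  "(T, \<one>\<^bsub>sec X T\<^esub>)\<in>germ X x (U'\<inter>V') (res X U' (U'\<inter>V') s'\<otimes>\<^bsub>sec X (U'\<inter>V')\<^esub> res X V' (U'\<inter>V') t')"
  unfolding stalk_def by auto
 obtain W1 where W1: "openin (pts X) U'" "s'\<in>carrier (sec X U')" "openin (pts X) W1" "x\<in>W1" "W1<=U\<inter>U'" "res X U W1 s = res X U' W1 s'"
  using *(1) unfolding germ_def by auto
 have V': "openin (pts X) V'" "t'\<in>carrier (sec X V')" using *(2) unfolding germ_def by auto
 define I where "I = U'\<inter>V'"
 have I: "openin (pts X) I" unfolding I_def using W1 V' by auto
 obtain W2 where W2: "openin (pts X) W2" "x\<in>W2" "W2<=I\<inter>T"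
  "res X I W2 (res X U' I s'\<otimes>\<^bsub>sec X I\<^esub> res X V' I t') = res X T W2 \<one>\<^bsub>sec X T\<^esub>"
  using *(3) unfolding germ_def I_def by auto
 define W where "W = W1\<inter>W2"
 have W: "openin (pts X) W" "x\<in>W" "W<=W1" "W<=W2" unfolding W_def using W1 W2 by auto
 have c: "res X U' I s'\<in>carrier (sec X I)" "res X V' I t'\<in>carrier (sec X I)"
  using presheaf_closed W1 V' I unfolding I_def by auto
 have sub: "W2<=I" "I<=U'" "I<=V'" "W2<=T" using W2 unfolding I_def by auto
 have "res X U W s = res X W1 W (res X U W1 s)" using U W1 W by (intro presheaf_comp[symmetric]) auto
 also have "... = res X U' W s'" unfolding W1(6) using W1 W by (intro presheaf_comp) auto
 also have "... = res X W2 W (res X I W2 (res X U' I s'))"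
  using presheaf_comp[of U' I W s'] presheaf_comp[of I W2 W "res X U' I s'"] W1 W2 I sub W c by auto
 finally have e1: "res X U W s = res X W2 W (res X I W2 (res X U' I s'))" .
 define r where "r = res X W2 W (res X I W2 (res X V' I t'))"
 have c2: "res X I W2 (res X U' I s')\<in>carrier (sec X W2)" "res X I W2 (res X V' I t')\<in>carrier (sec X W2)"
  using c presheaf_closed[OF I W2(1) sub(1)] by auto
 have "res X U W s\<otimes>\<^bsub>sec X W\<^esub> r = res X W2 W (res X I W2 (res X U' I s')\<otimes>\<^bsub>sec X W2\<^esub> res X I W2 (res X V' I t'))"
  unfolding e1 r_def using presheaf_mult[OF W2(1) W(1) W(4) c2] by simp
 also have "res X I W2 (res X U' I s')\<otimes>\<^bsub>sec X W2\<^esub> res X I W2 (res X V' I t') = \<one>\<^bsub>sec X W2\<^esub>"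
  using presheaf_mult[OF I W2(1) sub(1) c] W2(4) presheaf_one[OF T(1) W2(1) sub(4)] by simp
 also have "res X W2 W \<one>\<^bsub>sec X W2\<^esub> = \<one>\<^bsub>sec X W\<^esub>" using presheaf_one W2 W by auto
 finally have "res X U W s\<otimes>\<^bsub>sec X W\<^esub> r = \<one>\<^bsub>sec X W\<^esub>" .
 moreover have "r\<in>carrier (sec X W)" unfolding r_def using presheaf_closed[OF W2(1) W(1) W(4)] c2 by auto
 moreover have "W<=U" using W W1 by auto
 ultimately show ?thesis unfolding unit_near_def using W by blast
qed

lemma stalk_mult_germ:
 assumes U: "openin (pts X) U" "x\<in>U" "s\<in>carrier (sec X U)" and V: "openin (pts X) V" "x\<in>V" "t\<in>carrier (sec X V)"
 shows "germ X x U s\<otimes>\<^bsub>stalk X x\<^esub> germ X x V t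
  = germ X x (U\<inter>V) (res X U (U\<inter>V) s\<otimes>\<^bsub>sec X (U\<inter>V)\<^esub> res X V (U\<inter>V) t)"
proof -
 define P where "P U s V t = res X U (U\<inter>V) s\<otimes>\<^bsub>sec X (U\<inter>V)\<^esub> res X V (U\<inter>V) t" for U s V t
 have Pc: "P U s V t\<in>carrier (sec X (U\<inter>V))"
  if "openin (pts X) U" "s\<in>carrier (sec X U)" "openin (pts X) V" "t\<in>carrier (sec X V)" for U s V t
 proof -
  have "monoid (sec X (U\<inter>V))" using presheaf_monoid[of "U\<inter>V"] that comm_monoid.axioms(1) by blast
  moreover have "openin (pts X) (U\<inter>V)" using that by auto
  ultimately show ?thesis unfolding P_def
   using presheaf_closed[of U "U\<inter>V" s] presheaf_closed[of V "U\<inter>V" t] that by (intro monoid.m_closed) simp_all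
 qed
 have Pres: "res X (U\<inter>V) W (P U s V t) = res X U W s\<otimes>\<^bsub>sec X W\<^esub> res X V W t"
  if "openin (pts X) U" "s\<in>carrier (sec X U)" "openin (pts X) V" "t\<in>carrier (sec X V)" "openin (pts X) W" "W<=U\<inter>V" for U s V t W
 proof -
  have o: "openin (pts X) (U\<inter>V)" using that by auto
  have c: "res X U (U\<inter>V) s\<in>carrier (sec X (U\<inter>V))" "res X V (U\<inter>V) t\<in>carrier (sec X (U\<inter>V))"
   using presheaf_closed[of U "U\<inter>V" s] presheaf_closed[of V "U\<inter>V" t] that o by simp_all
  show ?thesis unfolding P_def presheaf_mult[OF o that(5,6) c]
   using presheaf_comp[of U "U\<inter>V" W s] presheaf_comp[of V "U\<inter>V" W t] that o by simp
 qed
 have "germ X x (U'\<inter>V') (P U' s' V' t') = germ X x (U\<inter>V) (P U s V t)"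
  if *: "(U', s')\<in>germ X x U s" "(V', t')\<in>germ X x V t" for U' s' V' t'
 proof -
  obtain W1 where W1: "openin (pts X) U'" "x\<in>U'" "s'\<in>carrier (sec X U')" "openin (pts X) W1" "x\<in>W1" "W1<=U\<inter>U'" "res X U W1 s = res X U' W1 s'"
   using *(1) unfolding germ_def by auto
  obtain W2 where W2: "openin (pts X) V'" "x\<in>V'" "t'\<in>carrier (sec X V')" "openin (pts X) W2" "x\<in>W2" "W2<=V\<inter>V'" "res X V W2 t = res X V' W2 t'"
   using *(2) unfolding germ_def by auto
  define W where "W = W1\<inter>W2"
  have W: "openin (pts X) W" "x\<in>W" "W<=W1" "W<=W2" unfolding W_def using W1 W2 by auto
  have e1: "res X U W s = res X U' W s'"
   using presheaf_comp[of U W1 W s] presheaf_comp[of U' W1 W s'] U W1 W by auto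
  have e2: "res X V W t = res X V' W t'"
   using presheaf_comp[of V W2 W t] presheaf_comp[of V' W2 W t'] V W2 W by auto
  have sub: "W<=U'\<inter>V'" "W<=U\<inter>V" using W W1 W2 by auto
  show ?thesis
  proof (rule germ_eqI[of _ _ _ _ _ W])
   show "res X (U'\<inter>V') W (P U' s' V' t') = res X (U\<inter>V) W (P U s V t)"
    using Pres[OF W1(1,3) W2(1,3) W(1) sub(1)] Pres[OF U(1,3) V(1,3) W(1) sub(2)] e1 e2 by simp
   show "P U' s' V' t'\<in>carrier (sec X (U'\<inter>V'))" using Pc[OF W1(1,3) W2(1,3)] .
   show "P U s V t\<in>carrier (sec X (U\<inter>V))" using Pc[OF U(1,3) V(1,3)] .
   show "W<=U'\<inter>V'\<inter>(U\<inter>V)" using sub by blast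
   show "x\<in>U'\<inter>V'" "x\<in>U\<inter>V" using W1 W2 U V by auto
  qed (use U(1) V(1) W1(1) W2(1) W in auto)
 qed
 hence all: "(\<Union>(V', t')\<in>germ X x V t. germ X x (U'\<inter>V') (P U' s' V' t')) = germ X x (U\<inter>V) (P U s V t)"
  if "(U', s')\<in>germ X x U s" for U' s'
  using that by (intro UN_constant_eq[OF germ_self[OF V]]) auto
 have "germ X x U s\<otimes>\<^bsub>stalk X x\<^esub> germ X x V t = (\<Union>(U', s')\<in>germ X x U s. \<Union>(V', t')\<in>germ X x V t. germ X x (U'\<inter>V') (P U' s' V' t'))"
  unfolding stalk_def P_def by simp
 also have "... = germ X x (U\<inter>V) (P U s V t)" using all by (intro UN_constant_eq[OF germ_self[OF U]]) auto
 finally show ?thesis unfolding P_def .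
qed

lemma unit_near_imp_Units_stalk:
 assumes U: "openin (pts X) U" "x\<in>U" "s\<in>carrier (sec X U)" and un: "unit_near X x U s"
 shows "germ X x U s\<in>Units (stalk X x)"
proof -
 obtain W t where W: "openin (pts X) W" "x\<in>W" "W<=U" "t\<in>carrier (sec X W)"
   "res X U W s\<otimes>\<^bsub>sec X W\<^esub> t = \<one>\<^bsub>sec X W\<^esub>"
  using un unfolding unit_near_def by blast
 interpret W: comm_monoid "sec X W" using presheaf_monoid[OF W(1)] .
 define T where "T = topspace (pts X)"
 have T: "openin (pts X) T" "x\<in>T" "\<one>\<^bsub>sec X T\<^esub>\<in>carrier (sec X T)" "W<=T"
  unfolding T_def using U W openin_subset comm_monoid.axioms(1)[OF presheaf_monoid[of "topspace (pts X)"]] monoid.one_closed by auto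
 have one: "\<one>\<^bsub>stalk X x\<^esub> = germ X x W \<one>\<^bsub>sec X W\<^esub>"
  unfolding stalk_def T_def[symmetric] monoid.simps
  by (rule germ_eqI[of _ _ _ _ _ W]) (use T W presheaf_one[OF T(1) W(1) T(4)] presheaf_id[OF W(1)] in auto)
 have sW: "res X U W s\<in>carrier (sec X W)" using presheaf_closed U W by auto
 have i: "U\<inter>W = W" "W\<inter>U = W" using W by auto
 have 1: "germ X x U s\<otimes>\<^bsub>stalk X x\<^esub> germ X x W t = \<one>\<^bsub>stalk X x\<^esub>"
  using stalk_mult_germ[OF U W(1,2,4)] W(5) presheaf_id[OF W(1) W(4)] one by (simp add: i)
 have 2: "germ X x W t\<otimes>\<^bsub>stalk X x\<^esub> germ X x U s = \<one>\<^bsub>stalk X x\<^esub>"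
  using stalk_mult_germ[OF W(1,2,4) U] W(5) presheaf_id[OF W(1) W(4)] one W.m_comm[OF W(4) sW] by (simp add: i)
 have "germ X x U s\<in>carrier (stalk X x)" "germ X x W t\<in>carrier (stalk X x)"
  unfolding stalk_def using U W by auto
 thus ?thesis unfolding Units_def using 1 2 by blast
qed

end

lemma sheaf_presheaf:
 assumes "is_sheaf cring ring_hom (X :: ('x, 's) ringed_space)"
 shows "presheaf X"
proof -
 have 1: "\<forall>U. openin (pts X) U --> cring (sec X U)"
  and 2: "\<forall>U V. openin (pts X) U & openin (pts X) V & V<=U --> res X U V\<in>ring_hom (sec X U) (sec X V)"
  and 3: "\<forall>U. openin (pts X) U --> (\<forall>s\<in>carrier (sec X U). res X U U s = s)"
  and 4: "\<forall>U V W. openin (pts X) U & openin (pts X) V & openin (pts X) W & W<=V & V<=U -->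
    (\<forall>s\<in>carrier (sec X U). res X V W (res X U V s) = res X U W s)"
  using assms unfolding is_sheaf_def by - (elim conjE, assumption)+
 have c: "cring (sec X U)" if "openin (pts X) U" for U using 1 that by simp
 have h: "res X U V\<in>ring_hom (sec X U) (sec X V)" if "openin (pts X) U" "openin (pts X) V" "V<=U" for U V
  using 2 that by simp
 have cm: "comm_monoid (sec X U)" if "openin (pts X) U" for U
  using c[OF that] cring.axioms(2) by blast
 show ?thesis
  unfolding presheaf_def
 proof (intro conjI allI impI ballI)
  show "comm_monoid (sec X U)" if "openin (pts X) U" for U using cm that .
  show "res X U U s = s" if "openin (pts X) U" "s\<in>carrier (sec X U)" for U s
   using 3 that by simp
  show "res X V W (res X U V s) = res X U W s"
   if "openin (pts X) U & openin (pts X) V & openin (pts X) W & W<=V & V<=U" "s\<in>carrier (sec X U)" for U V W s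
   using 4 that by simp
 next
  fix U V assume o: "openin (pts X) U & openin (pts X) V & V<=U"
  note hUV = h[of U V]
  show "res X U V s\<in>carrier (sec X V)" if "s\<in>carrier (sec X U)" for s
   using ring_hom_closed[OF hUV that] o by simp
  show "res X U V (s\<otimes>\<^bsub>sec X U\<^esub> t) = res X U V s\<otimes>\<^bsub>sec X V\<^esub> res X U V t"
   if "s\<in>carrier (sec X U)" "t\<in>carrier (sec X U)" for s t
   using ring_hom_mult[OF hUV that] o by simp
  show "res X U V \<one>\<^bsub>sec X U\<^esub> = \<one>\<^bsub>sec X V\<^esub>" using ring_hom_one[OF hUV] o by simp
 qed
qed

lemma is_sheafD:
 assumes "is_sheaf cring ring_hom (X :: ('x, 's) ringed_space)"
 shows "openin (pts X) U ==> cring (sec X U)"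
  and "openin (pts X) U ==> openin (pts X) V ==> V<=U ==> res X U V\<in>ring_hom (sec X U) (sec X V)"
proof -
 have 1: "\<forall>U. openin (pts X) U --> cring (sec X U)"
  and 2: "\<forall>U V. openin (pts X) U & openin (pts X) V & V<=U --> res X U V\<in>ring_hom (sec X U) (sec X V)"
  using assms unfolding is_sheaf_def by - (elim conjE, assumption)+
 thus "openin (pts X) U ==> cring (sec X U)"
  "openin (pts X) U ==> openin (pts X) V ==> V<=U ==> res X U V\<in>ring_hom (sec X U) (sec X V)" by simp_all
qed

lemma sh_homD:
 assumes "(f, F)\<in>sh_hom hm X Y"
 shows "continuous_map (pts X) (pts Y) f" "f\<in>extensional (topspace (pts X))"
  "!!V. openin (pts Y) V ==> F V\<in>hm (sec Y V) (sec X (preim X f V))"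
  "!!V. openin (pts Y) V ==> F V\<in>extensional (carrier (sec Y V))"
  "F\<in>extensional {V. openin (pts Y) V}"
  "!!V W s. openin (pts Y) V ==> openin (pts Y) W ==> W<=V ==> s\<in>carrier (sec Y V) ==>
    F W (res Y V W s) = res X (preim X f V) (preim X f W) (F V s)"
  "!!x V s. x\<in>topspace (pts X) ==> openin (pts Y) V ==> f x\<in>V ==> s\<in>carrier (sec Y V) ==>
    germ X x (preim X f V) (F V s)\<in>Units (stalk X x) ==> germ Y (f x) V s\<in>Units (stalk Y (f x))"
proof -
 have *: "continuous_map (pts X) (pts Y) f" "f\<in>extensional (topspace (pts X))"
  "\<forall>V. openin (pts Y) V --> F V\<in>hm (sec Y V) (sec X (preim X f V)) & F V\<in>extensional (carrier (sec Y V))"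
  "F\<in>extensional {V. openin (pts Y) V}"
  "\<forall>V W. openin (pts Y) V & openin (pts Y) W & W<=V -->
   (\<forall>s\<in>carrier (sec Y V). F W (res Y V W s) = res X (preim X f V) (preim X f W) (F V s))"
  "\<forall>x\<in>topspace (pts X). \<forall>V. openin (pts Y) V & f x\<in>V -->
   (\<forall>s\<in>carrier (sec Y V). germ X x (preim X f V) (F V s)\<in>Units (stalk X x) -->
     germ Y (f x) V s\<in>Units (stalk Y (f x)))"
  using assms unfolding sh_hom_def mem_Collect_eq prod.case by - (elim conjE, assumption)+
 show "continuous_map (pts X) (pts Y) f" "f\<in>extensional (topspace (pts X))" "F\<in>extensional {V. openin (pts Y) V}" by fact+
 show "!!V. openin (pts Y) V ==> F V\<in>hm (sec Y V) (sec X (preim X f V))"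
  "!!V. openin (pts Y) V ==> F V\<in>extensional (carrier (sec Y V))" using *(3) by simp_all
 show "!!V W s. openin (pts Y) V ==> openin (pts Y) W ==> W<=V ==> s\<in>carrier (sec Y V) ==>
    F W (res Y V W s) = res X (preim X f V) (preim X f W) (F V s)" using *(5) by simp
 show "!!x V s. x\<in>topspace (pts X) ==> openin (pts Y) V ==> f x\<in>V ==> s\<in>carrier (sec Y V) ==>
    germ X x (preim X f V) (F V s)\<in>Units (stalk X x) ==> germ Y (f x) V s\<in>Units (stalk Y (f x))" using *(6) by simp
qed

text \<open>The section over \<open>V\<close> given by the single fraction a/s.\<close>

definition cst :: "'a ring => 'a => 'a => 'a set set => 'a set => ('a \<times> 'a) set" where
 "cst R a s V = (\<lambda>q\<in>V. loc_frac R (carrier R - q) a s)"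

lemma cst_section:
 assumes "openin (pts (Spec R)) V" "a\<in>carrier R" "s\<in>carrier R" "!!q. q\<in>V ==> s\<notin>q"
 shows "cst R a s V\<in>carrier (sec (Spec R) V)"
 unfolding cst_def Spec_simps using loc_sections_const[OF assms] .

locale plain_cring = cring R for R :: "'a ring" (structure)
begin

lemma Spec_open_prime: "openin (pts (Spec R)) V ==> q\<in>V ==> primeideal q R"
 using openin_subset[of "pts (Spec R)" V] topspace_Spec[OF is_cring] by auto

lemma Spec_loc: "openin (pts (Spec R)) V ==> q\<in>V ==> loc_ring R (carrier R - q)"
 using Spec_open_prime loc_ring_prime is_cring by blast

lemma prime_no_one: "primeideal q R ==> \<one>\<notin>q"
 using loc_ring_prime[OF is_cring, of q] loc_ring.S(2) by blast

lemma cst_mult: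
 assumes V: "openin (pts (Spec R)) V" and a: "a\<in>carrier R" "s\<in>carrier R" "!!q. q\<in>V ==> s\<notin>q"
  and b: "b\<in>carrier R" "t\<in>carrier R" "!!q. q\<in>V ==> t\<notin>q"
 shows "cst R a s V\<otimes>\<^bsub>sec (Spec R) V\<^esub> cst R b t V = cst R (a\<otimes>b) (s\<otimes>t) V"
 unfolding Spec_simps cst_def
proof (rule restrict_ext)
 fix q assume q: "q\<in>V"
 interpret L: loc_ring R "carrier R - q" using Spec_loc[OF V q] .
 show "loc_mult R (carrier R - q) ((\<lambda>q\<in>V. loc_frac R (carrier R - q) a s) q) ((\<lambda>q\<in>V. loc_frac R (carrier R - q) b t) q)
   = loc_frac R (carrier R - q) (a\<otimes>b) (s\<otimes>t)"
  using q a b L.loc_mult_frac[of a s b t] by simp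
qed

lemma cst_add:
 assumes V: "openin (pts (Spec R)) V" and a: "a\<in>carrier R" and b: "b\<in>carrier R"
 shows "cst R a \<one> V\<oplus>\<^bsub>sec (Spec R) V\<^esub> cst R b \<one> V = cst R (a\<oplus>b) \<one> V"
 unfolding Spec_simps cst_def
proof (rule restrict_ext)
 fix q assume q: "q\<in>V"
 interpret L: loc_ring R "carrier R - q" using Spec_loc[OF V q] .
 show "loc_add R (carrier R - q) ((\<lambda>q\<in>V. loc_frac R (carrier R - q) a \<one>) q) ((\<lambda>q\<in>V. loc_frac R (carrier R - q) b \<one>) q)
   = loc_frac R (carrier R - q) (a\<oplus>b) \<one>"
  using q a b L.loc_add_frac[of a \<one> b \<one>] L.S(2) by simp
qed

lemma cst_eq:
 assumes V: "openin (pts (Spec R)) V" and a: "a\<in>carrier R" "s\<in>carrier R" "!!q. q\<in>V ==> s\<notin>q"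
  and b: "b\<in>carrier R" "t\<in>carrier R" "!!q. q\<in>V ==> t\<notin>q" and eq: "a\<otimes>t = b\<otimes>s"
 shows "cst R a s V = cst R b t V"
 unfolding cst_def
proof (rule restrict_ext)
 fix q assume q: "q\<in>V"
 interpret L: loc_ring R "carrier R - q" using Spec_loc[OF V q] .
 have "\<exists>u\<in>carrier R - q. u\<otimes>(a\<otimes>t) = u\<otimes>(b\<otimes>s)" using eq L.S(2) by (intro bexI[of _ \<one>]) simp_all
 thus "loc_frac R (carrier R - q) a s = loc_frac R (carrier R - q) b t"
  using L.loc_frac_eq_iff[of a s b t] a b q by simp
qed

lemma cst_eqD:
 assumes V: "openin (pts (Spec R)) V" and a: "a\<in>carrier R" "b\<in>carrier R" and eq: "cst R a \<one> V = cst R b \<one> V" and q: "q\<in>V"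
 shows "\<exists>u\<in>carrier R - q. u\<otimes>a = u\<otimes>b"
proof -
 interpret L: loc_ring R "carrier R - q" using Spec_loc[OF V q] .
 have "loc_frac R (carrier R - q) a \<one> = loc_frac R (carrier R - q) b \<one>"
  using fun_cong[OF eq, of q] q unfolding cst_def by simp
 hence "\<exists>u\<in>carrier R - q. u\<otimes>(a\<otimes>\<one>) = u\<otimes>(b\<otimes>\<one>)"
  using L.loc_frac_eq_iff[of a \<one> b \<one>] L.S(2) a by simp
 thus ?thesis using a by simp
qed

end

text \<open>An affine open subset together with a chosen isomorphism onto the spectrum, so that
  \<open>f\<close> and \<open>F\<close> can be used as functions.\<close>

locale chart =
 fixes X :: "('x, 's) ringed_space" and U :: "'x set" and R :: "'r ring"
  and f :: "'x => 'r set" and F :: "'r set set => ('r set => ('r \<times> 'r) set) => 's"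
 assumes sheaf: "is_sheaf cring ring_hom X" and U: "openin (pts X) U" and R: "cring R"
  and hom: "(f, F)\<in>sh_hom ring_hom (open_subspace X U) (Spec R)"
  and homeo: "homeomorphic_map (pts (open_subspace X U)) (pts (Spec R)) f"
  and bij: "!!V. openin (pts (Spec R)) V ==>
   bij_betw (F V) (carrier (sec (Spec R) V)) (carrier (sec (open_subspace X U) (preim (open_subspace X U) f V)))"
begin

sublocale R: plain_cring R unfolding plain_cring_def by (rule R)

lemmas pre = sheaf_presheaf[OF sheaf]

lemma sub_simps: "pts (open_subspace X U) = subtopology (pts X) U" "sec (open_subspace X U) = sec X"
 "res (open_subspace X U) = res X"
 unfolding open_subspace_def by auto

lemma topU: "topspace (subtopology (pts X) U) = U"
 using openin_subset[OF U] by auto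

definition pb :: "'r set set => 'x set" where "pb V = {x\<in>U. f x\<in>V}"

lemma preim_pb: "preim (open_subspace X U) f V = pb V"
 unfolding preim_def pb_def sub_simps topU by simp

abbreviation Top :: "'r set set" where "Top \<equiv> {p. primeideal p R}"

lemma Top: "openin (pts (Spec R)) Top" "topspace (pts (Spec R)) = Top"
 using topspace_Spec[OF R] openin_topspace[of "pts (Spec R)"] by auto

lemma f_inj: "inj_on f U" and f_img: "f ` U = Top"
 using homeo unfolding homeomorphic_eq_everything_map sub_simps topU Top(2) by auto

lemma f_prime: "x\<in>U ==> primeideal (f x) R"
 using f_img by auto

lemma pb_open: "openin (pts (Spec R)) V ==> openin (pts X) (pb V)"
proof -
 assume "openin (pts (Spec R)) V"
 hence "openin (subtopology (pts X) U) {x\<in>topspace (subtopology (pts X) U). f x\<in>V}"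
  using sh_homD(1)[OF hom] unfolding sub_simps continuous_map_def by blast
 thus ?thesis unfolding topU pb_def using U by (simp add: openin_open_subtopology)
qed

lemma f_open: "openin (pts X) W ==> W<=U ==> openin (pts (Spec R)) (f ` W)"
 using homeo U unfolding homeomorphic_eq_everything_map sub_simps open_map_def
 by (simp add: openin_open_subtopology)

lemma pb_f:
 assumes "W<=U"
 shows "pb (f ` W) = W"
proof -
 have "x\<in>U & f x\<in>f ` W \<longleftrightarrow> x\<in>W" for x
  using inj_on_image_mem_iff[OF f_inj _ assms, of x] assms by blast
 thus ?thesis unfolding pb_def by simp
qed

lemma f_pb:
 assumes "V<=Top"
 shows "f ` pb V = V"
proof -
 have "f ` pb V = f ` U\<inter>V" unfolding pb_def by auto
 thus ?thesis unfolding f_img using assms by (simp add: Int_absorb1)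
qed

lemma pb_Top: "pb Top = U" unfolding pb_def using f_prime by auto

lemma Fhom: "openin (pts (Spec R)) V ==> F V\<in>ring_hom (sec (Spec R) V) (sec X (pb V))"
 using sh_homD(3)[OF hom] unfolding preim_pb sub_simps by blast

lemma Fbij: "openin (pts (Spec R)) V ==> bij_betw (F V) (carrier (sec (Spec R) V)) (carrier (sec X (pb V)))"
 using bij unfolding preim_pb sub_simps by blast

lemma Fnat: "openin (pts (Spec R)) V ==> openin (pts (Spec R)) W ==> W<=V ==> \<sigma>\<in>carrier (sec (Spec R) V) ==>
  F W (restrict \<sigma> W) = res X (pb V) (pb W) (F V \<sigma>)"
 using sh_homD(6)[OF hom, of V W \<sigma>] by (simp only: preim_pb sub_simps Spec_simps(6))

text \<open>The identification of \<open>R\<close> with the sections over \<open>U\<close>; all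
  other sections are compared with these.\<close>

definition \<rho> :: "'r => 's" where "\<rho> r = F Top (cst R r \<one>\<^bsub>R\<^esub> Top)"

lemma cst1: "openin (pts (Spec R)) V ==> r\<in>carrier R ==> cst R r \<one>\<^bsub>R\<^esub> V\<in>carrier (sec (Spec R) V)"
 by (rule cst_section[OF _ _ R.one_closed R.prime_no_one[OF R.Spec_open_prime]])

lemma \<rho>_closed: "r\<in>carrier R ==> \<rho> r\<in>carrier (sec X U)"
 unfolding \<rho>_def using ring_hom_closed[OF Fhom[OF Top(1)] cst1[OF Top(1)]] pb_Top by simp

lemma \<rho>_res:
 assumes "openin (pts X) W" "W<=U" "r\<in>carrier R"
 shows "res X U W (\<rho> r) = F (f ` W) (cst R r \<one>\<^bsub>R\<^esub> (f ` W))"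
proof -
 have sub: "f ` W<=Top" using image_mono[OF assms(2), of f] f_img by simp
 have "restrict (cst R r \<one>\<^bsub>R\<^esub> Top) (f ` W) = cst R r \<one>\<^bsub>R\<^esub> (f ` W)"
  unfolding cst_def restrict_restrict Int_absorb1[OF sub] ..
 thus ?thesis
  unfolding \<rho>_def using Fnat[OF Top(1) f_open[OF assms(1,2)] sub cst1[OF Top(1) assms(3)]] pb_Top pb_f[OF assms(2)] by simp
qed

lemma \<rho>_hom: "\<rho>\<in>ring_hom R (sec X U)"
proof (rule ring_hom_memI)
 fix a b assume a: "a\<in>carrier R" and b: "b\<in>carrier R"
 note no1 = R.prime_no_one
 show "\<rho> a\<in>carrier (sec X U)" using \<rho>_closed[OF a] .
 have "cst R (a\<otimes>\<^bsub>R\<^esub> b) \<one>\<^bsub>R\<^esub> Top = cst R a \<one>\<^bsub>R\<^esub> Top\<otimes>\<^bsub>sec (Spec R) Top\<^esub> cst R b \<one>\<^bsub>R\<^esub> Top"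
  using R.cst_mult[OF Top(1) a R.one_closed _ b R.one_closed] no1 by simp
 thus "\<rho> (a\<otimes>\<^bsub>R\<^esub> b) = \<rho> a\<otimes>\<^bsub>sec X U\<^esub> \<rho> b"
  unfolding \<rho>_def using ring_hom_mult[OF Fhom[OF Top(1)] cst1[OF Top(1) a] cst1[OF Top(1) b]] pb_Top by simp
 show "\<rho> (a\<oplus>\<^bsub>R\<^esub> b) = \<rho> a\<oplus>\<^bsub>sec X U\<^esub> \<rho> b"
  unfolding \<rho>_def using ring_hom_add[OF Fhom[OF Top(1)] cst1[OF Top(1) a] cst1[OF Top(1) b]] pb_Top R.cst_add[OF Top(1) a b] by simp
next
 show "\<rho> \<one>\<^bsub>R\<^esub> = \<one>\<^bsub>sec X U\<^esub>"
  unfolding \<rho>_def using ring_hom_one[OF Fhom[OF Top(1)]] pb_Top by (simp add: Spec_simps cst_def)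
qed

text \<open>The local description of sections of the spectrum by fractions, carried over by
  \<open>F\<close>. It is stated as a product because the denominator is not yet known to be
  invertible in the sheaf.\<close>

lemma section_is_fraction:
 assumes V: "openin (pts X) V" and s: "s\<in>carrier (sec X V)" and x: "x\<in>V" "x\<in>U"
 shows "\<exists>a b W. a\<in>carrier R & b\<in>carrier R & b\<notin>f x & openin (pts X) W & x\<in>W & W<=U\<inter>V &
  res X V W s\<otimes>\<^bsub>sec X W\<^esub> res X U W (\<rho> b) = res X U W (\<rho> a)"
proof -
 define W0 where "W0 = U\<inter>V"
 have W0: "openin (pts X) W0" "W0<=U" "x\<in>W0" unfolding W0_def using U V x by auto
 have fW0: "openin (pts (Spec R)) (f ` W0)" using f_open[OF W0(1,2)] .
 have s0: "res X V W0 s\<in>carrier (sec X W0)" using presheaf_closed[OF pre V W0(1) _ s] unfolding W0_def by auto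
 obtain \<sigma> where \<sigma>: "\<sigma>\<in>carrier (sec (Spec R) (f ` W0))" "F (f ` W0) \<sigma> = res X V W0 s"
  using bij_betw_imp_surj_on[OF Fbij[OF fW0]] s0 unfolding pb_f[OF W0(2)] by (metis imageE)
 have "\<sigma>\<in>loc_sections R (pts (Spec R)) (f ` W0)" using \<sigma>(1) unfolding Spec_simps .
 moreover have "f x\<in>f ` W0" using W0 by auto
 ultimately obtain W1 a b where W1: "openin (pts (Spec R)) W1" "f x\<in>W1" "W1<=f ` W0" "a\<in>carrier R" "b\<in>carrier R"
  "!!q. q\<in>W1 ==> b\<notin>q" "!!q. q\<in>W1 ==> \<sigma> q = loc_frac R (carrier R - q) a b"
  by (rule loc_sectionsE) (rule that)
 define W where "W = pb W1"
 have W1T: "W1<=Top" using W1(3) image_mono[OF W0(2), of f] f_img by simp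
 have W: "openin (pts X) W" "x\<in>W" "W<=U" unfolding W_def using pb_open[OF W1(1)] W1(2) x by (auto simp: pb_def)
 have WW0: "W<=W0"
 proof -
  have "pb W1<=pb (f ` W0)" using W1(3) unfolding pb_def by auto
  thus ?thesis unfolding W_def pb_f[OF W0(2)] .
 qed
 have fW: "f ` W = W1" unfolding W_def using f_pb[OF W1T] .
 have "res X V W s = res X W0 W (res X V W0 s)"
  using presheaf_comp[OF pre V W0(1) W(1) WW0 _ s] unfolding W0_def by simp
 also have "... = F W1 (restrict \<sigma> W1)"
  using Fnat[OF fW0 W1(1,3) \<sigma>(1)] \<sigma>(2) pb_f[OF W0(2)] unfolding W_def by simp
 also have "restrict \<sigma> W1 = cst R a b W1" unfolding cst_def using W1(7) by (rule restrict_ext)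
 finally have e1: "res X V W s = F W1 (cst R a b W1)" .
 have e2: "res X U W (\<rho> r) = F W1 (cst R r \<one>\<^bsub>R\<^esub> W1)" if "r\<in>carrier R" for r
  using \<rho>_res[OF W(1,3) that] fW by simp
 have no1: "\<one>\<^bsub>R\<^esub>\<notin>q" if "q\<in>W1" for q using R.Spec_open_prime[OF W1(1) that] R.prime_no_one by blast
 have "cst R a b W1\<otimes>\<^bsub>sec (Spec R) W1\<^esub> cst R b \<one>\<^bsub>R\<^esub> W1 = cst R (a\<otimes>\<^bsub>R\<^esub> b) (b\<otimes>\<^bsub>R\<^esub> \<one>\<^bsub>R\<^esub>) W1"
  using R.cst_mult[OF W1(1,4,5,6) W1(5) R.one_closed no1] by simp
 also have "... = cst R a \<one>\<^bsub>R\<^esub> W1"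
  using W1(4,5,6) no1 by (intro R.cst_eq[OF W1(1)]) auto
 finally have "F W1 (cst R a b W1)\<otimes>\<^bsub>sec X (pb W1)\<^esub> F W1 (cst R b \<one>\<^bsub>R\<^esub> W1) = F W1 (cst R a \<one>\<^bsub>R\<^esub> W1)"
  using ring_hom_mult[OF Fhom[OF W1(1)] cst_section[OF W1(1,4,5,6)] cst1[OF W1(1,5)]] by simp
 hence "res X V W s\<otimes>\<^bsub>sec X W\<^esub> res X U W (\<rho> b) = res X U W (\<rho> a)"
  using e1 e2[OF W1(4)] e2[OF W1(5)] unfolding W_def by simp
 moreover have "b\<notin>f x" using W1(2,6) by blast
 moreover have "W<=U\<inter>V" using WW0 unfolding W0_def .
 ultimately show ?thesis
  using W W1(4,5) by (intro exI[of _ a] exI[of _ b] exI[of _ W]) simp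
qed

text \<open>\<open>F\<close> is injective, so equality near x means equality of the fractions a/1
  and b/1 in the localisation at \<open>f x\<close>.\<close>

lemma \<rho>_eqD:
 assumes W: "openin (pts X) W" "W<=U" "x\<in>W" and a: "a\<in>carrier R" "b\<in>carrier R"
  and eq: "res X U W (\<rho> a) = res X U W (\<rho> b)"
 shows "\<exists>u\<in>carrier R - f x. u\<otimes>\<^bsub>R\<^esub> a = u\<otimes>\<^bsub>R\<^esub> b"
proof -
 have fW: "openin (pts (Spec R)) (f ` W)" using f_open[OF W(1,2)] .
 have "F (f ` W) (cst R a \<one>\<^bsub>R\<^esub> (f ` W)) = F (f ` W) (cst R b \<one>\<^bsub>R\<^esub> (f ` W))"
  using \<rho>_res[OF W(1,2)] a eq by simp
 hence "cst R a \<one>\<^bsub>R\<^esub> (f ` W) = cst R b \<one>\<^bsub>R\<^esub> (f ` W)"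
  using inj_onD[OF bij_betw_imp_inj_on[OF Fbij[OF fW]] _ cst1[OF fW a(1)] cst1[OF fW a(2)]] by simp
 thus ?thesis using R.cst_eqD[OF fW a _ imageI[OF W(3)]] by simp
qed

text \<open>On the basic open set where \<open>b\<close> does not vanish, the section 1/b is an
  inverse, and \<open>F\<close> carries it to the scheme.\<close>

lemma unit_near_\<rho>:
 assumes x: "x\<in>U" and b: "b\<in>carrier R" "b\<notin>f x"
 shows "unit_near X x U (\<rho> b)"
proof -
 define W1 where "W1 = {p. primeideal p R & b\<notin>p}"
 have W1: "openin (pts (Spec R)) W1" unfolding W1_def using openin_Spec_basic[OF R b(1)] .
 define W where "W = pb W1"
 have W: "openin (pts X) W" "x\<in>W" "W<=U"
  unfolding W_def using pb_open[OF W1] x b(2) f_prime[OF x] by (auto simp: pb_def W1_def)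
 have fW: "f ` W = W1" unfolding W_def by (rule f_pb) (auto simp: W1_def)
 have nb: "b\<notin>q" "\<one>\<^bsub>R\<^esub>\<notin>q" if "q\<in>W1" for q using that R.prime_no_one unfolding W1_def by auto
 define t where "t = F W1 (cst R \<one>\<^bsub>R\<^esub> b W1)"
 have tc: "cst R \<one>\<^bsub>R\<^esub> b W1\<in>carrier (sec (Spec R) W1)" using cst_section[OF W1 R.one_closed b(1) nb(1)] .
 have "cst R b \<one>\<^bsub>R\<^esub> W1\<otimes>\<^bsub>sec (Spec R) W1\<^esub> cst R \<one>\<^bsub>R\<^esub> b W1 = cst R (b\<otimes>\<^bsub>R\<^esub> \<one>\<^bsub>R\<^esub>) (\<one>\<^bsub>R\<^esub>\<otimes>\<^bsub>R\<^esub> b) W1"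
  using R.cst_mult[OF W1 b(1) R.one_closed nb(2) R.one_closed b(1) nb(1)] by simp
 also have "... = cst R \<one>\<^bsub>R\<^esub> \<one>\<^bsub>R\<^esub> W1" using b(1) nb by (intro R.cst_eq[OF W1]) auto
 also have "... = \<one>\<^bsub>sec (Spec R) W1\<^esub>" unfolding Spec_simps cst_def by simp
 finally have "F W1 (cst R b \<one>\<^bsub>R\<^esub> W1)\<otimes>\<^bsub>sec X W\<^esub> t = \<one>\<^bsub>sec X W\<^esub>"
  unfolding t_def W_def using ring_hom_mult[OF Fhom[OF W1] cst1[OF W1 b(1)] tc] ring_hom_one[OF Fhom[OF W1]] by simp
 hence "res X U W (\<rho> b)\<otimes>\<^bsub>sec X W\<^esub> t = \<one>\<^bsub>sec X W\<^esub>" using \<rho>_res[OF W(1,3) b(1)] fW by simp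
 moreover have "t\<in>carrier (sec X W)" unfolding t_def W_def using ring_hom_closed[OF Fhom[OF W1] tc] .
 ultimately show ?thesis
  unfolding unit_near_def using W by (intro exI[of _ W] exI[of _ t]) simp
qed

text \<open>Near x an inverse is itself a fraction a/c, whence u c = u b a with u and c outside the
  prime \<open>f x\<close>; then b cannot lie in it.\<close>

lemma unit_near_\<rho>D:
 assumes x: "x\<in>U" and b: "b\<in>carrier R" and un: "unit_near X x U (\<rho> b)"
 shows "b\<notin>f x"
proof
 assume bx: "b\<in>f x"
 interpret P: primeideal "f x" R using f_prime[OF x] .
 obtain W t where W: "openin (pts X) W" "x\<in>W" "W<=U" "t\<in>carrier (sec X W)"
  "res X U W (\<rho> b)\<otimes>\<^bsub>sec X W\<^esub> t = \<one>\<^bsub>sec X W\<^esub>" using un unfolding unit_near_def by blast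
 obtain a c V where V: "a\<in>carrier R" "c\<in>carrier R" "c\<notin>f x" "openin (pts X) V" "x\<in>V" "V<=U\<inter>W"
  "res X W V t\<otimes>\<^bsub>sec X V\<^esub> res X U V (\<rho> c) = res X U V (\<rho> a)"
  using section_is_fraction[OF W(1,4,2) x] by blast
 interpret S: cring "sec X V" using is_sheafD(1)[OF sheaf V(4)] .
 have VW: "V<=W" "V<=U" using V by auto
 have rV: "res X U V (\<rho> r)\<in>carrier (sec X V)" if "r\<in>carrier R" for r
  using presheaf_closed[OF pre U V(4) VW(2) \<rho>_closed[OF that]] .
 have tV: "res X W V t\<in>carrier (sec X V)" using presheaf_closed[OF pre W(1) V(4) VW(1) W(4)] .
 have rbW: "res X U W (\<rho> b)\<in>carrier (sec X W)" using presheaf_closed[OF pre U W(1,3) \<rho>_closed[OF b]] .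
 have "res X W V (res X U W (\<rho> b)\<otimes>\<^bsub>sec X W\<^esub> t) = \<one>\<^bsub>sec X V\<^esub>"
  using W(5) presheaf_one[OF pre W(1) V(4) VW(1)] by simp
 hence one: "res X U V (\<rho> b)\<otimes>\<^bsub>sec X V\<^esub> res X W V t = \<one>\<^bsub>sec X V\<^esub>"
  using presheaf_mult[OF pre W(1) V(4) VW(1) rbW W(4)] presheaf_comp[OF pre U W(1) V(4) VW(1) W(3) \<rho>_closed[OF b]] by simp
 have "res X U V (\<rho> c) = (res X U V (\<rho> b)\<otimes>\<^bsub>sec X V\<^esub> res X W V t)\<otimes>\<^bsub>sec X V\<^esub> res X U V (\<rho> c)"
  using one rV[OF V(2)] by simp
 also have "... = res X U V (\<rho> b)\<otimes>\<^bsub>sec X V\<^esub> res X U V (\<rho> a)"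
  using V(7) rV[OF V(2)] rV[OF b] tV by (simp add: S.m_assoc)
 also have "... = res X U V (\<rho> (b\<otimes>\<^bsub>R\<^esub> a))"
  using presheaf_mult[OF pre U V(4) VW(2) \<rho>_closed[OF b] \<rho>_closed[OF V(1)]] ring_hom_mult[OF \<rho>_hom b V(1)] by simp
 finally obtain u where u: "u\<in>carrier R" "u\<notin>f x" "u\<otimes>\<^bsub>R\<^esub> c = u\<otimes>\<^bsub>R\<^esub> (b\<otimes>\<^bsub>R\<^esub> a)"
  using \<rho>_eqD[OF V(4) VW(2) V(5) V(2) R.m_closed[OF b V(1)]] by blast
 have "b\<otimes>\<^bsub>R\<^esub> a\<in>f x" using P.I_r_closed[OF bx V(1)] .
 hence "u\<otimes>\<^bsub>R\<^esub> c\<in>f x" using u P.I_l_closed by simp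
 thus False using P.I_prime[OF u(1) V(2)] u(2) V(3) by blast
qed

end

lemma affine_open_chart:
 assumes "is_sheaf cring ring_hom X" "affine_open X U R"
 shows "\<exists>f F. chart X U R f F"
proof -
 obtain f F where "(f, F)\<in>sh_hom ring_hom (open_subspace X U) (Spec R)"
  "homeomorphic_map (pts (open_subspace X U)) (pts (Spec R)) f"
  "\<forall>V. openin (pts (Spec R)) V -->
   bij_betw (F V) (carrier (sec (Spec R) V)) (carrier (sec (open_subspace X U) (preim (open_subspace X U) f V)))"
  using assms(2) unfolding affine_open_def sh_isomorphic_def by auto
 hence "chart X U R f F"
  using assms unfolding chart_def affine_open_def by simp
 thus ?thesis by blast
qed

context plain_cring
begin

lemma Spec_stalk_frac:
 assumes "\<sigma>\<in>carrier (sec (Spec R) U)" "p\<in>U"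
 obtains a s where "a\<in>carrier R" "s\<in>carrier R - p" "\<sigma> p = loc_frac R (carrier R - p) a s"
proof -
 have "\<sigma>\<in>loc_sections R (pts (Spec R)) U" using assms(1) unfolding Spec_simps .
 then obtain W a s where W: "openin (pts (Spec R)) W" "p\<in>W" "W<=U" "a\<in>carrier R" "s\<in>carrier R"
   "!!q. q\<in>W ==> s\<notin>q" "!!q. q\<in>W ==> \<sigma> q = loc_frac R (carrier R - q) a s"
  using assms(2) by (rule loc_sectionsE) (rule that)
 show ?thesis using that[of a s] W(4,5) W(6,7)[OF W(2)] by simp
qed

text \<open>The monoid laws are checked prime by prime, where every section is one fraction; closure
  under products additionally needs a common neighbourhood for the two fractions.\<close>

lemma presheaf_Spec: "presheaf (Spec R)"
proof -
 have cm: "comm_monoid (sec (Spec R) U)" if U: "openin (pts (Spec R)) U" for U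
 proof (rule comm_monoidI)
  fix \<sigma> \<tau> assume st: "\<sigma>\<in>carrier (sec (Spec R) U)" "\<tau>\<in>carrier (sec (Spec R) U)"
  show "\<sigma>\<otimes>\<^bsub>sec (Spec R) U\<^esub> \<tau>\<in>carrier (sec (Spec R) U)"
   unfolding Spec_simps(1) loc_sections_def
  proof (intro CollectI conjI ballI)
   show "\<sigma>\<otimes>\<^bsub>sec (Spec R) U\<^esub> \<tau>\<in>extensional U" unfolding Spec_simps by simp
   fix p assume p: "p\<in>U"
   have \<sigma>: "\<sigma>\<in>loc_sections R (pts (Spec R)) U" and \<tau>: "\<tau>\<in>loc_sections R (pts (Spec R)) U"
    using st unfolding Spec_simps .
   obtain W1 a s where W1: "openin (pts (Spec R)) W1" "p\<in>W1" "W1<=U" "a\<in>carrier R" "s\<in>carrier R"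
    "!!q. q\<in>W1 ==> s\<notin>q" "!!q. q\<in>W1 ==> \<sigma> q = loc_frac R (carrier R - q) a s"
    using \<sigma> p by (rule loc_sectionsE) (rule that)
   obtain W2 b t where W2: "openin (pts (Spec R)) W2" "p\<in>W2" "W2<=U" "b\<in>carrier R" "t\<in>carrier R"
    "!!q. q\<in>W2 ==> t\<notin>q" "!!q. q\<in>W2 ==> \<tau> q = loc_frac R (carrier R - q) b t"
    using \<tau> p by (rule loc_sectionsE) (rule that)
   have eq: "s\<otimes>t\<notin>q & (\<sigma>\<otimes>\<^bsub>sec (Spec R) U\<^esub> \<tau>) q = loc_frac R (carrier R - q) (a\<otimes>b) (s\<otimes>t)"
    if q: "q\<in>W1\<inter>W2" for q
   proof -
    have qU: "q\<in>U" using q W1(3) by blast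
    interpret L: loc_ring R "carrier R - q" using Spec_loc[OF U qU] .
    have s: "s\<in>carrier R - q" "t\<in>carrier R - q" using W1(5,6) W2(5,6) q by auto
    have "(\<sigma>\<otimes>\<^bsub>sec (Spec R) U\<^esub> \<tau>) q = loc_frac R (carrier R - q) (a\<otimes>b) (s\<otimes>t)"
     unfolding Spec_simps using qU q W1(7) W2(7) L.loc_mult_frac[OF W1(4) s(1) W2(4) s(2)] by simp
    thus ?thesis using L.S(3)[OF s] by blast
   qed
   show "\<exists>V a s. openin (pts (Spec R)) V & p\<in>V & V<=U & a\<in>carrier R & s\<in>carrier R &
     (\<forall>q\<in>V. s\<notin>q & (\<sigma>\<otimes>\<^bsub>sec (Spec R) U\<^esub> \<tau>) q = loc_frac R (carrier R - q) a s)"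
    by (intro exI[of _ "W1\<inter>W2"] exI[of _ "a\<otimes>b"] exI[of _ "s\<otimes>t"] conjI ballI)
     (use W1(1-5) W2(1-5) eq in \<open>simp_all add: subset_iff openin_Int\<close>)
  qed
  show "\<sigma>\<otimes>\<^bsub>sec (Spec R) U\<^esub> \<tau> = \<tau>\<otimes>\<^bsub>sec (Spec R) U\<^esub> \<sigma>"
   unfolding Spec_simps
  proof (rule restrict_ext)
   fix p assume p: "p\<in>U"
   interpret L: loc_ring R "carrier R - p" using Spec_loc[OF U p] .
   obtain a s where a: "a\<in>carrier R" "s\<in>carrier R - p" "\<sigma> p = loc_frac R (carrier R - p) a s"
    using Spec_stalk_frac[OF st(1) p] .
   obtain b t where b: "b\<in>carrier R" "t\<in>carrier R - p" "\<tau> p = loc_frac R (carrier R - p) b t"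
    using Spec_stalk_frac[OF st(2) p] .
   show "loc_mult R (carrier R - p) (\<sigma> p) (\<tau> p) = loc_mult R (carrier R - p) (\<tau> p) (\<sigma> p)"
    unfolding a(3) b(3) L.loc_mult_frac[OF a(1,2) b(1,2)] L.loc_mult_frac[OF b(1,2) a(1,2)]
    using a b by (simp add: m_comm)
  qed
  fix \<mu> assume mu: "\<mu>\<in>carrier (sec (Spec R) U)"
  show "\<sigma>\<otimes>\<^bsub>sec (Spec R) U\<^esub> \<tau>\<otimes>\<^bsub>sec (Spec R) U\<^esub> \<mu> = \<sigma>\<otimes>\<^bsub>sec (Spec R) U\<^esub> (\<tau>\<otimes>\<^bsub>sec (Spec R) U\<^esub> \<mu>)"
   unfolding Spec_simps
  proof (rule restrict_ext)
   fix p assume p: "p\<in>U"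
   interpret L: loc_ring R "carrier R - p" using Spec_loc[OF U p] .
   obtain a s where a: "a\<in>carrier R" "s\<in>carrier R - p" "\<sigma> p = loc_frac R (carrier R - p) a s"
    using Spec_stalk_frac[OF st(1) p] .
   obtain b t where b: "b\<in>carrier R" "t\<in>carrier R - p" "\<tau> p = loc_frac R (carrier R - p) b t"
    using Spec_stalk_frac[OF st(2) p] .
   obtain d w where d: "d\<in>carrier R" "w\<in>carrier R - p" "\<mu> p = loc_frac R (carrier R - p) d w"
    using Spec_stalk_frac[OF mu p] .
   show "loc_mult R (carrier R - p) ((\<lambda>p\<in>U. loc_mult R (carrier R - p) (\<sigma> p) (\<tau> p)) p) (\<mu> p)
     = loc_mult R (carrier R - p) (\<sigma> p) ((\<lambda>p\<in>U. loc_mult R (carrier R - p) (\<tau> p) (\<mu> p)) p)"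
    using p L.loc_mult_frac[OF a(1,2) b(1,2)] L.loc_mult_frac[OF b(1,2) d(1,2)]
     L.loc_mult_frac[OF m_closed[OF a(1) b(1)] L.S(3)[OF a(2) b(2)] d(1,2)]
     L.loc_mult_frac[OF a(1,2) m_closed[OF b(1) d(1)] L.S(3)[OF b(2) d(2)]] a b d
    by (simp add: m_assoc)
  qed
 next
  show "\<one>\<^bsub>sec (Spec R) U\<^esub>\<in>carrier (sec (Spec R) U)"
  proof -
   have "cst R \<one> \<one> U\<in>carrier (sec (Spec R) U)"
    using cst_section[OF U one_closed one_closed] Spec_open_prime[OF U] prime_no_one by blast
   thus ?thesis unfolding cst_def Spec_simps(3) .
  qed
  fix \<sigma> assume st: "\<sigma>\<in>carrier (sec (Spec R) U)"
  have ext: "\<sigma>\<in>extensional U" using st unfolding Spec_simps loc_sections_def by simp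
  have "\<one>\<^bsub>sec (Spec R) U\<^esub>\<otimes>\<^bsub>sec (Spec R) U\<^esub> \<sigma> = restrict \<sigma> U"
   unfolding Spec_simps
  proof (rule restrict_ext)
   fix p assume p: "p\<in>U"
   interpret L: loc_ring R "carrier R - p" using Spec_loc[OF U p] .
   obtain a s where a: "a\<in>carrier R" "s\<in>carrier R - p" "\<sigma> p = loc_frac R (carrier R - p) a s"
    using Spec_stalk_frac[OF st(1) p] .
   show "loc_mult R (carrier R - p) ((\<lambda>p\<in>U. loc_frac R (carrier R - p) \<one> \<one>) p) (\<sigma> p) = \<sigma> p"
    using p L.loc_mult_frac[OF one_closed L.S(2) a(1,2)] a by simp
  qed
  thus "\<one>\<^bsub>sec (Spec R) U\<^esub>\<otimes>\<^bsub>sec (Spec R) U\<^esub> \<sigma> = \<sigma>" using ext by (simp add: extensional_restrict)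
 qed
 show ?thesis
  unfolding presheaf_def
 proof (intro conjI allI impI ballI)
  show "comm_monoid (sec (Spec R) U)" if "openin (pts (Spec R)) U" for U using cm[OF that] .
  show "res (Spec R) U U s = s" if "s\<in>carrier (sec (Spec R) U)" for U s
   using that unfolding Spec_simps loc_sections_def by (simp add: extensional_restrict)
  show "res (Spec R) V W (res (Spec R) U V s) = res (Spec R) U W s"
   if "openin (pts (Spec R)) U & openin (pts (Spec R)) V & openin (pts (Spec R)) W & W<=V & V<=U" for U V W s
   using that unfolding Spec_simps by (simp add: Int_absorb1 restrict_restrict)
 next
  fix U V assume o: "openin (pts (Spec R)) U & openin (pts (Spec R)) V & V<=U"
  show "res (Spec R) U V s\<in>carrier (sec (Spec R) V)" if "s\<in>carrier (sec (Spec R) U)" for s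
   using loc_sections_restrict[of _ V U s] o that unfolding Spec_simps by blast
  show "res (Spec R) U V (s\<otimes>\<^bsub>sec (Spec R) U\<^esub> t) = res (Spec R) U V s\<otimes>\<^bsub>sec (Spec R) V\<^esub> res (Spec R) U V t" for s t
   using o unfolding Spec_simps by (auto simp: restrict_def fun_eq_iff)
  show "res (Spec R) U V \<one>\<^bsub>sec (Spec R) U\<^esub> = \<one>\<^bsub>sec (Spec R) V\<^esub>"
   using o unfolding Spec_simps by (auto simp: restrict_def fun_eq_iff)
 qed
qed

end

section \<open>Morphisms from the spectrum of a field\<close>

locale plain_field = field K for K :: "'a ring" (structure)
begin

sublocale plain_cring K by unfold_locales

abbreviation pt :: "'a set" where "pt \<equiv> {\<zero>}"

lemma primes: "primeideal p K \<longleftrightarrow> p = pt"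
proof
 assume p: "primeideal p K"
 then interpret P: primeideal p K .
 have "p\<in>{I. ideal I K}" using P.is_ideal by simp
 thus "p = pt" using all_ideals P.I_notcarr by auto
qed (use zeroprimeideal in simp)

lemma top_Spec: "topspace (pts (Spec K)) = {pt}"
 using topspace_Spec[OF is_cring] primes by auto

lemma open_Spec: "openin (pts (Spec K)) V \<longleftrightarrow> V = {} \<or> V = {pt}"
proof
 assume "openin (pts (Spec K)) V"
 hence "V<={pt}" using openin_subset top_Spec by blast
 thus "V = {} \<or> V = {pt}" by blast
next
 assume "V = {} \<or> V = {pt}"
 thus "openin (pts (Spec K)) V" using openin_topspace[of "pts (Spec K)"] unfolding top_Spec by auto
qed

lemma cst_in: "openin (pts (Spec K)) V ==> a\<in>carrier K ==> cst K a \<one> V\<in>carrier (sec (Spec K) V)"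
 using cst_section[of K V a \<one>] Spec_open_prime prime_no_one by blast

lemma cst_inj:
 assumes "a\<in>carrier K" "b\<in>carrier K" "cst K a \<one> {pt} = cst K b \<one> {pt}"
 shows "a = b"
proof -
 have o: "openin (pts (Spec K)) {pt}" using open_Spec by blast
 obtain u where u: "u\<in>carrier K - pt" "u\<otimes>a = u\<otimes>b" using cst_eqD[OF o assms, of pt] by blast
 thus ?thesis using m_lcancel[of u a b] assms by simp
qed

text \<open>At the only point a/s equals (a inv s)/1. Over the empty set there is a single section,
  represented by any constant.\<close>

lemma sections_cst:
 assumes "openin (pts (Spec K)) V" "\<sigma>\<in>carrier (sec (Spec K) V)"
 shows "\<exists>a\<in>carrier K. \<sigma> = cst K a \<one> V"
proof -
 have ext: "\<sigma>\<in>extensional V" using assms(2) unfolding Spec_simps loc_sections_def by simp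
 show ?thesis
 proof (cases "V = {}")
  case True
  thus ?thesis using ext unfolding cst_def by (intro bexI[of _ \<zero>]) auto
 next
  case False
  hence V: "V = {pt}" using assms(1) open_Spec by blast
  hence ptV: "pt\<in>V" by simp
  interpret L: loc_ring K "carrier K - pt" using Spec_loc[OF assms(1) ptV] .
  obtain a s where a: "a\<in>carrier K" "s\<in>carrier K - pt" "\<sigma> pt = loc_frac K (carrier K - pt) a s"
   using Spec_stalk_frac[OF assms(2) ptV] .
  have sU: "s\<in>Units K" using a(2) field_Units by simp
  define b where "b = a\<otimes>inv s"
  have b: "b\<in>carrier K" unfolding b_def using a sU by simp
  have bs: "b\<otimes>s = a" unfolding b_def using a sU by (simp add: m_assoc)
  have "\<exists>u\<in>carrier K - pt. u\<otimes>(a\<otimes>\<one>) = u\<otimes>(b\<otimes>s)"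
   using bs a L.S(2) by (intro bexI[of _ \<one>]) simp_all
  hence "\<sigma> pt = loc_frac K (carrier K - pt) b \<one>"
   unfolding a(3) using L.loc_frac_eq_iff[OF a(1,2) b L.S(2)] by simp
  hence "\<sigma> = cst K b \<one> V"
   using ext unfolding cst_def V by (intro extensionalityI[of _ "{pt}"]) auto
  thus ?thesis using b by blast
 qed
qed

lemma cst_mult1: "openin (pts (Spec K)) V ==> a\<in>carrier K ==> b\<in>carrier K ==>
  cst K a \<one> V\<otimes>\<^bsub>sec (Spec K) V\<^esub> cst K b \<one> V = cst K (a\<otimes>b) \<one> V"
 using cst_mult[of V a \<one> b \<one>] Spec_open_prime prime_no_one by simp

lemma cst_one: "\<one>\<^bsub>sec (Spec K) V\<^esub> = cst K \<one> \<one> V"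
 unfolding Spec_simps cst_def by simp

lemma pt_open: "openin (pts (Spec K)) {pt}" using open_Spec by blast

lemma unit_near_cst:
 assumes "a\<in>carrier K"
 shows "unit_near (Spec K) pt {pt} (cst K a \<one> {pt}) \<longleftrightarrow> a ~= \<zero>"
proof
 assume "unit_near (Spec K) pt {pt} (cst K a \<one> {pt})"
 then obtain W t where W: "openin (pts (Spec K)) W" "pt\<in>W" "t\<in>carrier (sec (Spec K) W)"
  "res (Spec K) {pt} W (cst K a \<one> {pt})\<otimes>\<^bsub>sec (Spec K) W\<^esub> t = \<one>\<^bsub>sec (Spec K) W\<^esub>"
  unfolding unit_near_def by blast
 hence Wp: "W = {pt}" using open_Spec by blast
 obtain b where b: "b\<in>carrier K" "t = cst K b \<one> {pt}" using sections_cst[OF W(1,3)] Wp by blast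
 have "res (Spec K) {pt} {pt} (cst K a \<one> {pt}) = cst K a \<one> {pt}"
  unfolding Spec_simps cst_def by (auto simp: restrict_def fun_eq_iff)
 hence "cst K (a\<otimes>b) \<one> {pt} = cst K \<one> \<one> {pt}"
  using W(4) b cst_mult1[OF pt_open assms b(1)] unfolding Wp cst_one by simp
 hence "a\<otimes>b = \<one>" using cst_inj[of "a\<otimes>b" \<one>] assms b by simp
 thus "a ~= \<zero>" using b zero_not_one by auto
next
 assume "a ~= \<zero>"
 hence aU: "a\<in>Units K" using assms field_Units by simp
 have r: "res (Spec K) {pt} {pt} (cst K a \<one> {pt}) = cst K a \<one> {pt}"
  unfolding Spec_simps cst_def by (auto simp: restrict_def fun_eq_iff)
 have "cst K a \<one> {pt}\<otimes>\<^bsub>sec (Spec K) {pt}\<^esub> cst K (inv a) \<one> {pt} = \<one>\<^bsub>sec (Spec K) {pt}\<^esub>"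
  using cst_mult1[OF pt_open assms, of "inv a"] aU unfolding cst_one by simp
 thus "unit_near (Spec K) pt {pt} (cst K a \<one> {pt})"
  unfolding unit_near_def using cst_in[OF pt_open, of "inv a"] aU pt_open r
  by (intro exI[of _ "{pt}"] exI[of _ "cst K (inv a) \<one> {pt}"]) simp
qed

lemma germ_unit_cst:
 assumes "a\<in>carrier K"
 shows "germ (Spec K) pt {pt} (cst K a \<one> {pt})\<in>Units (stalk (Spec K) pt) \<longleftrightarrow> a ~= \<zero>"
 using Units_stalk_imp_unit_near[OF presheaf_Spec pt_open _ cst_in[OF pt_open assms], of pt]
  unit_near_imp_Units_stalk[OF presheaf_Spec pt_open _ cst_in[OF pt_open assms], of pt] unit_near_cst[OF assms]
 by auto

end

text \<open>A morphism from the spectrum of a field \<open>K\<close> is a point \<open>\<xi>\<close> with a local homomorphism from the stalk at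
 \<open>\<xi>\<close> to \<open>K\<close>, given here as a compatible family of maps \<open>h V\<close> on sections.\<close>

definition point_data :: "('x, 's) ringed_space => 'a ring => 'x => ('x set => 's => 'a) => bool" where
 "point_data X K \<xi> h \<longleftrightarrow>
   \<xi>\<in>topspace (pts X) &
   (\<forall>V. openin (pts X) V & \<xi>\<in>V -->
    h V\<in>ring_hom (sec X V) K & (\<forall>s\<in>carrier (sec X V). h V s ~= \<zero>\<^bsub>K\<^esub> --> unit_near X \<xi> V s)) &
   (\<forall>V W. openin (pts X) V & openin (pts X) W & \<xi>\<in>W & W<=V -->
    (\<forall>s\<in>carrier (sec X V). h W (res X V W s) = h V s))"

text \<open>If \<xi> is not in \<open>V\<close>, the preimage of \<open>V\<close> is empty and the
  section does not depend on the value \<open>h V s\<close>.\<close>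

definition point_mor :: "('x, 's) ringed_space => 'a ring => 'x => ('x set => 's => 'a) =>
  ('a set => 'x) \<times> ('x set => 's => 'a set => ('a \<times> 'a) set)" where
 "point_mor X K \<xi> h =
   (\<lambda>q\<in>{{\<zero>\<^bsub>K\<^esub>}}. \<xi>,
   \<lambda>V\<in>{V. openin (pts X) V}. \<lambda>s\<in>carrier (sec X V). cst K (h V s) \<one>\<^bsub>K\<^esub> (if \<xi>\<in>V then {{\<zero>\<^bsub>K\<^esub>}} else {}))"

lemma point_dataD:
 assumes "point_data X K \<xi> h"
 shows "\<xi>\<in>topspace (pts X)"
  "openin (pts X) V ==> \<xi>\<in>V ==> h V\<in>ring_hom (sec X V) K"
  "openin (pts X) V ==> \<xi>\<in>V ==> s\<in>carrier (sec X V) ==> h V s ~= \<zero>\<^bsub>K\<^esub> ==> unit_near X \<xi> V s"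
  "openin (pts X) V ==> openin (pts X) W ==> \<xi>\<in>W ==> W<=V ==> s\<in>carrier (sec X V) ==> h W (res X V W s) = h V s"
 using assms unfolding point_data_def by simp_all

lemma cst_empty: "cst K a s {} = (%_. undefined)"
 unfolding cst_def by auto

context plain_field
begin

lemma preim_point: "preim (Spec K) (\<lambda>q\<in>{pt}. \<xi>) V = (if \<xi>\<in>V then {pt} else {})"
 unfolding preim_def top_Spec by auto

text \<open>Locality is the clause of \<open>point_data\<close> on nonzero values: a constant
  section of the spectrum of a field has a unit germ exactly when it is nonzero.\<close>

lemma point_mor_in_hom:
 assumes X: "is_sheaf cring ring_hom (X :: ('x, 's) ringed_space)" and d: "point_data X K \<xi> h"
 shows "point_mor X K \<xi> h\<in>sh_hom ring_hom (Spec K) X"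
proof -
 define D where "D V = (if \<xi>\<in>V then {pt} else {})" for V :: "'x set"
 have Do: "openin (pts (Spec K)) (D V)" for V unfolding D_def open_Spec by simp
 define c where "c = (\<lambda>q\<in>{pt}. \<xi>)"
 define G where "G = (\<lambda>V\<in>{V. openin (pts X) V}. \<lambda>s\<in>carrier (sec X V). cst K (h V s) \<one> (D V))"
 have eq: "point_mor X K \<xi> h = (c, G)" unfolding point_mor_def c_def G_def D_def ..
 have pre: "preim (Spec K) c V = D V" for V unfolding c_def preim_point D_def ..
 have G: "G V s = cst K (h V s) \<one> (D V)" if "openin (pts X) V" "s\<in>carrier (sec X V)" for V s
  unfolding G_def using that by simp
 note pX = sheaf_presheaf[OF X]
 show ?thesis
  unfolding eq sh_hom_def mem_Collect_eq prod.case pre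
 proof (intro conjI allI impI ballI)
  show "continuous_map (pts (Spec K)) (pts X) c"
   unfolding continuous_map_def
  proof (intro conjI allI impI)
   show "c\<in>topspace (pts (Spec K)) \<rightarrow> topspace (pts X)"
    unfolding c_def top_Spec using point_dataD(1)[OF d] by auto
   fix V
   have "{x\<in>topspace (pts (Spec K)). c x\<in>V} = D V" using pre[of V] unfolding preim_def .
   thus "openin (pts (Spec K)) {x\<in>topspace (pts (Spec K)). c x\<in>V}" using Do by simp
  qed
  show "c\<in>extensional (topspace (pts (Spec K)))" unfolding c_def top_Spec by simp
  show "G\<in>extensional {V. openin (pts X) V}" unfolding G_def by simp
  show "G V\<in>extensional (carrier (sec X V))" if "openin (pts X) V" for V unfolding G_def using that by simp
 next
  fix V assume V: "openin (pts X) V"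
  interpret S: cring "sec X V" using is_sheafD(1)[OF X V] .
  show "G V\<in>ring_hom (sec X V) (sec (Spec K) (D V))"
  proof (cases "\<xi>\<in>V")
   case True
   note hV = point_dataD(2)[OF d V True]
   have D: "D V = {pt}" unfolding D_def using True by simp
   show ?thesis
    unfolding D
   proof (rule ring_hom_memI)
    fix s t assume s: "s\<in>carrier (sec X V)" and t: "t\<in>carrier (sec X V)"
    have hs: "h V s\<in>carrier K" "h V t\<in>carrier K" using ring_hom_closed[OF hV] s t by auto
    show "G V s\<in>carrier (sec (Spec K) {pt})" unfolding G[OF V s] D using cst_in[OF pt_open hs(1)] .
    show "G V (s\<otimes>\<^bsub>sec X V\<^esub> t) = G V s\<otimes>\<^bsub>sec (Spec K) {pt}\<^esub> G V t"
     using G[OF V s] G[OF V t] G[OF V S.m_closed[OF s t]] ring_hom_mult[OF hV s t] cst_mult1[OF pt_open hs] D by simp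
    show "G V (s\<oplus>\<^bsub>sec X V\<^esub> t) = G V s\<oplus>\<^bsub>sec (Spec K) {pt}\<^esub> G V t"
     using G[OF V s] G[OF V t] G[OF V S.a_closed[OF s t]] ring_hom_add[OF hV s t] cst_add[OF pt_open hs] D by simp
   next
    show "G V \<one>\<^bsub>sec X V\<^esub> = \<one>\<^bsub>sec (Spec K) {pt}\<^esub>"
     using G[OF V S.one_closed] ring_hom_one[OF hV] D cst_one by simp
   qed
  next
   case False
   hence D: "D V = {}" unfolding D_def by simp
   have e: "(%_. undefined)\<in>carrier (sec (Spec K) {})" unfolding Spec_simps loc_sections_def by simp
   show ?thesis
    unfolding D
    by (rule ring_hom_memI) (use G[OF V] D e in \<open>auto simp: cst_empty Spec_simps\<close>)
  qed
 next
  fix V W s assume a: "openin (pts X) V & openin (pts X) W & W<=V" and s: "s\<in>carrier (sec X V)"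
  have rs: "res X V W s\<in>carrier (sec X W)" using presheaf_closed[OF pX _ _ _ s] a by blast
  show "G W (res X V W s) = res (Spec K) (D V) (D W) (G V s)"
  proof (cases "\<xi>\<in>W")
   case True
   hence D: "D V = {pt}" "D W = {pt}" unfolding D_def using a by auto
   have "h W (res X V W s) = h V s" using point_dataD(4)[OF d _ _ True _ s] a by blast
   thus ?thesis using G[of V s] G[of W "res X V W s"] a s rs D unfolding Spec_simps cst_def by simp
  next
   case False
   hence D: "D W = {}" unfolding D_def by simp
   thus ?thesis using G[of W "res X V W s"] a rs unfolding Spec_simps by (auto simp: cst_empty)
  qed
 next
  fix x V s assume x: "x\<in>topspace (pts (Spec K))" and a: "openin (pts X) V & c x\<in>V" and s: "s\<in>carrier (sec X V)"
   and un: "germ (Spec K) x (D V) (G V s)\<in>Units (stalk (Spec K) x)"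
  have x: "x = pt" using x top_Spec by simp
  hence cx: "c x = \<xi>" unfolding c_def by simp
  hence xi: "\<xi>\<in>V" using a by simp
  have V: "openin (pts X) V" using a by simp
  have hs: "h V s\<in>carrier K" using ring_hom_closed[OF point_dataD(2)[OF d V xi] s] .
  have "D V = {pt}" unfolding D_def using xi by simp
  hence "h V s ~= \<zero>" using un germ_unit_cst[OF hs] G[OF V s] x by simp
  hence "unit_near X \<xi> V s" using point_dataD(3)[OF d V xi s] by blast
  thus "germ X (c x) V s\<in>Units (stalk X (c x))"
   unfolding cx using unit_near_imp_Units_stalk[OF pX V xi s] by blast
 qed
qed

text \<open>Sections over the spectrum of a field are constants, so a morphism can be read as a
  family of values in \<open>K\<close>; locality on stalks says that sections with nonzero value are
  invertible near the image point.\<close>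

lemma hom_is_point_mor:
 assumes X: "is_sheaf cring ring_hom (X :: ('x, 's) ringed_space)" and g: "g\<in>sh_hom ring_hom (Spec K) X"
 shows "\<exists>\<xi> h. point_data X K \<xi> h & g = point_mor X K \<xi> h"
proof -
 obtain c G where gc: "g = (c, G)" by (cases g)
 note H = sh_homD[OF g[unfolded gc]]
 note pX = sheaf_presheaf[OF X]
 define \<xi> where "\<xi> = c pt"
 define D where "D V = (if \<xi>\<in>V then {pt} else {})" for V :: "'x set"
 have Do: "openin (pts (Spec K)) (D V)" for V unfolding D_def open_Spec by simp
 have pre: "preim (Spec K) c V = D V" for V unfolding D_def preim_def top_Spec \<xi>_def by auto
 have xi: "\<xi>\<in>topspace (pts X)" using H(1) unfolding continuous_map_def top_Spec \<xi>_def by auto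
 define h where "h V s = (SOME a. a\<in>carrier K & G V s = cst K a \<one> (D V))" for V s
 have h: "h V s\<in>carrier K" "G V s = cst K (h V s) \<one> (D V)" if "openin (pts X) V" "s\<in>carrier (sec X V)" for V s
 proof -
  have "G V s\<in>carrier (sec (Spec K) (D V))" using ring_hom_closed[OF H(3)[OF that(1)] that(2)] pre by simp
  hence "\<exists>a. a\<in>carrier K & G V s = cst K a \<one> (D V)" using sections_cst[OF Do] by blast
  from someI_ex[OF this] show "h V s\<in>carrier K" "G V s = cst K (h V s) \<one> (D V)" unfolding h_def by blast+
 qed
 have "point_data X K \<xi> h"
  unfolding point_data_def
 proof (intro conjI allI impI ballI)
  show "\<xi>\<in>topspace (pts X)" by fact
  fix V assume V: "openin (pts X) V & \<xi>\<in>V"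
  hence D: "D V = {pt}" unfolding D_def by simp
  have Vo: "openin (pts X) V" using V by simp
  interpret S: cring "sec X V" using is_sheafD(1)[OF X Vo] .
  note GV = H(3)[OF Vo, unfolded pre D]
  show "h V\<in>ring_hom (sec X V) K"
  proof (rule ring_hom_memI)
   fix s t assume s: "s\<in>carrier (sec X V)" and t: "t\<in>carrier (sec X V)"
   show "h V s\<in>carrier K" using h(1)[OF Vo s] .
   have "cst K (h V (s\<otimes>\<^bsub>sec X V\<^esub> t)) \<one> {pt} = cst K (h V s\<otimes>h V t) \<one> {pt}"
    using ring_hom_mult[OF GV s t] h(2)[OF Vo s] h(2)[OF Vo t] h(2)[OF Vo S.m_closed[OF s t]] D
     cst_mult1[OF pt_open h(1)[OF Vo s] h(1)[OF Vo t]] by simp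
   thus "h V (s\<otimes>\<^bsub>sec X V\<^esub> t) = h V s\<otimes>h V t"
    using cst_inj h(1)[OF Vo] S.m_closed[OF s t] s t by simp
   have "cst K (h V (s\<oplus>\<^bsub>sec X V\<^esub> t)) \<one> {pt} = cst K (h V s\<oplus>h V t) \<one> {pt}"
    using ring_hom_add[OF GV s t] h(2)[OF Vo s] h(2)[OF Vo t] h(2)[OF Vo S.a_closed[OF s t]] D
     cst_add[OF pt_open h(1)[OF Vo s] h(1)[OF Vo t]] by simp
   thus "h V (s\<oplus>\<^bsub>sec X V\<^esub> t) = h V s\<oplus>h V t"
    using cst_inj h(1)[OF Vo] S.a_closed[OF s t] s t by simp
  next
   have "cst K (h V \<one>\<^bsub>sec X V\<^esub>) \<one> {pt} = cst K \<one> \<one> {pt}"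
    using ring_hom_one[OF GV] h(2)[OF Vo S.one_closed] D cst_one by simp
   thus "h V \<one>\<^bsub>sec X V\<^esub> = \<one>" using cst_inj h(1)[OF Vo S.one_closed] by simp
  qed
  fix s assume s: "s\<in>carrier (sec X V)" and ne: "h V s ~= \<zero>"
  have "germ (Spec K) pt (preim (Spec K) c V) (G V s)\<in>Units (stalk (Spec K) pt)"
   using germ_unit_cst[OF h(1)[OF Vo s]] ne h(2)[OF Vo s] pre D by simp
  hence "germ X (c pt) V s\<in>Units (stalk X (c pt))"
   using H(7)[of pt V s] Vo V s top_Spec unfolding \<xi>_def by blast
  thus "unit_near X \<xi> V s"
   using Units_stalk_imp_unit_near[OF pX Vo _ s] V unfolding \<xi>_def by blast
 next
  fix V W s assume a: "openin (pts X) V & openin (pts X) W & \<xi>\<in>W & W<=V" and s: "s\<in>carrier (sec X V)"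
  hence D: "D V = {pt}" "D W = {pt}" unfolding D_def by auto
  have rs: "res X V W s\<in>carrier (sec X W)" using presheaf_closed[OF pX _ _ _ s] a by blast
  have "G W (res X V W s) = restrict (G V s) {pt}"
   using H(6)[of V W s] a s unfolding pre D Spec_simps by blast
  hence "cst K (h W (res X V W s)) \<one> {pt} = cst K (h V s) \<one> {pt}"
   using h(2)[of V s] h(2)[of W "res X V W s"] a s rs D unfolding cst_def by simp
  thus "h W (res X V W s) = h V s" using cst_inj h(1) a s rs by blast
 qed
 moreover have "g = point_mor X K \<xi> h"
  unfolding gc point_mor_def prod.inject
 proof
  show "c = (\<lambda>q\<in>{pt}. \<xi>)"
   using H(2) unfolding top_Spec \<xi>_def by (intro extensionalityI[of _ "{pt}"]) auto
  show "G = (\<lambda>V\<in>{V. openin (pts X) V}. \<lambda>s\<in>carrier (sec X V). cst K (h V s) \<one> (if \<xi>\<in>V then {pt} else {}))"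
  proof (rule extensionalityI[OF H(5)])
   fix V assume "V\<in>{V. openin (pts X) V}"
   hence V: "openin (pts X) V" by simp
   have "G V = (\<lambda>s\<in>carrier (sec X V). cst K (h V s) \<one> (if \<xi>\<in>V then {pt} else {}))"
    by (rule extensionalityI[OF H(4)[OF V]]) (use h(2)[OF V] in \<open>auto simp: D_def\<close>)
   thus "G V = (\<lambda>V\<in>{V. openin (pts X) V}. \<lambda>s\<in>carrier (sec X V). cst K (h V s) \<one> (if \<xi>\<in>V then {pt} else {})) V"
    using V by simp
  qed simp
 qed
 ultimately show ?thesis by blast
qed

lemma point_mor_inj:
 assumes d: "point_data X K \<xi> h" "point_data X K \<xi>' h'" and eq: "point_mor X K \<xi> h = point_mor X K \<xi>' h'"
 shows "\<xi> = \<xi>'" "openin (pts X) V ==> \<xi>\<in>V ==> s\<in>carrier (sec X V) ==> h V s = h' V s"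
proof -
 have e: "(\<lambda>q\<in>{pt}. \<xi>) = (\<lambda>q\<in>{pt}. \<xi>')"
  "(\<lambda>V\<in>{V. openin (pts X) V}. \<lambda>s\<in>carrier (sec X V). cst K (h V s) \<one> (if \<xi>\<in>V then {pt} else {}))
   = (\<lambda>V\<in>{V. openin (pts X) V}. \<lambda>s\<in>carrier (sec X V). cst K (h' V s) \<one> (if \<xi>'\<in>V then {pt} else {}))"
  using eq unfolding point_mor_def by auto
 show x: "\<xi> = \<xi>'" using fun_cong[OF e(1), of pt] by simp
 assume V: "openin (pts X) V" "\<xi>\<in>V" "s\<in>carrier (sec X V)"
 have "cst K (h V s) \<one> {pt} = cst K (h' V s) \<one> {pt}"
  using fun_cong[OF fun_cong[OF e(2), of V], of s] V x by simp
 thus "h V s = h' V s"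
  using cst_inj ring_hom_closed[OF point_dataD(2)[OF d(1) V(1,2)] V(3)]
   ring_hom_closed[OF point_dataD(2)[OF d(2) V(1)] V(3)] V(2) x by blast
qed

text \<open>Composition with the map of spectra induced by the inclusion of a subfield leaves \<xi>
  and \<open>h\<close> unchanged; the same values are merely read in the larger field. Descent of a
  morphism thus becomes a condition on its values.\<close>

lemma point_mor_subfield:
 assumes K': "subfield K' K" and d: "point_data X (K\<lparr>carrier := K'\<rparr>) \<xi> h"
 shows "point_data X K \<xi> h"
  and "sh_comp (Spec K) (Spec (K\<lparr>carrier := K'\<rparr>)) X (point_mor X (K\<lparr>carrier := K'\<rparr>) \<xi> h)
   (Spec_map (K\<lparr>carrier := K'\<rparr>) K (\<lambda>x\<in>K'. x)) = point_mor X K \<xi> h"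
proof -
 define K1 where "K1 = K\<lparr>carrier := K'\<rparr>"
 have K1s: "carrier K1 = K'" "\<zero>\<^bsub>K1\<^esub> = \<zero>" "\<one>\<^bsub>K1\<^esub> = \<one>" "mult K1 = mult K" "add K1 = add K"
  unfolding K1_def by simp_all
 have sub: "K'<=carrier K" using subfieldE(3)[OF K'] .
 interpret K1: plain_field K1
  unfolding plain_field_def K1_def using subfield_iff(2)[OF K'] .
 have hom: "ring_hom (sec X V) K1<=ring_hom (sec X V) K" for V
  unfolding ring_hom_def K1s using sub by auto
 show "point_data X K \<xi> h"
  unfolding point_data_def
 proof (intro conjI allI impI ballI)
  note d1 = point_dataD[OF d[folded K1_def]]
  show "\<xi>\<in>topspace (pts X)" by (rule d1(1))
  fix V assume V: "openin (pts X) V & \<xi>\<in>V"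
  show "h V\<in>ring_hom (sec X V) K" using d1(2)[of V] hom[of V] V by auto
  show "unit_near X \<xi> V s" if "s\<in>carrier (sec X V)" "h V s ~= \<zero>" for s
   using d1(3)[of V s] V that K1s(2) by simp
 next
  fix V W s assume "openin (pts X) V & openin (pts X) W & \<xi>\<in>W & W<=V" "s\<in>carrier (sec X V)"
  thus "h W (res X V W s) = h V s" using point_dataD(4)[OF d[folded K1_def], of V W s] by simp
 qed
 define D where "D V = (if \<xi>\<in>V then {pt} else {})" for V :: "'b set"
 have Do: "openin (pts (Spec K1)) (D V)" for V unfolding D_def K1.open_Spec K1s by simp
 define c where "c = (\<lambda>q\<in>{pt}. {a\<in>K'. (\<lambda>x\<in>K'. x) a\<in>q})"
 have cpt: "c pt = pt" unfolding c_def using subringE(2)[OF subfieldE(1)[OF K']] by auto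
 have top: "topspace (pts (Spec K)) = {pt}" "topspace (pts (Spec K1)) = {pt}"
  using top_Spec K1.top_Spec K1s by simp_all
 have fst_map: "fst (Spec_map K1 K (\<lambda>x\<in>K'. x)) = c"
  unfolding spectral_map_def Let_def top K1s c_def by simp
 have pre_c: "preim (Spec K) c (D V) = D V" for V :: "'b set"
  unfolding preim_def top D_def using cpt by auto
 have p1: "fst (point_mor X K1 \<xi> h) = (\<lambda>q\<in>{pt}. \<xi>)" unfolding point_mor_def K1s by simp
 have snd_map: "snd (Spec_map K1 K (\<lambda>x\<in>K'. x)) (D V) (cst K1 a \<one> (D V)) = cst K a \<one> (D V)"
  if a: "a\<in>K'" for a and V :: "'b set"
 proof -
  have "cst K1 a \<one> (D V)\<in>carrier (sec (Spec K1) (D V))"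
   using K1.cst_in[OF Do] a unfolding K1s by blast
  hence e: "snd (Spec_map K1 K (\<lambda>x\<in>K'. x)) (D V) (cst K1 a \<one> (D V))
    = (\<lambda>q\<in>D V. \<Union>(b, t)\<in>cst K1 a \<one> (D V) (c q). loc_frac K (carrier K - q) ((\<lambda>x\<in>K'. x) b) ((\<lambda>x\<in>K'. x) t))"
   unfolding spectral_map_def Let_def top K1s using Do pre_c unfolding c_def by simp
  show ?thesis
   unfolding e unfolding cst_def[of K]
  proof (rule restrict_ext)
   fix q assume q: "q\<in>D V"
   hence qp: "q = pt" and DV: "D V = {pt}" unfolding D_def by (auto split: if_splits)
   have cq: "cst K1 a \<one> (D V) (c q) = loc_frac K1 (K' - pt) a \<one>" unfolding cst_def qp cpt DV K1s by simp
   interpret L1: loc_ring K1 "K' - pt"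
    using K1.Spec_loc[OF K1.pt_open, of pt] unfolding K1s by simp
   interpret L: loc_ring K "carrier K - pt"
    using Spec_loc[OF pt_open, of pt] by simp
   have aK1: "a\<in>carrier K1" "\<one>\<in>K' - pt" using a L1.S(2) K1s by auto
   have "loc_frac K (carrier K - pt) ((\<lambda>x\<in>K'. x) b) ((\<lambda>x\<in>K'. x) t) = loc_frac K (carrier K - pt) a \<one>"
    if bt: "(b, t)\<in>loc_frac K1 (K' - pt) a \<one>" for b t
   proof -
    have b: "b\<in>K'" "t\<in>K' - pt" "\<exists>u\<in>K' - pt. u\<otimes>(a\<otimes>t) = u\<otimes>(b\<otimes>\<one>)"
     using L1.loc_fracD[OF bt] unfolding K1s by auto
    have cl: "b\<in>carrier K" "t\<in>carrier K - pt" "a\<in>carrier K" using b sub a by auto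
    obtain u where u: "u\<in>carrier K - pt" "u\<otimes>(a\<otimes>t) = u\<otimes>(b\<otimes>\<one>)" using b(3) sub by blast
    hence "\<exists>u\<in>carrier K - pt. u\<otimes>(b\<otimes>\<one>) = u\<otimes>(a\<otimes>t)" by metis
    thus ?thesis using L.loc_frac_eq_iff[OF cl(1,2,3) L.S(2)] b by simp
   qed
   thus "(\<Union>(b, t)\<in>cst K1 a \<one> (D V) (c q). loc_frac K (carrier K - q) ((\<lambda>x\<in>K'. x) b) ((\<lambda>x\<in>K'. x) t))
     = loc_frac K (carrier K - q) a \<one>"
    unfolding qp cq[unfolded qp] by (intro UN_constant_eq[OF L1.loc_frac_refl[OF aK1]]) auto
  qed
 qed
 have sndp: "snd (point_mor X K1 \<xi> h) = (\<lambda>V\<in>{V. openin (pts X) V}. \<lambda>s\<in>carrier (sec X V). cst K1 (h V s) \<one> (D V))"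
  unfolding point_mor_def K1s D_def by simp
 have hK': "cst K1 (h V s) \<one> (D V) = cst K1 a \<one> (D V) & cst K (h V s) \<one> (D V) = cst K a \<one> (D V)"
  if "a = (if \<xi>\<in>V then h V s else \<one>)" for V s a
  using that unfolding D_def by (auto simp: cst_empty)
 have comp: "compose (carrier (sec X V)) (snd (Spec_map K1 K (\<lambda>x\<in>K'. x)) (preim (Spec K1) (fst (point_mor X K1 \<xi> h)) V))
   (snd (point_mor X K1 \<xi> h) V) = (\<lambda>s\<in>carrier (sec X V). cst K (h V s) \<one> (D V))" if V: "openin (pts X) V" for V
 proof -
  have pr: "preim (Spec K1) (fst (point_mor X K1 \<xi> h)) V = D V"
   unfolding p1 using K1.preim_point[of \<xi> V] unfolding K1s D_def .
  show ?thesis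
   unfolding pr compose_def sndp
  proof (rule restrict_ext)
   fix s assume s: "s\<in>carrier (sec X V)"
   \<comment> \<open>For \<xi> outside \<open>V\<close> nothing is known about \<open>h V s\<close>.
     The section then lives over the empty set and 1 may replace the value, so that \<open>a\<close>
     is in the subfield in every case.\<close>
   define a where "a = (if \<xi>\<in>V then h V s else \<one>)"
   have a: "a\<in>K'"
    unfolding a_def using ring_hom_closed[OF point_dataD(2)[OF d[folded K1_def] V] s] K1.one_closed unfolding K1s by simp
   show "snd (Spec_map K1 K (\<lambda>x\<in>K'. x)) (D V)
     ((\<lambda>V\<in>{V. openin (pts X) V}. \<lambda>s\<in>carrier (sec X V). cst K1 (h V s) \<one> (D V)) V s) = cst K (h V s) \<one> (D V)"
    using V s hK'[OF a_def] snd_map[OF a] by simp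
  qed
 qed
 have one: "compose (topspace (pts (Spec K))) (fst (point_mor X K1 \<xi> h)) (fst (Spec_map K1 K (\<lambda>x\<in>K'. x))) = (\<lambda>q\<in>{pt}. \<xi>)"
  unfolding fst_map p1 top compose_def using cpt by (intro restrict_ext) auto
 have two: "(\<lambda>W\<in>{W. openin (pts X) W}. compose (carrier (sec X W))
   (snd (Spec_map K1 K (\<lambda>x\<in>K'. x)) (preim (Spec K1) (fst (point_mor X K1 \<xi> h)) W)) (snd (point_mor X K1 \<xi> h) W))
   = (\<lambda>W\<in>{W. openin (pts X) W}. \<lambda>s\<in>carrier (sec X W). cst K (h W s) \<one> (D W))"
  using comp by (intro restrict_ext) auto
 show "sh_comp (Spec K) (Spec (K\<lparr>carrier := K'\<rparr>)) X (point_mor X (K\<lparr>carrier := K'\<rparr>) \<xi> h)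
   (Spec_map (K\<lparr>carrier := K'\<rparr>) K (\<lambda>x\<in>K'. x)) = point_mor X K \<xi> h"
  unfolding K1_def[symmetric] sh_comp_def one two point_mor_def[of X K] D_def ..
qed

end

section \<open>Extending a residue map to a point with values in a field\<close>

context chart
begin

definition \<rho>r :: "'x set => 'r => 's" where "\<rho>r W r = res X U W (\<rho> r)"

lemma \<rho>r_hom: "openin (pts X) W ==> W<=U ==> \<rho>r W\<in>ring_hom R (sec X W)"
 using ring_hom_trans[OF \<rho>_hom is_sheafD(2)[OF sheaf U, of W]] unfolding \<rho>r_def comp_def by simp

lemma \<rho>r_res: "openin (pts X) W ==> openin (pts X) V ==> V<=W ==> W<=U ==> r\<in>carrier R ==>
  res X W V (\<rho>r W r) = \<rho>r V r"
 unfolding \<rho>r_def using presheaf_comp[OF pre U, of W V "\<rho> r"] \<rho>_closed by simp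

lemma \<rho>r_U: "r\<in>carrier R ==> \<rho>r U r = \<rho> r"
 unfolding \<rho>r_def using presheaf_id[OF pre U \<rho>_closed] .

text \<open>The witnesses of \<open>section_is_fraction\<close> under a name: well-definedness and
  additivity require moving several fractions to one neighbourhood.\<close>

definition is_frac :: "'x => 'x set => 's => 'r => 'r => 'x set => bool" where
 "is_frac x V s a b W \<longleftrightarrow> a\<in>carrier R & b\<in>carrier R & b\<notin>f x & openin (pts X) W & x\<in>W & W<=U\<inter>V &
   res X V W s\<otimes>\<^bsub>sec X W\<^esub> \<rho>r W b = \<rho>r W a"

lemma is_frac_exists:
 "openin (pts X) V ==> s\<in>carrier (sec X V) ==> x\<in>V ==> x\<in>U ==> \<exists>a b W. is_frac x V s a b W"
 using section_is_fraction unfolding is_frac_def \<rho>r_def by blast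

lemma is_frac_shrink:
 assumes V: "openin (pts X) V" "s\<in>carrier (sec X V)" and fr: "is_frac x V s a b W"
  and W': "openin (pts X) W'" "x\<in>W'" "W'<=W"
 shows "is_frac x V s a b W'"
proof -
 have a: "a\<in>carrier R" "b\<in>carrier R" and W: "openin (pts X) W" "W<=U" "W<=V"
  and eq: "res X V W s\<otimes>\<^bsub>sec X W\<^esub> \<rho>r W b = \<rho>r W a" using fr unfolding is_frac_def by auto
 have sW: "res X V W s\<in>carrier (sec X W)" using presheaf_closed[OF pre V(1) W(1,3) V(2)] .
 have bW: "\<rho>r W b\<in>carrier (sec X W)" using ring_hom_closed[OF \<rho>r_hom[OF W(1,2)] a(2)] .
 have "res X V W' s\<otimes>\<^bsub>sec X W'\<^esub> \<rho>r W' b = res X W W' (res X V W s)\<otimes>\<^bsub>sec X W'\<^esub> res X W W' (\<rho>r W b)"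
  using presheaf_comp[OF pre V(1) W(1) W'(1,3) W(3) V(2)] \<rho>r_res[OF W(1) W'(1,3) W(2) a(2)] by simp
 also have "... = res X W W' (\<rho>r W a)" using presheaf_mult[OF pre W(1) W'(1,3) sW bW] eq by simp
 also have "... = \<rho>r W' a" using \<rho>r_res[OF W(1) W'(1,3) W(2) a(1)] .
 finally show ?thesis using fr W' unfolding is_frac_def by auto
qed

lemma is_frac_common:
 assumes V: "openin (pts X) V" "s\<in>carrier (sec X V)" and V': "openin (pts X) V'" "s'\<in>carrier (sec X V')"
  and fr: "is_frac x V s a b W" "is_frac x V' s' a' b' W'"
 shows "\<exists>W. is_frac x V s a b W & is_frac x V' s' a' b' W"
proof -
 have o: "openin (pts X) (W\<inter>W')" "x\<in>W\<inter>W'" using fr unfolding is_frac_def by auto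
 thus ?thesis
  using is_frac_shrink[OF V fr(1) o] is_frac_shrink[OF V' fr(2) o] by auto
qed

end

text \<open>A homomorphism from \<open>R\<close> to a field whose kernel is the prime of x embeds
  the residue ring at x. The locale extends it to all sections near x and so to a morphism from the
  spectrum of the field with image x.\<close>

locale chart_point = chart X U R f F + K: plain_field K
 for X :: "('x, 's) ringed_space" and U :: "'x set" and R :: "'r ring"
  and f :: "'x => 'r set" and F :: "'r set set => ('r set => ('r \<times> 'r) set) => 's" and K :: "'a ring" +
 fixes \<psi> :: "'r => 'a" and x :: 'x
 assumes \<psi>: "\<psi>\<in>ring_hom R K" and x: "x\<in>U" and ker: "!!r. r\<in>carrier R ==> \<psi> r = \<zero>\<^bsub>K\<^esub> \<longleftrightarrow> r\<in>f x"
begin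

lemma \<psi>_closed: "r\<in>carrier R ==> \<psi> r\<in>carrier K" using ring_hom_closed[OF \<psi>] .

definition value_at :: "'x set => 's => 'a => bool" where
 "value_at V s k \<longleftrightarrow> k\<in>carrier K & (\<exists>a b W. is_frac x V s a b W & k\<otimes>\<^bsub>K\<^esub> \<psi> b = \<psi> a)"

lemma value_exists:
 assumes "openin (pts X) V" "s\<in>carrier (sec X V)" "x\<in>V"
 shows "\<exists>k. value_at V s k"
proof -
 obtain a b W where fr: "is_frac x V s a b W" using is_frac_exists[OF assms x] by blast
 hence ab: "a\<in>carrier R" "b\<in>carrier R" "b\<notin>f x" unfolding is_frac_def by auto
 have u: "\<psi> b\<in>Units K" using ker[OF ab(2)] ab K.field_Units \<psi>_closed by auto
 have "\<psi> a\<otimes>\<^bsub>K\<^esub> inv\<^bsub>K\<^esub> (\<psi> b)\<otimes>\<^bsub>K\<^esub> \<psi> b = \<psi> a"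
  using K.m_assoc[OF \<psi>_closed[OF ab(1)] K.Units_inv_closed[OF u] K.Units_closed[OF u]] K.Units_l_inv[OF u]
   \<psi>_closed[OF ab(1)] by simp
 moreover have "\<psi> a\<otimes>\<^bsub>K\<^esub> inv\<^bsub>K\<^esub> (\<psi> b)\<in>carrier K" using u \<psi>_closed[OF ab(1)] by simp
 ultimately show ?thesis unfolding value_at_def using fr by blast
qed

text \<open>Two fractions for the same section are equal in the localisation at \<open>f x\<close>.
  Applying \<psi>, which is nonzero outside \<open>f x\<close>, gives equal quotients in the
  field.\<close>

lemma value_unique:
 assumes V: "openin (pts X) V" "s\<in>carrier (sec X V)" and k: "value_at V s k" "value_at V s k'"
 shows "k = k'"
proof -
 obtain a b W0 where fr0: "is_frac x V s a b W0" and kk: "k\<in>carrier K" "k\<otimes>\<^bsub>K\<^esub> \<psi> b = \<psi> a" using k(1) unfolding value_at_def by blast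
 obtain a' b' W1 where fr1: "is_frac x V s a' b' W1" and kk': "k'\<in>carrier K" "k'\<otimes>\<^bsub>K\<^esub> \<psi> b' = \<psi> a'" using k(2) unfolding value_at_def by blast
 obtain W where fr: "is_frac x V s a b W" "is_frac x V s a' b' W" using is_frac_common[OF V V fr0 fr1] by blast
 have ab: "a\<in>carrier R" "b\<in>carrier R" "b\<notin>f x" "a'\<in>carrier R" "b'\<in>carrier R" "b'\<notin>f x"
  and W: "openin (pts X) W" "x\<in>W" "W<=U" "W<=V"
  and eq: "res X V W s\<otimes>\<^bsub>sec X W\<^esub> \<rho>r W b = \<rho>r W a" "res X V W s\<otimes>\<^bsub>sec X W\<^esub> \<rho>r W b' = \<rho>r W a'"
  using fr unfolding is_frac_def by auto
 interpret S: cring "sec X W" using is_sheafD(1)[OF sheaf W(1)] .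
 note rh = \<rho>r_hom[OF W(1,3)]
 have sW: "res X V W s\<in>carrier (sec X W)" using presheaf_closed[OF pre V(1) W(1,4) V(2)] .
 have rc: "\<rho>r W r\<in>carrier (sec X W)" if "r\<in>carrier R" for r using ring_hom_closed[OF rh that] .
 have "\<rho>r W (a\<otimes>\<^bsub>R\<^esub> b') = (res X V W s\<otimes>\<^bsub>sec X W\<^esub> \<rho>r W b)\<otimes>\<^bsub>sec X W\<^esub> \<rho>r W b'"
  using ring_hom_mult[OF rh ab(1,5)] eq by simp
 also have "... = (res X V W s\<otimes>\<^bsub>sec X W\<^esub> \<rho>r W b')\<otimes>\<^bsub>sec X W\<^esub> \<rho>r W b"
  using sW rc ab by (simp add: S.m_ac)
 also have "... = \<rho>r W (a'\<otimes>\<^bsub>R\<^esub> b)" using ring_hom_mult[OF rh ab(4,2)] eq by simp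
 finally obtain u where u: "u\<in>carrier R" "u\<notin>f x" "u\<otimes>\<^bsub>R\<^esub> (a\<otimes>\<^bsub>R\<^esub> b') = u\<otimes>\<^bsub>R\<^esub> (a'\<otimes>\<^bsub>R\<^esub> b)"
  using \<rho>_eqD[OF W(1,3,2) R.m_closed[OF ab(1,5)] R.m_closed[OF ab(4,2)]] unfolding \<rho>r_def by blast
 have "\<psi> u\<otimes>\<^bsub>K\<^esub> (\<psi> a\<otimes>\<^bsub>K\<^esub> \<psi> b') = \<psi> u\<otimes>\<^bsub>K\<^esub> (\<psi> a'\<otimes>\<^bsub>K\<^esub> \<psi> b)"
  using arg_cong[OF u(3), of \<psi>] u(1) ab ring_hom_mult[OF \<psi>] by simp
 hence "\<psi> a\<otimes>\<^bsub>K\<^esub> \<psi> b' = \<psi> a'\<otimes>\<^bsub>K\<^esub> \<psi> b"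
  using K.m_lcancel[of "\<psi> u"] ker[OF u(1)] u ab \<psi>_closed by simp
 hence "k\<otimes>\<^bsub>K\<^esub> (\<psi> b\<otimes>\<^bsub>K\<^esub> \<psi> b') = k'\<otimes>\<^bsub>K\<^esub> (\<psi> b\<otimes>\<^bsub>K\<^esub> \<psi> b')"
  using kk kk' ab \<psi>_closed by (metis K.m_assoc K.m_comm)
 moreover have "\<psi> b\<otimes>\<^bsub>K\<^esub> \<psi> b' ~= \<zero>\<^bsub>K\<^esub>" using K.integral ker ab \<psi>_closed by blast
 ultimately show ?thesis using K.m_rcancel[of "\<psi> b\<otimes>\<^bsub>K\<^esub> \<psi> b'" k k'] kk kk' ab \<psi>_closed by simp
qed

definition hh :: "'x set => 's => 'a" where "hh V s = (SOME k. value_at V s k)"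

lemma hh_value: "openin (pts X) V ==> s\<in>carrier (sec X V) ==> x\<in>V ==> value_at V s (hh V s)"
 unfolding hh_def using someI_ex[OF value_exists] by blast

lemma hh_eqI: "openin (pts X) V ==> s\<in>carrier (sec X V) ==> x\<in>V ==> value_at V s k ==> hh V s = k"
 using value_unique[OF _ _ hh_value] by blast

lemma hh_ring_hom:
 assumes V: "openin (pts X) V" "x\<in>V"
 shows "hh V\<in>ring_hom (sec X V) K"
proof -
 interpret T: cring "sec X V" using is_sheafD(1)[OF sheaf V(1)] .
 \<comment> \<open>If s = a/b and t = a'/b' near x, then b b' serves as denominator of both the
   product and the sum.\<close>
 have two: "value_at V (s\<otimes>\<^bsub>sec X V\<^esub> t) (hh V s\<otimes>\<^bsub>K\<^esub> hh V t) & value_at V (s\<oplus>\<^bsub>sec X V\<^esub> t) (hh V s\<oplus>\<^bsub>K\<^esub> hh V t)"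
  if s: "s\<in>carrier (sec X V)" and t: "t\<in>carrier (sec X V)" for s t
 proof -
  obtain a b W0 where fr0: "is_frac x V s a b W0" and kk: "hh V s\<in>carrier K" "hh V s\<otimes>\<^bsub>K\<^esub> \<psi> b = \<psi> a"
   using hh_value[OF V(1) s V(2)] unfolding value_at_def by blast
  obtain a' b' W1 where fr1: "is_frac x V t a' b' W1" and kk': "hh V t\<in>carrier K" "hh V t\<otimes>\<^bsub>K\<^esub> \<psi> b' = \<psi> a'"
   using hh_value[OF V(1) t V(2)] unfolding value_at_def by blast
  obtain W where fr: "is_frac x V s a b W" "is_frac x V t a' b' W" using is_frac_common[OF V(1) s V(1) t fr0 fr1] by blast
  have ab: "a\<in>carrier R" "b\<in>carrier R" "b\<notin>f x" "a'\<in>carrier R" "b'\<in>carrier R" "b'\<notin>f x"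
   and W: "openin (pts X) W" "x\<in>W" "W<=U" "W<=V"
   and eq: "res X V W s\<otimes>\<^bsub>sec X W\<^esub> \<rho>r W b = \<rho>r W a" "res X V W t\<otimes>\<^bsub>sec X W\<^esub> \<rho>r W b' = \<rho>r W a'"
   using fr unfolding is_frac_def by auto
  interpret S: cring "sec X W" using is_sheafD(1)[OF sheaf W(1)] .
  interpret P: primeideal "f x" R using f_prime[OF x] .
  note rh = \<rho>r_hom[OF W(1,3)]
  note resh = is_sheafD(2)[OF sheaf V(1) W(1,4)]
  have sW: "res X V W s\<in>carrier (sec X W)" "res X V W t\<in>carrier (sec X W)" using ring_hom_closed[OF resh] s t by auto
  have rc: "\<rho>r W r\<in>carrier (sec X W)" if "r\<in>carrier R" for r using ring_hom_closed[OF rh that] .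
  have bb: "b\<otimes>\<^bsub>R\<^esub> b'\<in>carrier R" "b\<otimes>\<^bsub>R\<^esub> b'\<notin>f x" using ab P.I_prime by auto
  have "res X V W (s\<otimes>\<^bsub>sec X V\<^esub> t)\<otimes>\<^bsub>sec X W\<^esub> \<rho>r W (b\<otimes>\<^bsub>R\<^esub> b')
    = (res X V W s\<otimes>\<^bsub>sec X W\<^esub> \<rho>r W b)\<otimes>\<^bsub>sec X W\<^esub> (res X V W t\<otimes>\<^bsub>sec X W\<^esub> \<rho>r W b')"
   unfolding ring_hom_mult[OF resh s t] ring_hom_mult[OF rh ab(2,5)] using sW rc[OF ab(2)] rc[OF ab(5)] by (simp add: S.m_ac)
  also have "... = \<rho>r W (a\<otimes>\<^bsub>R\<^esub> a')" unfolding eq using ring_hom_mult[OF rh ab(1,4)] by simp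
  finally have 1: "is_frac x V (s\<otimes>\<^bsub>sec X V\<^esub> t) (a\<otimes>\<^bsub>R\<^esub> a') (b\<otimes>\<^bsub>R\<^esub> b') W"
   unfolding is_frac_def using ab bb W by simp
  have "res X V W (s\<oplus>\<^bsub>sec X V\<^esub> t)\<otimes>\<^bsub>sec X W\<^esub> \<rho>r W (b\<otimes>\<^bsub>R\<^esub> b')
    = (res X V W s\<otimes>\<^bsub>sec X W\<^esub> \<rho>r W b)\<otimes>\<^bsub>sec X W\<^esub> \<rho>r W b'\<oplus>\<^bsub>sec X W\<^esub> (res X V W t\<otimes>\<^bsub>sec X W\<^esub> \<rho>r W b')\<otimes>\<^bsub>sec X W\<^esub> \<rho>r W b"
   unfolding ring_hom_add[OF resh s t] ring_hom_mult[OF rh ab(2,5)] using sW rc[OF ab(2)] rc[OF ab(5)] by (simp add: S.l_distr S.r_distr S.m_ac)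
  also have "... = \<rho>r W (a\<otimes>\<^bsub>R\<^esub> b'\<oplus>\<^bsub>R\<^esub> a'\<otimes>\<^bsub>R\<^esub> b)"
   unfolding eq using ring_hom_add[OF rh R.m_closed[OF ab(1,5)] R.m_closed[OF ab(4,2)]] ring_hom_mult[OF rh ab(1,5)] ring_hom_mult[OF rh ab(4,2)] by simp
  finally have 2: "is_frac x V (s\<oplus>\<^bsub>sec X V\<^esub> t) (a\<otimes>\<^bsub>R\<^esub> b'\<oplus>\<^bsub>R\<^esub> a'\<otimes>\<^bsub>R\<^esub> b) (b\<otimes>\<^bsub>R\<^esub> b') W"
   unfolding is_frac_def using ab bb W by simp
  note pc = \<psi>_closed[OF ab(1)] \<psi>_closed[OF ab(2)] \<psi>_closed[OF ab(4)] \<psi>_closed[OF ab(5)]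
  have "(hh V s\<otimes>\<^bsub>K\<^esub> hh V t)\<otimes>\<^bsub>K\<^esub> \<psi> (b\<otimes>\<^bsub>R\<^esub> b') = (hh V s\<otimes>\<^bsub>K\<^esub> \<psi> b)\<otimes>\<^bsub>K\<^esub> (hh V t\<otimes>\<^bsub>K\<^esub> \<psi> b')"
   unfolding ring_hom_mult[OF \<psi> ab(2,5)] using kk(1) kk'(1) pc by (simp add: K.m_ac)
  hence 3: "(hh V s\<otimes>\<^bsub>K\<^esub> hh V t)\<otimes>\<^bsub>K\<^esub> \<psi> (b\<otimes>\<^bsub>R\<^esub> b') = \<psi> (a\<otimes>\<^bsub>R\<^esub> a')"
   using kk(2) kk'(2) ring_hom_mult[OF \<psi> ab(1,4)] by simp
  have "(hh V s\<oplus>\<^bsub>K\<^esub> hh V t)\<otimes>\<^bsub>K\<^esub> \<psi> (b\<otimes>\<^bsub>R\<^esub> b')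
    = (hh V s\<otimes>\<^bsub>K\<^esub> \<psi> b)\<otimes>\<^bsub>K\<^esub> \<psi> b'\<oplus>\<^bsub>K\<^esub> (hh V t\<otimes>\<^bsub>K\<^esub> \<psi> b')\<otimes>\<^bsub>K\<^esub> \<psi> b"
   unfolding ring_hom_mult[OF \<psi> ab(2,5)] using kk(1) kk'(1) pc by (simp add: K.l_distr K.r_distr K.m_ac)
  hence 4: "(hh V s\<oplus>\<^bsub>K\<^esub> hh V t)\<otimes>\<^bsub>K\<^esub> \<psi> (b\<otimes>\<^bsub>R\<^esub> b') = \<psi> (a\<otimes>\<^bsub>R\<^esub> b'\<oplus>\<^bsub>R\<^esub> a'\<otimes>\<^bsub>R\<^esub> b)"
   using kk(2) kk'(2) ring_hom_add[OF \<psi> R.m_closed[OF ab(1,5)] R.m_closed[OF ab(4,2)]] ring_hom_mult[OF \<psi> ab(1,5)] ring_hom_mult[OF \<psi> ab(4,2)] by simp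
  show ?thesis
   unfolding value_at_def using 1 2 3 4 K.m_closed[OF kk(1) kk'(1)] K.a_closed[OF kk(1) kk'(1)] by blast
 qed
 show ?thesis
 proof (rule ring_hom_memI)
  fix s t assume s: "s\<in>carrier (sec X V)" and t: "t\<in>carrier (sec X V)"
  show "hh V s\<in>carrier K" using hh_value[OF V(1) s V(2)] unfolding value_at_def by blast
  show "hh V (s\<otimes>\<^bsub>sec X V\<^esub> t) = hh V s\<otimes>\<^bsub>K\<^esub> hh V t" "hh V (s\<oplus>\<^bsub>sec X V\<^esub> t) = hh V s\<oplus>\<^bsub>K\<^esub> hh V t"
   using hh_eqI[OF V(1) T.m_closed[OF s t] V(2)] hh_eqI[OF V(1) T.a_closed[OF s t] V(2)] two[OF s t] by auto
 next
  define W where "W = U\<inter>V"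
  have W: "openin (pts X) W" "x\<in>W" "W<=U" "W<=V" unfolding W_def using U V x by auto
  interpret S: cring "sec X W" using is_sheafD(1)[OF sheaf W(1)] .
  have "is_frac x V \<one>\<^bsub>sec X V\<^esub> \<one>\<^bsub>R\<^esub> \<one>\<^bsub>R\<^esub> W"
   unfolding is_frac_def
   using W R.prime_no_one[OF f_prime[OF x]] presheaf_one[OF pre V(1) W(1,4)] ring_hom_one[OF \<rho>r_hom[OF W(1,3)]] by simp
  hence "value_at V \<one>\<^bsub>sec X V\<^esub> \<one>\<^bsub>K\<^esub>"
   unfolding value_at_def using ring_hom_one[OF \<psi>] K.one_closed K.l_one[OF K.one_closed] by metis
  thus "hh V \<one>\<^bsub>sec X V\<^esub> = \<one>\<^bsub>K\<^esub>" using hh_eqI[OF V(1) T.one_closed V(2)] by blast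
 qed
qed

text \<open>A section a/b with nonzero value has \<open>a\<close> outside \<open>f x\<close>, so
  \<rho> a is invertible near x, and \<rho> b times its inverse is an inverse of the
  section.\<close>

lemma hh_point_data: "point_data X K x hh"
 unfolding point_data_def
proof (intro conjI allI impI ballI)
 show "x\<in>topspace (pts X)" using x openin_subset[OF U] by blast
 fix V assume V: "openin (pts X) V & x\<in>V"
 show "hh V\<in>ring_hom (sec X V) K" using hh_ring_hom V by blast
 fix s assume s: "s\<in>carrier (sec X V)" and ne: "hh V s ~= \<zero>\<^bsub>K\<^esub>"
 obtain a b W0 where fr0: "is_frac x V s a b W0" and kk: "hh V s\<in>carrier K" "hh V s\<otimes>\<^bsub>K\<^esub> \<psi> b = \<psi> a"
  using hh_value[OF _ s] V unfolding value_at_def by blast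
 have ab: "a\<in>carrier R" "b\<in>carrier R" "b\<notin>f x" using fr0 unfolding is_frac_def by auto
 have "\<psi> a ~= \<zero>\<^bsub>K\<^esub>" using kk ne ker ab K.integral \<psi>_closed by metis
 hence "unit_near X x U (\<rho> a)" using unit_near_\<rho>[OF x ab(1)] ker[OF ab(1)] by blast
 then obtain W1 t where W1: "openin (pts X) W1" "x\<in>W1" "W1<=U" "t\<in>carrier (sec X W1)"
  "\<rho>r W1 a\<otimes>\<^bsub>sec X W1\<^esub> t = \<one>\<^bsub>sec X W1\<^esub>" unfolding unit_near_def \<rho>r_def by blast
 define W where "W = W0\<inter>W1"
 have W0: "openin (pts X) W0" "x\<in>W0" using fr0 unfolding is_frac_def by auto
 have W: "openin (pts X) W" "x\<in>W" "W<=W0" "W<=W1" unfolding W_def using W0 W1 by auto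
 have fr: "is_frac x V s a b W" using is_frac_shrink[OF _ s fr0 W(1,2,3)] V by blast
 have WU: "W<=U" "W<=V" and eq: "res X V W s\<otimes>\<^bsub>sec X W\<^esub> \<rho>r W b = \<rho>r W a" using fr unfolding is_frac_def by auto
 interpret S: cring "sec X W" using is_sheafD(1)[OF sheaf W(1)] .
 have Vo: "openin (pts X) V" using V by blast
 have sW: "res X V W s\<in>carrier (sec X W)" using presheaf_closed[OF pre Vo W(1) WU(2) s] .
 have rc: "\<rho>r W r\<in>carrier (sec X W)" if "r\<in>carrier R" for r using ring_hom_closed[OF \<rho>r_hom[OF W(1) WU(1)] that] .
 have tW: "res X W1 W t\<in>carrier (sec X W)" using presheaf_closed[OF pre W1(1) W(1,4) W1(4)] .
 have ra: "\<rho>r W1 a\<in>carrier (sec X W1)" using ring_hom_closed[OF \<rho>r_hom[OF W1(1,3)] ab(1)] .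
 have "\<rho>r W a\<otimes>\<^bsub>sec X W\<^esub> res X W1 W t = \<one>\<^bsub>sec X W\<^esub>"
  using presheaf_mult[OF pre W1(1) W(1,4) ra W1(4)] W1(5) presheaf_one[OF pre W1(1) W(1,4)] \<rho>r_res[OF W1(1) W(1,4) W1(3) ab(1)] by simp
 hence "res X V W s\<otimes>\<^bsub>sec X W\<^esub> (\<rho>r W b\<otimes>\<^bsub>sec X W\<^esub> res X W1 W t) = \<one>\<^bsub>sec X W\<^esub>"
  using eq sW rc[OF ab(2)] tW by (simp add: S.m_assoc[symmetric])
 moreover have "\<rho>r W b\<otimes>\<^bsub>sec X W\<^esub> res X W1 W t\<in>carrier (sec X W)" using rc[OF ab(2)] tW by simp
 ultimately show "unit_near X x V s" unfolding unit_near_def using W(1,2) WU(2) by blast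
next
 fix V W s assume a: "openin (pts X) V & openin (pts X) W & x\<in>W & W<=V" and s: "s\<in>carrier (sec X V)"
 have o: "openin (pts X) V" "openin (pts X) W" "x\<in>W" "W<=V" "x\<in>V" using a by auto
 obtain a b W0 where fr0: "is_frac x V s a b W0" and kk: "hh V s\<in>carrier K" "hh V s\<otimes>\<^bsub>K\<^esub> \<psi> b = \<psi> a"
  using hh_value[OF o(1) s o(5)] unfolding value_at_def by blast
 define W1 where "W1 = W0\<inter>W"
 have W0: "openin (pts X) W0" "x\<in>W0" using fr0 unfolding is_frac_def by auto
 have W1: "openin (pts X) W1" "x\<in>W1" "W1<=W0" "W1<=W" unfolding W1_def using W0 o by auto
 have fr: "is_frac x V s a b W1" using is_frac_shrink[OF o(1) s fr0 W1(1-3)] .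
 hence "is_frac x W (res X V W s) a b W1"
  unfolding is_frac_def using presheaf_comp[OF pre o(1,2) W1(1,4) o(4) s] W1(4) by simp
 hence "value_at W (res X V W s) (hh V s)" unfolding value_at_def using kk by blast
 thus "hh W (res X V W s) = hh V s"
  using hh_eqI[OF o(2) presheaf_closed[OF pre o(1,2,4) s] o(3)] by blast
qed

lemma hh_\<rho>: "r\<in>carrier R ==> hh U (\<rho> r) = \<psi> r"
proof (rule hh_eqI[OF U \<rho>_closed x])
 assume r: "r\<in>carrier R"
 interpret S: cring "sec X U" using is_sheafD(1)[OF sheaf U] .
 have "is_frac x U (\<rho> r) r \<one>\<^bsub>R\<^esub> U"
  unfolding is_frac_def using r U x R.prime_no_one[OF f_prime[OF x]] ring_hom_one[OF \<rho>r_hom[OF U subset_refl]]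
   presheaf_id[OF pre U \<rho>_closed[OF r]] \<rho>r_U[OF r] \<rho>_closed[OF r] by simp
 moreover have "\<psi> r\<otimes>\<^bsub>K\<^esub> \<psi> \<one>\<^bsub>R\<^esub> = \<psi> r" using ring_hom_one[OF \<psi>] \<psi>_closed[OF r] by simp
 ultimately show "value_at U (\<rho> r) (\<psi> r)" unfolding value_at_def using \<psi>_closed[OF r] by blast
qed

end

context chart
begin

lemma point_data_hom:
 assumes d: "point_data X K x h" and x: "x\<in>U"
 shows "(%r. h U (\<rho> r))\<in>ring_hom R K"
 using ring_hom_trans[OF \<rho>_hom point_dataD(2)[OF d U x]] unfolding comp_def .

text \<open>The values on an arbitrary section are quotients of values on \<rho>(R). The value at
  the denominator is nonzero because \<rho> b is invertible near x.\<close>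

lemma point_data_fraction:
 assumes K: "field (K :: 'a ring)" and d: "point_data X K x h" and x: "x\<in>U"
  and V: "openin (pts X) V" "x\<in>V" "s\<in>carrier (sec X V)"
 shows "\<exists>a\<in>carrier R. \<exists>b\<in>carrier R. h U (\<rho> b) ~= \<zero>\<^bsub>K\<^esub> & h V s\<otimes>\<^bsub>K\<^esub> h U (\<rho> b) = h U (\<rho> a)"
proof -
 interpret K: field K by fact
 obtain a b W where fr: "is_frac x V s a b W" using is_frac_exists[OF V(1,3,2) x] by blast
 have ab: "a\<in>carrier R" "b\<in>carrier R" "b\<notin>f x" and W: "openin (pts X) W" "x\<in>W" "W<=U" "W<=V"
  and eq: "res X V W s\<otimes>\<^bsub>sec X W\<^esub> \<rho>r W b = \<rho>r W a" using fr unfolding is_frac_def by auto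
 have hr: "h W (\<rho>r W r) = h U (\<rho> r)" if "r\<in>carrier R" "openin (pts X) W" "x\<in>W" "W<=U" for r W
  unfolding \<rho>r_def using point_dataD(4)[OF d U that(2,3,4) \<rho>_closed[OF that(1)]] .
 have hs: "h W (res X V W s) = h V s" using point_dataD(4)[OF d V(1) W(1,2,4) V(3)] .
 have c: "res X V W s\<in>carrier (sec X W)" "\<rho>r W b\<in>carrier (sec X W)"
  using presheaf_closed[OF pre V(1) W(1,4) V(3)] ring_hom_closed[OF \<rho>r_hom[OF W(1,3)] ab(2)] by auto
 have "h V s\<otimes>\<^bsub>K\<^esub> h U (\<rho> b) = h U (\<rho> a)"
  using ring_hom_mult[OF point_dataD(2)[OF d W(1,2)] c] eq hr[OF ab(1) W(1-3)] hr[OF ab(2) W(1-3)] hs by simp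
 moreover have "h U (\<rho> b) ~= \<zero>\<^bsub>K\<^esub>"
 proof
  assume z: "h U (\<rho> b) = \<zero>\<^bsub>K\<^esub>"
  obtain W1 t where W1: "openin (pts X) W1" "x\<in>W1" "W1<=U" "t\<in>carrier (sec X W1)"
   "\<rho>r W1 b\<otimes>\<^bsub>sec X W1\<^esub> t = \<one>\<^bsub>sec X W1\<^esub>"
   using unit_near_\<rho>[OF x ab(2,3)] unfolding unit_near_def \<rho>r_def by blast
  note h1 = point_dataD(2)[OF d W1(1,2)]
  have "h W1 (\<rho>r W1 b)\<otimes>\<^bsub>K\<^esub> h W1 t = \<one>\<^bsub>K\<^esub>"
   using ring_hom_mult[OF h1 ring_hom_closed[OF \<rho>r_hom[OF W1(1,3)] ab(2)] W1(4)] W1(5) ring_hom_one[OF h1] by simp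
  thus False using z hr[OF ab(2) W1(1-3)] ring_hom_closed[OF h1 W1(4)] K.zero_not_one by simp
 qed
 ultimately show ?thesis using ab by blast
qed

text \<open>All values being quotients of values on \<rho>(R), they lie in every subfield that
  contains the latter; so the morphism is already defined over the subfield generated by the image
  of \<open>R\<close>.\<close>

lemma point_data_subfield:
 assumes K: "field (K :: 'a ring)" and d: "point_data X K x h" and x: "x\<in>U"
  and K': "subfield K' K" and gen: "!!r. r\<in>carrier R ==> h U (\<rho> r)\<in>K'"
 shows "point_data X (K\<lparr>carrier := K'\<rparr>) x h"
proof -
 interpret K: field K by fact
 have sub: "K'<=carrier K" using subfieldE(3)[OF K'] .
 have hK': "h V s\<in>K'" if V: "openin (pts X) V" "x\<in>V" "s\<in>carrier (sec X V)" for V s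
 proof -
  obtain a b where ab: "a\<in>carrier R" "b\<in>carrier R" "h U (\<rho> b) ~= \<zero>\<^bsub>K\<^esub>" "h V s\<otimes>\<^bsub>K\<^esub> h U (\<rho> b) = h U (\<rho> a)"
   using point_data_fraction[OF K d x V] by blast
  have i: "inv\<^bsub>K\<^esub> (h U (\<rho> b))\<in>K'" using K.subfield_m_inv(1)[OF K'] gen[OF ab(2)] ab(3) by blast
  have hs: "h V s\<in>carrier K" using ring_hom_closed[OF point_dataD(2)[OF d V(1,2)] V(3)] .
  have bU: "h U (\<rho> b)\<in>Units K" using gen[OF ab(2)] ab(3) sub K.field_Units by auto
  have "h V s = h U (\<rho> a)\<otimes>\<^bsub>K\<^esub> inv\<^bsub>K\<^esub> (h U (\<rho> b))"
   unfolding ab(4)[symmetric]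
   using K.m_assoc[OF hs K.Units_closed[OF bU] K.Units_inv_closed[OF bU]] K.Units_r_inv[OF bU] hs by simp
  thus ?thesis using subringE(6)[OF subfieldE(1)[OF K'] gen[OF ab(1)] i] by simp
 qed
 show ?thesis
  unfolding point_data_def
 proof (intro conjI allI impI ballI)
  show "x\<in>topspace (pts X)" using point_dataD(1)[OF d] .
  fix V assume V: "openin (pts X) V & x\<in>V"
  show "h V\<in>ring_hom (sec X V) (K\<lparr>carrier := K'\<rparr>)"
   using point_dataD(2)[OF d, of V] hK'[of V] V unfolding ring_hom_def by auto
  show "unit_near X x V s" if "s\<in>carrier (sec X V)" "h V s ~= \<zero>\<^bsub>K\<lparr>carrier := K'\<rparr>\<^esub>" for s
   using point_dataD(3)[OF d, of V s] V that by simp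
 next
  fix V W s assume "openin (pts X) V & openin (pts X) W & x\<in>W & W<=V" "s\<in>carrier (sec X V)"
  thus "h W (res X V W s) = h V s" using point_dataD(4)[OF d, of V W s] by simp
 qed
qed

end

section \<open>The points of an \<open>\<F>\<^sub>1\<close>-scheme over fields\<close>

lemma (in comm_monoid) finprod_fibres:
 assumes "finite Q" "!!q. q\<in>Q ==> F q\<in>carrier G"
 shows "finprod G F Q = (\<Otimes>z\<in>\<phi> ` Q. finprod G F {q\<in>Q. \<phi> q = z})"
proof -
 have "(\<Union>z\<in>\<phi> ` Q. {q\<in>Q. \<phi> q = z}) = Q" by auto
 moreover have "finprod G F (\<Union>z\<in>\<phi> ` Q. {q\<in>Q. \<phi> q = z}) = (\<Otimes>z\<in>\<phi> ` Q. finprod G F {q\<in>Q. \<phi> q = z})"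
  using assms by (intro finprod_UN_disjoint) (auto simp: pairwise_def disjnt_def)
 ultimately show ?thesis by simp
qed

section \<open>Evaluation of the monoid ring of a field\<close>

context cring
begin

lemma finsum_prod:
 assumes "finite A" "finite B" "a\<in>A \<rightarrow> carrier R" "b\<in>B \<rightarrow> carrier R"
 shows "(\<Oplus>x\<in>A. a x)\<otimes>(\<Oplus>y\<in>B. b y) = (\<Oplus>q\<in>A \<times> B. a (fst q)\<otimes>b (snd q))"
proof -
 have ac: "a x\<in>carrier R" if "x\<in>A" for x using assms(3) that by auto
 have bc: "b x\<in>carrier R" if "x\<in>B" for x using assms(4) that by auto
 have S: "(\<Oplus>y\<in>B. b y)\<in>carrier R" using bc by (intro finsum_closed) auto
 have "(\<Oplus>x\<in>A. a x)\<otimes>(\<Oplus>y\<in>B. b y) = (\<Oplus>x\<in>A. a x\<otimes>(\<Oplus>y\<in>B. b y))"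
  by (rule finsum_ldistr[OF assms(1) S assms(3)])
 also have "... = (\<Oplus>x\<in>A. \<Oplus>q\<in>{x} \<times> B. a (fst q)\<otimes>b (snd q))"
 proof (rule add.finprod_cong'[OF refl])
  have cl: "(\<Oplus>q\<in>{x} \<times> B. a (fst q)\<otimes>b (snd q))\<in>carrier R" if "x\<in>A" for x
   using ac bc that by (intro finsum_closed) auto
  thus "(%x. \<Oplus>q\<in>{x} \<times> B. a (fst q)\<otimes>b (snd q))\<in>A \<rightarrow> carrier R" by auto
  fix x assume x: "x\<in>A"
  have "a x\<otimes>(\<Oplus>y\<in>B. b y) = (\<Oplus>y\<in>B. a x\<otimes>b y)"
   by (rule finsum_rdistr[OF assms(2) ac[OF x] assms(4)])
  also have "... = (\<Oplus>q\<in>Pair x ` B. a (fst q)\<otimes>b (snd q))"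
   using ac[OF x] bc by (subst add.finprod_reindex) (auto intro!: add.finprod_cong' simp: inj_on_def)
  also have "Pair x ` B = {x} \<times> B" by auto
  finally show "a x\<otimes>(\<Oplus>y\<in>B. b y) = (\<Oplus>q\<in>{x} \<times> B. a (fst q)\<otimes>b (snd q))" .
 qed
 also have "... = (\<Oplus>q\<in>(\<Union>x\<in>A. {x} \<times> B). a (fst q)\<otimes>b (snd q))"
  using assms(1,2) ac bc by (intro add.finprod_UN_disjoint[symmetric]) (auto simp: pairwise_def disjnt_def)
 also have "(\<Union>x\<in>A. {x} \<times> B) = A \<times> B" by auto
 finally show ?thesis .
qed

lemma int_add_pow_0: "[(0 :: int)] \<cdot> z = \<zero>"
 by (simp add: add_pow_def int_pow_def nat_pow_def)

lemma int_add_pow_sum: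
 assumes "finite S" "z\<in>carrier R"
 shows "[(\<Sum>q\<in>S. n q :: int)] \<cdot> z = (\<Oplus>q\<in>S. [n q] \<cdot> z)"
 using assms(1)
proof (induction S rule: finite_induct)
 case empty
 thus ?case by (simp add: int_add_pow_0)
next
 case (insert q S)
 have "[(\<Sum>q\<in>insert q S. n q)] \<cdot> z = [n q] \<cdot> z\<oplus>[(\<Sum>q\<in>S. n q)] \<cdot> z"
  using insert assms(2) by (simp add: add.int_pow_mult)
 also have "... = (\<Oplus>q\<in>insert q S. [n q] \<cdot> z)"
  using insert assms(2) by (subst finsum_insert) auto
 finally show ?case .
qed

lemma int_add_pow_mult:
 fixes m n :: int
 assumes "x\<in>carrier R" "y\<in>carrier R"
 shows "([m] \<cdot> x)\<otimes>([n] \<cdot> y) = [(m * n)] \<cdot> (x\<otimes>y)"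
proof -
 have "([m] \<cdot> x)\<otimes>([n] \<cdot> y) = [m] \<cdot> (x\<otimes>[n] \<cdot> y)" using assms add_pow_ldistr_int[of x "[n] \<cdot> y" m] by simp
 also have "x\<otimes>[n] \<cdot> y = [n] \<cdot> (x\<otimes>y)" using assms add_pow_rdistr_int by simp
 also have "[m] \<cdot> ([n] \<cdot> (x\<otimes>y)) = [(m * n)] \<cdot> (x\<otimes>y)"
  using assms add.int_pow_pow[of "x\<otimes>y" m n] by (simp add: mult.commute)
 finally show ?thesis .
qed

end

lemma ring_pmonoid_simps [simp]:
 "carrier (ring_pmonoid R) = carrier R" "mult (ring_pmonoid R) = mult R" "one (ring_pmonoid R) = one R"
 "absorb (ring_pmonoid R) = zero R"
 unfolding ring_pmonoid_def by simp_all

context plain_field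
begin

lemma ring_pmonoid_pmonoid: "pmonoid (ring_pmonoid K)"
 by unfold_locales (auto simp: m_ac)

lemma Units_ring_pmonoid: "Units (ring_pmonoid K) = carrier K - {\<zero>}"
proof -
 have "Units (ring_pmonoid K) = Units K" unfolding Units_def by simp
 thus ?thesis using field_Units by simp
qed

lemma pm_field_ring: "pm_field (ring_pmonoid K)"
 unfolding pm_field_def Units_ring_pmonoid using ring_pmonoid_pmonoid by auto

lemma monoid_ring_carrier:
 "f\<in>carrier (monoid_ring (ring_pmonoid K)) \<longleftrightarrow> finite {x. f x ~= 0} & {x. f x ~= 0}<=carrier K - {\<zero>}"
 unfolding monoid_ring_def by simp

lemma monoid_ring_eval_superset:
 assumes f: "f\<in>carrier (monoid_ring (ring_pmonoid K))" and A: "finite A" "{x. f x ~= 0}<=A" "A<=carrier K"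
 shows "monoid_ring_eval K f = (\<Oplus>x\<in>A. [f x] \<cdot> x)"
proof -
 have "monoid_ring_eval K f = (\<Oplus>x\<in>{x. f x ~= 0}. [f x] \<cdot> x)"
  unfolding monoid_ring_eval_def using f by simp
 also have "... = (\<Oplus>x\<in>A. [f x] \<cdot> x)"
  using A by (intro add.finprod_mono_neutral_cong_left) (auto simp: int_add_pow_0)
 finally show ?thesis .
qed

text \<open>For multiplicativity the pairs of support points are grouped by their product: the
  coefficient of z in f g is the sum over the fibre of multiplication above z.\<close>

lemma monoid_ring_eval_hom: "monoid_ring_eval K\<in>ring_hom (monoid_ring (ring_pmonoid K)) K"
proof (rule ring_hom_memI)
 fix f g assume f: "f\<in>carrier (monoid_ring (ring_pmonoid K))" and g: "g\<in>carrier (monoid_ring (ring_pmonoid K))"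
 define A B where "A = {x. f x ~= 0}" and "B = {x. g x ~= 0}"
 have A: "finite A" "A<=carrier K - {\<zero>}" and B: "finite B" "B<=carrier K - {\<zero>}"
  using f g unfolding monoid_ring_carrier A_def B_def by auto
 have ef: "monoid_ring_eval K f = (\<Oplus>x\<in>A. [f x] \<cdot> x)" and eg: "monoid_ring_eval K g = (\<Oplus>x\<in>B. [g x] \<cdot> x)"
  using monoid_ring_eval_superset[OF f, of A] monoid_ring_eval_superset[OF g, of B] A B unfolding A_def B_def by auto
 have ca: "(%x. [f x] \<cdot> x)\<in>A \<rightarrow> carrier K" "(%x. [g x] \<cdot> x)\<in>B \<rightarrow> carrier K" using A B by auto
 show "monoid_ring_eval K f\<in>carrier K" unfolding ef using ca by (intro finsum_closed)
 define C where "C = A\<union>B"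
 have C: "finite C" "C<=carrier K" "C<=carrier K - {\<zero>}" unfolding C_def using A B by auto
 have fg: "f\<oplus>\<^bsub>monoid_ring (ring_pmonoid K)\<^esub> g = (%z. f z + g z)" unfolding monoid_ring_def by simp
 have sup: "{z. f z + g z ~= 0}<=C" unfolding C_def A_def B_def by auto
 have fgc: "(%z. f z + g z)\<in>carrier (monoid_ring (ring_pmonoid K))"
  unfolding monoid_ring_carrier using sup C finite_subset[OF sup] by auto
 have "monoid_ring_eval K (%z. f z + g z) = (\<Oplus>x\<in>C. [(f x + g x)] \<cdot> x)"
  using monoid_ring_eval_superset[OF fgc C(1) sup C(2)] .
 also have "... = (\<Oplus>x\<in>C. [f x] \<cdot> x\<oplus>[g x] \<cdot> x)"
  using C by (intro add.finprod_cong') (auto simp: add.int_pow_mult)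
 also have "... = (\<Oplus>x\<in>C. [f x] \<cdot> x)\<oplus>(\<Oplus>x\<in>C. [g x] \<cdot> x)"
  using C by (intro add.finprod_multf) auto
 also have "... = monoid_ring_eval K f\<oplus>monoid_ring_eval K g"
  using monoid_ring_eval_superset[OF f C(1) _ C(2)] monoid_ring_eval_superset[OF g C(1) _ C(2)]
  unfolding C_def A_def B_def by auto
 finally show "monoid_ring_eval K (f\<oplus>\<^bsub>monoid_ring (ring_pmonoid K)\<^esub> g) = monoid_ring_eval K f\<oplus>monoid_ring_eval K g"
  unfolding fg .
 define \<phi> where "\<phi> q = fst q\<otimes>snd q" for q
 define n where "n q = f (fst q) * g (snd q)" for q
 \<comment> \<open>All products of support points. A field has no zero divisors, so none of them is
   the absorbing element and no term of the product is lost.\<close>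
 define D where "D = \<phi> ` (A \<times> B)"
 have D: "finite D" "D<=carrier K - {\<zero>}" unfolding D_def \<phi>_def using A B by (auto dest!: subsetD dest: integral)
 define w where "w = f\<otimes>\<^bsub>monoid_ring (ring_pmonoid K)\<^esub> g"
 have w: "w z = (if z\<in>carrier K - {\<zero>} then \<Sum>q\<in>{q\<in>A \<times> B. \<phi> q = z}. n q else 0)" for z
 proof -
  have "{(x, y). f x ~= 0 & g y ~= 0 & x\<otimes>y = z} = {q\<in>A \<times> B. \<phi> q = z}" unfolding A_def B_def \<phi>_def by auto
  thus ?thesis unfolding w_def monoid_ring_def n_def by (simp add: case_prod_beta)
 qed
 have wsup: "{z. w z ~= 0}<=D"
 proof
  fix z assume "z\<in>{z. w z ~= 0}"
  hence "w z ~= 0" by simp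
  moreover have "w z = 0" if "{q\<in>A \<times> B. \<phi> q = z} = {}" unfolding w that by simp
  ultimately have "{q\<in>A \<times> B. \<phi> q = z} ~= {}" by blast
  thus "z\<in>D" unfolding D_def by auto
 qed
 have wc: "w\<in>carrier (monoid_ring (ring_pmonoid K))"
  unfolding monoid_ring_carrier using wsup D finite_subset[OF wsup] by auto
 have fin: "finite (A \<times> B)" using A B by simp
 have nc: "[n q] \<cdot> \<phi> q\<in>carrier K" if "q\<in>A \<times> B" for q unfolding \<phi>_def using that A B by (auto dest!: subsetD)
 have "monoid_ring_eval K w = (\<Oplus>z\<in>D. [w z] \<cdot> z)"
  using monoid_ring_eval_superset[OF wc D(1) wsup] D(2) by auto
 also have "... = (\<Oplus>z\<in>D. \<Oplus>q\<in>{q\<in>A \<times> B. \<phi> q = z}. [n q] \<cdot> \<phi> q)"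
 proof (rule add.finprod_cong'[OF refl])
  show "(%z. \<Oplus>q\<in>{q\<in>A \<times> B. \<phi> q = z}. [n q] \<cdot> \<phi> q)\<in>D \<rightarrow> carrier K"
   using nc by (auto intro!: finsum_closed)
  fix z assume z: "z\<in>D"
  have "[w z] \<cdot> z = [(\<Sum>q\<in>{q\<in>A \<times> B. \<phi> q = z}. n q)] \<cdot> z" using w z D by auto
  also have "... = (\<Oplus>q\<in>{q\<in>A \<times> B. \<phi> q = z}. [n q] \<cdot> z)"
   using fin z D by (intro int_add_pow_sum) auto
  also have "... = (\<Oplus>q\<in>{q\<in>A \<times> B. \<phi> q = z}. [n q] \<cdot> \<phi> q)"
   using nc by (intro add.finprod_cong') auto
  finally show "[w z] \<cdot> z = (\<Oplus>q\<in>{q\<in>A \<times> B. \<phi> q = z}. [n q] \<cdot> \<phi> q)" .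
 qed
 also have "... = (\<Oplus>q\<in>A \<times> B. [n q] \<cdot> \<phi> q)"
  unfolding D_def by (rule add.finprod_fibres[where F = "%q. [n q] \<cdot> \<phi> q", OF fin nc, symmetric])
 also have "... = (\<Oplus>q\<in>A \<times> B. ([f (fst q)] \<cdot> fst q)\<otimes>([g (snd q)] \<cdot> snd q))"
  unfolding n_def \<phi>_def using A B by (intro add.finprod_cong') (auto simp: int_add_pow_mult dest!: subsetD)
 also have "... = monoid_ring_eval K f\<otimes>monoid_ring_eval K g"
  unfolding ef eg using finsum_prod[OF A(1) B(1) ca] by simp
 finally show "monoid_ring_eval K (f\<otimes>\<^bsub>monoid_ring (ring_pmonoid K)\<^esub> g) = monoid_ring_eval K f\<otimes>monoid_ring_eval K g"
  unfolding w_def .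
next
 define u where "u = (%z. if z = \<one> & z ~= \<zero> then 1 else (0::int))"
 have one: "\<one>\<^bsub>monoid_ring (ring_pmonoid K)\<^esub> = u" unfolding monoid_ring_def u_def by simp
 have sup: "{x. u x ~= 0}<={\<one>}" unfolding u_def by auto
 have uc: "u\<in>carrier (monoid_ring (ring_pmonoid K))"
  unfolding monoid_ring_carrier u_def using finite_subset[OF sup] by (auto simp: u_def)
 have "monoid_ring_eval K u = (\<Oplus>x\<in>{\<one>}. [u x] \<cdot> x)"
  using monoid_ring_eval_superset[OF uc _ sup] by auto
 also have "... = \<one>" unfolding u_def by simp
 finally show "monoid_ring_eval K \<one>\<^bsub>monoid_ring (ring_pmonoid K)\<^esub> = \<one>" unfolding one .
qed

end

lemma mr_hom_eval: "plain_field K ==> MixMor (monoid_ring_eval K)\<in>mr_hom (MonObj (ring_pmonoid K)) (RingObj K)"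
 using plain_field.monoid_ring_eval_hom unfolding monoid_ring_eval_def by auto

context plain_field
begin

context
 fixes K' assumes K': "subfield K' K"
begin

abbreviation K1 :: "'a ring" where "K1 \<equiv> K\<lparr>carrier := K'\<rparr>"
abbreviation incl :: "'a => 'a" where "incl \<equiv> (\<lambda>x\<in>K'. x)"

lemma subK: "K'<=carrier K" using subfieldE(3)[OF K'] .

lemma K1_field: "plain_field K1"
 unfolding plain_field_def using subfield_iff(2)[OF K'] .

lemma id_hom: "(%x. x)\<in>ring_hom K1 K"
 unfolding ring_hom_def using subK by auto

lemma incl_ring: "RingMor incl\<in>mr_hom (RingObj K1) (RingObj K)"
proof -
 interpret K1: plain_field K1 by (rule K1_field)
 have "incl\<in>ring_hom K1 K"
 proof (rule ring_hom_memI)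
  fix x y assume xy: "x\<in>carrier K1" "y\<in>carrier K1"
  show "incl x\<in>carrier K" using xy subK by auto
  show "incl (x\<otimes>\<^bsub>K1\<^esub> y) = incl x\<otimes>incl y" using K1.m_closed[OF xy] xy by simp
  show "incl (x\<oplus>\<^bsub>K1\<^esub> y) = incl x\<oplus>incl y" using K1.a_closed[OF xy] xy by simp
 next
  show "incl \<one>\<^bsub>K1\<^esub> = \<one>" using K1.one_closed by simp
 qed
 thus ?thesis by auto
qed

lemma incl_mon: "incl\<in>pm_homs (ring_pmonoid K1) (ring_pmonoid K)"
proof -
 interpret K1: plain_field K1 by (rule K1_field)
 show ?thesis
  unfolding pmonoid_hom_def hom_def using subK K1.m_closed K1.one_closed K1.zero_closed by auto
qed

text \<open>Including and then evaluating equals evaluating and then including, in the category of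
  monoids and rings. This square links restriction to subfields on the monoid side with restriction
  on the ring side.\<close>

lemma eval_incl:
 "mr_comp (MonObj (ring_pmonoid K1)) (MonObj (ring_pmonoid K)) (MixMor (monoid_ring_eval K)) (MonMor incl)
  = mr_comp (MonObj (ring_pmonoid K1)) (RingObj K1) (RingMor incl) (MixMor (monoid_ring_eval K1))"
proof -
 interpret K1: plain_field K1 by (rule K1_field)
 interpret h: ring_hom_cring K1 K "%x. x"
  by unfold_locales (rule id_hom)
 have pow: "[n] \<cdot>\<^bsub>K1\<^esub> x = [n] \<cdot> x" if "x\<in>K'" for n :: int and x
 proof -
  have nat: "[m] \<cdot>\<^bsub>K1\<^esub> x = [m] \<cdot> x" for m :: nat
   unfolding add_pow_def by (induction m) simp_all
  have "\<ominus>\<^bsub>K1\<^esub> y = \<ominus> y" if "y\<in>K'" for y using h.hom_a_inv[of y] that by simp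
  moreover have "[m] \<cdot>\<^bsub>K1\<^esub> x\<in>K'" for m :: nat using K1.add.nat_pow_closed[of x m] that by simp
  ultimately show ?thesis
   using nat by (cases "n \<ge> 0") (simp_all add: add_pow_int_ge add_pow_int_lt)
 qed
 have "monoid_ring_eval K (monoid_ring_map (ring_pmonoid K1) (ring_pmonoid K) incl w) = incl (monoid_ring_eval K1 w)"
  if w: "w\<in>carrier (monoid_ring (ring_pmonoid K1))" for w
 proof -
  have wf: "finite {x. w x ~= 0}" "{x. w x ~= 0}<=K' - {\<zero>}" using w unfolding K1.monoid_ring_carrier by auto
  have wK: "w\<in>carrier (monoid_ring (ring_pmonoid K))" unfolding monoid_ring_carrier using wf subK by auto
  have "monoid_ring_map (ring_pmonoid K1) (ring_pmonoid K) incl w = w"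
  proof
   fix y
   have "(\<Sum>x\<in>{x. w x ~= 0 & incl x = y}. w x) = w y"
   proof (cases "w y = 0")
    case True
    hence "{x. w x ~= 0 & incl x = y} = {}" using wf by (auto split: if_splits)
    thus ?thesis using True by (simp only: sum.empty)
   next
    case False
    hence "y\<in>K'" using wf by auto
    hence "{x. w x ~= 0 & incl x = y} = {y}" using wf False by (auto split: if_splits)
    thus ?thesis by simp
   qed
   moreover have "w y = 0" if "y\<notin>carrier K - {\<zero>}" using wf subK that by auto
   ultimately show "monoid_ring_map (ring_pmonoid K1) (ring_pmonoid K) incl w y = w y"
    unfolding monoid_ring_map_def using w by auto
  qed
  moreover have "monoid_ring_eval K w = monoid_ring_eval K1 w"
  proof -
   have c: "(%x. [w x] \<cdot>\<^bsub>K1\<^esub> x)\<in>{x. w x ~= 0} \<rightarrow> carrier K1"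
    using wf K1.add.int_pow_closed by auto
   have "monoid_ring_eval K1 w = (\<Oplus>\<^bsub>K1\<^esub>x\<in>{x. w x ~= 0}. [w x] \<cdot>\<^bsub>K1\<^esub> x)" unfolding monoid_ring_eval_def using w by simp
   also have "... = (\<Oplus>x\<in>{x. w x ~= 0}. [w x] \<cdot>\<^bsub>K1\<^esub> x)" using h.hom_finsum[OF c] by (simp add: comp_def)
   also have "... = (\<Oplus>x\<in>{x. w x ~= 0}. [w x] \<cdot> x)"
    using wf subK pow by (intro add.finprod_cong') auto
   also have "... = monoid_ring_eval K w" unfolding monoid_ring_eval_def using wK by simp
   finally show ?thesis by simp
  qed
  moreover have "monoid_ring_eval K1 w\<in>K'" using ring_hom_closed[OF K1.monoid_ring_eval_hom w] by simp
  ultimately show ?thesis by simp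
 qed
 thus ?thesis by (auto simp: compose_def intro!: restrict_ext)
qed

end

end

text \<open>\<open>pt_of K y\<close> is the morphism from the spectrum of the field \<open>K\<close> to \<open>XZ\<close> that corresponds to \<open>y\<in>X(K)\<close>,
 where \<open>K\<close> is regarded as a monoid.\<close>

locale F1_points =
 fixes X :: "('u, 'v) mr_functor" and XZ :: "('y, 't) ringed_space"
  and \<eta> :: "'u ring => 'v => ('u set => 'y) \<times> ('y set => 't => 'u set => ('u \<times> 'u) set)"
  and \<Y> :: "('u pmonoid => 'v set) set" and Mon :: "('u pmonoid => 'v set) => 'u pmonoid"
  and \<theta> :: "('u pmonoid => 'v set) => 'u pmonoid => 'v => 'u => 'u"
 assumes mr_fun: "is_mr_functor X"
  and \<eta>_bij: "!!R. cring R ==> bij_betw (\<eta> R) (ring_obj X R) (sh_hom ring_hom (Spec R) XZ)"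
  and \<eta>_nat: "!!R S \<phi> x. cring R ==> cring S ==> \<phi>\<in>ring_hom R S\<inter>extensional (carrier R) ==> x\<in>ring_obj X R ==>
   \<eta> S (ring_mor X R S \<phi> x) = sh_comp (Spec S) (Spec R) XZ (\<eta> R x) (Spec_map R S \<phi>)"
  and field_bij: "!!K. field K ==> bij_betw (fmor X (MonObj (ring_pmonoid K)) (RingObj K) (MixMor (monoid_ring_eval K)))
     (mon_obj X (ring_pmonoid K)) (ring_obj X K)"
  and fin: "finite \<Y>"
  and Y_open: "!!Y. Y\<in>\<Y> ==> mon_open_subfunctor X Y"
  and Mon: "!!Y. Y\<in>\<Y> ==> pmonoid (Mon Y) & pmonoid_fin_gen (Mon Y)"
  and \<theta>_bij: "!!Y N. Y\<in>\<Y> ==> pmonoid N ==> bij_betw (\<theta> Y N) (Y N) (pm_homs (Mon Y) N)"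
  and \<theta>_nat: "!!Y N N' \<phi> y. Y\<in>\<Y> ==> pmonoid N ==> pmonoid N' ==> \<phi>\<in>pm_homs N N' ==> y\<in>Y N ==>
   \<theta> Y N' (mon_mor X N N' \<phi> y) = compose (carrier (Mon Y)) \<phi> (\<theta> Y N y)"
  and cover: "!!N. pm_field N ==> mon_obj X N = (\<Union>Y\<in>\<Y>. Y N)"
begin

definition pt_of :: "'u ring => 'v => ('u set => 'y) \<times> ('y set => 't => 'u set => ('u \<times> 'u) set)" where
 "pt_of K y = \<eta> K (fmor X (MonObj (ring_pmonoid K)) (RingObj K) (MixMor (monoid_ring_eval K)) y)"

lemma pt_of_bij: "field K ==> bij_betw (pt_of K) (mon_obj X (ring_pmonoid K)) (sh_hom ring_hom (Spec K) XZ)"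
 using bij_betw_trans[OF field_bij \<eta>_bij[OF fieldE(1)]] unfolding pt_of_def comp_def by blast

text \<open>Functoriality of \<open>X\<close> applied to both ways around the square
  \<open>eval_incl\<close>, followed by naturality of \<eta>.\<close>

lemma pt_of_nat:
 assumes K: "field (K :: 'u ring)" and K': "subfield K' K" and y: "y\<in>mon_obj X (ring_pmonoid (K\<lparr>carrier := K'\<rparr>))"
 shows "pt_of K (mon_mor X (ring_pmonoid (K\<lparr>carrier := K'\<rparr>)) (ring_pmonoid K) (\<lambda>x\<in>K'. x) y)
  = sh_comp (Spec K) (Spec (K\<lparr>carrier := K'\<rparr>)) XZ (pt_of (K\<lparr>carrier := K'\<rparr>) y) (Spec_map (K\<lparr>carrier := K'\<rparr>) K (\<lambda>x\<in>K'. x))"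
proof -
 define L where "L = K\<lparr>carrier := K'\<rparr>"
 interpret K: plain_field K unfolding plain_field_def by fact
 interpret L: plain_field L unfolding L_def by (rule K.K1_field[OF K'])
 define i where "i = (\<lambda>x\<in>K'. x)"
 let ?ev = "%K. MixMor (monoid_ring_eval K)"
 have comp: "!!A B C f g x. is_mr_obj A ==> is_mr_obj B ==> is_mr_obj C ==> f\<in>mr_hom A B ==> g\<in>mr_hom B C ==> x\<in>fobj X A ==>
   fmor X A C (mr_comp A B g f) x = fmor X B C g (fmor X A B f x)"
  using mr_fun unfolding is_mr_functor_def by blast
 have objs: "is_mr_obj (MonObj (ring_pmonoid K))" "is_mr_obj (MonObj (ring_pmonoid L))" "is_mr_obj (RingObj K)" "is_mr_obj (RingObj L)"
  using K.ring_pmonoid_pmonoid L.ring_pmonoid_pmonoid K.is_cring L.is_cring by auto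
 have ev: "?ev K\<in>mr_hom (MonObj (ring_pmonoid K)) (RingObj K)" "?ev L\<in>mr_hom (MonObj (ring_pmonoid L)) (RingObj L)"
  using mr_hom_eval K.plain_field_axioms L.plain_field_axioms by auto
 have im: "MonMor i\<in>mr_hom (MonObj (ring_pmonoid L)) (MonObj (ring_pmonoid K))"
  unfolding i_def L_def mr_hom.simps using K.incl_mon[OF K'] by (rule imageI)
 have ir: "RingMor i\<in>mr_hom (RingObj L) (RingObj K)"
  unfolding i_def L_def using K.incl_ring[OF K'] .
 have yL: "y\<in>mon_obj X (ring_pmonoid L)" using y unfolding L_def .
 have "fmor X (MonObj (ring_pmonoid K)) (RingObj K) (?ev K) (mon_mor X (ring_pmonoid L) (ring_pmonoid K) i y)
   = fmor X (MonObj (ring_pmonoid L)) (RingObj K) (mr_comp (MonObj (ring_pmonoid L)) (MonObj (ring_pmonoid K)) (?ev K) (MonMor i)) y"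
  using comp[OF objs(2,1,3) im ev(1) yL] by simp
 also have "mr_comp (MonObj (ring_pmonoid L)) (MonObj (ring_pmonoid K)) (?ev K) (MonMor i)
   = mr_comp (MonObj (ring_pmonoid L)) (RingObj L) (RingMor i) (?ev L)"
  unfolding L_def i_def using K.eval_incl[OF K'] .
 also have "fmor X (MonObj (ring_pmonoid L)) (RingObj K) ... y = ring_mor X L K i (fmor X (MonObj (ring_pmonoid L)) (RingObj L) (?ev L) y)"
  using comp[OF objs(2,4,3) ev(2) ir yL] .
 finally have e: "fmor X (MonObj (ring_pmonoid K)) (RingObj K) (?ev K) (mon_mor X (ring_pmonoid L) (ring_pmonoid K) i y)
   = ring_mor X L K i (fmor X (MonObj (ring_pmonoid L)) (RingObj L) (?ev L) y)" .
 have z: "fmor X (MonObj (ring_pmonoid L)) (RingObj L) (?ev L) y\<in>ring_obj X L"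
  using bij_betwE[OF field_bij[OF L.field_axioms]] yL by blast
 have ir': "i\<in>ring_hom L K\<inter>extensional (carrier L)" using ir by auto
 show ?thesis
  unfolding L_def[symmetric] i_def[symmetric] pt_of_def e
  using \<eta>_nat[OF L.is_cring K.is_cring ir' z] .
qed

text \<open>The K-point belongs to some Y(K) and is thus a homomorphism f on a finitely generated
  monoid. If f takes values in K', it is also an element of Y(K'), and naturality shows that its
  morphism induces g.\<close>

lemma hom_factors:
 assumes K: "field (K :: 'u ring)" and g: "g\<in>sh_hom ring_hom (Spec K) XZ"
 shows "\<exists>Y\<in>\<Y>. \<exists>f\<in>pm_homs (Mon Y) (ring_pmonoid K). \<forall>K'. subfield K' K & f ` carrier (Mon Y)<=K' -->
  (\<exists>g'\<in>sh_hom ring_hom (Spec (K\<lparr>carrier := K'\<rparr>)) XZ.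
    g = sh_comp (Spec K) (Spec (K\<lparr>carrier := K'\<rparr>)) XZ g' (Spec_map (K\<lparr>carrier := K'\<rparr>) K (\<lambda>x\<in>K'. x)))"
proof -
 interpret K: plain_field K unfolding plain_field_def by fact
 obtain y where y: "y\<in>mon_obj X (ring_pmonoid K)" "g = pt_of K y"
  using bij_betw_imp_surj_on[OF pt_of_bij[OF K]] g by (metis imageE)
 then obtain Y where Y: "Y\<in>\<Y>" "y\<in>Y (ring_pmonoid K)" using cover[OF K.pm_field_ring] by blast
 define f where "f = \<theta> Y (ring_pmonoid K) y"
 note tK = \<theta>_bij[OF Y(1) K.ring_pmonoid_pmonoid]
 have f: "f\<in>pm_homs (Mon Y) (ring_pmonoid K)" unfolding f_def using bij_betwE[OF tK] Y(2) by blast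
 have "\<exists>g'\<in>sh_hom ring_hom (Spec (K\<lparr>carrier := K'\<rparr>)) XZ.
    g = sh_comp (Spec K) (Spec (K\<lparr>carrier := K'\<rparr>)) XZ g' (Spec_map (K\<lparr>carrier := K'\<rparr>) K (\<lambda>x\<in>K'. x))"
  if K': "subfield K' K" and sub: "f ` carrier (Mon Y)<=K'" for K'
 proof -
  define L where "L = K\<lparr>carrier := K'\<rparr>"
  interpret L: plain_field L unfolding L_def by (rule K.K1_field[OF K'])
  have fL: "f\<in>pm_homs (Mon Y) (ring_pmonoid L)"
   using f sub unfolding pmonoid_hom_def hom_def L_def by auto
  note tL = \<theta>_bij[OF Y(1) L.ring_pmonoid_pmonoid]
  obtain y' where y': "y'\<in>Y (ring_pmonoid L)" "f = \<theta> Y (ring_pmonoid L) y'"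
   using bij_betw_imp_surj_on[OF tL] fL by (metis imageE)
  have sf: "mon_subfunctor X Y" using Y_open[OF Y(1)] unfolding mon_open_subfunctor_def by blast
  have y'X: "y'\<in>mon_obj X (ring_pmonoid L)" using sf L.ring_pmonoid_pmonoid y'(1) unfolding mon_subfunctor_def by blast
  have im: "(\<lambda>x\<in>K'. x)\<in>pm_homs (ring_pmonoid L) (ring_pmonoid K)" unfolding L_def by (rule K.incl_mon[OF K'])
  define z where "z = mon_mor X (ring_pmonoid L) (ring_pmonoid K) (\<lambda>x\<in>K'. x) y'"
  have zY: "z\<in>Y (ring_pmonoid K)"
   unfolding z_def using sf L.ring_pmonoid_pmonoid K.ring_pmonoid_pmonoid im y'(1) unfolding mon_subfunctor_def by blast
  have "\<theta> Y (ring_pmonoid K) z = compose (carrier (Mon Y)) (\<lambda>x\<in>K'. x) f"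
   unfolding z_def using \<theta>_nat[OF Y(1) L.ring_pmonoid_pmonoid K.ring_pmonoid_pmonoid im y'(1)] y'(2) by simp
  also have "... = f" using sub f by (intro extensionalityI[of _ "carrier (Mon Y)"]) (auto simp: compose_def)
  finally have "z = y" using inj_onD[OF bij_betw_imp_inj_on[OF tK] _ zY Y(2)] unfolding f_def by blast
  hence "g = sh_comp (Spec K) (Spec L) XZ (pt_of L y') (Spec_map L K (\<lambda>x\<in>K'. x))"
   using y(2) pt_of_nat[OF K K' y'X[unfolded L_def]] unfolding z_def L_def by simp
  moreover have "pt_of L y'\<in>sh_hom ring_hom (Spec L) XZ" using bij_betwE[OF pt_of_bij[OF L.field_axioms]] y'X by blast
  ultimately show ?thesis unfolding L_def by blast
 qed
 thus ?thesis using Y(1) f by blast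
qed

text \<open>The converse of \<open>hom_factors\<close>: a morphism over K' gives a K'-point of
  \<open>X\<close>, which a priori need not lie in Y(K'). Openness of Y decides this by an ideal of
  K', and over fields the condition is insensitive to enlarging the field.\<close>

lemma hom_descends:
 assumes Y: "Y\<in>\<Y>" and K: "field (K :: 'u ring)" and f: "f\<in>pm_homs (Mon Y) (ring_pmonoid K)"
 shows "\<exists>g\<in>sh_hom ring_hom (Spec K) XZ. \<forall>K' g'. subfield K' K & g'\<in>sh_hom ring_hom (Spec (K\<lparr>carrier := K'\<rparr>)) XZ &
    g = sh_comp (Spec K) (Spec (K\<lparr>carrier := K'\<rparr>)) XZ g' (Spec_map (K\<lparr>carrier := K'\<rparr>) K (\<lambda>x\<in>K'. x)) -->
    f ` carrier (Mon Y)<=K'"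
proof -
 interpret K: plain_field K unfolding plain_field_def by fact
 note tK = \<theta>_bij[OF Y K.ring_pmonoid_pmonoid]
 obtain y where y: "y\<in>Y (ring_pmonoid K)" "f = \<theta> Y (ring_pmonoid K) y"
  using bij_betw_imp_surj_on[OF tK] f by (metis imageE)
 have sf: "mon_subfunctor X Y" using Y_open[OF Y] unfolding mon_open_subfunctor_def by blast
 have yX: "y\<in>mon_obj X (ring_pmonoid K)" using sf K.ring_pmonoid_pmonoid y(1) unfolding mon_subfunctor_def by blast
 have g: "pt_of K y\<in>sh_hom ring_hom (Spec K) XZ" using bij_betwE[OF pt_of_bij[OF K]] yX by blast
 have "f ` carrier (Mon Y)<=K'"
  if K': "subfield K' K" and g': "g'\<in>sh_hom ring_hom (Spec (K\<lparr>carrier := K'\<rparr>)) XZ"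
   and eq: "pt_of K y = sh_comp (Spec K) (Spec (K\<lparr>carrier := K'\<rparr>)) XZ g' (Spec_map (K\<lparr>carrier := K'\<rparr>) K (\<lambda>x\<in>K'. x))" for K' g'
 proof -
  define L where "L = K\<lparr>carrier := K'\<rparr>"
  have Ls: "carrier L = K'" "mult L = mult K" "one L = one K" "zero L = zero K" unfolding L_def by simp_all
  interpret L: plain_field L unfolding L_def by (rule K.K1_field[OF K'])
  define i where "i = (\<lambda>x\<in>K'. x)"
  obtain y' where y': "y'\<in>mon_obj X (ring_pmonoid L)" "g' = pt_of L y'"
   using bij_betw_imp_surj_on[OF pt_of_bij[OF L.field_axioms]] g'[folded L_def] by (metis imageE)
  have im: "i\<in>pm_homs (ring_pmonoid L) (ring_pmonoid K)" unfolding L_def i_def by (rule K.incl_mon[OF K'])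
  have mor: "mon_mor X (ring_pmonoid L) (ring_pmonoid K) i y'\<in>mon_obj X (ring_pmonoid K)"
  proof -
   have "is_mr_obj (MonObj (ring_pmonoid L))" "is_mr_obj (MonObj (ring_pmonoid K))"
    using K.ring_pmonoid_pmonoid L.ring_pmonoid_pmonoid by auto
   moreover have "MonMor i\<in>mr_hom (MonObj (ring_pmonoid L)) (MonObj (ring_pmonoid K))" using im by simp
   ultimately have "mon_mor X (ring_pmonoid L) (ring_pmonoid K) i\<in>mon_obj X (ring_pmonoid L) \<rightarrow> mon_obj X (ring_pmonoid K)"
    using mr_fun unfolding is_mr_functor_def by blast
   thus ?thesis using y'(1) by blast
  qed
  have "pt_of K (mon_mor X (ring_pmonoid L) (ring_pmonoid K) i y') = pt_of K y"
   unfolding eq y'(2) L_def i_def using pt_of_nat[OF K K' y'(1)[unfolded L_def]] .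
  hence my: "mon_mor X (ring_pmonoid L) (ring_pmonoid K) i y' = y"
   using inj_onD[OF bij_betw_imp_inj_on[OF pt_of_bij[OF K]] _ mor yX] by blast
  have A: "\<forall>M. pmonoid M --> (\<forall>x\<in>mon_obj X M. \<exists>I. pmonoid_ideal I M &
    (\<forall>N. pmonoid N --> (\<forall>\<phi>\<in>pm_homs M N. mon_mor X M N \<phi> x\<in>Y N \<longleftrightarrow> {\<phi> a\<otimes>\<^bsub>N\<^esub> b | a b. a\<in>I & b\<in>carrier N} = carrier N)))"
   using Y_open[OF Y] unfolding mon_open_subfunctor_def by (rule conjunct2)
  have "\<exists>I. pmonoid_ideal I (ring_pmonoid L) &
    (\<forall>N. pmonoid N --> (\<forall>\<phi>\<in>pm_homs (ring_pmonoid L) N. mon_mor X (ring_pmonoid L) N \<phi> y'\<in>Y N \<longleftrightarrow>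
      {\<phi> a\<otimes>\<^bsub>N\<^esub> b | a b. a\<in>I & b\<in>carrier N} = carrier N))"
   by (rule A[THEN spec, THEN mp, OF L.ring_pmonoid_pmonoid, THEN bspec, OF y'(1)])
  then obtain I where I: "pmonoid_ideal I (ring_pmonoid L)" and op: "!!N \<phi>. pmonoid N ==> \<phi>\<in>pm_homs (ring_pmonoid L) N ==>
    mon_mor X (ring_pmonoid L) N \<phi> y'\<in>Y N \<longleftrightarrow> {\<phi> a\<otimes>\<^bsub>N\<^esub> b | a b. a\<in>I & b\<in>carrier N} = carrier N"
   by auto
  have IL: "I<=K'" using I unfolding pmonoid_ideal_def by (simp add: Ls)
  have "{i a\<otimes>\<^bsub>ring_pmonoid K\<^esub> b | a b. a\<in>I & b\<in>carrier (ring_pmonoid K)} = carrier (ring_pmonoid K)"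
   using op[OF K.ring_pmonoid_pmonoid im] my y(1) by simp
  hence "\<one>\<^bsub>K\<^esub>\<in>{i a\<otimes>\<^bsub>K\<^esub> b | a b. a\<in>I & b\<in>carrier K}" by simp
  \<comment> \<open>That the image of \<open>I\<close> generates the unit ideal of \<open>K\<close>
    produces a nonzero element of \<open>I\<close>; it is already invertible in K'.\<close>
  then obtain a b where ab: "a\<in>I" "b\<in>carrier K" "i a\<otimes>\<^bsub>K\<^esub> b = \<one>\<^bsub>K\<^esub>" by auto
  have aK: "a\<in>K'" using ab IL by auto
  hence a0: "a ~= \<zero>\<^bsub>K\<^esub>" using ab(2,3) unfolding i_def by auto
  hence aU: "a\<in>Units L" using L.field_Units aK Ls by auto
  \<comment> \<open>The openness criterion is now used for the identity of K', so that the
    conclusion concerns y' itself.\<close>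
  have im1: "i\<in>pm_homs (ring_pmonoid L) (ring_pmonoid L)"
   unfolding i_def pmonoid_hom_def hom_def using L.m_closed L.one_closed L.zero_closed by (auto simp: Ls)
  have "{i a\<otimes>\<^bsub>ring_pmonoid L\<^esub> b | a b. a\<in>I & b\<in>carrier (ring_pmonoid L)} = carrier (ring_pmonoid L)"
  proof
   show "{i a\<otimes>\<^bsub>ring_pmonoid L\<^esub> b | a b. a\<in>I & b\<in>carrier (ring_pmonoid L)}<=carrier (ring_pmonoid L)"
    using IL L.m_closed unfolding i_def by (auto simp: Ls)
   show "carrier (ring_pmonoid L)<={i a\<otimes>\<^bsub>ring_pmonoid L\<^esub> b | a b. a\<in>I & b\<in>carrier (ring_pmonoid L)}"
   proof
    fix z assume "z\<in>carrier (ring_pmonoid L)"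
    hence z: "z\<in>carrier L" by simp
    have "i a\<otimes>\<^bsub>L\<^esub> (inv\<^bsub>L\<^esub> a\<otimes>\<^bsub>L\<^esub> z) = z"
     using L.m_assoc[OF L.Units_closed[OF aU] L.Units_inv_closed[OF aU] z] L.Units_r_inv[OF aU] z aK unfolding i_def by simp
    hence "z = i a\<otimes>\<^bsub>ring_pmonoid L\<^esub> (inv\<^bsub>L\<^esub> a\<otimes>\<^bsub>L\<^esub> z)" by simp
    moreover have "inv\<^bsub>L\<^esub> a\<otimes>\<^bsub>L\<^esub> z\<in>carrier (ring_pmonoid L)" using L.Units_inv_closed[OF aU] z by simp
    ultimately show "z\<in>{i a\<otimes>\<^bsub>ring_pmonoid L\<^esub> b | a b. a\<in>I & b\<in>carrier (ring_pmonoid L)}" using ab(1) by blast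
   qed
  qed
  hence "mon_mor X (ring_pmonoid L) (ring_pmonoid L) i y'\<in>Y (ring_pmonoid L)"
   using op[OF L.ring_pmonoid_pmonoid im1] by simp
  moreover have "mon_mor X (ring_pmonoid L) (ring_pmonoid L) i y' = y'"
  proof -
   have "is_mr_obj (MonObj (ring_pmonoid L))" using L.ring_pmonoid_pmonoid by simp
   hence "fmor X (MonObj (ring_pmonoid L)) (MonObj (ring_pmonoid L)) (mr_id (MonObj (ring_pmonoid L))) y' = y'"
    using mr_fun y'(1) unfolding is_mr_functor_def by blast
   thus ?thesis unfolding i_def by (simp add: Ls)
  qed
  ultimately have yY: "y'\<in>Y (ring_pmonoid L)" by simp
  have "f = compose (carrier (Mon Y)) i (\<theta> Y (ring_pmonoid L) y')"
   using \<theta>_nat[OF Y L.ring_pmonoid_pmonoid K.ring_pmonoid_pmonoid im yY] my y(2) by simp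
  moreover have "\<theta> Y (ring_pmonoid L) y'\<in>pm_homs (Mon Y) (ring_pmonoid L)"
   using bij_betwE[OF \<theta>_bij[OF Y L.ring_pmonoid_pmonoid]] yY by blast
  hence "\<theta> Y (ring_pmonoid L) y' c\<in>K'" if "c\<in>carrier (Mon Y)" for c
   using that unfolding pmonoid_hom_def hom_def by (auto simp: Ls)
  ultimately show ?thesis unfolding i_def by (auto simp: compose_def)
 qed
 thus ?thesis using g by blast
qed

end

section \<open>Residue fields and transcendence degrees\<close>

lemma horner_hom:
 assumes "ring R" "ring K" "\<psi>\<in>ring_hom R K" "set cs<=carrier R" "x\<in>carrier R"
 shows "\<psi> (horner R cs x) = horner K (map \<psi> cs) (\<psi> x)" "horner R cs x\<in>carrier R"
proof -
 interpret R: ring R by fact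
 have "\<psi> (horner R cs x) = horner K (map \<psi> cs) (\<psi> x) & horner R cs x\<in>carrier R"
  using assms(4)
 proof (induction cs)
  case Nil
  thus ?case using ring_hom_zero[OF assms(3,1,2)] by simp
 next
  case (Cons c cs)
  thus ?case using assms(5) by (simp add: ring_hom_add[OF assms(3)] ring_hom_mult[OF assms(3)])
 qed
 thus "\<psi> (horner R cs x) = horner K (map \<psi> cs) (\<psi> x)" "horner R cs x\<in>carrier R" by auto
qed

context
 fixes R :: "('a, 'm) ring_scheme" and K :: "('b, 'n) ring_scheme" and \<psi> :: "'a => 'b"
 assumes R: "cring R" and K: "cring K" and \<psi>: "\<psi>\<in>ring_hom R K"
begin

lemma lift_list: "set cs<=\<psi> ` C ==> \<exists>ds. set ds<=C & cs = map \<psi> ds"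
 by (intro exI[of _ "map (inv_into C \<psi>) cs"] conjI)
  (auto simp: comp_def f_inv_into_f subset_iff intro!: inv_into_into map_idI[symmetric])

lemma horner_hom': "set cs<=carrier R ==> x\<in>carrier R ==> \<psi> (horner R cs x) = horner K (map \<psi> cs) (\<psi> x)"
 using horner_hom(1)[OF cring.axioms(1)[OF R] cring.axioms(1)[OF K] \<psi>] .

lemma adjoin_hom:
 assumes "C<=carrier R" "x\<in>carrier R"
 shows "adjoin K (\<psi> ` C) (\<psi> x) = \<psi> ` adjoin R C x"
proof
 show "adjoin K (\<psi> ` C) (\<psi> x)<=\<psi> ` adjoin R C x"
 proof
  fix y assume "y\<in>adjoin K (\<psi> ` C) (\<psi> x)"
  then obtain cs where cs: "set cs<=\<psi> ` C" "y = horner K cs (\<psi> x)" unfolding adjoin_def by auto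
  obtain ds where "set ds<=C" "cs = map \<psi> ds" using lift_list[OF cs(1)] by auto
  thus "y\<in>\<psi> ` adjoin R C x" unfolding adjoin_def cs(2)
   using horner_hom'[of ds x] assms by (intro image_eqI[of _ _ "horner R ds x"]) auto
 qed
 show "\<psi> ` adjoin R C x<=adjoin K (\<psi> ` C) (\<psi> x)"
 proof
  fix y assume "y\<in>\<psi> ` adjoin R C x"
  then obtain cs where cs: "set cs<=C" "y = \<psi> (horner R cs x)" unfolding adjoin_def by auto
  hence "y = horner K (map \<psi> cs) (\<psi> x)" "set (map \<psi> cs)<=\<psi> ` C" using horner_hom'[of cs x] assms by auto
  thus "y\<in>adjoin K (\<psi> ` C) (\<psi> x)" unfolding adjoin_def by blast
 qed
qed

lemma foldl_adjoin_hom: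
 assumes "C<=carrier R" "set xs<=carrier R"
 shows "foldl (adjoin K) (\<psi> ` C) (map \<psi> xs) = \<psi> ` foldl (adjoin R) C xs"
 using assms
proof (induction xs arbitrary: C)
 case (Cons x xs)
 hence "adjoin R C x<=carrier R" using cring.adjoin_closed[OF R] by simp
 thus ?case using Cons adjoin_hom[of C x] by simp
qed simp

lemma transc_mod_hom:
 assumes "C<=carrier R" "x\<in>carrier R" "!!r. r\<in>carrier R ==> \<psi> r\<in>Q \<longleftrightarrow> r\<in>P"
 shows "transc_mod K Q (\<psi> ` C) (\<psi> x) \<longleftrightarrow> transc_mod R P C x"
proof
 assume t: "transc_mod K Q (\<psi> ` C) (\<psi> x)"
 show "transc_mod R P C x" unfolding transc_mod_def
 proof (intro allI impI)
  fix cs assume cs: "set cs<=C" "horner R cs x\<in>P"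
  hence cc: "set cs<=carrier R" using assms(1) by blast
  have "set (map \<psi> cs)<=\<psi> ` C" using cs(1) by auto
  moreover have "horner K (map \<psi> cs) (\<psi> x)\<in>Q"
   using assms(2,3) cs(2) horner_hom'[OF cc, of x] cring.horner_closed[OF R cc, of x] by metis
  ultimately have "set (map \<psi> cs)<=Q" using t unfolding transc_mod_def by blast
  thus "set cs<=P" using cc assms(3) by auto
 qed
next
 assume t: "transc_mod R P C x"
 show "transc_mod K Q (\<psi> ` C) (\<psi> x)" unfolding transc_mod_def
 proof (intro allI impI)
  fix cs assume cs: "set cs<=\<psi> ` C" "horner K cs (\<psi> x)\<in>Q"
  obtain ds where ds: "set ds<=C" "cs = map \<psi> ds" using lift_list[OF cs(1)] by auto
  have dc: "set ds<=carrier R" using ds(1) assms(1) by blast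
  have "horner R ds x\<in>P"
   using assms(2,3) cs(2) ds(2) horner_hom'[OF dc, of x] cring.horner_closed[OF R dc, of x] by metis
  hence "set ds<=P" using t ds unfolding transc_mod_def by blast
  thus "set cs<=Q" using ds(2) dc assms(3) by auto
 qed
qed

lemma indep_mod_hom:
 assumes "C<=carrier R" "set xs<=carrier R" "!!r. r\<in>carrier R ==> \<psi> r\<in>Q \<longleftrightarrow> r\<in>P"
 shows "indep_mod K Q (\<psi> ` C) (map \<psi> xs) \<longleftrightarrow> indep_mod R P C xs"
 using assms(1,2)
proof (induction xs arbitrary: C)
 case (Cons x xs)
 hence "adjoin R C x<=carrier R" using cring.adjoin_closed[OF R] by simp
 thus ?case using Cons adjoin_hom[of C x] transc_mod_hom[OF _ _ assms(3), of C x] by simp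
qed simp

end

text \<open>The image of the integers. Intersecting a prime with it remembers exactly the point of
  the spectrum of Z below that prime.\<close>

definition zim :: "('a, 'm) ring_scheme => 'a set" where
 "zim R = range (\<lambda>n :: int. [n] \<cdot>\<^bsub>R\<^esub> \<one>\<^bsub>R\<^esub>)"

lemma (in cring) zim_subring: "subring (zim R) R"
proof (rule subringI)
 show "zim R<=carrier R" unfolding zim_def by auto
 have "[(1 :: int)] \<cdot> \<one> = \<one>" by simp
 thus "\<one>\<in>zim R" unfolding zim_def by (metis rangeI)
next
 fix h assume "h\<in>zim R"
 then obtain n :: int where n: "h = [n] \<cdot> \<one>" unfolding zim_def by auto
 have "\<ominus> h = [(- n)] \<cdot> \<one>" unfolding n using add.int_pow_neg[of \<one> n] by simp
 thus "\<ominus> h\<in>zim R" unfolding zim_def by auto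
next
 fix h k assume "h\<in>zim R" "k\<in>zim R"
 then obtain m n :: int where n: "h = [m] \<cdot> \<one>" "k = [n] \<cdot> \<one>" unfolding zim_def by auto
 have "h\<oplus>k = [(m + n)] \<cdot> \<one>" unfolding n using add.int_pow_mult[of \<one> m n] by simp
 thus "h\<oplus>k\<in>zim R" unfolding zim_def by auto
 have "h\<otimes>k = [m] \<cdot> ([n] \<cdot> \<one>)" unfolding n using add_pow_ldistr_int[of \<one> "[n] \<cdot> \<one>" m] by simp
 also have "... = [(n * m)] \<cdot> \<one>" using add.int_pow_pow[of \<one> m n] by simp
 finally show "h\<otimes>k\<in>zim R" unfolding zim_def by auto
qed

lemma countable_zim: "countable (zim R)" unfolding zim_def by auto

lemma int_add_pow_hom:
 assumes "ring R" "ring K" "\<psi>\<in>ring_hom R K" "x\<in>carrier R"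
 shows "\<psi> ([(n :: int)] \<cdot>\<^bsub>R\<^esub> x) = [n] \<cdot>\<^bsub>K\<^esub> \<psi> x"
proof -
 interpret R: ring R by fact
 interpret K: ring K by fact
 have "\<psi>\<in>hom (add_monoid R) (add_monoid K)"
  unfolding hom_def using ring_hom_add[OF assms(3)] ring_hom_closed[OF assms(3)] by auto
 hence "\<psi> (x [^]\<^bsub>add_monoid R\<^esub> n) = \<psi> x [^]\<^bsub>add_monoid K\<^esub> n"
  using hom_int_pow[OF _ _ R.add.group_axioms K.add.group_axioms] assms(4) by simp
 thus ?thesis unfolding add_pow_def .
qed

lemma zim_hom:
 assumes "ring R" "ring K" "\<psi>\<in>ring_hom R K"
 shows "\<psi> ` zim R = zim K"
proof -
 interpret R: ring R by fact
 show ?thesis unfolding zim_def image_image using int_add_pow_hom[OF assms R.one_closed] ring_hom_one[OF assms(3)] by simp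
qed

lemma ring_fin_gen_adjoin:
 assumes "cring R" "ring_fin_gen R"
 shows "\<exists>gs. set gs<=carrier R & foldl (adjoin R) (zim R) gs = carrier R"
proof -
 interpret cring R by fact
 obtain G where G: "G<=carrier R" "finite G" "\<forall>S. subring S R & G<=S --> S = carrier R"
  using assms(2) unfolding ring_fin_gen_def by blast
 obtain gs where gs: "set gs = G" using finite_list[OF G(2)] by blast
 have gc: "set gs<=carrier R" using gs G(1) by simp
 have "foldl (adjoin R) (zim R) gs = carrier R"
  using G(3) foldl_adjoin_subring[OF zim_subring gc] foldl_adjoin_gens[OF zim_subring gc] unfolding gs by simp
 thus ?thesis using gc by auto
qed

text \<open>The field of fractions of a domain, built from the localisation classes that are used
  for structure sheaves.\<close>

definition FF :: "'a ring => ('a \<times> 'a) set ring" where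
 "FF D = (let S = carrier D - {\<zero>\<^bsub>D\<^esub>} in
   \<lparr>carrier = {loc_frac D S a s | a s. a\<in>carrier D & s\<in>S}, mult = loc_mult D S, one = loc_frac D S \<one>\<^bsub>D\<^esub> \<one>\<^bsub>D\<^esub>,
   zero = loc_frac D S \<zero>\<^bsub>D\<^esub> \<one>\<^bsub>D\<^esub>, add = loc_add D S\<rparr>)"

locale plain_domain = domain D for D :: "'a ring" (structure)
begin

abbreviation nz :: "'a set" where "nz \<equiv> carrier D - {\<zero>}"
abbreviation fr :: "'a => 'a => ('a \<times> 'a) set" where "fr \<equiv> loc_frac D nz"

lemma loc: "loc_ring D nz"
 by unfold_locales (auto simp: integral_iff)

lemma nz_mult: "s\<in>nz ==> t\<in>nz ==> s\<otimes>t\<in>nz" by (auto simp: integral_iff)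

lemma nz_one: "\<one>\<in>nz" by simp

lemma fr_eq:
 assumes "a\<in>carrier D" "s\<in>nz" "b\<in>carrier D" "t\<in>nz"
 shows "fr a s = fr b t \<longleftrightarrow> a\<otimes>t = b\<otimes>s"
proof -
 interpret loc_monoid D nz by unfold_locales (auto simp: integral_iff)
 show ?thesis unfolding loc_frac_eq_iff[OF assms] using assms m_lcancel nz_one by auto
qed

lemma fr_mult:
 "a\<in>carrier D ==> s\<in>nz ==> b\<in>carrier D ==> t\<in>nz ==> fr a s\<otimes>\<^bsub>FF D\<^esub> fr b t = fr (a\<otimes>b) (s\<otimes>t)"
proof -
 interpret loc_monoid D nz by unfold_locales (auto simp: integral_iff)
 show "a\<in>carrier D ==> s\<in>nz ==> b\<in>carrier D ==> t\<in>nz ==> fr a s\<otimes>\<^bsub>FF D\<^esub> fr b t = fr (a\<otimes>b) (s\<otimes>t)"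
  unfolding FF_def Let_def using loc_mult_frac by simp
qed

lemma fr_add:
 "a\<in>carrier D ==> s\<in>nz ==> b\<in>carrier D ==> t\<in>nz ==> fr a s\<oplus>\<^bsub>FF D\<^esub> fr b t = fr (a\<otimes>t\<oplus>b\<otimes>s) (s\<otimes>t)"
 unfolding FF_def Let_def using loc_ring.loc_add_frac[OF loc] by simp

lemma FF_ops: "\<one>\<^bsub>FF D\<^esub> = fr \<one> \<one>" "\<zero>\<^bsub>FF D\<^esub> = fr \<zero> \<one>" "carrier (FF D) = {fr a s | a s. a\<in>carrier D & s\<in>nz}"
 unfolding FF_def Let_def by simp_all

lemma FF_in: "a\<in>carrier D ==> s\<in>nz ==> fr a s\<in>carrier (FF D)"
 unfolding FF_ops by blast

lemma FF_E:
 assumes "x\<in>carrier (FF D)"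
 obtains a s where "a\<in>carrier D" "s\<in>nz" "x = fr a s"
 using assms unfolding FF_ops by blast

lemma FF_cring: "cring (FF D)"
proof (rule cringI)
 show "abelian_group (FF D)"
 proof (rule abelian_groupI)
  fix x y z assume "x\<in>carrier (FF D)" "y\<in>carrier (FF D)" "z\<in>carrier (FF D)"
  then obtain a s b t c u where [simp]: "x = fr a s" "y = fr b t" "z = fr c u"
   and m: "a\<in>carrier D" "s\<in>nz" "b\<in>carrier D" "t\<in>nz" "c\<in>carrier D" "u\<in>nz" by (elim FF_E) blast
  have mc: "s\<in>carrier D" "t\<in>carrier D" "u\<in>carrier D" using m by auto
  show "x\<oplus>\<^bsub>FF D\<^esub> y\<oplus>\<^bsub>FF D\<^esub> z = x\<oplus>\<^bsub>FF D\<^esub> (y\<oplus>\<^bsub>FF D\<^esub> z)"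
  proof -
   have "(a\<otimes>t\<oplus>b\<otimes>s)\<otimes>u\<oplus>c\<otimes>(s\<otimes>t) = a\<otimes>(t\<otimes>u)\<oplus>(b\<otimes>u\<oplus>c\<otimes>t)\<otimes>s"
    using m(1,3,5) mc by algebra
   moreover have "s\<otimes>t\<otimes>u = s\<otimes>(t\<otimes>u)" using mc by algebra
   ultimately show ?thesis using m mc nz_mult by (simp add: fr_add del: Diff_iff)
  qed
 next
  fix x y assume "x\<in>carrier (FF D)" "y\<in>carrier (FF D)"
  then obtain a s b t where [simp]: "x = fr a s" "y = fr b t"
   and m: "a\<in>carrier D" "s\<in>nz" "b\<in>carrier D" "t\<in>nz" by (elim FF_E) blast
  have mc: "s\<in>carrier D" "t\<in>carrier D" using m by auto
  show "x\<oplus>\<^bsub>FF D\<^esub> y\<in>carrier (FF D)" using m mc nz_mult by (simp add: fr_add FF_in del: Diff_iff)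
  have "a\<otimes>t\<oplus>b\<otimes>s = b\<otimes>s\<oplus>a\<otimes>t" "s\<otimes>t = t\<otimes>s" using m(1,3) mc by algebra+
  thus "x\<oplus>\<^bsub>FF D\<^esub> y = y\<oplus>\<^bsub>FF D\<^esub> x" using m by (simp add: fr_add del: Diff_iff)
 next
  fix x assume "x\<in>carrier (FF D)"
  then obtain a s where [simp]: "x = fr a s" and m: "a\<in>carrier D" "s\<in>nz" by (elim FF_E) blast
  have mc: "s\<in>carrier D" using m by auto
  show "\<zero>\<^bsub>FF D\<^esub>\<oplus>\<^bsub>FF D\<^esub> x = x" using m mc nz_one by (simp add: fr_add FF_ops del: Diff_iff)
  have "fr (\<ominus> a) s\<oplus>\<^bsub>FF D\<^esub> x = fr (\<ominus> a\<otimes>s\<oplus>a\<otimes>s) (s\<otimes>s)" using m by (simp add: fr_add del: Diff_iff)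
  also have "\<ominus> a\<otimes>s\<oplus>a\<otimes>s = \<zero>" using m(1) mc by algebra
  also have "fr \<zero> (s\<otimes>s) = \<zero>\<^bsub>FF D\<^esub>" unfolding FF_ops using m mc nz_mult nz_one by (subst fr_eq) auto
  finally show "\<exists>y\<in>carrier (FF D). y\<oplus>\<^bsub>FF D\<^esub> x = \<zero>\<^bsub>FF D\<^esub>" using FF_in[of "\<ominus> a" s] m by blast
 next
  show "\<zero>\<^bsub>FF D\<^esub>\<in>carrier (FF D)" unfolding FF_ops(2) by (rule FF_in[OF zero_closed nz_one])
 qed
 show "comm_monoid (FF D)"
 proof (rule comm_monoidI)
  fix x y z assume "x\<in>carrier (FF D)" "y\<in>carrier (FF D)" "z\<in>carrier (FF D)"
  then obtain a s b t c u where [simp]: "x = fr a s" "y = fr b t" "z = fr c u"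
   and m: "a\<in>carrier D" "s\<in>nz" "b\<in>carrier D" "t\<in>nz" "c\<in>carrier D" "u\<in>nz" by (elim FF_E) blast
  have mc: "s\<in>carrier D" "t\<in>carrier D" "u\<in>carrier D" using m by auto
  show "x\<otimes>\<^bsub>FF D\<^esub> y\<otimes>\<^bsub>FF D\<^esub> z = x\<otimes>\<^bsub>FF D\<^esub> (y\<otimes>\<^bsub>FF D\<^esub> z)"
   using m mc nz_mult by (simp add: fr_mult m_assoc del: Diff_iff)
 next
  fix x y assume "x\<in>carrier (FF D)" "y\<in>carrier (FF D)"
  then obtain a s b t where [simp]: "x = fr a s" "y = fr b t"
   and m: "a\<in>carrier D" "s\<in>nz" "b\<in>carrier D" "t\<in>nz" by (elim FF_E) blast
  have mc: "s\<in>carrier D" "t\<in>carrier D" using m by auto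
  show "x\<otimes>\<^bsub>FF D\<^esub> y\<in>carrier (FF D)" using m mc nz_mult by (simp add: fr_mult FF_in del: Diff_iff)
  show "x\<otimes>\<^bsub>FF D\<^esub> y = y\<otimes>\<^bsub>FF D\<^esub> x" using m m_comm[of a b] m_comm[of s t] mc by (simp add: fr_mult del: Diff_iff)
 next
  fix x assume "x\<in>carrier (FF D)"
  then obtain a s where [simp]: "x = fr a s" and m: "a\<in>carrier D" "s\<in>nz" by (elim FF_E) blast
  have mc: "s\<in>carrier D" using m by auto
  show "\<one>\<^bsub>FF D\<^esub>\<otimes>\<^bsub>FF D\<^esub> x = x" using m mc nz_one by (simp add: fr_mult FF_ops del: Diff_iff)
 next
  show "\<one>\<^bsub>FF D\<^esub>\<in>carrier (FF D)" unfolding FF_ops(1) by (rule FF_in[OF one_closed nz_one])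
 qed
 fix x y z assume "x\<in>carrier (FF D)" "y\<in>carrier (FF D)" "z\<in>carrier (FF D)"
 then obtain a s b t c u where [simp]: "x = fr a s" "y = fr b t" "z = fr c u"
  and m: "a\<in>carrier D" "s\<in>nz" "b\<in>carrier D" "t\<in>nz" "c\<in>carrier D" "u\<in>nz" by (elim FF_E) blast
 have mc: "s\<in>carrier D" "t\<in>carrier D" "u\<in>carrier D" using m by auto
 have "(x\<oplus>\<^bsub>FF D\<^esub> y)\<otimes>\<^bsub>FF D\<^esub> z = fr ((a\<otimes>t\<oplus>b\<otimes>s)\<otimes>c) (s\<otimes>t\<otimes>u)"
  using m mc nz_mult by (simp add: fr_mult fr_add del: Diff_iff)
 also have "... = fr (a\<otimes>c\<otimes>(t\<otimes>u)\<oplus>b\<otimes>c\<otimes>(s\<otimes>u)) (s\<otimes>u\<otimes>(t\<otimes>u))"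
 proof -
  have "(a\<otimes>t\<oplus>b\<otimes>s)\<otimes>c\<otimes>(s\<otimes>u\<otimes>(t\<otimes>u)) = (a\<otimes>c\<otimes>(t\<otimes>u)\<oplus>b\<otimes>c\<otimes>(s\<otimes>u))\<otimes>(s\<otimes>t\<otimes>u)"
   using m(1,3,5) mc by algebra
  thus ?thesis using m mc nz_mult by (subst fr_eq) (simp_all del: Diff_iff)
 qed
 also have "... = x\<otimes>\<^bsub>FF D\<^esub> z\<oplus>\<^bsub>FF D\<^esub> y\<otimes>\<^bsub>FF D\<^esub> z"
  using m mc nz_mult by (simp add: fr_mult fr_add del: Diff_iff)
 finally show "(x\<oplus>\<^bsub>FF D\<^esub> y)\<otimes>\<^bsub>FF D\<^esub> z = x\<otimes>\<^bsub>FF D\<^esub> z\<oplus>\<^bsub>FF D\<^esub> y\<otimes>\<^bsub>FF D\<^esub> z" .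
qed

lemma FF_field: "field (FF D)"
proof (rule cring.cring_fieldI2[OF FF_cring])
 show "\<zero>\<^bsub>FF D\<^esub> ~= \<one>\<^bsub>FF D\<^esub>" unfolding FF_ops using fr_eq[of \<zero> \<one> \<one> \<one>] by simp
 fix x assume x: "x\<in>carrier (FF D)" "x ~= \<zero>\<^bsub>FF D\<^esub>"
 then obtain a s where e: "x = fr a s" and m: "a\<in>carrier D" "s\<in>nz" by (elim FF_E) blast
 have mc: "s\<in>carrier D" using m by auto
 have a0: "a\<in>nz" using x(2) m mc fr_eq[of a s \<zero> \<one>] unfolding e FF_ops by auto
 have "x\<otimes>\<^bsub>FF D\<^esub> fr s a = fr (a\<otimes>s) (s\<otimes>a)" unfolding e using m mc a0 by (simp add: fr_mult del: Diff_iff)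
 also have "... = \<one>\<^bsub>FF D\<^esub>" unfolding FF_ops using m mc a0 nz_mult nz_one m_comm by (subst fr_eq) auto
 finally show "\<exists>b\<in>carrier (FF D). x\<otimes>\<^bsub>FF D\<^esub> b = \<one>\<^bsub>FF D\<^esub>" using FF_in[OF mc a0] by blast
qed

lemma FF_incl: "(%a. fr a \<one>)\<in>ring_hom D (FF D)" "a\<in>carrier D ==> fr a \<one> = \<zero>\<^bsub>FF D\<^esub> \<longleftrightarrow> a = \<zero>"
proof -
 show "(%a. fr a \<one>)\<in>ring_hom D (FF D)"
  using nz_one by (intro ring_hom_memI) (simp_all add: FF_in fr_mult fr_add FF_ops(1) del: Diff_iff)
 show "a\<in>carrier D ==> fr a \<one> = \<zero>\<^bsub>FF D\<^esub> \<longleftrightarrow> a = \<zero>"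
  unfolding FF_ops using fr_eq[of a \<one> \<zero> \<one>] by simp
qed

lemma FF_countable: "countable (carrier D) ==> countable (carrier (FF D))"
proof -
 have "carrier (FF D)<=(%(a, s). fr a s) ` (carrier D \<times> carrier D)" unfolding FF_ops by auto
 thus "countable (carrier D) ==> countable (carrier (FF D))" by (meson countable_SIGMA countable_image countable_subset)
qed

end

text \<open>The fraction field of R/P is countable because \<open>R\<close> is. It therefore injects
  into any infinite type, and \<open>image_ring\<close> transports the field structure along the
  injection.\<close>

lemma residue_field_exists:
 fixes R :: "'a ring"
 assumes R: "cring R" and P: "primeideal P R" and cnt: "countable (carrier R)"
 shows "\<exists>K :: ('u :: infinite) ring. field K & (\<exists>\<psi>\<in>ring_hom R K. \<forall>r\<in>carrier R. \<psi> r = \<zero>\<^bsub>K\<^esub> \<longleftrightarrow> r\<in>P)"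
proof -
 interpret R: cring R by fact
 interpret P: primeideal P R by fact
 define D where "D = R Quot P"
 interpret D: plain_domain D unfolding plain_domain_def D_def by (rule P.quotient_is_domain)
 have \<pi>: "(+>\<^bsub>R\<^esub>) P\<in>ring_hom R D" unfolding D_def by (rule P.rcos_ring_hom)
 have Dc: "carrier D = (+>\<^bsub>R\<^esub>) P ` carrier R" unfolding D_def FactRing_def A_RCOSETS_def' by auto
 have \<pi>0: "P +>\<^bsub>R\<^esub> r = \<zero>\<^bsub>D\<^esub> \<longleftrightarrow> r\<in>P" if "r\<in>carrier R" for r
 proof -
  have "\<zero>\<^bsub>D\<^esub> = P" unfolding D_def FactRing_def by simp
  thus ?thesis using that P.a_rcos_const P.a_rcos_self by metis
 qed
 interpret F: field "FF D" by (rule D.FF_field)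
 have "countable (carrier (FF D))" using D.FF_countable Dc cnt by simp
 then obtain g :: "('a set \<times> 'a set) set => nat" where g: "inj_on g (carrier (FF D))" unfolding countable_def by blast
 obtain i :: "nat => 'u" where i: "inj i" using infinite_countable_subset[OF infinite_UNIV] by blast
 have ig: "inj_on (i \<circ> g) (carrier (FF D))" using g i by (intro comp_inj_on) (auto intro: inj_on_subset)
 define K where "K = image_ring (i \<circ> g) (FF D)"
 have Kf: "field K" unfolding K_def by (rule F.inj_imp_image_ring_is_field[OF ig])
 have iso: "i \<circ> g\<in>ring_iso (FF D) K" unfolding K_def by (rule inj_imp_image_ring_iso[OF ig])
 hence hom: "i \<circ> g\<in>ring_hom (FF D) K" unfolding ring_iso_def by simp
 interpret K: field K by (rule Kf)
 have z: "(i \<circ> g) x = \<zero>\<^bsub>K\<^esub> \<longleftrightarrow> x = \<zero>\<^bsub>FF D\<^esub>" if "x\<in>carrier (FF D)" for x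
  using ring_hom_zero[OF hom F.is_ring K.is_ring] inj_onD[OF ig _ that F.zero_closed] by metis
 define \<psi> where "\<psi> = (i \<circ> g) \<circ> ((%a. D.fr a \<one>\<^bsub>D\<^esub>) \<circ> (+>\<^bsub>R\<^esub>) P)"
 have "\<psi>\<in>ring_hom R K" unfolding \<psi>_def by (intro ring_hom_trans[OF ring_hom_trans[OF \<pi> D.FF_incl(1)] hom])
 moreover have "\<psi> r = \<zero>\<^bsub>K\<^esub> \<longleftrightarrow> r\<in>P" if r: "r\<in>carrier R" for r
 proof -
  have c: "P +>\<^bsub>R\<^esub> r\<in>carrier D" using Dc r by blast
  show ?thesis
   using z[OF ring_hom_closed[OF D.FF_incl(1) c]] D.FF_incl(2)[OF c] \<pi>0[OF r] unfolding \<psi>_def by simp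
 qed
 ultimately show ?thesis using Kf by blast
qed

section \<open>Algebraically independent elements in a countable field\<close>

definition RR :: "real ring" where
 "RR = \<lparr>carrier = UNIV, mult = %x y. x * y, one = 1, zero = 0, add = %x y. x + y\<rparr>"

lemma RR_simps [simp]: "carrier RR = UNIV" "x\<otimes>\<^bsub>RR\<^esub> y = x * y" "one RR = 1" "zero RR = 0"
 "x\<oplus>\<^bsub>RR\<^esub> y = x + y"
 unfolding RR_def by simp_all

lemma RR_cring: "cring RR"
 by (rule cringI, rule abelian_groupI, auto intro!: comm_monoidI simp: algebra_simps intro: exI[of _ "- x" for x])

lemma RR_domain: "domain RR"
 by (intro domain.intro RR_cring) (unfold_locales, auto)

lemma horner_RR: "horner RR cs x = poly (Poly cs) x"
 by (induction cs) simp_all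

text \<open>There are only countably many nonzero polynomials over a countable set of coefficients,
  each with finitely many roots, and the reals are uncountable.\<close>

lemma transc_real_exists:
 assumes "countable C"
 shows "\<exists>x. transc_mod RR {0} C x"
proof -
 define A where "A = (\<Union>cs\<in>{cs\<in>lists C. Poly cs ~= 0}. {x :: real. poly (Poly cs) x = 0})"
 have "countable {cs\<in>lists C. Poly cs ~= 0}" by (rule countable_subset[OF _ countable_lists[OF assms]]) auto
 hence "countable A"
  unfolding A_def by (rule countable_UN) (auto intro: countable_finite poly_roots_finite)
 hence "A ~= UNIV" using uncountable_UNIV_real by metis
 then obtain x where x: "x\<notin>A" by blast
 have "transc_mod RR {0} C x" unfolding transc_mod_def
 proof (intro allI impI)
  fix cs assume cs: "set cs<=C" "horner RR cs x\<in>{0}"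
  hence "Poly cs = 0" using x unfolding A_def horner_RR by (auto simp: lists_eq_set)
  then obtain n where "cs = replicate n 0" unfolding Poly_eq_0 by blast
  thus "set cs<={0}" by auto
 qed
 thus ?thesis by blast
qed

lemma indep_reals_exist: "countable C ==> \<exists>xs. length xs = n & indep_mod RR {0} C xs"
proof (induction n arbitrary: C)
 case (Suc n)
 obtain x where x: "transc_mod RR {0} C x" using transc_real_exists Suc.prems by blast
 obtain xs where "length xs = n" "indep_mod RR {0} (adjoin RR C x) xs"
  using Suc.IH[OF cring.countable_adjoin[OF RR_cring Suc.prems]] by blast
 hence "length (x # xs) = Suc n & indep_mod RR {0} C (x # xs)" using x by simp
 thus ?case by blast
qed simp

text \<open>The subring of the reals generated by n independent numbers is countable, so its
  fraction field can be copied into the given type; independence survives under injective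
  homomorphisms.\<close>

lemma indep_field_exists:
 "\<exists>(K :: ('u :: infinite) ring) ts. field K & length ts = n & set ts<=carrier K & indep_mod K {\<zero>\<^bsub>K\<^esub>} (zim K) ts"
proof -
 interpret RR: domain RR by (rule RR_domain)
 obtain xs where xs: "length xs = n" "indep_mod RR {0} (zim RR) xs" using indep_reals_exist[OF countable_zim] by blast
 define S where "S = foldl (adjoin RR) (zim RR) xs"
 have S: "subring S RR" "set xs<=S" "countable S"
  unfolding S_def using RR.foldl_adjoin_subring[OF RR.zim_subring] RR.foldl_adjoin_gens[OF RR.zim_subring]
   RR.countable_foldl_adjoin[OF countable_zim] by auto
 define A where "A = RR\<lparr>carrier := S\<rparr>"
 have As: "carrier A = S" "zero A = 0" "one A = 1" unfolding A_def by simp_all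
 have Ad: "domain A" unfolding A_def using RR.subring_is_domain[OF S(1)] .
 interpret A: domain A by (rule Ad)
 have id: "(%x. x)\<in>ring_hom A RR" unfolding ring_hom_def A_def by auto
 have zA: "zim A = zim RR" using zim_hom[OF A.ring_axioms RR.ring_axioms id] by simp
 have zc: "zim A<=carrier A" using subringE(1)[OF A.zim_subring] .
 have xc: "set xs<=carrier A" using S(2) unfolding As .
 have iA: "indep_mod A {0} (zim A) xs"
  using indep_mod_hom[OF A.is_cring RR.is_cring id zc xc, of "{0}" "{0}"] xs(2) unfolding zA by simp
 obtain K :: "'u ring" and \<psi> where K: "field K" and \<psi>: "\<psi>\<in>ring_hom A K" "!!r. r\<in>carrier A ==> \<psi> r = \<zero>\<^bsub>K\<^esub> \<longleftrightarrow> r\<in>{0}"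
  using residue_field_exists[OF A.is_cring A.zeroprimeideal] S(3) unfolding As by auto
 interpret K: field K by (rule K)
 have "indep_mod K {\<zero>\<^bsub>K\<^esub>} (\<psi> ` zim A) (map \<psi> xs)"
  using indep_mod_hom[OF A.is_cring K.is_cring \<psi>(1) zc xc, of "{\<zero>\<^bsub>K\<^esub>}" "{0}"] iA \<psi>(2) by simp
 hence "indep_mod K {\<zero>\<^bsub>K\<^esub>} (zim K) (map \<psi> xs)" using zim_hom[OF A.ring_axioms K.ring_axioms \<psi>(1)] by simp
 moreover have "set (map \<psi> xs)<=carrier K" using ring_hom_closed[OF \<psi>(1)] S(2) unfolding As by auto
 ultimately show ?thesis using K xs(1) by (intro exI[of _ K] exI[of _ "map \<psi> xs"]) simp
qed

section \<open>Bounds on transcendence degrees\<close>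

context domain
begin

text \<open>A greedy choice: an element is kept if it is transcendental over what precedes it and is
  algebraic otherwise. Choosing from the given list is what later allows the basis to be lifted to
  \<open>R\<close>.\<close>

lemma transcendence_basis_of_list:
 assumes "subring C R" "set gs<=carrier R"
 shows "\<exists>xs. set xs<=set gs & indep_mod R {\<zero>} C xs & (\<forall>g\<in>set gs. alg_over (foldl (adjoin R) C xs) g)"
 using assms
proof (induction gs arbitrary: C)
 case (Cons g gs)
 have g: "g\<in>carrier R" "set gs<=carrier R" using Cons.prems(2) by auto
 show ?case
 proof (cases "transc_mod R {\<zero>} C g")
  case True
  obtain xs where xs: "set xs<=set gs" "indep_mod R {\<zero>} (adjoin R C g) xs"
    "\<forall>h\<in>set gs. alg_over (foldl (adjoin R) (adjoin R C g) xs) h"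
   using Cons.IH[OF adjoin_subring[OF Cons.prems(1) g(1)] g(2)] by blast
  have gx: "set (g # xs)<=carrier R" using xs(1) g by auto
  have "alg_over (foldl (adjoin R) C (g # xs)) g"
   using foldl_adjoin_gens[OF Cons.prems(1) gx] alg_over_self[OF foldl_adjoin_subring[OF Cons.prems(1) gx]] by auto
  thus ?thesis using True xs by (intro exI[of _ "g # xs"]) auto
 next
  case False
  obtain xs where xs: "set xs<=set gs" "indep_mod R {\<zero>} C xs" "\<forall>h\<in>set gs. alg_over (foldl (adjoin R) C xs) h"
   using Cons.IH[OF Cons.prems(1) g(2)] by blast
  have xc: "set xs<=carrier R" using xs(1) g by auto
  have "alg_over (foldl (adjoin R) C xs) g"
   using alg_over_mono[OF foldl_adjoin_base[OF Cons.prems(1) xc] False] .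
  thus ?thesis using xs by (intro exI[of _ xs]) auto
 qed
qed simp

text \<open>The equation is T^e - t^e, with e - 1 zeros between constant and leading
  coefficient.\<close>

lemma alg_over_root:
 assumes t: "t\<in>carrier R" and e: "e > 0" and D: "\<ominus> (t [^] (e :: nat))\<in>D" "\<zero>\<in>D" "\<one>\<in>D"
 shows "alg_over D t"
proof -
 define cs where "cs = replicate (e - 1) \<zero> @ [\<one>]"
 have rep: "set (replicate (e - 1) \<zero>)<=carrier R" by auto
 have "horner R cs t = horner R (replicate (e - 1) \<zero>) t\<oplus>t [^] (e - 1)\<otimes>horner R [\<one>] t"
  unfolding cs_def using horner_append[OF rep _ t, of "[\<one>]"] by simp
 hence "horner R cs t = t [^] (e - 1)" using t horner_replicate_zero[OF t] by simp
 hence "horner R (\<ominus> (t [^] e) # cs) t = \<ominus> (t [^] e)\<oplus>t\<otimes>t [^] (e - 1)" by simp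
 also have "t\<otimes>t [^] (e - 1) = t [^] e" using nat_pow_Suc2[OF t, of "e - 1"] e by simp
 also have "\<ominus> (t [^] e)\<oplus>t [^] e = \<zero>" using t l_neg by simp
 finally have "horner R (\<ominus> (t [^] e) # cs) t\<in>{\<zero>}" by simp
 moreover have "set (\<ominus> (t [^] e) # cs)<=D" using D unfolding cs_def by auto
 moreover have "\<not> set (\<ominus> (t [^] e) # cs)<={\<zero>}" unfolding cs_def by simp
 ultimately show ?thesis unfolding transc_mod_def by metis
qed

end

context plain_field
begin

lemma alg_over_root_subfield:
 assumes C: "subring C K" and D: "subfield D K" "!!d. d\<in>D ==> alg_over C d"
  and t: "t\<in>carrier K" "e > 0" "t [^] (e :: nat)\<in>D"
 shows "alg_over C t"
proof -
 have s: "subring D K" using subfieldE(1)[OF D(1)] .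
 show ?thesis
  by (rule alg_over_trans[OF C subringE(1)[OF s] D(2) t(1)], assumption, rule alg_over_root[OF t(1,2)])
   (use subringE[OF s] t(3) in auto)
qed

text \<open>A transcendence basis \<open>xs\<close> is chosen among the images of the generators of
  \<open>R\<close>. The field generated by \<psi>(R) is algebraic over it, and so are the
  \<open>ts\<close>, whose e-th powers lie there; Steinitz bounds their number by that of
  \<open>xs\<close>, and \<open>xs\<close> lifts to \<open>R\<close> by construction.\<close>

lemma indep_lift_of_generators:
 assumes R: "cring R" and gs: "set gs<=carrier R" "foldl (adjoin R) (zim R) gs = carrier R" and \<psi>: "\<psi>\<in>ring_hom R K"
  and ts: "set ts<=carrier K" "indep_mod K {\<zero>} (zim K) ts"
  and e: "e > 0" "!!t. t\<in>set ts ==> t [^] (e :: nat)\<in>generate_field K (\<psi> ` carrier R)"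
 shows "\<exists>ys. set ys<=carrier R & length ts \<le> length ys & indep_mod R {r\<in>carrier R. \<psi> r = \<zero>} (zim R) ys"
proof -
 interpret R: cring R by fact
 have zh: "\<psi> ` zim R = zim K" by (rule zim_hom[OF R.ring_axioms ring_axioms \<psi>])
 have zR: "zim R<=carrier R" using subringE(1)[OF R.zim_subring] .
 have \<psi>c: "\<psi> ` carrier R<=carrier K" using ring_hom_closed[OF \<psi>] by auto
 have gK: "set (map \<psi> gs)<=carrier K" using gs(1) \<psi>c by auto
 obtain xs where xs: "set xs<=set (map \<psi> gs)" "indep_mod K {\<zero>} (zim K) xs"
   "\<forall>g\<in>set (map \<psi> gs). alg_over (foldl (adjoin K) (zim K) xs) g"
  using transcendence_basis_of_list[OF zim_subring gK] by blast
 define C where "C = foldl (adjoin K) (zim K) xs"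
 have xK: "set xs<=carrier K" using xs(1) gK by auto
 have C: "subring C K" "zim K<=C" unfolding C_def
  using foldl_adjoin_subring[OF zim_subring xK] foldl_adjoin_base[OF zim_subring xK] by auto
 have algR: "alg_over C y" if "y\<in>\<psi> ` carrier R" for y
 proof (rule alg_over_foldl[OF C(1) gK])
  have s: "subring (foldl (adjoin K) C (map \<psi> gs)) K" by (rule foldl_adjoin_subring[OF C(1) gK])
  have "\<psi> ` carrier R = foldl (adjoin K) (zim K) (map \<psi> gs)"
   using foldl_adjoin_hom[OF R is_cring \<psi> zR gs(1)] gs(2) zh by simp
  also have "...<=foldl (adjoin K) C (map \<psi> gs)"
   using foldl_adjoin_minimal[OF s] C(2) foldl_adjoin_base[OF C(1) gK] foldl_adjoin_gens[OF C(1) gK] by blast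
  finally show "y\<in>foldl (adjoin K) C (map \<psi> gs)" using that by blast
  fix x assume "x\<in>set (map \<psi> gs)"
  thus "alg_over C x" using xs(3) unfolding C_def by blast
 qed
 have "alg_over C t" if "t\<in>set ts" for t
  using alg_over_root_subfield[OF C(1) generate_field_is_subfield[OF \<psi>c] alg_over_generate_field[OF C(1) \<psi>c algR]]
   that ts(1) e by blast
 hence len: "length ts \<le> length xs"
  using steinitz[OF zim_subring xK ts] unfolding C_def by blast
 obtain ys where ys: "set ys<=set gs" "xs = map \<psi> ys" using lift_list[OF R is_cring \<psi>, of xs "set gs"] xs(1) by auto
 have yR: "set ys<=carrier R" using ys(1) gs(1) by auto
 have "indep_mod R {r\<in>carrier R. \<psi> r = \<zero>} (zim R) ys"
  using indep_mod_hom[OF R is_cring \<psi> zR yR, of "{\<zero>}" "{r\<in>carrier R. \<psi> r = \<zero>}"] xs(2) zh ys(2) by simp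
 thus ?thesis using yR len ys(2) by (intro exI[of _ ys]) simp
qed

lemma subfield_units_subgroup:
 assumes S: "subfield S K"
 shows "subgroup (S - {\<zero>}) (units_of (ring_pmonoid K))"
proof -
 interpret N: pmonoid "ring_pmonoid K" by (rule ring_pmonoid_pmonoid)
 interpret U: comm_group "units_of (ring_pmonoid K)" by (rule N.units_of_comm_group)
 have sub: "S - {\<zero>}<=carrier K - {\<zero>}" using subfieldE(3)[OF S] by auto
 have s: "subring S K" using subfieldE(1)[OF S] .
 have inv: "inv\<^bsub>ring_pmonoid K\<^esub> a = inv a" for a unfolding m_inv_def by simp
 show ?thesis
 proof (rule U.subgroupI)
  show "S - {\<zero>}<=carrier (units_of (ring_pmonoid K))" unfolding units_of_carrier Units_ring_pmonoid by (rule sub)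
  show "S - {\<zero>} ~= {}" using subringE(3)[OF s] by auto
  fix a assume a: "a\<in>S - {\<zero>}"
  hence "inv\<^bsub>units_of (ring_pmonoid K)\<^esub> a = inv a"
   using N.units_of_inv[of a] sub unfolding Units_ring_pmonoid inv by blast
  thus "inv\<^bsub>units_of (ring_pmonoid K)\<^esub> a\<in>S - {\<zero>}" using subfield_m_inv(1)[OF S a] by simp
  fix b assume b: "b\<in>S - {\<zero>}"
  show "a\<otimes>\<^bsub>units_of (ring_pmonoid K)\<^esub> b\<in>S - {\<zero>}"
   using subringE(6)[OF s] a b sub integral[of a b] unfolding units_of_mult by auto
 qed
qed

text \<open>The e-th power of the value at a generator outside the kernel is a product of integral
  powers of values on \<open>B\<close>. Hence all values of f, and with them the field they
  generate, are algebraic over the ring generated by f(B), and Steinitz applies.\<close>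

lemma indep_bounded_by_prime_basis:
 assumes pb: "prime_basis M G p B e c" and f: "f\<in>pmonoid_hom M (ring_pmonoid K)" and ker: "p = pm_ker M (ring_pmonoid K) f"
  and xs: "indep_mod K {\<zero>} (zim K) xs" "set xs<=generate_field K (f ` carrier M)"
 shows "length xs \<le> card B"
proof -
 interpret prime_basis M G p B e c by fact
 interpret N: pmonoid "ring_pmonoid K" by (rule ring_pmonoid_pmonoid)
 interpret U: comm_group "units_of (ring_pmonoid K)" by (rule N.units_of_comm_group)
 have fM: "f ` carrier M<=carrier K" using f unfolding pmonoid_hom_def hom_def by auto
 have fin: "finite B" using B HM(2) finite_subset by blast
 then obtain bl where bl: "set bl = B" "length bl = card B" using finite_distinct_list distinct_card by metis
 have BM: "B<=carrier M" using B HM(1) by auto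
 have bK: "set (map f bl)<=carrier K" using bl fM BM by auto
 define C where "C = foldl (adjoin K) (zim K) (map f bl)"
 have C: "subring C K" unfolding C_def by (rule foldl_adjoin_subring[OF zim_subring bK])
 have un: "f g\<in>Units (ring_pmonoid K)" if "g\<in>carrier M" "g\<notin>p" for g
  by (rule pm_ker_prime(2)[OF pmonoid_axioms pm_field_ring f]) (use that ker in simp)
 have fB: "f ` B<=carrier K" using fM BM by auto
 define S where "S = generate_field K (f ` B)"
 have S: "subfield S K" unfolding S_def by (rule generate_field_is_subfield[OF fB])
 have "f ` B<=C" unfolding C_def using foldl_adjoin_gens[OF zim_subring bK] bl by auto
 hence algB: "alg_over C b" if "b\<in>f ` B" for b using alg_over_self[OF C] that by blast
 have algS: "alg_over C d" if "d\<in>S" for d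
  using alg_over_generate_field[OF C fB algB] that unfolding S_def by blast
 have H: "subgroup (S - {\<zero>}) (units_of (ring_pmonoid K))" by (rule subfield_units_subgroup[OF S])
 have prodS: "(\<Otimes>\<^bsub>units_of (ring_pmonoid K)\<^esub>b\<in>A. f b [^]\<^bsub>units_of (ring_pmonoid K)\<^esub> k b)\<in>S - {\<zero>}"
  if "finite A" "A<=B" for A and k :: "'b => int"
  using that
 proof (induction A rule: finite_induct)
  case empty
  thus ?case using subgroup.one_closed[OF H] by simp
 next
  case (insert b A)
  have pw: "f x [^]\<^bsub>units_of (ring_pmonoid K)\<^esub> k x\<in>S - {\<zero>}" if "x\<in>B" for x
  proof (rule U.subgroup_int_pow_closed[OF H])
   have "f x\<in>S" unfolding S_def using that by (intro generate_field.incl) blast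
   moreover have "f x ~= \<zero>" using un[of x] that B BM unfolding Units_ring_pmonoid by blast
   ultimately show "f x\<in>S - {\<zero>}" by simp
  qed
  have "(%x. f x [^]\<^bsub>units_of (ring_pmonoid K)\<^esub> k x)\<in>B \<rightarrow> carrier (units_of (ring_pmonoid K))"
   using pw subgroup.subset[OF H] by blast
  thus ?case
   using insert subgroup.m_closed[OF H pw] by (subst U.finprod_insert) auto
 qed
 have algG: "alg_over C (f g)" if g: "g\<in>G" for g
 proof (cases "g\<in>p")
  case True
  hence "f g = \<zero>" unfolding ker pm_ker_def by simp
  thus ?thesis using alg_over_self[OF C] subringE(2)[OF C] by simp
 next
  case False
  have gM: "g\<in>carrier M" using g G by auto
  have unG: "f h\<in>Units (ring_pmonoid K)" if "h\<in>G - p" for h using un HM(1) that by blast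
  have "f g [^]\<^bsub>units_of (ring_pmonoid K)\<^esub> e
    = (\<Otimes>\<^bsub>units_of (ring_pmonoid K)\<^esub>b\<in>B. f b [^]\<^bsub>units_of (ring_pmonoid K)\<^esub> c b g)"
   by (rule hom_torsion_basis[OF ring_pmonoid_pmonoid f unG]) (use g False in auto)
  hence "f g [^]\<^bsub>units_of (ring_pmonoid K)\<^esub> e\<in>S - {\<zero>}"
   using prodS[OF fin order_refl, of "%b. c b g"] by simp
  moreover have "f g [^]\<^bsub>units_of (ring_pmonoid K)\<^esub> n = f g [^] n" for n :: nat
   by (induction n) (simp_all add: units_of_mult units_of_one)
  ultimately have "f g [^] e\<in>S" by simp
  thus ?thesis using alg_over_root_subfield[OF C S algS _ e] fM gM by blast
 qed
 \<comment> \<open>Being algebraic is stable under products, so it passes from the generators to the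
   whole monoid.\<close>
 define T where "T = {x\<in>carrier M. alg_over C (f x)}"
 have "submonoid T M"
 proof
  show "T<=carrier M" unfolding T_def by auto
  have "f \<one>\<^bsub>M\<^esub> = \<one>" using f unfolding pmonoid_hom_def by simp
  thus "\<one>\<^bsub>M\<^esub>\<in>T" unfolding T_def using alg_over_self[OF C] subringE(3)[OF C] by simp
  fix x y assume xy: "x\<in>T" "y\<in>T"
  hence c: "set [f x, f y]<=carrier K" "x\<in>carrier M" "y\<in>carrier M" using fM unfolding T_def by auto
  have "f x\<otimes>f y\<in>foldl (adjoin K) C [f x, f y]"
   using subringE(6)[OF foldl_adjoin_subring[OF C c(1)]] foldl_adjoin_gens[OF C c(1)] by auto
  hence "alg_over C (f x\<otimes>f y)" by (rule alg_over_foldl[OF C c(1), rotated]) (use xy in \<open>auto simp: T_def\<close>)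
  moreover have "f (x\<otimes>\<^bsub>M\<^esub> y) = f x\<otimes>f y" using f c unfolding pmonoid_hom_def hom_def by auto
  ultimately show "x\<otimes>\<^bsub>M\<^esub> y\<in>T" unfolding T_def using c by simp
 qed
 moreover have "f (absorb M) = \<zero>" using f unfolding pmonoid_hom_def by simp
 hence "absorb M\<in>T" unfolding T_def using alg_over_self[OF C] subringE(2)[OF C] absorb_closed by simp
 moreover have "G<=T" unfolding T_def using algG G by auto
 ultimately have "T = carrier M" using G(3) by blast
 hence "alg_over C y" if "y\<in>f ` carrier M" for y using that unfolding T_def by auto
 hence "alg_over C x" if "x\<in>set xs" for x
  using alg_over_generate_field[OF C fM] xs(2) that by blast
 moreover have "set xs<=carrier K" using xs(2) subfieldE(3)[OF generate_field_is_subfield[OF fM]] by blast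
 ultimately show ?thesis using steinitz[OF zim_subring bK _ xs(1)] bl(2) unfolding C_def by simp
qed

end

section \<open>Chains of irreducible closed sets in fibres\<close>

lemma int_ring_add_pow: "[(n :: int)] \<cdot>\<^bsub>\<Z>\<^esub> 1 = n"
proof -
 have nat: "[(k :: nat)] \<cdot>\<^bsub>\<Z>\<^esub> 1 = int k" for k
  unfolding add_pow_def by (induction k) (simp_all add: nat_pow_def)
 have "\<ominus>\<^bsub>\<Z>\<^esub> k = - k" for k by (rule int_a_inv_eq)
 thus ?thesis using nat by (cases "n \<ge> 0") (simp_all add: add_pow_int_ge add_pow_int_lt)
qed

context plain_cring
begin

lemma res_cst: "W<=V ==> res (Spec R) V W (cst R a s V) = cst R a s W"
 unfolding Spec_simps cst_def by (auto simp: restrict_def fun_eq_iff)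

lemma unit_near_cstD:
 assumes V: "openin (pts (Spec R)) V" "q\<in>V" and a: "a\<in>carrier R" and un: "unit_near (Spec R) q V (cst R a \<one> V)"
 shows "a\<notin>q"
proof
 assume aq: "a\<in>q"
 obtain W t where W: "openin (pts (Spec R)) W" "q\<in>W" "W<=V" "t\<in>carrier (sec (Spec R) W)"
   "cst R a \<one> W\<otimes>\<^bsub>sec (Spec R) W\<^esub> t = \<one>\<^bsub>sec (Spec R) W\<^esub>"
  using un unfolding unit_near_def by (auto simp: res_cst)
 obtain b s where b: "b\<in>carrier R" "s\<in>carrier R - q" "t q = loc_frac R (carrier R - q) b s"
  using Spec_stalk_frac[OF W(4,2)] by blast
 interpret q: primeideal q R using Spec_open_prime[OF V] .
 interpret loc_ring R "carrier R - q" by (rule Spec_loc[OF V])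
 have o: "\<one>\<in>carrier R - q" using prime_no_one[OF Spec_open_prime[OF V]] by simp
 have "loc_mult R (carrier R - q) (loc_frac R (carrier R - q) a \<one>) (t q) = loc_frac R (carrier R - q) \<one> \<one>"
  using fun_cong[OF W(5), of q] W(2) unfolding Spec_simps cst_def by simp
 hence "loc_frac R (carrier R - q) (a\<otimes>b) (\<one>\<otimes>s) = loc_frac R (carrier R - q) \<one> \<one>"
  unfolding b(3) using loc_mult_frac[OF a o b(1,2)] by simp
 then obtain u where u: "u\<in>carrier R - q" "u\<otimes>(a\<otimes>b\<otimes>\<one>) = u\<otimes>(\<one>\<otimes>(\<one>\<otimes>s))"
  using loc_frac_eq_iff[of "a\<otimes>b" "\<one>\<otimes>s" \<one> \<one>] a b o by auto
 have "a\<otimes>b\<in>q" using q.I_r_closed[OF aq b(1)] .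
 hence "u\<otimes>(a\<otimes>b)\<in>q" using q.I_l_closed u(1) by blast
 moreover have "u\<otimes>(a\<otimes>b) = u\<otimes>s" using u a b by simp
 ultimately have "u\<otimes>s\<in>q" by simp
 thus False using q.I_prime[of u s] u b by blast
qed

lemma cst_unit_basic:
 assumes a: "a\<in>carrier R" and D: "D = {p. primeideal p R & a\<notin>p}"
 shows "openin (pts (Spec R)) D" "cst R \<one> a D\<in>carrier (sec (Spec R) D)" "cst R a \<one> D\<in>carrier (sec (Spec R) D)"
  "cst R a \<one> D\<otimes>\<^bsub>sec (Spec R) D\<^esub> cst R \<one> a D = \<one>\<^bsub>sec (Spec R) D\<^esub>"
proof -
 show o: "openin (pts (Spec R)) D" unfolding D using openin_Spec_basic[OF is_cring a] .
 have n: "!!q. q\<in>D ==> a\<notin>q" "!!q. q\<in>D ==> \<one>\<notin>q" unfolding D using prime_no_one by auto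
 show "cst R \<one> a D\<in>carrier (sec (Spec R) D)" "cst R a \<one> D\<in>carrier (sec (Spec R) D)"
  by (rule cst_section[OF o], use a n in auto)+
 have "cst R a \<one> D\<otimes>\<^bsub>sec (Spec R) D\<^esub> cst R \<one> a D = cst R (a\<otimes>\<one>) (\<one>\<otimes>a) D"
  by (rule cst_mult[OF o a one_closed n(2) one_closed a n(1)])
 also have "... = cst R \<one> \<one> D" by (rule cst_eq[OF o]) (use a n in auto)
 also have "... = \<one>\<^bsub>sec (Spec R) D\<^esub>" unfolding Spec_simps cst_def ..
 finally show "cst R a \<one> D\<otimes>\<^bsub>sec (Spec R) D\<^esub> cst R \<one> a D = \<one>\<^bsub>sec (Spec R) D\<^esub>" .
qed

end

context chart
begin

lemma unit_near_restrict:
 assumes V: "openin (pts X) V" "U<=V" and s: "s\<in>carrier (sec X V)" and x: "x\<in>U"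
 shows "unit_near X x V s \<longleftrightarrow> unit_near X x U (res X V U s)"
proof
 have rr: "res X U W (res X V U s) = res X V W s" if "openin (pts X) W" "W<=U" for W
  using presheaf_comp[OF pre V(1) U that(1) that(2) V(2) s] .
 show "unit_near X x V s" if un: "unit_near X x U (res X V U s)"
 proof -
  obtain W t where W: "openin (pts X) W" "x\<in>W" "W<=U" "t\<in>carrier (sec X W)"
    "res X U W (res X V U s)\<otimes>\<^bsub>sec X W\<^esub> t = \<one>\<^bsub>sec X W\<^esub>"
   using un unfolding unit_near_def by blast
  thus ?thesis unfolding unit_near_def using rr[OF W(1,3)] V(2) by (intro exI[of _ W] exI[of _ t]) auto
 qed
 assume "unit_near X x V s"
 then obtain W t where W: "openin (pts X) W" "x\<in>W" "W<=V" "t\<in>carrier (sec X W)"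
   "res X V W s\<otimes>\<^bsub>sec X W\<^esub> t = \<one>\<^bsub>sec X W\<^esub>"
  unfolding unit_near_def by blast
 define W' where "W' = W\<inter>U"
 have W': "openin (pts X) W'" "x\<in>W'" "W'<=W" "W'<=U" unfolding W'_def using W U x by auto
 define t' where "t' = res X W W' t"
 have t': "t'\<in>carrier (sec X W')" unfolding t'_def by (rule presheaf_closed[OF pre W(1) W'(1,3) W(4)])
 have sW: "res X V W s\<in>carrier (sec X W)" by (rule presheaf_closed[OF pre V(1) W(1,3) s])
 have "res X V W' s\<otimes>\<^bsub>sec X W'\<^esub> t' = res X W W' (res X V W s)\<otimes>\<^bsub>sec X W'\<^esub> t'"
  using presheaf_comp[OF pre V(1) W(1) W'(1) W'(3) W(3) s] by simp
 also have "... = res X W W' (res X V W s\<otimes>\<^bsub>sec X W\<^esub> t)"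
  unfolding t'_def using presheaf_mult[OF pre W(1) W'(1,3) sW W(4)] by simp
 also have "... = \<one>\<^bsub>sec X W'\<^esub>" unfolding W(5) using presheaf_one[OF pre W(1) W'(1,3)] .
 finally show "unit_near X x U (res X V U s)"
  unfolding unit_near_def using rr[OF W'(1,4)] W' t' by (intro exI[of _ W'] exI[of _ t']) auto
qed

text \<open>Ring homomorphisms fix the integers, so multiples of 1 can be compared in
  \<open>A\<close> and in \<open>R\<close> without knowing more about \<pi>. On either side, lying
  outside the prime means being invertible near x.\<close>

lemma base_map_integers:
 fixes n :: int
 assumes A: "cring A" and \<pi>: "\<pi>\<in>sh_hom ring_hom X (Spec A)" and x: "x\<in>U"
 shows "[n] \<cdot>\<^bsub>A\<^esub> \<one>\<^bsub>A\<^esub>\<in>fst \<pi> x \<longleftrightarrow> [n] \<cdot>\<^bsub>R\<^esub> \<one>\<^bsub>R\<^esub>\<in>f x"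
proof -
 interpret Z: plain_cring A unfolding plain_cring_def by (rule A)
 define w where "w = [n] \<cdot>\<^bsub>A\<^esub> \<one>\<^bsub>A\<^esub>"
 have w: "w\<in>carrier A" unfolding w_def by simp
 interpret R: cring R by (rule R)
 obtain g G where \<pi>e: "\<pi> = (g, G)" by (cases \<pi>)
 note h = sh_homD[OF \<pi>[unfolded \<pi>e]]
 define T where "T = {p. primeideal p A}"
 have topT: "topspace (pts (Spec A)) = T" unfolding T_def by (rule topspace_Spec[OF A])
 have T: "openin (pts (Spec A)) T" using topT by (metis openin_topspace)
 have xt: "x\<in>topspace (pts X)" using x openin_subset[OF U] by blast
 have gT: "g y\<in>T" if "y\<in>topspace (pts X)" for y using h(1) that topT unfolding continuous_map_def by auto
 define V where "V = topspace (pts X)"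
 have pV: "preim X g T = V" unfolding preim_def V_def using gT by auto
 have V: "openin (pts X) V" "U<=V" "x\<in>V" unfolding V_def using openin_subset[OF U] xt by auto
 have noT: "!!q. q\<in>T ==> \<one>\<^bsub>A\<^esub>\<notin>q" unfolding T_def using Z.prime_no_one by blast
 have cT: "cst A k \<one>\<^bsub>A\<^esub> T\<in>carrier (sec (Spec A) T)" if "k\<in>carrier A" for k using noT that by (intro cst_section[OF T]) auto
 have GT: "G T\<in>ring_hom (sec (Spec A) T) (sec X V)" using h(3)[OF T] unfolding pV .
 interpret SU: cring "sec X U" by (rule is_sheafD(1)[OF sheaf U])
 define \<kappa> where "\<kappa> k = G T (cst A k \<one>\<^bsub>A\<^esub> T)" for k
 have \<kappa>c: "\<kappa> k\<in>carrier (sec X V)" if "k\<in>carrier A" for k unfolding \<kappa>_def using ring_hom_closed[OF GT cT[OF that]] .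
 have rU: "res X V U\<in>ring_hom (sec X V) (sec X U)" by (rule is_sheafD(2)[OF sheaf V(1) U V(2)])
 have \<kappa>hom: "\<kappa>\<in>ring_hom A (sec X V)"
 proof (rule ring_hom_memI)
  fix a b assume ab: "a\<in>carrier A" "b\<in>carrier A"
  show "\<kappa> a\<in>carrier (sec X V)" by (rule \<kappa>c[OF ab(1)])
  have "\<kappa> a\<otimes>\<^bsub>sec X V\<^esub> \<kappa> b = G T (cst A a \<one>\<^bsub>A\<^esub> T\<otimes>\<^bsub>sec (Spec A) T\<^esub> cst A b \<one>\<^bsub>A\<^esub> T)"
   unfolding \<kappa>_def using ring_hom_mult[OF GT cT[OF ab(1)] cT[OF ab(2)]] by simp
  also have "cst A a \<one>\<^bsub>A\<^esub> T\<otimes>\<^bsub>sec (Spec A) T\<^esub> cst A b \<one>\<^bsub>A\<^esub> T = cst A (a\<otimes>\<^bsub>A\<^esub> b) (\<one>\<^bsub>A\<^esub>\<otimes>\<^bsub>A\<^esub> \<one>\<^bsub>A\<^esub>) T"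
   by (rule Z.cst_mult[OF T]) (use noT ab in auto)
  finally show "\<kappa> (a\<otimes>\<^bsub>A\<^esub> b) = \<kappa> a\<otimes>\<^bsub>sec X V\<^esub> \<kappa> b" unfolding \<kappa>_def by simp
  have "\<kappa> a\<oplus>\<^bsub>sec X V\<^esub> \<kappa> b = G T (cst A a \<one>\<^bsub>A\<^esub> T\<oplus>\<^bsub>sec (Spec A) T\<^esub> cst A b \<one>\<^bsub>A\<^esub> T)"
   unfolding \<kappa>_def using ring_hom_add[OF GT cT[OF ab(1)] cT[OF ab(2)]] by simp
  also have "cst A a \<one>\<^bsub>A\<^esub> T\<oplus>\<^bsub>sec (Spec A) T\<^esub> cst A b \<one>\<^bsub>A\<^esub> T = cst A (a\<oplus>\<^bsub>A\<^esub> b) \<one>\<^bsub>A\<^esub> T"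
   by (rule Z.cst_add[OF T ab])
  finally show "\<kappa> (a\<oplus>\<^bsub>A\<^esub> b) = \<kappa> a\<oplus>\<^bsub>sec X V\<^esub> \<kappa> b" unfolding \<kappa>_def by simp
 next
  have "cst A \<one>\<^bsub>A\<^esub> \<one>\<^bsub>A\<^esub> T = \<one>\<^bsub>sec (Spec A) T\<^esub>" unfolding Spec_simps cst_def ..
  thus "\<kappa> \<one>\<^bsub>A\<^esub> = \<one>\<^bsub>sec X V\<^esub>" unfolding \<kappa>_def using ring_hom_one[OF GT] by simp
 qed
 have "(res X V U \<circ> \<kappa>) ([n] \<cdot>\<^bsub>A\<^esub> \<one>\<^bsub>A\<^esub>) = [n] \<cdot>\<^bsub>sec X U\<^esub> (res X V U \<circ> \<kappa>) \<one>\<^bsub>A\<^esub>"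
  by (rule int_add_pow_hom[OF Z.ring_axioms SU.ring_axioms ring_hom_trans[OF \<kappa>hom rU] Z.one_closed])
 also have "... = [n] \<cdot>\<^bsub>sec X U\<^esub> \<rho> \<one>\<^bsub>R\<^esub>"
  using ring_hom_one[OF ring_hom_trans[OF \<kappa>hom rU]] ring_hom_one[OF \<rho>_hom] by simp
 also have "... = \<rho> ([n] \<cdot>\<^bsub>R\<^esub> \<one>\<^bsub>R\<^esub>)"
  using int_add_pow_hom[OF R.ring_axioms SU.ring_axioms \<rho>_hom R.one_closed] by simp
 finally have key: "res X V U (\<kappa> w) = \<rho> ([n] \<cdot>\<^bsub>R\<^esub> \<one>\<^bsub>R\<^esub>)" unfolding w_def by simp
 have rn: "[n] \<cdot>\<^bsub>R\<^esub> \<one>\<^bsub>R\<^esub>\<in>carrier R" by simp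
 have near: "unit_near X x V (\<kappa> w) \<longleftrightarrow> [n] \<cdot>\<^bsub>R\<^esub> \<one>\<^bsub>R\<^esub>\<notin>f x"
  using unit_near_restrict[OF V(1,2) \<kappa>c[OF w] x] unit_near_\<rho>[OF x rn] unit_near_\<rho>D[OF x rn] unfolding key by blast
 \<comment> \<open>Here locality of \<pi> on stalks enters: a unit above comes from a unit
   below.\<close>
 have "w\<notin>g x" if "unit_near X x V (\<kappa> w)"
 proof -
  have "germ X x V (\<kappa> w)\<in>Units (stalk X x)" by (rule unit_near_imp_Units_stalk[OF pre V(1,3) \<kappa>c[OF w] that])
  hence "germ (Spec A) (g x) T (cst A w \<one>\<^bsub>A\<^esub> T)\<in>Units (stalk (Spec A) (g x))"
   using h(7)[OF xt T gT[OF xt] cT[OF w]] unfolding pV \<kappa>_def by simp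
  hence "unit_near (Spec A) (g x) T (cst A w \<one>\<^bsub>A\<^esub> T)"
   by (rule Units_stalk_imp_unit_near[OF Z.presheaf_Spec T gT[OF xt] cT[OF w]])
  thus ?thesis using Z.unit_near_cstD[OF T gT[OF xt] w] by simp
 qed
 \<comment> \<open>On the basic open set of \<open>w\<close> the inverse 1/w exists, and \<pi> pulls
   it back to an inverse near x.\<close>
 moreover have "unit_near X x V (\<kappa> w)" if ng: "w\<notin>g x"
 proof -
  define D where "D = {p. primeideal p A & w\<notin>p}"
  note c = Z.cst_unit_basic[OF w D_def]
  have DT: "D<=T" unfolding D_def T_def by auto
  have xD: "g x\<in>D" using gT[OF xt] ng unfolding D_def T_def by auto
  define W where "W = preim X g D"
  have W: "openin (pts X) W" "x\<in>W" "W<=V"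
   unfolding W_def preim_def V_def using openin_continuous_map_preimage[OF h(1) c(1)] xt xD by auto
  have GD: "G D\<in>ring_hom (sec (Spec A) D) (sec X W)" using h(3)[OF c(1)] unfolding W_def .
  have "res X V W (\<kappa> w) = G D (cst A w \<one>\<^bsub>A\<^esub> D)"
   using h(6)[OF T c(1) DT cT[OF w]] unfolding Z.res_cst[OF DT] pV W_def \<kappa>_def by simp
  hence "res X V W (\<kappa> w)\<otimes>\<^bsub>sec X W\<^esub> G D (cst A \<one>\<^bsub>A\<^esub> w D) = \<one>\<^bsub>sec X W\<^esub>"
   using ring_hom_mult[OF GD c(3,2)] ring_hom_one[OF GD] c(4) by simp
  thus ?thesis unfolding unit_near_def
   using W ring_hom_closed[OF GD c(2)] by (intro exI[of _ W] exI[of _ "G D (cst A \<one>\<^bsub>A\<^esub> w D)"]) simp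
 qed
 ultimately show ?thesis using near \<pi>e unfolding w_def by auto
qed

lemma structure_map_char:
 assumes "\<pi>\<in>sh_hom ring_hom X (Spec \<Z>)" "x\<in>U"
 shows "n\<in>fst \<pi> x \<longleftrightarrow> [n] \<cdot>\<^bsub>R\<^esub> \<one>\<^bsub>R\<^esub>\<in>f x"
 using base_map_integers[OF int_is_cring assms, of n] int_ring_add_pow by simp

text \<open>Basic open sets form a basis of the spectrum; this expresses the topology of the chart
  through elements of \<open>R\<close>.\<close>

lemma separating_element:
 assumes V: "openin (pts X) V" and z: "z\<in>U" "z\<in>V"
 shows "\<exists>a\<in>carrier R. a\<notin>f z & (\<forall>y\<in>U. y\<notin>V --> a\<in>f y)"
proof -
 have W: "openin (pts X) (U\<inter>V)" "U\<inter>V<=U" using U V by auto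
 obtain I where I: "I<=carrier R" "f ` (U\<inter>V) = {p. primeideal p R & \<not> I<=p}"
  using f_open[OF W] unfolding openin_Spec[OF R] by auto
 hence "f z\<in>{p. primeideal p R & \<not> I<=p}" using z by blast
 then obtain a where a: "a\<in>I" "a\<notin>f z" by auto
 have "a\<in>f y" if y: "y\<in>U" "y\<notin>V" for y
 proof (rule ccontr)
  assume "a\<notin>f y"
  hence "f y\<in>f ` (U\<inter>V)" using I(2) f_prime[OF y(1)] a(1) by auto
  thus False using inj_onD[OF f_inj] y by blast
 qed
 thus ?thesis using a I(1) by blast
qed

lemma vanishing_open: "a\<in>carrier R ==> openin (pts X) {x\<in>U. a\<notin>f x}"
proof -
 assume "a\<in>carrier R"
 hence "openin (pts X) (pb {p. primeideal p R & a\<notin>p})" by (rule pb_open[OF openin_Spec_basic[OF R]])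
 moreover have "pb {p. primeideal p R & a\<notin>p} = {x\<in>U. a\<notin>f x}" unfolding pb_def using f_prime by auto
 ultimately show ?thesis by simp
qed

end

context chart
begin

text \<open>The closed sets are replaced by their vanishing ideals in the chart. Irreducibility
  makes these prime, inclusions are reversed, and independent elements come from
  \<open>prime_chain_indep\<close>. A point of the smallest set in \<open>U\<close> ensures that
  every set of the chain meets the chart.\<close>

lemma fibre_chain_indep:
 fixes n :: nat
 assumes \<pi>: "\<pi>\<in>sh_hom ring_hom X (Spec \<Z>)"
  and irr: "!!i. i \<le> n ==> irreducible_closed (subtopology (pts X) (preim X (fst \<pi>) {y})) (Z i)"
  and mono: "!!i. i < n ==> Z i \<subset> Z (Suc i)" and x0: "x0\<in>Z 0" "x0\<in>U"
 shows "\<exists>x\<in>U. \<exists>xs. length xs = n & set xs<=carrier R & indep_mod R (f x) (zim R) xs"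
proof -
 interpret R: cring R by (rule R)
 define Fib where "Fib = preim X (fst \<pi>) {y}"
 define T where "T = subtopology (pts X) Fib"
 define P where "P i = {a\<in>carrier R. \<forall>x\<in>Z i\<inter>U. a\<in>f x}" for i
 have cl: "closedin T (Z i)" and ir: "!!A B. closedin T A ==> closedin T B ==> Z i<=A\<union>B ==> Z i<=A \<or> Z i<=B"
  if "i \<le> n" for i using irr[OF that] unfolding irreducible_closed_def T_def Fib_def by blast+
 have ZF: "Z i<=Fib" if "i \<le> n" for i using closedin_subset[OF cl[OF that]] unfolding T_def by auto
 have x0Z: "x0\<in>Z i" if "i \<le> n" for i using that
 proof (induction i)
  case (Suc i)
  thus ?case using mono[of i] by auto
 qed (use x0 in simp)
 have cut: "closedin T (Z i - V)" if "openin (pts X) V" "i \<le> n" for V i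
 proof -
  have "openin T (Fib\<inter>V)" unfolding T_def using that(1) by (rule openin_subtopology_Int2)
  hence "closedin T (Z i - (Fib\<inter>V))" by (rule closedin_diff[OF cl[OF that(2)]])
  moreover have "Z i - (Fib\<inter>V) = Z i - V" using ZF[OF that(2)] by auto
  ultimately show ?thesis by simp
 qed
 have pf: "prime_in R (carrier R) (f x)" if "x\<in>U" for x using f_prime[OF that] R.primeideal_iff_prime_in by blast
 have prime: "prime_in R (carrier R) (P i)" if i: "i \<le> n" for i
  unfolding prime_in_def
 proof (intro conjI ballI impI)
  show "P i<=carrier R" unfolding P_def by auto
  show "\<zero>\<^bsub>R\<^esub>\<in>P i" unfolding P_def using R.prime_inD(2)[OF pf] by auto
  show "\<one>\<^bsub>R\<^esub>\<notin>P i" unfolding P_def using R.prime_inD(5)[OF pf[OF x0(2)]] x0Z[OF i] x0(2) by auto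
 next
  fix a b assume "a\<in>P i" "b\<in>P i"
  thus "a\<oplus>\<^bsub>R\<^esub> b\<in>P i" unfolding P_def using R.prime_inD(3)[OF pf] by auto
 next
  fix a b assume "a\<in>P i" "b\<in>carrier R"
  thus "b\<otimes>\<^bsub>R\<^esub> a\<in>P i" unfolding P_def using R.prime_inD(4)[OF pf] by auto
 next
  fix a b assume ab: "a\<in>carrier R" "b\<in>carrier R" and abP: "a\<otimes>\<^bsub>R\<^esub> b\<in>P i"
  let ?V = "%a. {x\<in>U. a\<notin>f x}"
  have "Z i<=(Z i - ?V a)\<union>(Z i - ?V b)"
   using abP R.prime_inD(6)[OF pf ab] unfolding P_def by blast
  hence "Z i<=Z i - ?V a \<or> Z i<=Z i - ?V b"
   by (rule ir[OF i cut[OF vanishing_open[OF ab(1)] i] cut[OF vanishing_open[OF ab(2)] i]])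
  thus "a\<in>P i \<or> b\<in>P i" unfolding P_def using ab by blast
 qed
 \<comment> \<open>All points of the chain lie over \<open>y\<close>, so membership of an integer is
   decided by \<open>y\<close> alone.\<close>
 have zim: "P i\<inter>zim R = P 0\<inter>zim R" if i: "i \<le> n" for i
 proof -
  have eq: "[k] \<cdot>\<^bsub>R\<^esub> \<one>\<^bsub>R\<^esub>\<in>P j \<longleftrightarrow> k\<in>y" if j: "j \<le> n" for j and k :: int
  proof -
   have "[k] \<cdot>\<^bsub>R\<^esub> \<one>\<^bsub>R\<^esub>\<in>f x \<longleftrightarrow> k\<in>y" if "x\<in>Z j\<inter>U" for x
    using structure_map_char[OF \<pi>, of x k] that ZF[OF j] unfolding Fib_def preim_def by auto
   thus ?thesis unfolding P_def using x0Z[OF j] x0(2) by auto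
  qed
  show ?thesis unfolding zim_def using eq[OF i] eq[of 0] by auto
 qed
 have strict: "P (Suc i) \<subset> P i" if i: "i < n" for i
 proof
  show "P (Suc i)<=P i" unfolding P_def using mono[OF i] by auto
  have i1: "Suc i \<le> n" "i \<le> n" using i by auto
  \<comment> \<open>Strictness must be visible inside the chart: an irreducible set that meets
    \<open>U\<close> is not the union of a proper closed subset and its part outside
    \<open>U\<close>.\<close>
  have "\<exists>z\<in>Z (Suc i)\<inter>U. z\<notin>Z i"
  proof (rule ccontr)
   assume "\<not> ?thesis"
   hence "Z (Suc i)<=Z i\<union>(Z (Suc i) - U)" by blast
   hence "Z (Suc i)<=Z i \<or> Z (Suc i)<=Z (Suc i) - U"
    by (rule ir[OF i1(1) cl[OF i1(2)] cut[OF U i1(1)]])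
   thus False using mono[OF i] x0Z[OF i1(1)] x0(2) by blast
  qed
  then obtain z where z: "z\<in>Z (Suc i)" "z\<in>U" "z\<notin>Z i" by blast
  obtain C where C: "closedin (pts X) C" "Z i = C\<inter>Fib"
   using cl[OF i1(2)] unfolding T_def closedin_subtopology by blast
  define V where "V = topspace (pts X) - C"
  have V: "openin (pts X) V" unfolding V_def using C(1) by blast
  have "z\<in>V" unfolding V_def using z C(2) ZF[OF i1(1)] openin_subset[OF U] by blast
  then obtain a where a: "a\<in>carrier R" "a\<notin>f z" "\<forall>y\<in>U. y\<notin>V --> a\<in>f y"
   using separating_element[OF V z(2)] by blast
  have "a\<in>P i" unfolding P_def V_def using a C(2) unfolding V_def by blast
  moreover have "a\<notin>P (Suc i)" unfolding P_def using a(2) z by blast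
  ultimately show "P (Suc i) ~= P i" by blast
 qed
 obtain xs where xs: "length xs = n" "set xs<=carrier R" "indep_mod R (P n) (zim R) xs"
  using R.prime_chain_indep[OF prime strict R.zim_subring zim] by blast
 have "P n\<in>f ` U" unfolding f_img using prime[of n] R.primeideal_iff_prime_in by simp
 then obtain x where "x\<in>U" "P n = f x" by auto
 thus ?thesis using xs by (intro bexI[of _ x] exI[of _ xs]) simp_all
qed

text \<open>A chain of primes over one point of the base corresponds to points z_i of the chart, and
  their closures within the fibre are irreducible. Equality of the traces on \<open>zim R\<close>
  keeps the points in the same fibre.\<close>

lemma indep_fibre_chain:
 assumes \<pi>: "\<pi>\<in>sh_hom ring_hom X (Spec \<Z>)" and x: "x\<in>U"
  and gs: "set gs<=carrier R" "foldl (adjoin R) (zim R) gs = carrier R"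
  and ys: "set ys<=carrier R" "indep_mod R (f x) (zim R) ys"
 shows "\<exists>Z. (\<forall>i \<le> length ys. irreducible_closed (subtopology (pts X) (preim X (fst \<pi>) {fst \<pi> x})) (Z i)) &
  (\<forall>i < length ys. Z i \<subset> Z (Suc i))"
proof -
 interpret R: cring R by (rule R)
 define n where "n = length ys"
 define Fib where "Fib = preim X (fst \<pi>) {fst \<pi> x}"
 have px: "prime_in R (carrier R) (f x)" using f_prime[OF x] R.primeideal_iff_prime_in by blast
 obtain Q where Q: "Q 0 = f x" "!!i. i \<le> n ==> prime_in R (carrier R) (Q i)" "!!i. i \<le> n ==> Q i\<inter>zim R = f x\<inter>zim R"
   "!!i. i < n ==> Q i \<subset> Q (Suc i)"
  using R.prime_chain_exists[OF px R.zim_subring gs(2,1) ys] unfolding n_def by auto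
 have "\<exists>z. z\<in>U & f z = Q i" if "i \<le> n" for i
 proof -
  have "Q i\<in>f ` U" unfolding f_img using Q(2)[OF that] R.primeideal_iff_prime_in by simp
  thus ?thesis by auto
 qed
 then obtain z where z: "!!i. i \<le> n ==> z i\<in>U" "!!i. i \<le> n ==> f (z i) = Q i" by metis
 have zt: "z i\<in>topspace (pts X)" if "i \<le> n" for i using z(1)[OF that] openin_subset[OF U] by blast
 have zF: "z i\<in>Fib" if i: "i \<le> n" for i
 proof -
  have "k\<in>fst \<pi> (z i) \<longleftrightarrow> k\<in>fst \<pi> x" for k
  proof -
   have "[k] \<cdot>\<^bsub>R\<^esub> \<one>\<^bsub>R\<^esub>\<in>zim R" unfolding zim_def by simp
   thus ?thesis
    using structure_map_char[OF \<pi> z(1)[OF i]] structure_map_char[OF \<pi> x] Q(3)[OF i] z(2)[OF i] by blast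
  qed
  hence "fst \<pi> (z i) = fst \<pi> x" by blast
  thus ?thesis unfolding Fib_def preim_def using zt[OF i] by simp
 qed
 define E where "E i = (pts X) closure_of {z i}\<inter>Fib" for i
 have zE: "z i\<in>E i" if "i \<le> n" for i
  unfolding E_def using zF[OF that] closure_of_subset[of "{z i}" "pts X"] zt[OF that] by auto
 have irr: "irreducible_closed (subtopology (pts X) Fib) (E i)" if i: "i \<le> n" for i
  unfolding irreducible_closed_def
 proof (intro conjI allI impI)
  show "closedin (subtopology (pts X) Fib) (E i)" unfolding E_def closedin_subtopology
   by (intro exI[of _ "(pts X) closure_of {z i}"]) simp
  show "E i ~= {}" using zE[OF i] by blast
  fix A B assume ab: "closedin (subtopology (pts X) Fib) A & closedin (subtopology (pts X) Fib) B & E i<=A\<union>B"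
  have "E i<=A" if A: "closedin (subtopology (pts X) Fib) A" "z i\<in>A" for A
  proof -
   obtain C where C: "closedin (pts X) C" "A = C\<inter>Fib" using A(1) unfolding closedin_subtopology by blast
   have "(pts X) closure_of {z i}<=C" by (rule closure_of_minimal[OF _ C(1)]) (use A(2) C(2) in auto)
   thus ?thesis unfolding E_def C(2) by auto
  qed
  thus "E i<=A \<or> E i<=B" using ab zE[OF i] by blast
 qed
 have strict: "E (Suc i) \<subset> E i" if i: "i < n" for i
 proof
  have i1: "i \<le> n" "Suc i \<le> n" using i by auto
  have "z (Suc i)\<in>(pts X) closure_of {z i}" unfolding in_closure_of
  proof (intro conjI allI impI)
   show "z (Suc i)\<in>topspace (pts X)" by (rule zt[OF i1(2)])
   fix V assume V: "z (Suc i)\<in>V & openin (pts X) V"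
   then obtain a where "a\<notin>f (z (Suc i))" "\<forall>y\<in>U. y\<notin>V --> a\<in>f y"
    using separating_element[of V "z (Suc i)"] z(1)[OF i1(2)] by blast
   hence "z i\<in>V" using Q(4)[OF i] z(1)[OF i1(1)] z(2)[OF i1(1)] z(2)[OF i1(2)] by blast
   thus "\<exists>y. y\<in>{z i} & y\<in>V" by simp
  qed
  hence "(pts X) closure_of {z (Suc i)}<=(pts X) closure_of {z i}" by (intro closure_of_minimal) auto
  thus "E (Suc i)<=E i" unfolding E_def by auto
  obtain a where a: "a\<in>Q (Suc i)" "a\<notin>Q i" using Q(4)[OF i] by blast
  have aR: "a\<in>carrier R" using a(1) R.prime_inD(1)[OF Q(2)[OF i1(2)]] by blast
  have "z i\<notin>(pts X) closure_of {z (Suc i)}"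
  proof
   assume "z i\<in>(pts X) closure_of {z (Suc i)}"
   hence c: "\<forall>V. z i\<in>V & openin (pts X) V --> (\<exists>y. y\<in>{z (Suc i)} & y\<in>V)"
    unfolding in_closure_of by (rule conjunct2)
   have "z i\<in>{x\<in>U. a\<notin>f x}" using z(1)[OF i1(1)] z(2)[OF i1(1)] a(2) by simp
   hence "z (Suc i)\<in>{x\<in>U. a\<notin>f x}"
    using spec[OF c, of "{x\<in>U. a\<notin>f x}"] vanishing_open[OF aR] by simp
   thus False using a z(2)[OF i1(2)] by auto
  qed
  thus "E (Suc i) ~= E i" using zE[OF i1(1)] unfolding E_def by blast
 qed
 \<comment> \<open>Larger primes have smaller closures, so the chain has to be read
   backwards.\<close>
 have "E (n - i) \<subset> E (n - Suc i)" if "i < n" for i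
  using strict[of "n - Suc i"] that by (simp add: Suc_diff_Suc)
 thus ?thesis using irr unfolding n_def[symmetric] Fib_def[symmetric] by (intro exI[of _ "%i. E (n - i)"]) simp
qed

text \<open>A nonzero value forces invertibility near x, and an inverse near x forces a nonzero
  value; in the chart, invertibility near x means lying outside \<open>f x\<close>.\<close>

lemma point_data_ker:
 assumes K: "field K" and d: "point_data X K x h" and x: "x\<in>U" and r: "r\<in>carrier R"
 shows "h U (\<rho> r) = \<zero>\<^bsub>K\<^esub> \<longleftrightarrow> r\<in>f x"
proof
 interpret K: field K by fact
 note rc = \<rho>_closed[OF r]
 show "h U (\<rho> r) = \<zero>\<^bsub>K\<^esub>" if "r\<in>f x"
  using point_dataD(3)[OF d U x rc] unit_near_\<rho>D[OF x r] that by blast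
 assume z: "h U (\<rho> r) = \<zero>\<^bsub>K\<^esub>"
 show "r\<in>f x"
 proof (rule ccontr)
  assume "r\<notin>f x"
  hence "unit_near X x U (\<rho> r)" by (rule unit_near_\<rho>[OF x r])
  then obtain W t where W: "openin (pts X) W" "x\<in>W" "W<=U" "t\<in>carrier (sec X W)"
    "res X U W (\<rho> r)\<otimes>\<^bsub>sec X W\<^esub> t = \<one>\<^bsub>sec X W\<^esub>"
   unfolding unit_near_def by (elim exE conjE)
  note hW = point_dataD(2)[OF d W(1,2)]
  have "\<one>\<^bsub>K\<^esub> = h W (res X U W (\<rho> r))\<otimes>\<^bsub>K\<^esub> h W t"
   using ring_hom_one[OF hW] W(5) ring_hom_mult[OF hW presheaf_closed[OF pre U W(1,3) rc] W(4)] by simp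
  also have "h W (res X U W (\<rho> r)) = \<zero>\<^bsub>K\<^esub>" using point_dataD(4)[OF d U W(1,2,3) rc] z by simp
  also have "\<zero>\<^bsub>K\<^esub>\<otimes>\<^bsub>K\<^esub> h W t = \<zero>\<^bsub>K\<^esub>" using ring_hom_closed[OF hW W(4)] by simp
  finally show False by simp
 qed
qed

end

section \<open>Comparison of the dimension with the counting function\<close>

lemma (in domain) indep_nonzero:
 "subring C R ==> set xs<=carrier R ==> indep_mod R {\<zero>} C xs ==> \<zero>\<notin>set xs"
proof (induction xs arbitrary: C)
 case (Cons x xs)
 have "x ~= \<zero>"
 proof
  assume "x = \<zero>"
  moreover have "horner R [\<zero>, \<one>] \<zero>\<in>{\<zero>}" by simp
  moreover have "set [\<zero>, \<one>]<=C" using subringE(2,3)[OF Cons.prems(1)] by simp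
  ultimately have "set [\<zero>, \<one>]<={\<zero>}" using Cons.prems(3) unfolding indep_mod.simps transc_mod_def by blast
  thus False by simp
 qed
 moreover have "\<zero>\<notin>set xs"
  by (rule Cons.IH[OF adjoin_subring[OF Cons.prems(1)]]) (use Cons.prems in auto)
 ultimately show ?case by simp
qed simp

context F1_points
begin

text \<open>The point x with residue map \<psi> is a morphism from the spectrum of \<open>K\<close>,
  hence comes from a homomorphism m on one of the monoids. The morphism descends to the field
  generated by the image of m, so \<psi>(R) lies in that field, and its transcendence degree is
  bounded by the basis at the kernel of m.\<close>

lemma indep_le_prime_basis:
 assumes ch: "chart XZ U (R :: 't ring) f F" and K: "field (K :: 'u ring)" and \<psi>: "\<psi>\<in>ring_hom R K"
  and x: "x\<in>U" and ker: "!!r. r\<in>carrier R ==> \<psi> r = \<zero>\<^bsub>K\<^esub> \<longleftrightarrow> r\<in>f x"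
  and xs: "set xs<=carrier R" "indep_mod R (f x) (zim R) xs"
 shows "\<exists>Y\<in>\<Y>. \<exists>G p B e c. prime_basis (Mon Y) G p B e c & length xs \<le> card B"
proof -
 interpret C: chart XZ U R f F by (rule ch)
 interpret K: plain_field K unfolding plain_field_def by (rule K)
 interpret P: chart_point XZ U R f F K \<psi> x by unfold_locales (use \<psi> x ker in auto)
 define g where "g = point_mor XZ K x P.hh"
 have g: "g\<in>sh_hom ring_hom (Spec K) XZ" unfolding g_def by (rule K.point_mor_in_hom[OF C.sheaf P.hh_point_data])
 obtain Y m where Y: "Y\<in>\<Y>" and m: "m\<in>pm_homs (Mon Y) (ring_pmonoid K)"
  and fac: "\<forall>K'. subfield K' K & m ` carrier (Mon Y)<=K' --> (\<exists>g'\<in>sh_hom ring_hom (Spec (K\<lparr>carrier := K'\<rparr>)) XZ.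
    g = sh_comp (Spec K) (Spec (K\<lparr>carrier := K'\<rparr>)) XZ g' (Spec_map (K\<lparr>carrier := K'\<rparr>) K (\<lambda>x\<in>K'. x)))"
  using hom_factors[OF K g] by (elim bexE) (rule that)
 have mh: "m\<in>pmonoid_hom (Mon Y) (ring_pmonoid K)" using m by blast
 hence mc: "m ` carrier (Mon Y)<=carrier K" unfolding pmonoid_hom_def hom_def by auto
 \<comment> \<open>The smallest subfield through which m factors, and therefore the best field of
   definition that \<open>hom_factors\<close> can provide.\<close>
 define K' where "K' = generate_field K (m ` carrier (Mon Y))"
 have K': "subfield K' K" unfolding K'_def by (rule K.generate_field_is_subfield[OF mc])
 have mK: "m ` carrier (Mon Y)<=K'" unfolding K'_def by (rule subsetI, rule generate_field.incl)
 obtain g' where g': "g'\<in>sh_hom ring_hom (Spec (K\<lparr>carrier := K'\<rparr>)) XZ"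
   "g = sh_comp (Spec K) (Spec (K\<lparr>carrier := K'\<rparr>)) XZ g' (Spec_map (K\<lparr>carrier := K'\<rparr>) K (\<lambda>x\<in>K'. x))"
  using spec[OF fac, of K', THEN mp, OF conjI[OF K' mK]] by (elim bexE) (rule that)
 obtain \<xi> h where h: "point_data XZ (K\<lparr>carrier := K'\<rparr>) \<xi> h" "g' = point_mor XZ (K\<lparr>carrier := K'\<rparr>) \<xi> h"
  using plain_field.hom_is_point_mor[OF K.K1_field[OF K'] C.sheaf g'(1)] by (elim exE conjE)
 note sf = K.point_mor_subfield[OF K' h(1)]
 have "point_mor XZ K x P.hh = point_mor XZ K \<xi> h" using g'(2) sf(2) unfolding g_def h(2) by simp
 note inj = K.point_mor_inj[OF P.hh_point_data sf(1) this]
 have \<psi>K: "\<psi> r\<in>K'" if r: "r\<in>carrier R" for r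
 proof -
  have "\<psi> r = h U (C.\<rho> r)" using P.hh_\<rho>[OF r] inj(2)[OF C.U x C.\<rho>_closed[OF r]] by simp
  thus ?thesis using ring_hom_closed[OF point_dataD(2)[OF h(1) C.U] C.\<rho>_closed[OF r]] inj(1) x by simp
 qed
 have zR: "zim R<=carrier R" using subringE(1)[OF cring.zim_subring[OF C.R]] .
 have "indep_mod K {\<zero>\<^bsub>K\<^esub>} (\<psi> ` zim R) (map \<psi> xs)"
  using indep_mod_hom[OF C.R K.is_cring \<psi> zR xs(1), of "{\<zero>\<^bsub>K\<^esub>}" "f x"] ker xs(2) by simp
 hence ind: "indep_mod K {\<zero>\<^bsub>K\<^esub>} (zim K) (map \<psi> xs)" using zim_hom[OF cring.axioms(1)[OF C.R] K.ring_axioms \<psi>] by simp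
 define p where "p = pm_ker (Mon Y) (ring_pmonoid K) m"
 have MY: "pmonoid (Mon Y)" "pmonoid_fin_gen (Mon Y)" using Mon[OF Y] by auto
 obtain G where G: "finite G" "G<=carrier (Mon Y)" "\<forall>S. submonoid S (Mon Y) & absorb (Mon Y)\<in>S & G<=S --> S = carrier (Mon Y)"
  using MY(2) unfolding pmonoid_fin_gen_def by blast
 have "pmonoid_prime p (Mon Y)" unfolding p_def by (rule pm_ker_prime(1)[OF MY(1) K.pm_field_ring mh])
 then obtain B e c where pb: "prime_basis (Mon Y) G p B e c" using prime_basis_exists[OF MY(1) G] by blast
 have "set (map \<psi> xs)<=generate_field K (m ` carrier (Mon Y))" using \<psi>K xs(1) unfolding K'_def by auto
 hence "length (map \<psi> xs) \<le> card B" by (rule K.indep_bounded_by_prime_basis[OF pb mh p_def ind])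
 hence "prime_basis (Mon Y) G p B e c & length xs \<le> card B" using pb by simp
 thus ?thesis using Y
  by (intro bexI[of _ Y] exI[of _ G] exI[of _ p] exI[of _ B] exI[of _ e] exI[of _ c]) simp_all
qed

text \<open>Independent elements t_b are assigned to the basis and give a homomorphism with values
  t_b^e on it. The corresponding morphism is defined over the field generated by the image of
  \<open>R\<close> in a chart; by \<open>hom_descends\<close> that field contains the t_b^e, so
  \<open>R\<close> has at least as many independent elements.\<close>

lemma prime_basis_le_indep:
 assumes sheaf: "is_sheaf cring ring_hom XZ"
  and cov: "!!x. x\<in>topspace (pts XZ) ==> \<exists>U (R :: 't ring) f F gs. x\<in>U & chart XZ U R f F &
   set gs<=carrier R & foldl (adjoin R) (zim R) gs = carrier R"
  and Y: "Y\<in>\<Y>" and pb: "prime_basis (Mon Y) G p B e c"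
  and K: "field (K :: 'u ring)" and ts: "length ts = card B" "set ts<=carrier K" "indep_mod K {\<zero>\<^bsub>K\<^esub>} (zim K) ts"
 shows "\<exists>U (R :: 't ring) f F gs x ys. x\<in>U & chart XZ U R f F & set gs<=carrier R & foldl (adjoin R) (zim R) gs = carrier R &
  set ys<=carrier R & card B \<le> length ys & indep_mod R (f x) (zim R) ys"
proof -
 interpret K: plain_field K unfolding plain_field_def by (rule K)
 interpret pb: prime_basis "Mon Y" G p B e c by (rule pb)
 have finB: "finite B" using pb.B pb.HM(2) finite_subset by blast
 then obtain bl where bl: "set bl = B" "distinct bl" using finite_distinct_list by blast
 have len: "length bl = length ts" using bl ts(1) distinct_card by metis
 define v where "v b = the (map_of (zip bl ts) b)" for b
 have vt: "map v bl = ts"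
  by (rule nth_equalityI) (use len bl(2) in \<open>auto simp: v_def map_of_zip_nth\<close>)
 have vB: "v ` B = set ts" using arg_cong[OF vt, of set] bl(1) by simp
 have tn: "\<zero>\<^bsub>K\<^esub>\<notin>set ts" by (rule K.indep_nonzero[OF K.zim_subring ts(2,3)])
 have vU: "v b\<in>Units (ring_pmonoid K)" if "b\<in>B" for b
 proof -
  have "v b\<in>set ts" using imageI[OF that, of v] unfolding vB .
  thus ?thesis unfolding K.Units_ring_pmonoid using ts(2) tn by auto
 qed
 have "\<exists>\<chi>\<in>pm_homs (Mon Y) (ring_pmonoid K). (\<forall>x\<in>p. \<chi> x = absorb (ring_pmonoid K)) &
   (\<forall>b\<in>B. \<chi> b = v b [^]\<^bsub>units_of (ring_pmonoid K)\<^esub> e) & (\<forall>x\<in>carrier (Mon Y) - p. \<chi> x\<in>Units (ring_pmonoid K))"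
  by (rule pb.hom_extend_basis[OF K.ring_pmonoid_pmonoid]) (rule vU)
 then obtain \<chi> where \<chi>: "\<chi>\<in>pm_homs (Mon Y) (ring_pmonoid K)"
   "\<forall>b\<in>B. \<chi> b = v b [^]\<^bsub>units_of (ring_pmonoid K)\<^esub> e"
  by (elim bexE conjE) (rule that)
 have pow: "a [^]\<^bsub>units_of (ring_pmonoid K)\<^esub> n = a [^]\<^bsub>K\<^esub> n" for a and n :: nat
  unfolding nat_pow_def by (induction n) (simp_all add: units_of_mult units_of_one)
 obtain g where g: "g\<in>sh_hom ring_hom (Spec K) XZ"
  and desc: "\<forall>K' g'. subfield K' K & g'\<in>sh_hom ring_hom (Spec (K\<lparr>carrier := K'\<rparr>)) XZ &
    g = sh_comp (Spec K) (Spec (K\<lparr>carrier := K'\<rparr>)) XZ g' (Spec_map (K\<lparr>carrier := K'\<rparr>) K (\<lambda>x\<in>K'. x)) -->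
    \<chi> ` carrier (Mon Y)<=K'"
  using hom_descends[OF Y K \<chi>(1)] by (elim bexE) (rule that)
 obtain x h where h: "point_data XZ K x h" "g = point_mor XZ K x h" using K.hom_is_point_mor[OF sheaf g] by (elim exE conjE)
 \<comment> \<open>The chart can be chosen only now, because the image point x is determined by the
   morphism.\<close>
 obtain U and R :: "'t ring" and f F gs where xU: "x\<in>U" and ch: "chart XZ U R f F"
  and gs: "set gs<=carrier R" "foldl (adjoin R) (zim R) gs = carrier R"
  using cov[OF point_dataD(1)[OF h(1)]] by (elim exE conjE)
 interpret C: chart XZ U R f F by (rule ch)
 define \<psi> where "\<psi> r = h U (C.\<rho> r)" for r
 have \<psi>: "\<psi>\<in>ring_hom R K" unfolding \<psi>_def by (rule C.point_data_hom[OF h(1) xU])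
 define K' where "K' = generate_field K (\<psi> ` carrier R)"
 have \<psi>c: "\<psi> ` carrier R<=carrier K" using ring_hom_closed[OF \<psi>] by auto
 have K': "subfield K' K" unfolding K'_def by (rule K.generate_field_is_subfield[OF \<psi>c])
 have "h U (C.\<rho> r)\<in>K'" if "r\<in>carrier R" for r
  unfolding K'_def by (rule generate_field.incl) (use that in \<open>auto simp: \<psi>_def\<close>)
 hence d: "point_data XZ (K\<lparr>carrier := K'\<rparr>) x h" by (rule C.point_data_subfield[OF K h(1) xU K'])
 have \<chi>K: "\<chi> ` carrier (Mon Y)<=K'"
  by (rule desc[THEN spec, THEN spec, THEN mp], intro conjI, rule K', rule plain_field.point_mor_in_hom[OF K.K1_field[OF K'] sheaf d])
   (simp only: K.point_mor_subfield(2)[OF K' d] h(2))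
 have "v b [^]\<^bsub>K\<^esub> e\<in>K'" if b: "b\<in>B" for b
 proof -
  have "b\<in>carrier (Mon Y)" using pb.B pb.HM(1) b by blast
  from imageI[OF this, of \<chi>] have "\<chi> b\<in>K'" using \<chi>K by blast
  thus ?thesis using bspec[OF \<chi>(2) b] pow by simp
 qed
 hence te: "t [^]\<^bsub>K\<^esub> e\<in>generate_field K (\<psi> ` carrier R)" if "t\<in>set ts" for t
  using that unfolding vB[symmetric] K'_def by auto
 have "\<exists>ys. set ys<=carrier R & length ts \<le> length ys & indep_mod R {r\<in>carrier R. \<psi> r = \<zero>\<^bsub>K\<^esub>} (zim R) ys"
  by (rule K.indep_lift_of_generators[OF C.R gs \<psi> ts(2,3) pb.e]) (rule te)
 then obtain ys where ys: "set ys<=carrier R" "length ts \<le> length ys" "indep_mod R {r\<in>carrier R. \<psi> r = \<zero>\<^bsub>K\<^esub>} (zim R) ys"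
  by (elim exE conjE)
 have "prime_in R (carrier R) (f x)" using C.f_prime[OF xU] cring.primeideal_iff_prime_in[OF C.R] by simp
 from cring.prime_inD(1)[OF C.R this] have "{r\<in>carrier R. \<psi> r = \<zero>\<^bsub>K\<^esub>} = f x" unfolding \<psi>_def using C.point_data_ker[OF K h(1) xU] by auto
 hence "indep_mod R (f x) (zim R) ys" "card B \<le> length ys" using ys(2,3) ts(1) by simp_all
 thus ?thesis using xU ch gs ys(1)
  by (intro exI[of _ U] exI[of _ R] exI[of _ f] exI[of _ F] exI[of _ gs] exI[of _ x] exI[of _ ys]) simp
qed

lemma card_mon_obj_bounds:
 assumes c: "cyc el z m" and N: "N = cyc_pmonoid el z m"
 shows "Y\<in>\<Y> ==> card (pm_homs (Mon Y) N) \<le> card (mon_obj X N)"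
  and "card (mon_obj X N) \<le> (\<Sum>Y\<in>\<Y>. card (pm_homs (Mon Y) N))"
proof -
 have N': "pm_field N" "pmonoid N" "finite (carrier N)"
  unfolding N using cyc.field[OF c] cyc.pm[OF c] cyc.finite_carrier[OF c] by auto
 have ob: "mon_obj X N = (\<Union>Y\<in>\<Y>. Y N)" by (rule cover[OF N'(1)])
 have cY: "finite (Y N)" "card (Y N) = card (pm_homs (Mon Y) N)" if "Y\<in>\<Y>" for Y
  using bij_betw_same_card[OF \<theta>_bij[OF that N'(2)]] bij_betw_finite[OF \<theta>_bij[OF that N'(2)]]
   finite_pm_homs[of "Mon Y" N] Mon[OF that] N' by auto
 have "finite (mon_obj X N)" unfolding ob using fin cY(1) by auto
 thus "card (pm_homs (Mon Y) N) \<le> card (mon_obj X N)" if "Y\<in>\<Y>"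
  using cY(2)[OF that] card_mono[of "mon_obj X N" "Y N"] that unfolding ob by auto
 have "card (mon_obj X N) \<le> (\<Sum>Y\<in>\<Y>. card (Y N))" unfolding ob by (rule card_UN_le[OF fin])
 thus "card (mon_obj X N) \<le> (\<Sum>Y\<in>\<Y>. card (pm_homs (Mon Y) N))" using cY(2) by simp
qed

text \<open>Homomorphisms are sorted by the subfunctor Y and by their kernel p. There are finitely
  many such pairs, each contributing at most a constant times m^(card B), so a lower bound m^d for
  the total forces one basis to have at least d elements.\<close>

lemma prime_basis_of_degree:
 assumes el: "inj el" "z\<notin>range el"
  and bound: "!!m. m \<ge> 1 ==> m ^ d \<le> card (mon_obj X (cyc_pmonoid el z m))"
 shows "\<exists>Y\<in>\<Y>. \<exists>G p B e c. prime_basis (Mon Y) G p B e c & d \<le> card B"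
proof -
 define I where "I = Sigma \<Y> (%Y. {p. pmonoid_prime p (Mon Y)})"
 have fp: "finite {p. pmonoid_prime p (Mon Y)}" if "Y\<in>\<Y>" for Y using finite_pm_primes Mon[OF that] by blast
 have finI: "finite I" unfolding I_def using fin fp by (intro finite_SigmaI) auto
 have "\<exists>q. prime_basis (Mon (fst i)) (fst q) (snd i) (fst (snd q)) (fst (snd (snd q))) (snd (snd (snd q)))" if i: "i\<in>I" for i
 proof -
  obtain Y p where Yp: "i = (Y, p)" "Y\<in>\<Y>" "pmonoid_prime p (Mon Y)" using i unfolding I_def by blast
  have MY: "pmonoid (Mon Y)" "pmonoid_fin_gen (Mon Y)" using Mon[OF Yp(2)] by auto
  obtain G where G: "finite G" "G<=carrier (Mon Y)" "\<forall>S. submonoid S (Mon Y) & absorb (Mon Y)\<in>S & G<=S --> S = carrier (Mon Y)"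
   using MY(2) unfolding pmonoid_fin_gen_def by blast
  obtain B e c where "prime_basis (Mon Y) G p B e c" using prime_basis_exists[OF MY(1) G Yp(3)] by (elim exE)
  thus ?thesis unfolding Yp(1) by (intro exI[of _ "(G, B, e, c)"]) simp
 qed
 then obtain q where q: "\<forall>i\<in>I. prime_basis (Mon (fst i)) (fst (q i)) (snd i) (fst (snd (q i))) (fst (snd (snd (q i)))) (snd (snd (snd (q i))))"
  using bchoice[of I "%i q. prime_basis (Mon (fst i)) (fst q) (snd i) (fst (snd q)) (fst (snd (snd q))) (snd (snd (snd q)))"] by auto
 define G B e c where "G i = fst (q i)" and "B i = fst (snd (q i))" and "e i = fst (snd (snd (q i)))" and "c i = snd (snd (snd (q i)))" for i
 have pb: "prime_basis (Mon (fst i)) (G i) (snd i) (B i) (e i) (c i)" if "i\<in>I" for i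
  unfolding G_def B_def e_def c_def using bspec[OF q that] .
 have "m ^ d \<le> (\<Sum>i\<in>I. e i ^ card (G i - snd i) * m ^ card (B i))" if m: "m \<ge> 1" for m :: nat
 proof -
  have cy: "cyc el z m" using el m by unfold_locales
  define N where "N = cyc_pmonoid el z m"
  have "card (pm_homs (Mon Y) N) \<le> (\<Sum>p\<in>{p. pmonoid_prime p (Mon Y)}. e (Y, p) ^ card (G (Y, p) - p) * m ^ card (B (Y, p)))"
   if Y: "Y\<in>\<Y>" for Y
  proof -
   have N': "pm_field N" unfolding N_def by (rule cyc.field[OF cy])
   have sub: "pm_homs (Mon Y) N<=(\<Union>p\<in>{p. pmonoid_prime p (Mon Y)}. {\<chi>\<in>pm_homs (Mon Y) N. pm_ker (Mon Y) N \<chi> = p})"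
   proof
    fix \<chi> assume \<chi>: "\<chi>\<in>pm_homs (Mon Y) N"
    hence "pmonoid_prime (pm_ker (Mon Y) N \<chi>) (Mon Y)" using pm_ker_prime(1)[of "Mon Y" N \<chi>] Mon[OF Y] N' by blast
    thus "\<chi>\<in>(\<Union>p\<in>{p. pmonoid_prime p (Mon Y)}. {\<chi>\<in>pm_homs (Mon Y) N. pm_ker (Mon Y) N \<chi> = p})"
     using \<chi> by auto
   qed
   have fh: "finite (pm_homs (Mon Y) N)"
    using finite_pm_homs[of "Mon Y" N] Mon[OF Y] cyc.pm[OF cy] cyc.finite_carrier[OF cy] unfolding N_def by blast
   have "card (pm_homs (Mon Y) N)
     \<le> card (\<Union>p\<in>{p. pmonoid_prime p (Mon Y)}. {\<chi>\<in>pm_homs (Mon Y) N. pm_ker (Mon Y) N \<chi> = p})"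
    by (rule card_mono[OF _ sub], rule finite_UN_I[OF fp[OF Y]]) (rule finite_subset[OF _ fh], auto)
   also have "... \<le> (\<Sum>p\<in>{p. pmonoid_prime p (Mon Y)}. card {\<chi>\<in>pm_homs (Mon Y) N. pm_ker (Mon Y) N \<chi> = p})"
    by (rule card_UN_le[OF fp[OF Y]])
   also have "... \<le> (\<Sum>p\<in>{p. pmonoid_prime p (Mon Y)}. e (Y, p) ^ card (G (Y, p) - p) * m ^ card (B (Y, p)))"
   proof (rule sum_mono)
    fix p assume "p\<in>{p. pmonoid_prime p (Mon Y)}"
    hence "(Y, p)\<in>I" unfolding I_def using Y by simp
    hence "prime_basis_cyc (Mon Y) (G (Y, p)) p (B (Y, p)) (e (Y, p)) (c (Y, p)) el z m"
     using pb[of "(Y, p)"] cy unfolding prime_basis_cyc_def by simp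
    thus "card {\<chi>\<in>pm_homs (Mon Y) N. pm_ker (Mon Y) N \<chi> = p} \<le> e (Y, p) ^ card (G (Y, p) - p) * m ^ card (B (Y, p))"
     unfolding N_def by (rule prime_basis_cyc.count_upper)
   qed
   finally show ?thesis .
  qed
  hence "(\<Sum>Y\<in>\<Y>. card (pm_homs (Mon Y) N))
    \<le> (\<Sum>Y\<in>\<Y>. \<Sum>p\<in>{p. pmonoid_prime p (Mon Y)}. e (Y, p) ^ card (G (Y, p) - p) * m ^ card (B (Y, p)))"
   by (rule sum_mono)
  also have "... = (\<Sum>(Y, p)\<in>I. e (Y, p) ^ card (G (Y, p) - p) * m ^ card (B (Y, p)))"
   unfolding I_def using fin fp by (intro sum.Sigma) auto
  also have "... = (\<Sum>i\<in>I. e i ^ card (G i - snd i) * m ^ card (B i))" by (simp add: case_prod_beta)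
  finally show ?thesis
   using bound[OF m] card_mon_obj_bounds(2)[OF cy N_def] unfolding N_def by linarith
 qed
 hence "\<exists>i\<in>I. d \<le> card (B i)" by (rule exponent_le_of_sum_bound[OF finI])
 then obtain i where i: "i\<in>I" "d \<le> card (B i)" by blast
 have "fst i\<in>\<Y>" using i(1) unfolding I_def by auto
 thus ?thesis using pb[OF i(1)] i(2)
  by (intro bexI[of _ "fst i"] exI[of _ "G i"] exI[of _ "snd i"] exI[of _ "B i"] exI[of _ "e i"] exI[of _ "c i"]) simp_all
qed

end

lemma F1_points_exist:
 assumes F: "F1_scheme X XM XZ" and N: "F1_noetherian X XZ"
 shows "\<exists>\<eta> \<Y> Mon \<theta>. F1_points X XZ \<eta> \<Y> Mon \<theta>"
proof -
 have fn: "is_mr_functor X" and rr: "ring_realisation X XZ"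
  and fb: "\<forall>K. field K --> bij_betw (fmor X (MonObj (ring_pmonoid K)) (RingObj K) (MixMor (monoid_ring_eval K)))
     (mon_obj X (ring_pmonoid K)) (ring_obj X K)"
  using F unfolding F1_scheme_def by auto
 obtain \<eta> where \<eta>: "\<forall>R. cring R --> bij_betw (\<eta> R) (ring_obj X R) (sh_hom ring_hom (Spec R) XZ)"
   "\<forall>R S. cring R & cring S --> (\<forall>\<phi>\<in>ring_hom R S\<inter>extensional (carrier R). \<forall>x\<in>ring_obj X R.
     \<eta> S (ring_mor X R S \<phi> x) = sh_comp (Spec S) (Spec R) XZ (\<eta> R x) (Spec_map R S \<phi>))"
  using rr unfolding ring_realisation_def by (elim exE conjE)
 obtain \<Y> where Y: "finite \<Y>" "\<forall>Y\<in>\<Y>. mon_open_subfunctor X Y & (\<exists>M. pmonoid_fin_gen M & mon_represented X Y M)"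
   "\<forall>M (H :: 'a monoid). pmonoid M & comm_group H & pmonoid_iso M (group_pmonoid H) --> mon_obj X M = (\<Union>Y\<in>\<Y>. Y M)"
  using N unfolding F1_noetherian_def by (elim exE conjE)
 have "\<forall>Y\<in>\<Y>. \<exists>M. pmonoid_fin_gen M & mon_represented X Y M" using Y(2) by simp
 hence "\<exists>Mon. \<forall>Y\<in>\<Y>. pmonoid_fin_gen (Mon Y) & mon_represented X Y (Mon Y)" by (rule bchoice)
 then obtain Mon where Mon: "\<forall>Y\<in>\<Y>. pmonoid_fin_gen (Mon Y) & mon_represented X Y (Mon Y)" by (elim exE)
 have "\<forall>Y\<in>\<Y>. \<exists>\<theta>. (\<forall>N. pmonoid N --> bij_betw (\<theta> N) (Y N) (pm_homs (Mon Y) N)) &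
    (\<forall>N N'. pmonoid N & pmonoid N' --> (\<forall>\<phi>\<in>pm_homs N N'. \<forall>y\<in>Y N.
       \<theta> N' (mon_mor X N N' \<phi> y) = compose (carrier (Mon Y)) \<phi> (\<theta> N y)))"
 proof
  fix Y assume "Y\<in>\<Y>"
  hence "mon_represented X Y (Mon Y)" using Mon by simp
  thus "\<exists>\<theta>. (\<forall>N. pmonoid N --> bij_betw (\<theta> N) (Y N) (pm_homs (Mon Y) N)) &
    (\<forall>N N'. pmonoid N & pmonoid N' --> (\<forall>\<phi>\<in>pm_homs N N'. \<forall>y\<in>Y N.
       \<theta> N' (mon_mor X N N' \<phi> y) = compose (carrier (Mon Y)) \<phi> (\<theta> N y)))"
   unfolding mon_represented_def by (rule conjunct2)
 qed
 hence "\<exists>\<theta>. \<forall>Y\<in>\<Y>. (\<forall>N. pmonoid N --> bij_betw (\<theta> Y N) (Y N) (pm_homs (Mon Y) N)) &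
    (\<forall>N N'. pmonoid N & pmonoid N' --> (\<forall>\<phi>\<in>pm_homs N N'. \<forall>y\<in>Y N.
       \<theta> Y N' (mon_mor X N N' \<phi> y) = compose (carrier (Mon Y)) \<phi> (\<theta> Y N y)))"
  by (rule bchoice)
 then obtain \<theta> where \<theta>: "\<forall>Y\<in>\<Y>. (\<forall>N. pmonoid N --> bij_betw (\<theta> Y N) (Y N) (pm_homs (Mon Y) N)) &
    (\<forall>N N'. pmonoid N & pmonoid N' --> (\<forall>\<phi>\<in>pm_homs N N'. \<forall>y\<in>Y N.
       \<theta> Y N' (mon_mor X N N' \<phi> y) = compose (carrier (Mon Y)) \<phi> (\<theta> Y N y)))"
  by (elim exE)
 have "F1_points X XZ \<eta> \<Y> Mon \<theta>"
 proof (rule F1_points.intro)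
  show "is_mr_functor X" "finite \<Y>" by fact+
  show "bij_betw (\<eta> R) (ring_obj X R) (sh_hom ring_hom (Spec R) XZ)" if "cring R" for R using \<eta>(1) that by simp
  show "\<eta> S (ring_mor X R S \<phi> x) = sh_comp (Spec S) (Spec R) XZ (\<eta> R x) (Spec_map R S \<phi>)"
   if "cring R" "cring S" "\<phi>\<in>ring_hom R S\<inter>extensional (carrier R)" "x\<in>ring_obj X R" for R S \<phi> x
   using \<eta>(2)[THEN spec, THEN spec, THEN mp, OF conjI[OF that(1,2)], THEN bspec, OF that(3), THEN bspec, OF that(4)] .
  show "bij_betw (fmor X (MonObj (ring_pmonoid K)) (RingObj K) (MixMor (monoid_ring_eval K)))
     (mon_obj X (ring_pmonoid K)) (ring_obj X K)" if "field K" for K using fb that by simp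
  show "mon_open_subfunctor X Y" if "Y\<in>\<Y>" for Y using Y(2) that by simp
  show "pmonoid (Mon Y) & pmonoid_fin_gen (Mon Y)" if "Y\<in>\<Y>" for Y
   using Mon that unfolding mon_represented_def by simp
  show "bij_betw (\<theta> Y N) (Y N) (pm_homs (Mon Y) N)" if "Y\<in>\<Y>" "pmonoid N" for Y N
   using bspec[OF \<theta> that(1)] that(2) by simp
  show "\<theta> Y N' (mon_mor X N N' \<phi> y) = compose (carrier (Mon Y)) \<phi> (\<theta> Y N y)"
   if "Y\<in>\<Y>" "pmonoid N" "pmonoid N'" "\<phi>\<in>pm_homs N N'" "y\<in>Y N" for Y N N' \<phi> y
   using bspec[OF \<theta> that(1), THEN conjunct2, THEN spec, THEN spec, THEN mp, OF conjI[OF that(2,3)], THEN bspec, OF that(4), THEN bspec, OF that(5)] .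
  \<comment> \<open>The covering condition ranges over groups of the same type as the monoid; the
    group of units of \<open>N\<close> is such a group.\<close>
  show "mon_obj X N = (\<Union>Y\<in>\<Y>. Y N)" if N: "pm_field N" for N
   using Y(3)[THEN spec, THEN spec, of N "units_of N", THEN mp] pm_field_iso_units[OF N] N unfolding pm_field_def by simp
 qed
 thus ?thesis by (intro exI)
qed

section \<open>The counting polynomial and its degree\<close>

lemma map_poly_of_int_mult: "map_poly real_of_int (p * q) = map_poly of_int p * map_poly of_int q"
 by (rule poly_eqI) (simp add: coeff_map_poly coeff_mult)

lemma poly_of_int_shifted_powers:
 "poly (map_poly real_of_int (\<Sum>x\<in>S. [:- 1, 1:] ^ r x)) t = (\<Sum>x\<in>S. (t - 1) ^ r x)"
proof -
 have pw: "poly (map_poly real_of_int ([:- 1, 1:] ^ k)) t = (t - 1) ^ k" for k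
 proof (induction k)
  case (Suc k)
  have "map_poly real_of_int ([:- 1, 1:] ^ Suc k) = map_poly of_int [:- 1, 1:] * map_poly of_int ([:- 1, 1:] ^ k)"
   unfolding power_Suc by (rule map_poly_of_int_mult)
  hence "poly (map_poly real_of_int ([:- 1, 1:] ^ Suc k)) t = poly (map_poly real_of_int [:- 1, 1:]) t * (t - 1) ^ k"
   using Suc by (simp only: poly_mult)
  thus ?case by (simp only: power_Suc) (simp add: map_poly_pCons)
 qed simp
 have add: "map_poly real_of_int (p + q) = map_poly of_int p + map_poly of_int q" for p q
  by (rule poly_eqI) (simp add: coeff_map_poly)
 show ?thesis by (induction S rule: infinite_finite_induct) (simp_all add: add pw)
qed

text \<open>Powers of T - 1 have leading coefficient 1, so nothing cancels in the highest
  degree.\<close>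

lemma degree_shifted_powers:
 fixes r :: "'x => nat"
 assumes S: "finite S" "S ~= {}"
 defines "P \<equiv> (\<Sum>x\<in>S. [:- 1, 1:] ^ r x) :: int poly"
 shows "P ~= 0" "Polynomial.degree P = Max (r ` S)"
proof -
 define d where "d = Max (r ` S)"
 have le: "r x \<le> d" if "x\<in>S" for x unfolding d_def using S that by (intro Max_ge) auto
 have "d\<in>r ` S" unfolding d_def using S by (intro Max_in) auto
 then obtain x0 where x0: "x0\<in>S" "r x0 = d" by auto
 have deg: "Polynomial.degree ([:- 1, 1 :: int:] ^ k) = k" for k by (simp add: degree_power_eq)
 have "coeff ([:- 1, 1 :: int:] ^ k) d = (if k = d then 1 else 0)" if "k \<le> d" for k
 proof (cases "k = d")
  case True
  have "lead_coeff ([:- 1, 1 :: int:] ^ k) = 1" by (simp add: lead_coeff_power)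
  thus ?thesis using True deg[of k] by simp
 next
  case False
  thus ?thesis using that deg[of k] by (simp add: coeff_eq_0)
 qed
 hence "coeff P d = (\<Sum>x\<in>S. if r x = d then 1 else 0)" unfolding P_def coeff_sum using le by (intro sum.cong) auto
 also have "... \<ge> (\<Sum>x\<in>{x0}. if r x = d then 1 else 0)" using S x0 by (intro sum_mono2) auto
 finally have c: "coeff P d ~= 0" using x0 by auto
 thus "P ~= 0" by auto
 have "Polynomial.degree P \<le> d" unfolding P_def using le deg by (intro degree_sum_le S(1)) simp
 thus "Polynomial.degree P = Max (r ` S)" using le_degree[OF c] unfolding d_def by simp
qed

theorem theorem2p32:
  fixes X :: "('u :: infinite, 'v) mr_functor"
    and XM :: "('x, 's) monoidal_space"
    and XZ :: "('y, 't) ringed_space"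
    and N :: "real \<Rightarrow> real"
  assumes "F1_scheme X XM XZ"
    and "F1_noetherian X XZ"
    and "F1_torsion_free XM"
    and "counting_function X XM XZ N"
    and "finite_type_over_Z XZ"
    and "\<pi> \<in> sh_hom ring_hom XZ (Spec \<Z>)"
  shows "\<exists>P :: int poly.
           (\<forall>t. N t = poly (map_poly of_int P) t) \<and>
           poly_deg P = reldim XZ (Spec \<Z>) \<pi>"
proof -
 define S where "S = topspace (pts XM)"
 define r where "r x = ab_rank (stalk_units XM x)" for x
 define P :: "int poly" where "P = (\<Sum>x\<in>S. [:- 1, 1:] ^ r x)"
 have Nt: "N t = (\<Sum>x\<in>S. (t - 1) ^ r x)" for t
  using assms(4)[unfolded counting_function_def, THEN conjunct2, THEN conjunct2, THEN spec, of t] unfolding S_def r_def .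
 obtain \<eta> \<Y> Mon \<theta> where "F1_points X XZ \<eta> \<Y> Mon \<theta>" using F1_points_exist[OF assms(1,2)] by (elim exE)
 then interpret F: F1_points X XZ \<eta> \<Y> Mon \<theta> .
 have sheaf: "is_sheaf cring ring_hom XZ" using assms(5) unfolding finite_type_over_Z_def scheme_def by blast
 obtain i :: "nat => 'u" where i: "inj i" using infinite_countable_subset[OF infinite_UNIV] by blast
 \<comment> \<open>The shift by \<open>Suc\<close> keeps \<open>i 0\<close> free for the absorbing
   element.\<close>
 define el where "el k = i (Suc (to_nat (k :: int)))" for k
 have el: "inj el" "i 0\<notin>range el"
  unfolding el_def by (auto simp: inj_on_def inj_eq[OF i])
 have count: "card (mon_obj X (cyc_pmonoid el (i 0) m)) = (\<Sum>x\<in>S. m ^ r x)" if m: "m \<ge> 1" for m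
 proof -
  have c: "cyc el (i 0) m" using el m by unfold_locales
  have "real (card (mon_obj X (cyc_pmonoid el (i 0) m))) = N (real m + 1)"
   by (rule assms(4)[unfolded counting_function_def, THEN conjunct1, THEN spec, THEN spec, THEN mp])
    (use m cyc.pm[OF c] cyc.iso[OF c] in simp)
  also have "... = real (\<Sum>x\<in>S. m ^ r x)" unfolding Nt by simp
  finally show ?thesis by linarith
 qed
 have cov: "\<exists>U (R :: 't ring) f F gs. x\<in>U & chart XZ U R f F & set gs<=carrier R & foldl (adjoin R) (zim R) gs = carrier R"
  if x: "x\<in>topspace (pts XZ)" for x
 proof -
  obtain \<U> where \<U>: "\<Union>\<U> = topspace (pts XZ)" "\<forall>U\<in>\<U>. \<exists>R :: 't ring. affine_open XZ U R & ring_fin_gen R"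
   using assms(5) unfolding finite_type_over_Z_def by (elim exE conjE)
  obtain U where U: "U\<in>\<U>" "x\<in>U" using \<U>(1) x by blast
  obtain R :: "'t ring" where R: "affine_open XZ U R" "ring_fin_gen R" using bspec[OF \<U>(2) U(1)] by (elim exE conjE)
  obtain f F where ch: "chart XZ U R f F" using affine_open_chart[OF sheaf R(1)] by (elim exE)
  obtain gs where "set gs<=carrier R" "foldl (adjoin R) (zim R) gs = carrier R"
   using ring_fin_gen_adjoin[OF chart.R[OF ch] R(2)] by (elim exE conjE)
  thus ?thesis using U(2) ch by (intro exI[of _ U] exI[of _ R] exI[of _ f] exI[of _ F] exI[of _ gs]) simp
 qed
 define fib where "fib y = subtopology (pts XZ) (preim XZ (fst \<pi>) {y})" for y
 have basis_bound: "S ~= {} & finite S & card B \<le> Max (r ` S)" if Y: "Y\<in>\<Y>" and pb: "prime_basis (Mon Y) G p B e c" for Y G p B e c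
 proof -
  interpret prime_basis "Mon Y" G p B e c by (rule pb)
  have b: "(m div e) ^ card B \<le> (\<Sum>x\<in>S. m ^ r x)" if m: "m \<ge> 1" for m
  proof -
   have c: "cyc el (i 0) m" using el m by unfold_locales
   interpret prime_basis_cyc "Mon Y" G p B e c el "i 0" m
    unfolding prime_basis_cyc_def using pb c by simp
   show ?thesis using count_lower F.card_mon_obj_bounds(1)[OF c refl Y] count[OF m] by linarith
  qed
  \<comment> \<open>At m = e the lower bound is 1, so the sum is nonzero. Since empty sums and sums
    over infinite sets are both 0, this makes \<open>S\<close> finite and nonempty.\<close>
  have s: "(\<Sum>x\<in>S. e ^ r x) ~= 0" using b[of e] e by auto
  have S: "S ~= {}" "finite S" using s by (metis sum.empty, metis sum.infinite)
  have "(m div e) ^ card B \<le> card S * m ^ Max (r ` S)" if m: "m \<ge> 1" for m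
  proof -
   have "(\<Sum>x\<in>S. m ^ r x) \<le> (\<Sum>x\<in>S. m ^ Max (r ` S))" using S m by (intro sum_mono power_increasing Max_ge) auto
   thus ?thesis using b[OF m] by simp
  qed
  hence "card B \<le> Max (r ` S)" by (rule exponent_le_of_div_bound[OF e])
  thus ?thesis using S by simp
 qed
 \<comment> \<open>Finiteness of \<open>S\<close> belongs to the conclusion because the degree of
   \<open>P\<close> equals the maximal rank only for finite nonempty \<open>S\<close>.\<close>
 have upper: "S ~= {} & finite S & n \<le> Max (r ` S)"
  if irr: "\<forall>i \<le> n. irreducible_closed (fib y) (Z i)" and mono: "\<forall>i < n. Z i \<subset> Z (Suc i)" for n y Z
 proof -
  have "irreducible_closed (fib y) (Z 0)" using irr by simp
  hence Z0: "Z 0 ~= {}" "closedin (fib y) (Z 0)" unfolding irreducible_closed_def by blast+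
  then obtain x0 where x0: "x0\<in>Z 0" by blast
  hence x0t: "x0\<in>topspace (pts XZ)" using closedin_subset[OF Z0(2)] unfolding fib_def by auto
  obtain U and R :: "'t ring" and f F gs where U: "x0\<in>U" and ch: "chart XZ U R f F"
   and gs: "set gs<=carrier R" "foldl (adjoin R) (zim R) gs = carrier R"
   using cov[OF x0t] by (elim exE conjE)
  interpret C: chart XZ U R f F by (rule ch)
  have "\<exists>x\<in>U. \<exists>xs. length xs = n & set xs<=carrier R & indep_mod R (f x) (zim R) xs"
   by (rule C.fibre_chain_indep[where y = y and Z = Z, OF assms(6) _ _ x0 U])
    (use irr[unfolded fib_def] mono in simp_all)
  then obtain x xs where x: "x\<in>U" and xs: "length xs = n" "set xs<=carrier R" "indep_mod R (f x) (zim R) xs"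
   by (elim bexE exE conjE)
  have cnt: "countable (carrier R)" using cring.countable_foldl_adjoin[OF C.R countable_zim, of R gs] unfolding gs(2) .
  obtain K :: "'u ring" and \<psi> where K: "field K" "\<psi>\<in>ring_hom R K" "\<forall>a\<in>carrier R. \<psi> a = \<zero>\<^bsub>K\<^esub> \<longleftrightarrow> a\<in>f x"
   using residue_field_exists[where 'u = 'u, OF C.R C.f_prime[OF x] cnt] by (elim exE conjE bexE)
  have "\<exists>Y\<in>\<Y>. \<exists>G p B e c. prime_basis (Mon Y) G p B e c & length xs \<le> card B"
   by (rule F.indep_le_prime_basis[OF ch K(1,2) x _ xs(2,3)]) (rule bspec[OF K(3)])
  then obtain Y G p B e c where Y: "Y\<in>\<Y>" "prime_basis (Mon Y) G p B e c" "length xs \<le> card B"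
   by (elim bexE exE conjE)
  show ?thesis using basis_bound[OF Y(1,2)] Y(3) xs(1) by simp
 qed
 have "reldim XZ (Spec \<Z>) \<pi> \<le> poly_deg P"
  unfolding reldim_def krull_dim_def
 proof (intro SUP_least Sup_least)
  fix y v assume "v\<in>{ereal (real n) | n. \<exists>Z. (\<forall>i \<le> n. irreducible_closed (subtopology (pts XZ) (preim XZ (fst \<pi>) {y})) (Z i)) & (\<forall>i < n. Z i \<subset> Z (Suc i))}"
  then obtain n Z where v: "v = ereal (real n)" and Z: "\<forall>i \<le> n. irreducible_closed (fib y) (Z i)" "\<forall>i < n. Z i \<subset> Z (Suc i)"
   unfolding fib_def by auto
  \<comment> \<open>A single chain already forces \<open>P\<close> to be nonzero, so the value
    -\<infinity> of \<open>poly_deg\<close> does not interfere.\<close>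
  thus "v \<le> poly_deg P"
   using upper[OF Z] degree_shifted_powers[of S r] unfolding poly_deg_def P_def v by simp
 qed
 moreover have "poly_deg P \<le> reldim XZ (Spec \<Z>) \<pi>"
 proof (cases "P = 0")
  case True
  thus ?thesis unfolding poly_deg_def by simp
 next
  case False
  \<comment> \<open>A sum over an infinite set is 0 by convention, so a nonzero \<open>P\<close> has
    a finite index set.\<close>
  hence S: "finite S" "S ~= {}" unfolding P_def by (metis sum.infinite, metis sum.empty)
  define d where "d = Max (r ` S)"
  have "d\<in>r ` S" unfolding d_def using S by (intro Max_in) auto
  then obtain x0 where x0: "x0\<in>S" "r x0 = d" by auto
  have "m ^ d \<le> card (mon_obj X (cyc_pmonoid el (i 0) m))" if m: "m \<ge> 1" for m
   unfolding count[OF m] using member_le_sum[of x0 S "%x. m ^ r x"] x0 S by simp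
  hence "\<exists>Y\<in>\<Y>. \<exists>G p B e c. prime_basis (Mon Y) G p B e c & d \<le> card B" by (rule F.prime_basis_of_degree[OF el])
  then obtain Y G p B e c where Y: "Y\<in>\<Y>" and pb: "prime_basis (Mon Y) G p B e c" and d: "d \<le> card B"
   by (elim bexE exE conjE)
  obtain K :: "'u ring" and ts where K: "field K" "length ts = card B" "set ts<=carrier K" "indep_mod K {\<zero>\<^bsub>K\<^esub>} (zim K) ts"
   using indep_field_exists[where 'u = 'u and n = "card B"] by (elim exE conjE)
  have "\<exists>U (R :: 't ring) f F gs x ys. x\<in>U & chart XZ U R f F & set gs<=carrier R &
    foldl (adjoin R) (zim R) gs = carrier R & set ys<=carrier R & card B \<le> length ys & indep_mod R (f x) (zim R) ys"
   by (rule F.prime_basis_le_indep[OF sheaf _ Y pb K]) (rule cov)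
  then obtain U and R :: "'t ring" and f F gs x ys where x: "x\<in>U" and ch: "chart XZ U R f F"
   and gs: "set gs<=carrier R" "foldl (adjoin R) (zim R) gs = carrier R"
   and ys: "set ys<=carrier R" "card B \<le> length ys" "indep_mod R (f x) (zim R) ys"
   by (elim exE conjE)
  interpret C: chart XZ U R f F by (rule ch)
  have "ereal (real (length ys)) \<le> krull_dim (subtopology (pts XZ) (preim XZ (fst \<pi>) {fst \<pi> x}))"
   unfolding krull_dim_def
   by (rule Sup_upper, rule CollectI, rule exI[of _ "length ys"], rule conjI[OF refl])
    (rule C.indep_fibre_chain[OF assms(6) x gs ys(1,3)])
  also have "... \<le> reldim XZ (Spec \<Z>) \<pi>"
   unfolding reldim_def
  proof (rule SUP_upper)
   obtain g G where "\<pi> = (g, G)" by (cases \<pi>)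
   hence "continuous_map (pts XZ) (pts (Spec \<Z>)) (fst \<pi>)" using sh_homD(1)[of g G ring_hom XZ "Spec \<Z>"] assms(6) by simp
   moreover have "x\<in>topspace (pts XZ)" using x openin_subset[OF C.U] by blast
   ultimately show "fst \<pi> x\<in>topspace (pts (Spec \<Z>))" unfolding continuous_map_def by blast
  qed
  finally have "ereal (real (length ys)) \<le> reldim XZ (Spec \<Z>) \<pi>" .
  moreover have "poly_deg P \<le> ereal (real (length ys))"
   using False d ys(2) degree_shifted_powers(2)[OF S, of r] unfolding poly_deg_def P_def d_def by simp
  ultimately show ?thesis by (rule order_trans[rotated])
 qed
 ultimately have "poly_deg P = reldim XZ (Spec \<Z>) \<pi>" by (rule order_antisym[rotated])
 moreover have "N t = poly (map_poly of_int P) t" for t unfolding P_def poly_of_int_shifted_powers Nt ..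
 ultimately show ?thesis by (intro exI[of _ P]) simp
qed

end
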